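(* The spaces $(\pi'_l,{\cal U}^+)$, $(\pi'_l,{\cal U}^-)$, $(\pi'_r,{\cal U}'^+)$ and $(\pi'_r,{\cal U}'^-)$ have pseudounitary structures (non-degenerate indefinite Hermitian forms) that are preserved by the real form $\mathfrak u(2,2)$ of $\mathfrak{gl}(2,\mathbb H_{\mathbb C})$. The invariant pseudounitary structure on ${\cal U}^+$ can be described as $$\bigl(f^{(1)}_{l,m,n},f^{(1)}_{l',m',n'}\bigr)_{{\cal U}^+}=\frac{2l+1}{2\pi^2}\int_{X\in S^3}\bigl(f^{(1)}_{l',m',n'}(X)\bigr)^+\cdot f^{(1)}_{l,m,n}(X)\,dS,$$ $$\bigl(f^{(2)}_{l,m,n},f^{(2)}_{l',m',n'}\bigr)_{{\cal U}^+}=-\frac{2l(2l+1)}{2\pi^2}\int_{X\in S^3}\bigl(f^{(2)}_{l',m',n'}(X)\bigr)^+\cdot f^{(2)}_{l,m,n}(X)\,dS,$$ $$\bigl(f^{(3)}_{l,m,n},f^{(3)}_{l',m',n'}\bigr)_{{\cal U}^+}=-\frac{2l}{2\pi^2}\int_{X\in S^3}\bigl(f^{(3)}_{l',m',n'}(X)\bigr)^+\cdot f^{(3)}_{l,m,n}(X)\,dS,$$ $$\bigl(f^{(\alpha)}_{l,m,n},f^{(\alpha')}_{l',m',n'}\bigr)_{{\cal U}^+}=0\quad\text{if }\alpha\ne\alpha'.$$ And the invariant pseudounitary structures on ${\cal U}^-$, ${\cal U}'^+$, ${\cal U}'^-$ are similar (that is, they have analogous descriptions in terms of the bases $\tilde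 f^{(\alpha)}_{l,m,n}$, $g^{(\alpha)}_{l,m,n}$, $\tilde g^{(\alpha)}_{l,m,n}$ respectively).
   Context: $\mathbb H_{\mathbb C}=\mathbb C\otimes_{\mathbb R}\mathbb H$ is identified with $2\times2$ complex matrices $Z=\bigl(\begin{smallmatrix}z_{11}&z_{12}\\ z_{21}&z_{22}\end{smallmatrix}\bigr)=z^0e_0+z^1e_1+z^2e_2+z^3e_3$, with $e_0=1$, $e_1=\bigl(\begin{smallmatrix}0&-i\\-i&0\end{smallmatrix}\bigr)$, $e_2=\bigl(\begin{smallmatrix}0&-1\\1&0\end{smallmatrix}\bigr)$, $e_3=\bigl(\begin{smallmatrix}-i&0\\0&i\end{smallmatrix}\bigr)$; $\mathbb H$ is the subset with real $z^j$; $N(Z)=\det Z$. $\mathbb S$, $\mathbb S'$ are the spaces of complex $2$-columns and $2$-rows; for $s\in\mathbb S$, $s^+\in\mathbb S'$ is the conjugate transpose, and likewise $s'^+\in\mathbb S$ for $s'\in\mathbb S'$. $S^3=\{X\in\mathbb H;N(X)=1\}$ with Euclidean volume element $dS$. $\nabla=e_0\partial_{z^0}-e_1\partial_{z^1}-e_2\partial_{z^2}-e_3\partial_{z^3}$, $\square=\sum_j\partial_{z^j}^2$, $g\overleftarrow\nabla$ is $\nabla$ acting from the right. ${\cal U}=\{f\in\mathbb C[z^0,z^1,z^2,z^3,N(Z)^{-1}]\otimes\mathbb S;\nabla\square f=0\}$, ${\cal U}'=\{g\in\mathbb C[z^0,z^1,z^2,z^3,N(Z)^{-1}]\otimes\mathbb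 S';(\square g)\overleftarrow\nabla=0\}$; ${\cal U}^\pm$, ${\cal U}'^\pm$ are the spans of the homogeneous elements of degree $\ge0$ (for $+$), $<0$ (for $-$). $t^l_{n\,\underline m}(Z)=\frac1{2\pi i}\oint(sz_{11}+z_{21})^{l-m}(sz_{12}+z_{22})^{l+m}s^{-l+n}\frac{ds}s$ for $l=0,\frac12,1,\dots$, $m,n\in\mathbb Z+l$, $-l\le m,n\le l$ (counterclockwise loop around $0$), and $t^l_{n\,\underline m}=0$ for out-of-range indices. In all families below $l=0,\frac12,1,\dots$ and the indices $m,n$ run in integer steps between the stated bounds. Basis of ${\cal U}^+$: $f^{(1)}_{l,m,n}=\Bigl(\begin{smallmatrix}t^l_{n-1/2\,\underline m}(Z)\\-t^l_{n+1/2\,\underline m}(Z)\end{smallmatrix}\Bigr)$ ($-l\le m\le l$, $-l-\frac12\le n\le l+\frac12$), $f^{(2)}_{l,m,n}=\Bigl(\begin{smallmatrix}(l-n+1/2)t^l_{n-1/2\,\underline m}(Z)\\(l+n+1/2)t^l_{n+1/2\,\underline m}(Z)\end{smallmatrix}\Bigr)$ ($-l\le m\le l$, $-l+\frac12\le n\le l-\frac12$), $f^{(3)}_{l,m,n}=N(Z)\Bigl(\begin{smallmatrix}t^{l-1}_{n-1/2\,\underline m}(Z)\\-t^{l-1}_{n+1/2\,\underline m}(Z)\end{smallmatrix}\Bigr)$ ($-l+1\le m\le l-1$, $-l+\frac12\le n\le l-\frac12$). Basis of ${\cal U}^-$: $\tilde f^{(1)}_{l,m,n}=\Bigl(\begin{smallmatrix}t^{l+1/2}_{m\,\underline{n+1/2}}(Z^{-1})\\-t^{l+1/2}_{m\,\underline{n-1/2}}(Z^{-1})\end{smallmatrix}\Bigr)$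 ($-l-\frac12\le m\le l+\frac12$, $-l\le n\le l$), $\tilde f^{(2)}_{l,m,n}=N(Z)^{-1}\Bigl(\begin{smallmatrix}(l-n)t^{l-1/2}_{m\,\underline{n+1/2}}(Z^{-1})\\(l+n)t^{l-1/2}_{m\,\underline{n-1/2}}(Z^{-1})\end{smallmatrix}\Bigr)$ ($-l+\frac12\le m\le l-\frac12$, $-l\le n\le l$), $\tilde f^{(3)}_{l,m,n}=N(Z)^{-1}\Bigl(\begin{smallmatrix}t^{l-1/2}_{m\,\underline{n+1/2}}(Z^{-1})\\-t^{l-1/2}_{m\,\underline{n-1/2}}(Z^{-1})\end{smallmatrix}\Bigr)$ ($-l+\frac12\le m\le l-\frac12$, $-l+1\le n\le l-1$). Basis of ${\cal U}'^+$: $g^{(1)}_{l,m,n}=\bigl((l+m+\frac12)t^l_{n\,\underline{m-1/2}}(Z),-(l-m+\frac12)t^l_{n\,\underline{m+1/2}}(Z)\bigr)$ ($-l-\frac12\le m\le l+\frac12$, $-l\le n\le l$), $g^{(2)}_{l,m,n}=\bigl(t^l_{n\,\underline{m-1/2}}(Z),t^l_{n\,\underline{m+1/2}}(Z)\bigr)$ ($-l+\frac12\le m\le l-\frac12$, $-l\le n\le l$), $g^{(3)}_{l,m,n}=N(Z)\bigl((l+m-\frac12)t^{l-1}_{n\,\underline{m-1/2}}(Z),-(l-m-\frac12)t^{l-1}_{n\,\underline{m+1/2}}(Z)\bigr)$ ($-l+\frac12\le m\le l-\frac12$, $-l+1\le n\le l-1$). Basis of ${\cal U}'^-$: $\tilde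 g^{(1)}_{l,m,n}=\bigl((l+m+1)t^{l+1/2}_{m+1/2\,\underline n}(Z^{-1}),-(l-m+1)t^{l+1/2}_{m-1/2\,\underline n}(Z^{-1})\bigr)$ ($-l\le m\le l$, $-l-\frac12\le n\le l+\frac12$), $\tilde g^{(2)}_{l,m,n}=N(Z)^{-1}\bigl(t^{l-1/2}_{m+1/2\,\underline n}(Z^{-1}),t^{l-1/2}_{m-1/2\,\underline n}(Z^{-1})\bigr)$ ($-l\le m\le l$, $-l+\frac12\le n\le l-\frac12$), $\tilde g^{(3)}_{l,m,n}=N(Z)^{-1}\bigl((l+m)t^{l-1/2}_{m+1/2\,\underline n}(Z^{-1}),-(l-m)t^{l-1/2}_{m-1/2\,\underline n}(Z^{-1})\bigr)$ ($-l+1\le m\le l-1$, $-l+\frac12\le n\le l-\frac12$). $\mathfrak{gl}(2,\mathbb H_{\mathbb C})$ acts by differentiating $(\pi'_l(h)f)(Z)=\frac{a'-Zc'}{N(a'-Zc')}f\bigl((a'-Zc')^{-1}(-b'+Zd')\bigr)$, $(\pi'_r(h)g)(Z)=g\bigl((aZ+b)(cZ+d)^{-1}\bigr)\frac{cZ+d}{N(cZ+d)}$, $h=\bigl(\begin{smallmatrix}a'&b'\\ c'&d'\end{smallmatrix}\bigr)$, $h^{-1}=\bigl(\begin{smallmatrix}a&b\\ c&d\end{smallmatrix}\bigr)$. $\mathfrak u(2,2)=\bigl\{\bigl(\begin{smallmatrix}A&B\\ B^*&D\end{smallmatrix}\bigr);A,B,D\in\mathbb H_{\mathbb C},A=-A^*,D=-D^*\bigr\}$,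 $*$ being conjugate transpose. A form is linear in the first and antilinear in the second argument; preserved means $(\pi(Y)f_1,f_2)+(f_1,\pi(Y)f_2)=0$ for $Y\in\mathfrak u(2,2)$, $\pi$ the respective action. *)

theory Defs
  imports
    "HOL-Complex_Analysis.Contour_Integration"
    "HOL-Library.Function_Algebras"
begin

section \<open>Complexified quaternions\<close>

type_synonym hc = "complex^2^2"
type_synonym spinor = "complex^2"

definition cmul :: "complex \<Rightarrow> complex^'n^'m \<Rightarrow> complex^'n^'m" where
  "cmul c A = (\<chi> i j. c * A $ i $ j)"

definition conj_transpose :: "complex^'n^'m \<Rightarrow> complex^'m^'n" where
  "conj_transpose A = (\<chi> i j. cnj (A $ j $ i))"

text \<open>The index type \<^typ>\<open>4\<close> consists of \<open>0, 1, 2, 3\<close> (and \<open>4 = 0\<close>); in the index type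
  \<^typ>\<open>2\<close> the two indices are written \<open>1\<close> and \<open>2\<close>.\<close>

definition qe :: "4 \<Rightarrow> hc" where
  "qe j = (if j = 0 then vector [vector [1, 0], vector [0, 1]]
     else if j = 1 then vector [vector [0, - \<i>], vector [- \<i>, 0]]
     else if j = 2 then vector [vector [0, - 1], vector [1, 0]]
     else vector [vector [- \<i>, 0], vector [0, \<i>]])"

definition quat :: "complex^4 \<Rightarrow> hc" where
  "quat z = (\<Sum>j\<in>UNIV. cmul (z $ j) (qe j))"

definition real_quat :: "real^4 \<Rightarrow> hc" where
  "real_quat x = quat (\<chi> j. complex_of_real (x $ j))"

definition coords :: "hc \<Rightarrow> complex^4" where
  "coords Z = (\<chi> j.
     if j = 0 then (Z$1$1 + Z$2$2) / 2
     else if j = 1 then \<i> * (Z$1$2 + Z$2$1) / 2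
     else if j = 2 then (Z$2$1 - Z$1$2) / 2
     else \<i> * (Z$1$1 - Z$2$2) / 2)"

lemma UNIV_index4: "(UNIV :: 4 set) = {0, 1, 2, 3}"
proof -
  have "(UNIV :: 4 set) = {1, 2, 3, 4}"
    by (rule UNIV_4)
  moreover have "(4 :: 4) = 0"
    by simp
  ultimately show ?thesis
    by auto
qed

lemma quat_expand:
  "quat z = cmul (z $ 0) (qe 0) + cmul (z $ 1) (qe 1) + cmul (z $ 2) (qe 2) + cmul (z $ 3) (qe 3)"
  unfolding quat_def UNIV_index4 by (simp add: add.assoc)

lemma quat_nth:
  "quat z $ 1 $ 1 = z $ 0 - \<i> * z $ 3"
  "quat z $ 1 $ 2 = - \<i> * z $ 1 - z $ 2"
  "quat z $ 2 $ 1 = - \<i> * z $ 1 + z $ 2"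
  "quat z $ 2 $ 2 = z $ 0 + \<i> * z $ 3"
  by (simp_all add: quat_expand cmul_def qe_def)

lemma coords_nth:
  "coords Z $ 0 = (Z$1$1 + Z$2$2) / 2"
  "coords Z $ 1 = \<i> * (Z$1$2 + Z$2$1) / 2"
  "coords Z $ 2 = (Z$2$1 - Z$1$2) / 2"
  "coords Z $ 3 = \<i> * (Z$1$1 - Z$2$2) / 2"
  by (simp_all add: coords_def)

lemma quat_coords: "quat (coords Z) = Z"
proof -
  have "quat (coords Z) $ 1 $ 1 = Z $ 1 $ 1" "quat (coords Z) $ 1 $ 2 = Z $ 1 $ 2"
    "quat (coords Z) $ 2 $ 1 = Z $ 2 $ 1" "quat (coords Z) $ 2 $ 2 = Z $ 2 $ 2"
    unfolding quat_nth coords_nth by (simp_all add: complex_eq_iff field_simps)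
  then show ?thesis
    by (simp add: vec_eq_iff forall_2)
qed

lemma norm_power2_real4: "(norm (x :: real^4))\<^sup>2 = (x $ 0)\<^sup>2 + (x $ 1)\<^sup>2 + (x $ 2)\<^sup>2 + (x $ 3)\<^sup>2"
proof -
  have "(norm x)\<^sup>2 = (\<Sum>j\<in>UNIV. (x $ j)\<^sup>2)"
    unfolding power2_norm_eq_inner inner_vec_def by (simp add: power2_eq_square)
  then show ?thesis
    unfolding UNIV_index4 by simp
qed

lemma det_real_quat: "det (real_quat x) = complex_of_real ((norm x)\<^sup>2)"
proof -
  have "(a - \<i> * d) * (a + \<i> * d) - (- \<i> * b - c) * (- \<i> * b + c) = a\<^sup>2 + b\<^sup>2 + c\<^sup>2 + d\<^sup>2"
    for a b c d :: complex
  proof -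
    have "\<i> * \<i> = (- 1 :: complex)"
      by simp
    then show ?thesis
      by algebra
  qed
  then show ?thesis
    by (simp only: det_2 real_quat_def quat_nth norm_power2_real4 vec_lambda_beta of_real_add of_real_power)
qed


section \<open>The function spaces\<close>

text \<open>Elements of the algebra of polynomials in the coordinates and in the inverse of the
  determinant are represented as functions on the set of invertible matrices. To obtain a unique
  representative, all functions are extended by zero to the singular matrices.\<close>

definition on_invertible :: "(hc \<Rightarrow> 'a::zero) \<Rightarrow> hc \<Rightarrow> 'a" where
  "on_invertible F Z = (if det Z = 0 then 0 else F Z)"

inductive_set laurent_algebra :: "(hc \<Rightarrow> complex) set" where
  const: "on_invertible (\<lambda>Z. c) \<in> laurent_algebra"
| coord: "on_invertible (\<lambda>Z. coords Z $ j) \<in> laurent_algebra"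
| inverse_det: "on_invertible (\<lambda>Z. inverse (det Z)) \<in> laurent_algebra"
| add: "\<lbrakk>p \<in> laurent_algebra; q \<in> laurent_algebra\<rbrakk> \<Longrightarrow> (\<lambda>Z. p Z + q Z) \<in> laurent_algebra"
| mult: "\<lbrakk>p \<in> laurent_algebra; q \<in> laurent_algebra\<rbrakk> \<Longrightarrow> (\<lambda>Z. p Z * q Z) \<in> laurent_algebra"

text \<open>Complex partial derivative in the coordinate with index \<open>j\<close>.\<close>

definition pd :: "4 \<Rightarrow> (hc \<Rightarrow> spinor) \<Rightarrow> hc \<Rightarrow> spinor" where
  "pd j F Z = (\<chi> i. deriv (\<lambda>w. F (Z + cmul w (qe j)) $ i) 0)"

definition laplacian :: "(hc \<Rightarrow> spinor) \<Rightarrow> hc \<Rightarrow> spinor" where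
  "laplacian F Z = (\<Sum>j\<in>UNIV. pd j (pd j F) Z)"

definition nabla :: "(hc \<Rightarrow> spinor) \<Rightarrow> hc \<Rightarrow> spinor" where
  "nabla F Z = qe 0 *v pd 0 F Z - qe 1 *v pd 1 F Z - qe 2 *v pd 2 F Z - qe 3 *v pd 3 F Z"

definition nabla_right :: "(hc \<Rightarrow> spinor) \<Rightarrow> hc \<Rightarrow> spinor" where
  "nabla_right G Z = pd 0 G Z v* qe 0 - pd 1 G Z v* qe 1 - pd 2 G Z v* qe 2 - pd 3 G Z v* qe 3"

text \<open>Both columns and rows are of type \<^typ>\<open>spinor\<close>; matrices act on columns by \<open>*v\<close> and on
  rows by \<open>v*\<close>.\<close>

definition quasi_antiregular :: "(hc \<Rightarrow> spinor) set" where
  "quasi_antiregular = {f. (\<forall>i. (\<lambda>Z. f Z $ i) \<in> laurent_algebra) \<and>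
           (\<forall>Z. det Z \<noteq> 0 \<longrightarrow> nabla (laplacian f) Z = 0)}"

definition quasi_antiregular_right :: "(hc \<Rightarrow> spinor) set" where
  "quasi_antiregular_right = {g. (\<forall>i. (\<lambda>Z. g Z $ i) \<in> laurent_algebra) \<and>
            (\<forall>Z. det Z \<noteq> 0 \<longrightarrow> nabla_right (laplacian g) Z = 0)}"

definition homogeneous :: "int \<Rightarrow> (hc \<Rightarrow> spinor) \<Rightarrow> bool" where
  "homogeneous d f \<longleftrightarrow> (\<forall>c Z. c \<noteq> 0 \<longrightarrow> f (cmul c Z) = (c powi d) *s f Z)"

definition fscale :: "complex \<Rightarrow> (hc \<Rightarrow> spinor) \<Rightarrow> hc \<Rightarrow> spinor" where
  "fscale c f = (\<lambda>Z. c *s f Z)"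

lemma vector_space_fscale: "vector_space fscale"
proof
  fix a b :: complex and x y :: "hc \<Rightarrow> spinor"
  show "fscale a (x + y) = fscale a x + fscale a y"
    unfolding fscale_def plus_fun_def by (rule ext) (rule vector_add_ldistrib)
  show "fscale (a + b) x = fscale a x + fscale b x"
    unfolding fscale_def plus_fun_def by (rule ext) (rule vector_sadd_rdistrib)
  show "fscale a (fscale b x) = fscale (a * b) x"
    unfolding fscale_def by (rule ext) (rule vector_smult_assoc)
  show "fscale 1 x = x"
    unfolding fscale_def by (rule ext) (rule vector_smult_lid)
qed

definition U_plus :: "(hc \<Rightarrow> spinor) set" where
  "U_plus = module.span fscale {f \<in> quasi_antiregular. \<exists>d\<ge>0. homogeneous d f}"

definition U_minus :: "(hc \<Rightarrow> spinor) set" where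
  "U_minus = module.span fscale {f \<in> quasi_antiregular. \<exists>d<0. homogeneous d f}"

definition U'_plus :: "(hc \<Rightarrow> spinor) set" where
  "U'_plus = module.span fscale {g \<in> quasi_antiregular_right. \<exists>d\<ge>0. homogeneous d g}"

definition U'_minus :: "(hc \<Rightarrow> spinor) set" where
  "U'_minus = module.span fscale {g \<in> quasi_antiregular_right. \<exists>d<0. homogeneous d g}"


section \<open>Basis functions\<close>

text \<open>The indices \<open>l, m, n\<close> are integers or half-integers and are represented as real numbers.
  The condition in the definition of \<open>tf\<close> says that \<open>l\<close> is one of \<open>0, 1/2, 1, \<dots>\<close> and that
  \<open>m, n\<close> are in \<open>{-l, -l + 1, \<dots>, l}\<close>.\<close>

definition tf :: "real \<Rightarrow> real \<Rightarrow> real \<Rightarrow> hc \<Rightarrow> complex" where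
  "tf l n m Z =
     (if l - m \<in> \<nat> \<and> l + m \<in> \<nat> \<and> l - n \<in> \<nat> \<and> l + n \<in> \<nat>
      then 1 / (2 * of_real pi * \<i>) *
        contour_integral (circlepath 0 1)
          (\<lambda>s. (s * Z$1$1 + Z$2$1) ^ nat \<lfloor>l - m\<rfloor> * (s * Z$1$2 + Z$2$2) ^ nat \<lfloor>l + m\<rfloor>
               * s powi \<lfloor>n - l\<rfloor> / s)
      else 0)"

definition steps :: "real \<Rightarrow> real \<Rightarrow> real set" where
  "steps a b = {x. x - a \<in> \<nat> \<and> b - x \<in> \<nat>}"

datatype series_index = First | Second | Third

fun ind :: "series_index \<Rightarrow> (real \<times> real \<times> real) set" where
  "ind First = {(l, m, n). 2 * l \<in> \<nat> \<and> m \<in> steps (- l) l \<and> n \<in> steps (- l - 1/2) (l + 1/2)}"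
| "ind Second = {(l, m, n). 2 * l \<in> \<nat> \<and> m \<in> steps (- l) l \<and> n \<in> steps (- l + 1/2) (l - 1/2)}"
| "ind Third = {(l, m, n). 2 * l \<in> \<nat> \<and> m \<in> steps (- l + 1) (l - 1) \<and> n \<in> steps (- l + 1/2) (l - 1/2)}"

fun ind' :: "series_index \<Rightarrow> (real \<times> real \<times> real) set" where
  "ind' First = {(l, m, n). 2 * l \<in> \<nat> \<and> m \<in> steps (- l - 1/2) (l + 1/2) \<and> n \<in> steps (- l) l}"
| "ind' Second = {(l, m, n). 2 * l \<in> \<nat> \<and> m \<in> steps (- l + 1/2) (l - 1/2) \<and> n \<in> steps (- l) l}"
| "ind' Third = {(l, m, n). 2 * l \<in> \<nat> \<and> m \<in> steps (- l + 1/2) (l - 1/2) \<and> n \<in> steps (- l + 1) (l - 1)}"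

text \<open>The families \<open>f_fam\<close> and \<open>gt_fam\<close> are indexed by \<open>ind\<close>, the families \<open>ft_fam\<close> and \<open>g_fam\<close>
  by \<open>ind'\<close>.\<close>

fun f_fam :: "series_index \<Rightarrow> real \<Rightarrow> real \<Rightarrow> real \<Rightarrow> hc \<Rightarrow> spinor" where
  "f_fam First l m n = on_invertible (\<lambda>Z. vector
     [tf l (n - 1/2) m Z,
      - tf l (n + 1/2) m Z])"
| "f_fam Second l m n = on_invertible (\<lambda>Z. vector
     [of_real (l - n + 1/2) * tf l (n - 1/2) m Z,
      of_real (l + n + 1/2) * tf l (n + 1/2) m Z])"
| "f_fam Third l m n = on_invertible (\<lambda>Z. det Z *s vector
     [tf (l - 1) (n - 1/2) m Z,
      - tf (l - 1) (n + 1/2) m Z])"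

fun ft_fam :: "series_index \<Rightarrow> real \<Rightarrow> real \<Rightarrow> real \<Rightarrow> hc \<Rightarrow> spinor" where
  "ft_fam First l m n = on_invertible (\<lambda>Z. vector
     [tf (l + 1/2) m (n + 1/2) (matrix_inv Z),
      - tf (l + 1/2) m (n - 1/2) (matrix_inv Z)])"
| "ft_fam Second l m n = on_invertible (\<lambda>Z. inverse (det Z) *s vector
     [of_real (l - n) * tf (l - 1/2) m (n + 1/2) (matrix_inv Z),
      of_real (l + n) * tf (l - 1/2) m (n - 1/2) (matrix_inv Z)])"
| "ft_fam Third l m n = on_invertible (\<lambda>Z. inverse (det Z) *s vector
     [tf (l - 1/2) m (n + 1/2) (matrix_inv Z),
      - tf (l - 1/2) m (n - 1/2) (matrix_inv Z)])"

fun g_fam :: "series_index \<Rightarrow> real \<Rightarrow> real \<Rightarrow> real \<Rightarrow> hc \<Rightarrow> spinor" where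
  "g_fam First l m n = on_invertible (\<lambda>Z. vector
     [of_real (l + m + 1/2) * tf l n (m - 1/2) Z,
      - of_real (l - m + 1/2) * tf l n (m + 1/2) Z])"
| "g_fam Second l m n = on_invertible (\<lambda>Z. vector
     [tf l n (m - 1/2) Z,
      tf l n (m + 1/2) Z])"
| "g_fam Third l m n = on_invertible (\<lambda>Z. det Z *s vector
     [of_real (l + m - 1/2) * tf (l - 1) n (m - 1/2) Z,
      - of_real (l - m - 1/2) * tf (l - 1) n (m + 1/2) Z])"

fun gt_fam :: "series_index \<Rightarrow> real \<Rightarrow> real \<Rightarrow> real \<Rightarrow> hc \<Rightarrow> spinor" where
  "gt_fam First l m n = on_invertible (\<lambda>Z. vector
     [of_real (l + m + 1) * tf (l + 1/2) (m + 1/2) n (matrix_inv Z),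
      - of_real (l - m + 1) * tf (l + 1/2) (m - 1/2) n (matrix_inv Z)])"
| "gt_fam Second l m n = on_invertible (\<lambda>Z. inverse (det Z) *s vector
     [tf (l - 1/2) (m + 1/2) n (matrix_inv Z),
      tf (l - 1/2) (m - 1/2) n (matrix_inv Z)])"
| "gt_fam Third l m n = on_invertible (\<lambda>Z. inverse (det Z) *s vector
     [of_real (l + m) * tf (l - 1/2) (m + 1/2) n (matrix_inv Z),
      - of_real (l - m) * tf (l - 1/2) (m - 1/2) n (matrix_inv Z)])"


section \<open>The Lie algebra actions\<close>

text \<open>A \<open>2 \<times> 2\<close> matrix over the complexified quaternions is a complex matrix with row and column
  indices in \<^typ>\<open>2 + 2\<close>.\<close>

type_synonym gl2hc = "complex^(2 + 2)^(2 + 2)"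

definition ul :: "gl2hc \<Rightarrow> hc" where "ul h = (\<chi> i j. h $ Inl i $ Inl j)"
definition ur :: "gl2hc \<Rightarrow> hc" where "ur h = (\<chi> i j. h $ Inl i $ Inr j)"
definition ll :: "gl2hc \<Rightarrow> hc" where "ll h = (\<chi> i j. h $ Inr i $ Inl j)"
definition lr :: "gl2hc \<Rightarrow> hc" where "lr h = (\<chi> i j. h $ Inr i $ Inr j)"

definition pi_l :: "gl2hc \<Rightarrow> (hc \<Rightarrow> spinor) \<Rightarrow> hc \<Rightarrow> spinor" where
  "pi_l h F Z =
     (let a' = ul h; b' = ur h; c' = ll h; d' = lr h; M = a' - Z ** c'
      in cmul (inverse (det M)) M *v F (matrix_inv M ** (- b' + Z ** d')))"

definition pi_r :: "gl2hc \<Rightarrow> (hc \<Rightarrow> spinor) \<Rightarrow> hc \<Rightarrow> spinor" where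
  "pi_r h G Z =
     (let k = matrix_inv h; a = ul k; b = ur k; c = ll k; d = lr k; M = c ** Z + d
      in G ((a ** Z + b) ** matrix_inv M) v* cmul (inverse (det M)) M)"

text \<open>The action of the Lie algebra is the differential of the group action at the identity.\<close>

definition differentiated ::
  "(gl2hc \<Rightarrow> (hc \<Rightarrow> spinor) \<Rightarrow> hc \<Rightarrow> spinor) \<Rightarrow> gl2hc \<Rightarrow> (hc \<Rightarrow> spinor) \<Rightarrow> hc \<Rightarrow> spinor" where
  "differentiated act Y F =
     on_invertible (\<lambda>Z. frechet_derivative (\<lambda>h. act h F Z) (at (mat 1)) Y)"

definition u22 :: "gl2hc set" where
  "u22 = {Y. ul Y = - conj_transpose (ul Y) \<and> lr Y = - conj_transpose (lr Y) \<and>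
             ll Y = conj_transpose (ur Y)}"


section \<open>Pseudounitary structures\<close>

text \<open>Antilinearity in the second argument follows from linearity in the first one and Hermitian
  symmetry, which also makes \<open>B u u\<close> real.\<close>

definition pseudounitary :: "(hc \<Rightarrow> spinor) set \<Rightarrow> ((hc \<Rightarrow> spinor) \<Rightarrow> (hc \<Rightarrow> spinor) \<Rightarrow> complex) \<Rightarrow> bool" where
  "pseudounitary V B \<longleftrightarrow>
     (\<forall>u\<in>V. \<forall>v\<in>V. \<forall>w\<in>V. B (u + v) w = B u w + B v w) \<and>
     (\<forall>c. \<forall>u\<in>V. \<forall>w\<in>V. B (fscale c u) w = c * B u w) \<and>
     (\<forall>u\<in>V. \<forall>w\<in>V. B w u = cnj (B u w)) \<and>
     (\<forall>u\<in>V. (\<forall>w\<in>V. B u w = 0) \<longrightarrow> u = 0) \<and>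
     (\<exists>u\<in>V. Re (B u u) > 0) \<and> (\<exists>u\<in>V. Re (B u u) < 0)"

text \<open>The first conjunct expresses that the space carries the action of the whole Lie algebra, so
  that the form is only evaluated on its domain.\<close>

definition preserved_by_u22 ::
  "(gl2hc \<Rightarrow> (hc \<Rightarrow> spinor) \<Rightarrow> hc \<Rightarrow> spinor) \<Rightarrow> (hc \<Rightarrow> spinor) set \<Rightarrow>
   ((hc \<Rightarrow> spinor) \<Rightarrow> (hc \<Rightarrow> spinor) \<Rightarrow> complex) \<Rightarrow> bool" where
  "preserved_by_u22 act V B \<longleftrightarrow>
     (\<forall>Y. \<forall>u\<in>V. differentiated act Y u \<in> V) \<and>
     (\<forall>Y\<in>u22. \<forall>u\<in>V. \<forall>v\<in>V. B (differentiated act Y u) v + B u (differentiated act Y v) = 0)"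

text \<open>The Euclidean surface measure on the unit sphere, in polar coordinates: the measure of a
  subset is the dimension times the volume of the cone over it in the unit ball. The origin,
  where \<^const>\<open>sgn\<close> vanishes, is a null set.\<close>

definition sphere_measure :: "'a::euclidean_space measure" where
  "sphere_measure =
     scale_measure (of_nat DIM('a)) (distr (restrict_space lborel (cball 0 1)) borel sgn)"

lemma sgn_borel_measurable: "sgn \<in> borel_measurable (borel :: 'a::euclidean_space measure)"
proof -
  have "(\<lambda>x::'a. inverse (norm x) *\<^sub>R x) \<in> borel_measurable borel"
    by measurable
  then show ?thesis
    by (simp add: sgn_div_norm[abs_def])
qed

lemma emeasure_sphere_measure: "emeasure (sphere_measure :: (real^4) measure) UNIV = ennreal (2 * pi\<^sup>2)"
proof -
  have "sgn \<in> measurable (restrict_space lborel (cball (0::real^4) 1)) borel"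
    by (rule measurable_restrict_space1) (simp add: sgn_borel_measurable)
  then have "emeasure (sphere_measure :: (real^4) measure) UNIV = 4 * emeasure lborel (cball (0::real^4) 1)"
    by (simp add: sphere_measure_def emeasure_distr emeasure_restrict_space space_restrict_space)
  also have "emeasure lborel (cball (0::real^4) 1) = ennreal (pi\<^sup>2 / 2)"
  proof -
    have "unit_ball_vol 4 = pi\<^sup>2 / 2"
      using unit_ball_vol_even[of 2] by (simp add: fact_numeral)
    then show ?thesis
      by (simp add: emeasure_cball)
  qed
  also have "4 * ennreal (pi\<^sup>2 / 2) = ennreal (2 * pi\<^sup>2)"
    by (subst ennreal_numeral[symmetric], subst ennreal_mult'[symmetric]) auto
  finally show ?thesis .
qed

definition integral_S3 :: "(hc \<Rightarrow> complex) \<Rightarrow> complex" where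
  "integral_S3 F = integral\<^sup>L sphere_measure (\<lambda>x::real^4. F (real_quat x))"

text \<open>This is \<open>v\<^sup>+ \<cdot> u\<close> for columns and \<open>u \<cdot> v\<^sup>+\<close> for rows.\<close>

definition hdot :: "spinor \<Rightarrow> spinor \<Rightarrow> complex" where
  "hdot u v = (\<Sum>i\<in>UNIV. cnj (v $ i) * u $ i)"

text \<open>With the chosen normalization of the bases, the same coefficients occur for all four spaces.\<close>

fun form_coeff :: "series_index \<Rightarrow> real \<Rightarrow> real" where
  "form_coeff First l = (2 * l + 1) / (2 * pi\<^sup>2)"
| "form_coeff Second l = - (2 * l * (2 * l + 1) / (2 * pi\<^sup>2))"
| "form_coeff Third l = - (2 * l / (2 * pi\<^sup>2))"

definition described_on_S3 ::
  "(series_index \<Rightarrow> (real \<times> real \<times> real) set) \<Rightarrow> (series_index \<Rightarrow> real \<Rightarrow> real \<Rightarrow> real \<Rightarrow> hc \<Rightarrow> spinor) \<Rightarrow>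
   ((hc \<Rightarrow> spinor) \<Rightarrow> (hc \<Rightarrow> spinor) \<Rightarrow> complex) \<Rightarrow> bool" where
  "described_on_S3 ix b B \<longleftrightarrow>
     (\<forall>\<alpha>. \<forall>(l, m, n)\<in>ix \<alpha>. \<forall>(l', m', n')\<in>ix \<alpha>.
        B (b \<alpha> l m n) (b \<alpha> l' m' n') =
          of_real (form_coeff \<alpha> l) * integral_S3 (\<lambda>X. hdot (b \<alpha> l m n X) (b \<alpha> l' m' n' X))) \<and>
     (\<forall>\<alpha> \<alpha>'. \<alpha> \<noteq> \<alpha>' \<longrightarrow>
        (\<forall>(l, m, n)\<in>ix \<alpha>. \<forall>(l', m', n')\<in>ix \<alpha>'. B (b \<alpha> l m n) (b \<alpha>' l' m' n') = 0))"

end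

theory Submission
  imports Defs
begin

text \<open>
  The form on \<^const>\<open>U_plus\<close> is inherited from a tensor product of two unitary or pseudounitary
  representations of \<open>u(2,2)\<close>. The polynomials on \<open>2 \<times> 2\<close> matrices that are harmonic for the
  determinant form carry the inner product \<open>hform\<close>, which on homogeneous polynomials of degree
  \<open>k\<close> is \<open>(k + 1) / (2 \<pi>\<^sup>2)\<close> times the inner product of \<open>L\<^sup>2(S\<^sup>3)\<close>, and for which \<open>u(2,2)\<close> acts by
  skew-Hermitian operators (\<open>rho_adjoint\<close>). The space \<open>\<complex>\<^sup>4\<close> carries the standard form of signature
  \<open>(2,2)\<close>. On the tensor product, that is on pairs \<open>(f, g)\<close> of harmonic spinors, the difference
  \<open>wform\<close> of the two inner products is therefore invariant (\<open>wform_invariant\<close>).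

  The evaluation map \<open>(f, g) \<mapsto> f + Z g\<close> intertwines the action on pairs with the differential of
  \<^const>\<open>pi_l\<close> (\<open>lie_evalmap\<close>), and its image is \<^const>\<open>U_plus\<close>. Every element of the image has a
  lift that is \<open>wform\<close>-orthogonal to the kernel, and \<open>plus_form\<close> is \<open>wform\<close> evaluated on such lifts.
  The lifts are explicit: a basis function of the first kind lifts to \<open>(f, 0)\<close>, one of the third
  kind to \<open>(0, g)\<close>, and one of the second kind, which equals \<open>Z r\<close> with \<open>r\<close> homogeneous of degree
  \<open>2 l - 1\<close>, lifts to \<open>(- 2 l f, (2 l + 1) r)\<close>. Since elements of \<open>S\<^sup>3\<close> act unitarily on spinors, the
  integrals over \<open>S\<^sup>3\<close> of \<open>Z g\<close> and \<open>Z r\<close> agree with those of \<open>g\<close> and \<open>r\<close>, and the coefficients of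
  the three families come out as \<open>2 l + 1\<close>, \<open>- 2 l (2 l + 1)\<close> and \<open>- 2 l\<close>.

  That \<^const>\<open>U_plus\<close> and \<^const>\<open>U_minus\<close> are spanned by the expected functions
  (\<open>U_plus_span\<close>, \<open>U_minus_span\<close>) follows by diagonalization: all Laurent spinors are combinations of
  two families, \<open>afun\<close> and \<open>bfun\<close>, of eigenfunctions of \<open>N(Z) Z \<nabla> \<box>\<close>, so the solutions are spanned
  by the eigenfunctions with eigenvalue \<open>0\<close>, and the Euler operator separates the degrees.

  The other three spaces are obtained by transport (\<open>transport_form\<close>). The inversion
  \<open>f \<mapsto> N(Z)\<^sup>-\<^sup>1 Z f(Z\<^sup>-\<^sup>1)\<close> is the action of the group element exchanging the two blocks; it
  exchanges \<^const>\<open>U_plus\<close> and \<^const>\<open>U_minus\<close> and conjugates \<open>u(2,2)\<close> by the block exchange.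
  Transposition of the argument turns columns into rows and \<^const>\<open>pi_l\<close> into \<^const>\<open>pi_r\<close> up to
  an automorphism of \<open>u(2,2)\<close>. Both maps preserve integrals over \<open>S\<^sup>3\<close> and match the given bases
  up to scalar factors, which drop out of the asserted formulas because both sides are
  sesquilinear.
\<close>

section \<open>Matrix coefficients as coefficients of binary forms\<close>

text \<open>The coefficient of \<open>s\<^sup>i\<close> in \<open>(s z\<^sub>1\<^sub>1 + z\<^sub>2\<^sub>1)\<^sup>b (s z\<^sub>1\<^sub>2 + z\<^sub>2\<^sub>2)\<^sup>k\<^sup>-\<^sup>b\<close>. For \<open>k = 2 l\<close>, \<open>i = l - n\<close> and
  \<open>b = l - m\<close> this is the matrix coefficient with indices \<open>l, n, m\<close>. The indices are integers and not
  natural numbers so that the identities below hold at the boundary, where coefficients vanish.\<close>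

definition tcoef :: "int \<Rightarrow> int \<Rightarrow> int \<Rightarrow> hc \<Rightarrow> complex" where
  "tcoef k i b Z =
     (if 0 \<le> i \<and> 0 \<le> b \<and> b \<le> k
      then poly.coeff ([:Z$2$1, Z$1$1:] ^ nat b * [:Z$2$2, Z$1$2:] ^ nat (k - b)) (nat i) else 0)"

lemma tcoef_outside: "i < 0 \<or> i > k \<or> b < 0 \<or> b > k \<Longrightarrow> tcoef k i b Z = 0"
proof -
  assume a: "i < 0 \<or> i > k \<or> b < 0 \<or> b > k"
  have "poly.coeff ([:Z$2$1, Z$1$1:] ^ nat b * [:Z$2$2, Z$1$2:] ^ nat (k - b)) (nat i) = 0"
    if "0 \<le> b" "b \<le> k" "i > k"
  proof (rule coeff_eq_0)
    have 1: "degree ([:x, y:] ^ n) \<le> n" for x y :: complex and n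
      using degree_power_le[of "[:x, y:]" n] degree_pCons_le[of x "[:y:]"]
      by (smt (verit) One_nat_def degree_pCons_0 le_trans mult.commute mult_le_mono2 nat_mult_1_right)
    have "degree ([:Z$2$1, Z$1$1:] ^ nat b * [:Z$2$2, Z$1$2:] ^ nat (k - b)) \<le> nat b + nat (k - b)"
      using 1 add_mono degree_mult_le order_trans by meson
    also have "\<dots> = nat k" using that by linarith
    also have "\<dots> < nat i" using that by linarith
    finally show "degree ([:Z$2$1, Z$1$1:] ^ nat b * [:Z$2$2, Z$1$2:] ^ nat (k - b)) < nat i" .
  qed
  then show ?thesis using a unfolding tcoef_def by auto
qed

lemma tcoef_000: "tcoef 0 0 0 Z = 1"
  by (simp add: tcoef_def)

lemma coeff_linear_mult:
  "poly.coeff ([:c, d:] * p) n = c * poly.coeff p n + (if n = 0 then 0 else d * poly.coeff p (n - 1))"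
  by (cases n) simp_all

text \<open>Multiplying the generating polynomial by one more linear factor.\<close>

lemma tcoef_rec1:
  assumes "0 \<le> b" "b \<le> k"
  shows "tcoef (k + 1) i (b + 1) Z = Z$1$1 * tcoef k (i - 1) b Z + Z$2$1 * tcoef k i b Z"
proof -
  have 1: "nat (b + 1) = Suc (nat b)" "nat (k + 1 - (b + 1)) = nat (k - b)" using assms by auto
  show ?thesis
    unfolding tcoef_def 1 power_Suc mult.assoc coeff_linear_mult using assms
    by (auto simp: nat_diff_distrib algebra_simps)
qed

lemma tcoef_rec2:
  assumes "0 \<le> b" "b \<le> k"
  shows "tcoef (k + 1) i b Z = Z$1$2 * tcoef k (i - 1) b Z + Z$2$2 * tcoef k i b Z"
proof -
  have 1: "nat (k + 1 - b) = Suc (nat (k - b))" using assms by auto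
  have 2: "p * (q * r) = q * (p * r)" for p q r :: "complex poly" by (simp add: algebra_simps)
  show ?thesis
    unfolding tcoef_def 1 power_Suc 2[of "[:Z$2$1, Z$1$1:] ^ nat b"] coeff_linear_mult using assms
    by (auto simp: nat_diff_distrib algebra_simps)
qed

lemma tcoef_rec1':
  "of_int b * (Z$1$1 * tcoef (k - 1) (i - 1) (b - 1) Z + Z$2$1 * tcoef (k - 1) i (b - 1) Z)
     = of_int b * tcoef k i b Z"
proof (cases "1 \<le> b \<and> b \<le> k")
  case True
  then show ?thesis using tcoef_rec1[of "b - 1" "k - 1" i Z] by simp
next
  case False
  then have "b = 0 \<or> b < 0 \<or> b > k" by auto
  then show ?thesis by (auto simp: tcoef_outside)
qed

lemma tcoef_rec2':
  "of_int (k - b) * (Z$1$2 * tcoef (k - 1) (i - 1) b Z + Z$2$2 * tcoef (k - 1) i b Z)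
     = of_int (k - b) * tcoef k i b Z"
proof (cases "0 \<le> b \<and> b \<le> k - 1")
  case True
  then show ?thesis using tcoef_rec2[of "b" "k - 1" i Z] by simp
next
  case False
  then have "b = k \<or> b < 0 \<or> b > k" by auto
  then show ?thesis by (auto simp: tcoef_outside)
qed

text \<open>This and the following identity come from differentiating the generating polynomial in \<open>s\<close>: they
  express the action of the lowering and the raising operator of \<open>sl\<^sub>2\<close> on binary forms.\<close>

lemma tcoef_lower:
  "of_int b * (Z$1$1 * tcoef (k - 1) i (b - 1) Z) + of_int (k - b) * (Z$1$2 * tcoef (k - 1) i b Z)
     = of_int (i + 1) * tcoef k (i + 1) b Z"
proof (cases "0 \<le> b \<and> b \<le> k \<and> 0 \<le> i")
  case True
  let ?u = "[:Z$2$1, Z$1$1:]" and ?v = "[:Z$2$2, Z$1$2:]"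
  have d: "pderiv (?u ^ nat b * ?v ^ nat (k - b)) =
     smult (of_int b * Z$1$1) (?u ^ (nat b - 1) * ?v ^ nat (k - b)) +
     smult (of_int (k - b) * Z$1$2) (?u ^ nat b * ?v ^ (nat (k - b) - 1))"
    using True by (simp add: pderiv_mult pderiv_power pderiv_pCons algebra_simps smult_add_left of_nat_nat)
  have "of_int (i + 1) * tcoef k (i + 1) b Z = poly.coeff (pderiv (?u ^ nat b * ?v ^ nat (k - b))) (nat i)"
    using True unfolding coeff_pderiv tcoef_def by (auto simp: nat_add_distrib of_nat_nat)
  also have "\<dots> = of_int b * (Z$1$1 * tcoef (k - 1) i (b - 1) Z) + of_int (k - b) * (Z$1$2 * tcoef (k - 1) i b Z)"
  proof -
    have "of_int b * poly.coeff (?u ^ (nat b - 1) * ?v ^ nat (k - b)) (nat i) = of_int b * tcoef (k - 1) i (b - 1) Z"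
      using True unfolding tcoef_def by (cases "b = 0") (auto simp: nat_diff_distrib)
    moreover have "of_int (k - b) * poly.coeff (?u ^ nat b * ?v ^ (nat (k - b) - 1)) (nat i) = of_int (k - b) * tcoef (k - 1) i b Z"
    proof (cases "b = k")
      case False
      then have "nat (k - b) - 1 = nat (k - 1 - b)" by linarith
      then show ?thesis using True False unfolding tcoef_def by auto
    qed simp
    ultimately show ?thesis unfolding d coeff_add coeff_smult
      by (smt (verit) mult.assoc mult.commute)
  qed
  finally show ?thesis by simp
next
  case False
  then consider "i < -1" | "i = -1" | "b < 0" | "b = k + 1" | "b > k + 1" by linarith
  then show ?thesis by cases (auto simp: tcoef_outside)
qed

lemma tcoef_raise:
  "of_int b * (Z$2$1 * tcoef (k - 1) i (b - 1) Z) + of_int (k - b) * (Z$2$2 * tcoef (k - 1) i b Z)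
     = of_int (k - i) * tcoef k i b Z"
  using tcoef_rec1'[of b Z k i] tcoef_rec2'[of k b Z i] tcoef_lower[of b Z k "i - 1"]
  unfolding of_int_diff of_int_add diff_add_cancel by algebra

text \<open>The factors \<open>k - b\<close> and \<open>b\<close> are kept on both sides because they vanish exactly where a neighbouring
  index leaves its range.\<close>

lemma tcoef_cross:
  assumes "0 \<le> b" "b \<le> k"
  shows "of_int (k - b) * (Z$1$1 * tcoef k i b Z - Z$1$2 * tcoef k i (b + 1) Z)
     = of_int (k - b) * (det Z * tcoef (k - 1) i b Z)"
    and "of_int b * (Z$1$2 * tcoef k i b Z - Z$1$1 * tcoef k i (b - 1) Z)
     = - of_int b * (det Z * tcoef (k - 1) i (b - 1) Z)"
    and "of_int (k - b) * (Z$2$1 * tcoef k i b Z - Z$2$2 * tcoef k i (b + 1) Z)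
     = - of_int (k - b) * (det Z * tcoef (k - 1) (i - 1) b Z)"
    and "of_int b * (Z$2$2 * tcoef k i b Z - Z$2$1 * tcoef k i (b - 1) Z)
     = of_int b * (det Z * tcoef (k - 1) (i - 1) (b - 1) Z)"
proof -
  have r: "tcoef k i (c + 1) Z = Z$1$1 * tcoef (k - 1) (i - 1) c Z + Z$2$1 * tcoef (k - 1) i c Z"
     "tcoef k i c Z = Z$1$2 * tcoef (k - 1) (i - 1) c Z + Z$2$2 * tcoef (k - 1) i c Z" if "0 \<le> c" "c \<le> k - 1" for c
    using tcoef_rec1[OF that, of i Z] tcoef_rec2[OF that, of i Z] by simp_all
  show "of_int (k - b) * (Z$1$1 * tcoef k i b Z - Z$1$2 * tcoef k i (b + 1) Z)
     = of_int (k - b) * (det Z * tcoef (k - 1) i b Z)"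
  proof (cases "b = k")
    case False
    then have "0 \<le> b" "b \<le> k - 1" using assms by auto
    from r[OF this] show ?thesis unfolding det_2 by algebra
  qed simp
  show "of_int b * (Z$1$2 * tcoef k i b Z - Z$1$1 * tcoef k i (b - 1) Z)
     = - of_int b * (det Z * tcoef (k - 1) i (b - 1) Z)"
  proof (cases "b = 0")
    case False
    then have "0 \<le> b - 1" "b - 1 \<le> k - 1" using assms by auto
    from r[OF this] show ?thesis unfolding det_2 diff_add_cancel by algebra
  qed simp
  show "of_int (k - b) * (Z$2$1 * tcoef k i b Z - Z$2$2 * tcoef k i (b + 1) Z)
     = - of_int (k - b) * (det Z * tcoef (k - 1) (i - 1) b Z)"
  proof (cases "b = k")
    case False
    then have "0 \<le> b" "b \<le> k - 1" using assms by auto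
    from r[OF this] show ?thesis unfolding det_2 by algebra
  qed simp
  show "of_int b * (Z$2$2 * tcoef k i b Z - Z$2$1 * tcoef k i (b - 1) Z)
     = of_int b * (det Z * tcoef (k - 1) (i - 1) (b - 1) Z)"
  proof (cases "b = 0")
    case False
    then have "0 \<le> b - 1" "b - 1 \<le> k - 1" using assms by auto
    from r[OF this] show ?thesis unfolding det_2 diff_add_cancel by algebra
  qed simp
qed

text \<open>The Clebsch-Gordan decomposition of a product with a matrix entry. It shows that powers of the
  determinant times matrix coefficients span all polynomials, and that the harmonic part of the
  product is again a matrix coefficient.\<close>

lemma tcoef_mult_entry:
  assumes "0 \<le> b" "b \<le> k"
  shows "of_int (k + 1) * (Z$1$1 * tcoef k i b Z)
           = of_int (i + 1) * tcoef (k + 1) (i + 1) (b + 1) Z + of_int (k - b) * (det Z * tcoef (k - 1) i b Z)"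
    and "of_int (k + 1) * (Z$1$2 * tcoef k i b Z)
           = of_int (i + 1) * tcoef (k + 1) (i + 1) b Z - of_int b * (det Z * tcoef (k - 1) i (b - 1) Z)"
    and "of_int (k + 1) * (Z$2$1 * tcoef k i b Z)
           = of_int (k + 1 - i) * tcoef (k + 1) i (b + 1) Z - of_int (k - b) * (det Z * tcoef (k - 1) (i - 1) b Z)"
    and "of_int (k + 1) * (Z$2$2 * tcoef k i b Z)
           = of_int (k + 1 - i) * tcoef (k + 1) i b Z + of_int b * (det Z * tcoef (k - 1) (i - 1) (b - 1) Z)"
proof -
  note lin = add_diff_cancel_right' of_int_diff of_int_add of_int_1
  show "of_int (k + 1) * (Z$1$1 * tcoef k i b Z)
           = of_int (i + 1) * tcoef (k + 1) (i + 1) (b + 1) Z + of_int (k - b) * (det Z * tcoef (k - 1) i b Z)"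
    using tcoef_cross(1)[OF assms, of Z i] tcoef_lower[of "b + 1" Z "k + 1" i] unfolding lin by algebra
  show "of_int (k + 1) * (Z$1$2 * tcoef k i b Z)
           = of_int (i + 1) * tcoef (k + 1) (i + 1) b Z - of_int b * (det Z * tcoef (k - 1) i (b - 1) Z)"
    using tcoef_cross(2)[OF assms, of Z i] tcoef_lower[of b Z "k + 1" i] unfolding lin by algebra
  show "of_int (k + 1) * (Z$2$1 * tcoef k i b Z)
           = of_int (k + 1 - i) * tcoef (k + 1) i (b + 1) Z - of_int (k - b) * (det Z * tcoef (k - 1) (i - 1) b Z)"
    using tcoef_cross(3)[OF assms, of Z i] tcoef_raise[of "b + 1" Z "k + 1" i] unfolding lin by algebra
  show "of_int (k + 1) * (Z$2$2 * tcoef k i b Z)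
           = of_int (k + 1 - i) * tcoef (k + 1) i b Z + of_int b * (det Z * tcoef (k - 1) (i - 1) (b - 1) Z)"
    using tcoef_cross(4)[OF assms, of Z i] tcoef_raise[of b Z "k + 1" i] unfolding lin by algebra
qed

text \<open>The representation on binary forms is unitary when monomials are weighted by binomial
  coefficients; this is the reason for the two weights.\<close>

lemma tcoef_transpose:
  "of_nat (nat k choose nat b) * tcoef k i b (transpose Z) = of_nat (nat k choose nat i) * tcoef k b i Z"
proof -
  have "of_nat (n choose nat b) * tcoef (int n) i b (transpose Z) = of_nat (n choose nat i) * tcoef (int n) b i Z" 
    for n i b
  proof (induction n arbitrary: i b)
    case 0
    show ?case
    proof (cases "i = 0 \<and> b = 0")
      case False
      then have "i < 0 \<or> i > 0 \<or> b < 0 \<or> b > 0" by auto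
      then show ?thesis by (auto simp: tcoef_outside)
    qed (simp add: tcoef_000)
  next
    case (Suc n)
    have choose1: "of_int i * of_nat (Suc n choose nat i) = (of_nat (Suc n) * of_nat (n choose nat (i - 1)) :: complex)" if "i > 0" for i
    proof -
      obtain j where j: "i = int (Suc j)" using \<open>i > 0\<close> by (metis gr0_implies_Suc pos_int_cases)
      have "Suc j * (Suc n choose Suc j) = Suc n * (n choose j)" by (rule Suc_times_binomial)
      then have "of_nat (Suc j * (Suc n choose Suc j)) = (of_nat (Suc n * (n choose j)) :: complex)" by presburger
      moreover have "nat i = Suc j" "nat (i - 1) = j" using j by auto
      ultimately show ?thesis using j by (simp only: of_nat_mult of_int_of_nat_eq)
    qed
    have choose2: "of_int (int (Suc n) - i) * of_nat (Suc n choose nat i) = (of_nat (Suc n) * of_nat (n choose nat i) :: complex)" 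
      if ij: "i \<ge> 0" "i \<le> int (Suc n)" for i
    proof -
      obtain j where j: "i = int j" using ij(1) by (metis nonneg_int_cases)
      have "(Suc n - j) * (Suc n choose j) = Suc n * (n choose j)" 
        using binomial_absorb_comp[of "Suc n" j] by simp
      then have "of_nat ((Suc n - j) * (Suc n choose j)) = (of_nat (Suc n * (n choose j)) :: complex)" by (rule arg_cong)
      moreover have "of_int (int (Suc n) - i) = (of_nat (Suc n - j) :: complex)" using j ij by (simp add: of_nat_diff)
      moreover have "nat i = j" using j by auto
      ultimately show ?thesis using j by (simp only: of_nat_mult)
    qed
    have tr: "transpose Z $ a $ c = Z $ c $ a" for a c by (simp add: transpose_def)
    have pred: "int (Suc n) - 1 = int n" by simp
    consider "b < 0 \<or> b > int (Suc n) \<or> i < 0 \<or> i > int (Suc n)" 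
      | "0 < b" "b \<le> int (Suc n)" "0 \<le> i" "i \<le> int (Suc n)" | "b = 0" "0 \<le> i" "i \<le> int (Suc n)" by linarith
    then show ?case
    proof cases
      case 1 then show ?thesis by (auto simp: tcoef_outside)
    next
      case 2
      have "of_int b * (of_nat (Suc n choose nat b) * tcoef (int (Suc n)) i b (transpose Z)) = 
        of_int b * of_nat (Suc n choose nat b) * (Z$1$1 * tcoef (int n) (i - 1) (b - 1) (transpose Z) + Z$1$2 * tcoef (int n) i (b - 1) (transpose Z))"
        using tcoef_rec1[of "b - 1" "int n" i "transpose Z"] 2 by (simp add: tr add.commute)
      also have "\<dots> = of_nat (Suc n) * (Z$1$1 * (of_nat (n choose nat (i - 1)) * tcoef (int n) (b - 1) (i - 1) Z) + Z$1$2 * (of_nat (n choose nat i) * tcoef (int n) (b - 1) i Z))"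
        unfolding choose1[OF 2(1)] Suc.IH[symmetric] by (simp add: algebra_simps)
      also have "\<dots> = Z$1$1 * ((of_int i * of_nat (Suc n choose nat i)) * tcoef (int n) (b - 1) (i - 1) Z) + Z$1$2 * ((of_int (int (Suc n) - i) * of_nat (Suc n choose nat i)) * tcoef (int n) (b - 1) i Z)"
        unfolding choose2[OF 2(3,4)] using choose1[of i] 2(3) by (cases "i = 0") (auto simp: tcoef_outside algebra_simps)
      also have "\<dots> = of_nat (Suc n choose nat i) * (of_int b * tcoef (int (Suc n)) b i Z)"
        using tcoef_lower[of i Z "int (Suc n)" "b - 1"] unfolding pred diff_add_cancel by algebra
      finally show ?thesis using 2 by simp
    next
      case 3
      have "of_nat (Suc n) * tcoef (int (Suc n)) i 0 (transpose Z) = 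
        of_nat (Suc n) * (Z$2$1 * tcoef (int n) (i - 1) 0 (transpose Z) + Z$2$2 * tcoef (int n) i 0 (transpose Z))"
        using tcoef_rec2[of 0 "int n" i "transpose Z"] 3 by (simp add: tr add.commute)
      also have "\<dots> = of_nat (Suc n) * (Z$2$1 * (of_nat (n choose nat (i - 1)) * tcoef (int n) 0 (i - 1) Z) + Z$2$2 * (of_nat (n choose nat i) * tcoef (int n) 0 i Z))"
        using Suc.IH[of 0] by simp
      also have "\<dots> = Z$2$1 * ((of_int i * of_nat (Suc n choose nat i)) * tcoef (int n) 0 (i - 1) Z) + Z$2$2 * ((of_int (int (Suc n) - i) * of_nat (Suc n choose nat i)) * tcoef (int n) 0 i Z)"
        unfolding choose2[OF 3(2,3)] using choose1[of i] 3(2) by (cases "i = 0") (auto simp: tcoef_outside algebra_simps)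
      also have "\<dots> = of_nat (Suc n choose nat i) * (of_int (int (Suc n)) * tcoef (int (Suc n)) 0 i Z)"
        using tcoef_raise[of i Z "int (Suc n)" "0"] unfolding pred diff_zero by algebra
      finally show ?thesis using 3 by (simp add: mult.left_commute del: of_nat_Suc)
    qed
  qed
  from this[of "nat k" b i] show ?thesis
    by (cases "k \<ge> 0") (auto simp: tcoef_def)
qed

text \<open>The adjugate matrix, which on the unit sphere is the inverse.\<close>

definition adj :: "hc \<Rightarrow> hc" where
  "adj Z = vector [vector [Z$2$2, - Z$1$2], vector [- Z$2$1, Z$1$1]]"

lemma adj_nth [simp]:
  "adj Z $ 1 $ 1 = Z$2$2" "adj Z $ 1 $ 2 = - Z$1$2" "adj Z $ 2 $ 1 = - Z$2$1" "adj Z $ 2 $ 2 = Z$1$1"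
  by (simp_all add: adj_def)

lemma tcoef_adj_transpose:
  assumes "0 \<le> b" "b \<le> k"
  shows "tcoef k i b (adj Z) = (-1) powi (i + b) * tcoef k (k - i) (k - b) (transpose Z)"
proof -
  have "tcoef (int n) i b (adj Z) = (-1) powi (i + b) * tcoef (int n) (int n - i) (int n - b) (transpose Z)" 
    if "0 \<le> b" "b \<le> int n" for n i b
    using that
  proof (induction n arbitrary: i b)
    case 0
    then have "b = 0" by simp
    consider "i = 0" | "i < 0" | "i > 0" by linarith
    then show ?case
      using \<open>b = 0\<close> by cases (auto simp: tcoef_000 tcoef_outside)
  next
    case (Suc n)
    have tr: "transpose Z $ a $ c = Z $ c $ a" for a c by (simp add: transpose_def)
    have sgn: "(-1) powi (x + 1) = - ((-1) powi x :: complex)" "(-1) powi (x - 1) = - ((-1) powi x :: complex)" for x :: int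
      by (simp_all add: power_int_add power_int_diff)
    consider "0 < b" | "b = 0" using Suc.prems by linarith
    then show ?case
    proof cases
      case 1
      have "tcoef (int (Suc n)) i b (adj Z) = Z$2$2 * tcoef (int n) (i - 1) (b - 1) (adj Z) - Z$2$1 * tcoef (int n) i (b - 1) (adj Z)"
        using tcoef_rec1[of "b - 1" "int n" i "adj Z"] 1 Suc.prems by (simp add: add.commute)
      also have "\<dots> = (-1) powi (i + b) * (Z$2$2 * tcoef (int n) (int n - i + 1) (int n - b + 1) (transpose Z) + Z$2$1 * tcoef (int n) (int n - i) (int n - b + 1) (transpose Z))"
      proof -
        have "(i - 1) + (b - 1) = (i + b) - 1 - 1" "i + (b - 1) = (i + b) - 1" by auto
        then have "(-1) powi ((i - 1) + (b - 1)) = ((-1) powi (i + b) :: complex)" "(-1) powi (i + (b - 1)) = - ((-1) powi (i + b) :: complex)"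
          by (simp_all only: sgn minus_minus)
        then show ?thesis
          using Suc.IH[of "b - 1" "i - 1"] Suc.IH[of "b - 1" i] 1 Suc.prems by (simp add: algebra_simps)
      qed
      also have "\<dots> = (-1) powi (i + b) * tcoef (int (Suc n)) (int (Suc n) - i) (int (Suc n) - b) (transpose Z)"
        using tcoef_rec2[of "int n - b + 1" "int n" "int n + 1 - i" "transpose Z"] 1 Suc.prems by (simp add: tr algebra_simps)
      finally show ?thesis .
    next
      case 2
      have "tcoef (int (Suc n)) i 0 (adj Z) = - Z$1$2 * tcoef (int n) (i - 1) 0 (adj Z) + Z$1$1 * tcoef (int n) i 0 (adj Z)"
        using tcoef_rec2[of 0 "int n" i "adj Z"] by (simp add: add.commute)
      also have "\<dots> = (-1) powi i * (Z$1$2 * tcoef (int n) (int n - i + 1) (int n) (transpose Z) + Z$1$1 * tcoef (int n) (int n - i) (int n) (transpose Z))"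
          using Suc.IH[of 0 "i - 1"] Suc.IH[of 0 i] sgn by (simp add: algebra_simps)
      also have "\<dots> = (-1) powi i * tcoef (int (Suc n)) (int (Suc n) - i) (int (Suc n)) (transpose Z)"
        using tcoef_rec1[of "int n" "int n" "int n + 1 - i" "transpose Z"] by (simp add: tr algebra_simps)
      finally show ?thesis using 2 by simp
    qed
  qed
  from this[of b "nat k" i] show ?thesis using assms by simp
qed

lemma tcoef_adj:
  assumes "0 \<le> b" "b \<le> k"
  shows "of_nat (nat k choose nat b) * tcoef k i b (adj Z) = (-1) powi (i + b) * of_nat (nat k choose nat i) * tcoef k (k - b) (k - i) Z"
proof (cases "0 \<le> i \<and> i \<le> k")
  case True
  have 0: "nat (k - b) = nat k - nat b" "nat (k - i) = nat k - nat i" using assms True by linarith+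
  have 1: "nat k choose nat b = (nat k choose nat (k - b))" "nat k choose nat i = (nat k choose nat (k - i))"
    unfolding 0 using assms True by (intro binomial_symmetric; linarith)+
  show ?thesis unfolding tcoef_adj_transpose[OF assms] 1
    using tcoef_transpose[of k "k - b" "k - i" Z] by algebra
next
  case False
  then show ?thesis by (auto simp: tcoef_outside)
qed

lemma tcoef_cmul: "0 \<le> b \<Longrightarrow> b \<le> k \<Longrightarrow> tcoef k i b (cmul c Z) = c ^ nat k * tcoef k i b Z"
proof -
  assume a: "0 \<le> b" "b \<le> k"
  have 1: "[:cmul c Z $ 2 $ x, cmul c Z $ 1 $ x:] = smult c [:Z $ 2 $ x, Z $ 1 $ x:]" for x
    by (simp add: cmul_def)
  have 2: "nat k = nat b + nat (k - b)" using a by auto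
  have 3: "smult c p ^ n = smult (c ^ n) (p ^ n)" for p n
    by (simp add: smult_power)
  show ?thesis unfolding tcoef_def 1 2 3
    by (auto simp: power_add mult.assoc mult.commute mult.left_commute)
qed

section \<open>Complex gradients off the singular matrices\<close>

definition unit_mat :: "2 \<Rightarrow> 2 \<Rightarrow> hc" where
  "unit_mat a b = (\<chi> i j. if i = a \<and> j = b then 1 else 0)"

text \<open>Complex differentiability, with the gradient collected in a matrix. The four coordinates are
  replaced by the four matrix entries, in which the differential operators take their simplest form.\<close>

definition has_cgrad :: "(hc \<Rightarrow> complex) \<Rightarrow> hc \<Rightarrow> hc \<Rightarrow> bool" where
  "has_cgrad F g Z \<longleftrightarrow> (F has_derivative (\<lambda>V. V$1$1 * g$1$1 + V$1$2 * g$1$2 + V$2$1 * g$2$1 + V$2$2 * g$2$2)) (at Z)"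

text \<open>Extended by zero to singular matrices, so that derivatives of elements of the Laurent algebra are
  again elements of it.\<close>

definition partial :: "2 \<Rightarrow> 2 \<Rightarrow> (hc \<Rightarrow> complex) \<Rightarrow> hc \<Rightarrow> complex" where
  "partial a b F = on_invertible (\<lambda>Z. frechet_derivative F (at Z) (unit_mat a b))"

definition smooth :: "(hc \<Rightarrow> complex) \<Rightarrow> bool" where
  "smooth F \<longleftrightarrow> (\<forall>Z. det Z \<noteq> 0 \<longrightarrow> (\<exists>g. has_cgrad F g Z))"

lemma exhaust_2_cases: "(a::2) = 1 \<or> a = 2"
  by (rule exhaust_2)

lemma cmul_nth [simp]: "cmul c A $ i $ j = c * A $ i $ j"
  by (simp add: cmul_def)

lemma hc_eqI: "(A::hc) $ 1 $ 1 = B $ 1 $ 1 \<Longrightarrow> A $ 1 $ 2 = B $ 1 $ 2 \<Longrightarrow> A $ 2 $ 1 = B $ 2 $ 1 \<Longrightarrow> A $ 2 $ 2 = B $ 2 $ 2 \<Longrightarrow> A = B"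
  by (simp add: vec_eq_iff forall_2)

lemma frechet_derivative_cgrad:
  assumes "has_cgrad F g Z"
  shows "frechet_derivative F (at Z) V = V$1$1 * g$1$1 + V$1$2 * g$1$2 + V$2$1 * g$2$1 + V$2$2 * g$2$2"
  by (simp add: frechet_derivative_at[OF assms[unfolded has_cgrad_def], symmetric])

lemma partial_eq:
  assumes "has_cgrad F g Z" "det Z \<noteq> 0"
  shows "partial a b F Z = g $ a $ b"
  using frechet_derivative_cgrad[OF assms(1)] assms(2) exhaust_2_cases[of a] exhaust_2_cases[of b]
  by (auto simp: partial_def on_invertible_def unit_mat_def)

lemma partial_singular [simp]: "det Z = 0 \<Longrightarrow> partial a b F Z = 0"
  by (simp add: partial_def on_invertible_def)

lemma smoothD:
  assumes "smooth F" "det Z \<noteq> 0"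
  shows "has_cgrad F (\<chi> a b. partial a b F Z) Z"
proof -
  obtain g where g: "has_cgrad F g Z" using assms smooth_def by blast
  moreover have "(\<chi> a b. partial a b F Z) = g"
    by (simp add: vec_eq_iff partial_eq[OF g assms(2)])
  ultimately show ?thesis by simp
qed

text \<open>The form in which derivatives are computed: equality of functions, including the singular matrices.\<close>

lemma partialI:
  assumes "\<And>Z. det Z \<noteq> 0 \<Longrightarrow> has_cgrad F (g Z) Z" "\<And>Z. det Z = 0 \<Longrightarrow> G Z = 0" "\<And>Z. det Z \<noteq> 0 \<Longrightarrow> G Z = g Z $ a $ b"
  shows "partial a b F = G"
proof
  fix Z show "partial a b F Z = G Z"
    using assms(2,3) partial_eq[OF assms(1)] by (cases "det Z = 0") auto
qed

lemma open_invertible: "open {Z::hc. det Z \<noteq> 0}"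
proof -
  have "continuous_on UNIV (\<lambda>Z::hc. det Z)"
    unfolding det_2 by (intro continuous_intros)
  then have "open ((\<lambda>Z::hc. det Z) -` (- {0}))"
    by (intro open_vimage) auto
  moreover have "(\<lambda>Z::hc. det Z) -` (- {0}) = {Z. det Z \<noteq> 0}" by auto
  ultimately show ?thesis by simp
qed

lemma has_cgrad_cong:
  assumes "has_cgrad F g Z" "det Z \<noteq> 0" "\<And>W. det W \<noteq> 0 \<Longrightarrow> F W = G W"
  shows "has_cgrad G g Z"
  unfolding has_cgrad_def
  by (rule has_derivative_transform_within_open[OF assms(1)[unfolded has_cgrad_def] open_invertible])
     (use assms in auto)

lemma has_cgrad_on_invertible:
  assumes "has_cgrad F g Z" "det Z \<noteq> 0"
  shows "has_cgrad (on_invertible F) g Z"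
  by (rule has_cgrad_cong[OF assms]) (simp add: on_invertible_def)

lemma has_cgrad_const: "has_cgrad (\<lambda>Z. c) 0 Z"
  by (simp add: has_cgrad_def)

lemma has_cgrad_entry: "has_cgrad (\<lambda>Z. Z $ a $ b) (unit_mat a b) Z"
proof -
  have "bounded_linear (\<lambda>Z::hc. Z $ a $ b)"
    using bounded_linear_compose[OF bounded_linear_vec_nth[of b] bounded_linear_vec_nth[of a]] .
  then have "((\<lambda>Z::hc. Z $ a $ b) has_derivative (\<lambda>V. V $ a $ b)) (at Z)"
    by (rule bounded_linear_imp_has_derivative)
  then show ?thesis
    unfolding has_cgrad_def unit_mat_def using exhaust_2_cases[of a] exhaust_2_cases[of b] by auto
qed

lemma has_cgrad_add:
  assumes "has_cgrad F f Z" "has_cgrad G g Z"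
  shows "has_cgrad (\<lambda>Z. F Z + G Z) (f + g) Z"
  using has_derivative_add[OF assms[unfolded has_cgrad_def]] unfolding has_cgrad_def
  by (simp add: algebra_simps)

lemma has_cgrad_mult:
  assumes "has_cgrad F f Z" "has_cgrad G g Z"
  shows "has_cgrad (\<lambda>Z. F Z * G Z) (cmul (F Z) g + cmul (G Z) f) Z"
  using has_derivative_mult[OF assms[unfolded has_cgrad_def]] unfolding has_cgrad_def
  by (simp add: algebra_simps)

lemma has_cgrad_cmult:
  assumes "has_cgrad F f Z"
  shows "has_cgrad (\<lambda>Z. c * F Z) (cmul c f) Z"
  using has_cgrad_mult[OF has_cgrad_const[of c] assms]
  by (simp add: cmul_def vec_eq_iff has_cgrad_def)

lemma has_cgrad_eq: "has_cgrad F f Z \<Longrightarrow> f = g \<Longrightarrow> has_cgrad F g Z"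
  by simp

lemma has_cgrad_det: "has_cgrad det (transpose (adj Z)) Z"
proof -
  have "has_cgrad (\<lambda>Z. Z$1$1 * Z$2$2 + (-1) * (Z$1$2 * Z$2$1)) (transpose (adj Z)) Z"
    by (rule has_cgrad_eq[OF has_cgrad_add[OF has_cgrad_mult[OF has_cgrad_entry has_cgrad_entry]
          has_cgrad_cmult[OF has_cgrad_mult[OF has_cgrad_entry has_cgrad_entry]]]])
       (rule hc_eqI; simp add: unit_mat_def transpose_def)
  moreover have "(\<lambda>Z. Z$1$1 * Z$2$2 + (-1) * (Z$1$2 * Z$2$1)) = (det :: hc \<Rightarrow> complex)"
    by (rule ext) (simp add: det_2)
  ultimately show ?thesis by simp
qed

lemma has_cgrad_powi_det:
  assumes "det Z \<noteq> 0"
  shows "has_cgrad (\<lambda>Z. det Z powi j) (cmul (of_int j * det Z powi (j - 1)) (transpose (adj Z))) Z"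
proof -
  have "((\<lambda>w::complex. w powi j) has_field_derivative (of_int j * det Z powi (j - 1))) (at (det Z))"
    using assms by (auto intro!: derivative_eq_intros)
  from has_derivative_compose[OF has_cgrad_det[of Z, unfolded has_cgrad_def] this[unfolded has_field_derivative_def]]
  show ?thesis
    unfolding has_cgrad_def by (simp add: algebra_simps)
qed

lemma smooth_const: "smooth (\<lambda>Z. c)" using has_cgrad_const smooth_def by blast
lemma smooth_entry: "smooth (\<lambda>Z. Z $ a $ b)" using has_cgrad_entry smooth_def by blast
lemma smooth_add: "smooth F \<Longrightarrow> smooth G \<Longrightarrow> smooth (\<lambda>Z. F Z + G Z)" 
  using has_cgrad_add unfolding smooth_def by meson
lemma smooth_mult: "smooth F \<Longrightarrow> smooth G \<Longrightarrow> smooth (\<lambda>Z. F Z * G Z)" 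
  using has_cgrad_mult unfolding smooth_def by meson
lemma smooth_powi_det: "smooth (\<lambda>Z. det Z powi j)" 
  using has_cgrad_powi_det unfolding smooth_def by blast
lemma smooth_on_invertible: "smooth F \<Longrightarrow> smooth (on_invertible F)" 
  using has_cgrad_on_invertible unfolding smooth_def by blast

lemma smooth_cong: "smooth F \<Longrightarrow> (\<And>Z. det Z \<noteq> 0 \<Longrightarrow> F Z = G Z) \<Longrightarrow> smooth G"
  using has_cgrad_cong unfolding smooth_def by metis

lemma partial_add:
  assumes "smooth F" "smooth G"
  shows "partial a b (\<lambda>Z. F Z + G Z) = (\<lambda>Z. partial a b F Z + partial a b G Z)"
  by (rule partialI[OF has_cgrad_add[OF smoothD[OF assms(1)] smoothD[OF assms(2)]]]) auto

lemma partial_mult: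
  assumes "smooth F" "smooth G"
  shows "partial a b (\<lambda>Z. F Z * G Z) = (\<lambda>Z. F Z * partial a b G Z + G Z * partial a b F Z)"
  by (rule partialI[OF has_cgrad_mult[OF smoothD[OF assms(1)] smoothD[OF assms(2)]]]) auto

lemma partial_cmult:
  assumes "smooth F"
  shows "partial a b (\<lambda>Z. c * F Z) = (\<lambda>Z. c * partial a b F Z)"
  by (rule partialI[OF has_cgrad_cmult[OF smoothD[OF assms(1)]]]) auto

lemma partial_entry_mult:
  assumes "smooth F" "det Z \<noteq> 0"
  shows "partial a b (\<lambda>Z. Z $ c $ d * F Z) Z = (if a = c \<and> b = d then F Z else 0) + Z $ c $ d * partial a b F Z"
  by (subst partial_eq[OF has_cgrad_mult[OF has_cgrad_entry smoothD[OF assms]] assms(2)])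
     (auto simp: unit_mat_def)

lemma partial_cong: "smooth F \<Longrightarrow> (\<And>Z. det Z \<noteq> 0 \<Longrightarrow> F Z = G Z) \<Longrightarrow> partial a b F = partial a b G"
proof
  fix Z assume F: "smooth F" and eq: "\<And>Z. det Z \<noteq> 0 \<Longrightarrow> F Z = G Z"
  show "partial a b F Z = partial a b G Z"
  proof (cases "det Z = 0")
    case False
    show ?thesis
      using partial_eq[OF smoothD[OF F False] False] partial_eq[OF has_cgrad_cong[OF smoothD[OF F False] False eq] False]
      by simp
  qed simp
qed

lemma has_cgrad_line:
  assumes "has_cgrad F g Z"
  shows "((\<lambda>w. F (Z + cmul w V)) has_field_derivative (V$1$1 * g$1$1 + V$1$2 * g$1$2 + V$2$1 * g$2$1 + V$2$2 * g$2$2)) (at 0)"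
proof -
  have "bounded_linear (\<lambda>w::complex. cmul w V)"
  proof -
    have "linear (\<lambda>w::complex. cmul w V)"
      by (rule linearI) (simp_all add: vec_eq_iff algebra_simps)
    then show ?thesis by (simp add: linear_conv_bounded_linear)
  qed
  then have 1: "((\<lambda>w::complex. Z + cmul w V) has_derivative (\<lambda>w. cmul w V)) (at 0)"
    by (auto intro!: derivative_eq_intros bounded_linear_imp_has_derivative)
  have "cmul 0 V = 0" by (simp add: vec_eq_iff)
  then have 2: "(F has_derivative (\<lambda>V. V$1$1 * g$1$1 + V$1$2 * g$1$2 + V$2$1 * g$2$1 + V$2$2 * g$2$2)) (at (Z + cmul 0 V))"
    using assms by (simp add: has_cgrad_def)
  from has_derivative_compose[OF 1 2] show ?thesis
    unfolding has_field_derivative_def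
    by (rule has_derivative_eq_rhs) (simp add: algebra_simps fun_eq_iff)
qed

lemma eventually_line_invertible:
  fixes Z V :: hc
  assumes "det Z \<noteq> 0"
  shows "\<forall>\<^sub>F w in nhds 0. det (Z + cmul w V) \<noteq> 0"
proof -
  have "continuous_on UNIV (\<lambda>w::complex. det (Z + cmul w V))"
    unfolding det_2 vector_add_component cmul_nth by (intro continuous_intros)
  then have "open ((\<lambda>w. det (Z + cmul w V)) -` (- {0}))"
    by (intro open_vimage) auto
  moreover have "0 \<in> ((\<lambda>w. det (Z + cmul w V)) -` (- {0}))"
    using assms by (simp add: det_2)
  ultimately have "\<forall>\<^sub>F w in nhds 0. w \<in> (\<lambda>w. det (Z + cmul w V)) -` (- {0})"
    by (rule eventually_nhds_in_open)
  then show ?thesis by simp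
qed

lemma pd_cong:
  assumes "det Z \<noteq> 0" "\<And>W. det W \<noteq> 0 \<Longrightarrow> f W = g W"
  shows "pd j f Z = pd j g Z"
proof -
  have "\<forall>\<^sub>F w in nhds 0. f (Z + cmul w (qe j)) $ i = g (Z + cmul w (qe j)) $ i" for i
    using eventually_line_invertible[OF assms(1), of "qe j"] by (rule eventually_mono) (simp add: assms(2))
  from deriv_cong_ev[OF this refl] show ?thesis
    unfolding pd_def by simp
qed

lemma pd_partial:
  assumes "smooth (\<lambda>Z. f Z $ i)" "det Z \<noteq> 0"
  shows "pd j f Z $ i = qe j $1$1 * partial 1 1 (\<lambda>Z. f Z $ i) Z + qe j $1$2 * partial 1 2 (\<lambda>Z. f Z $ i) Z
     + qe j $2$1 * partial 2 1 (\<lambda>Z. f Z $ i) Z + qe j $2$2 * partial 2 2 (\<lambda>Z. f Z $ i) Z"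
  unfolding pd_def using DERIV_imp_deriv[OF has_cgrad_line[OF smoothD[OF assms]]] by simp

lemma qe_nth:
  "qe 0 $1$1 = 1" "qe 0 $1$2 = 0" "qe 0 $2$1 = 0" "qe 0 $2$2 = 1"
  "qe 1 $1$1 = 0" "qe 1 $1$2 = -\<i>" "qe 1 $2$1 = -\<i>" "qe 1 $2$2 = 0"
  "qe 2 $1$1 = 0" "qe 2 $1$2 = -1" "qe 2 $2$1 = 1" "qe 2 $2$2 = 0"
  "qe 3 $1$1 = -\<i>" "qe 3 $1$2 = 0" "qe 3 $2$1 = 0" "qe 3 $2$2 = \<i>"
  by (simp_all add: qe_def)

lemma matrix_vector_2: "((A::hc) *v x) $ 1 = A$1$1 * x$1 + A$1$2 * x$2" "(A *v x) $ 2 = A$2$1 * x$1 + A$2$2 * x$2"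
  by (simp_all add: matrix_vector_mult_def sum_2)

lemma vector_matrix_2: "(x v* (A::hc)) $ 1 = A$1$1 * x$1 + A$2$1 * x$2" "(x v* A) $ 2 = A$1$2 * x$1 + A$2$2 * x$2"
  by (simp_all add: vector_matrix_mult_def sum_2)

text \<open>In the matrix entries the operator \<open>\<nabla>\<close> is twice the matrix of partial derivatives, transposed.\<close>

lemma nabla_partial:
  assumes "\<And>i. smooth (\<lambda>Z. f Z $ i)" "det Z \<noteq> 0"
  shows "nabla f Z $ 1 = 2 * (partial 1 1 (\<lambda>Z. f Z $ 1) Z + partial 2 1 (\<lambda>Z. f Z $ 2) Z)"
    and "nabla f Z $ 2 = 2 * (partial 1 2 (\<lambda>Z. f Z $ 1) Z + partial 2 2 (\<lambda>Z. f Z $ 2) Z)"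
  unfolding nabla_def by (simp_all add: matrix_vector_2 pd_partial[OF assms] qe_nth algebra_simps)

lemma nabla_right_partial:
  assumes "\<And>i. smooth (\<lambda>Z. f Z $ i)" "det Z \<noteq> 0"
  shows "nabla_right f Z $ 1 = 2 * (partial 1 1 (\<lambda>Z. f Z $ 1) Z + partial 1 2 (\<lambda>Z. f Z $ 2) Z)"
    and "nabla_right f Z $ 2 = 2 * (partial 2 1 (\<lambda>Z. f Z $ 1) Z + partial 2 2 (\<lambda>Z. f Z $ 2) Z)"
  unfolding nabla_right_def by (simp_all add: vector_matrix_2 pd_partial[OF assms] qe_nth algebra_simps)

text \<open>The operator \<open>\<box>\<close> in the matrix entries: it is four times the determinant of the matrix of partial
  derivatives, symmetrized in the order of differentiation.\<close>

definition lap :: "(hc \<Rightarrow> complex) \<Rightarrow> hc \<Rightarrow> complex" where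
  "lap F Z = 2 * (partial 1 1 (partial 2 2 F) Z + partial 2 2 (partial 1 1 F) Z
     - partial 1 2 (partial 2 1 F) Z - partial 2 1 (partial 1 2 F) Z)"

lemma laplacian_partial:
  assumes "smooth (\<lambda>Z. f Z $ i)" "\<And>a b. smooth (partial a b (\<lambda>Z. f Z $ i))" "det Z \<noteq> 0"
  shows "laplacian f Z $ i = lap (\<lambda>Z. f Z $ i) Z"
proof -
  let ?F = "\<lambda>Z. f Z $ i"
  have line: "pd j (pd j f) Z $ i = 
      qe j $1$1 * partial 1 1 (\<lambda>Z. pd j f Z $ i) Z + qe j $1$2 * partial 1 2 (\<lambda>Z. pd j f Z $ i) Z
     + qe j $2$1 * partial 2 1 (\<lambda>Z. pd j f Z $ i) Z + qe j $2$2 * partial 2 2 (\<lambda>Z. pd j f Z $ i) Z" 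
   and part: "partial a b (\<lambda>Z. pd j f Z $ i) Z = qe j $1$1 * partial a b (partial 1 1 ?F) Z + qe j $1$2 * partial a b (partial 1 2 ?F) Z
     + qe j $2$1 * partial a b (partial 2 1 ?F) Z + qe j $2$2 * partial a b (partial 2 2 ?F) Z" for j a b
  proof -
    let ?G = "\<lambda>Z. qe j $1$1 * partial 1 1 ?F Z + qe j $1$2 * partial 1 2 ?F Z
     + qe j $2$1 * partial 2 1 ?F Z + qe j $2$2 * partial 2 2 ?F Z"
    have sG: "smooth ?G" by (intro smooth_add smooth_mult smooth_const assms)
    have eq: "?G Z = pd j f Z $ i" if "det Z \<noteq> 0" for Z using pd_partial[OF assms(1) that] by simp
    have sm: "smooth (\<lambda>Z. pd j f Z $ i)" using smooth_cong[OF sG eq] .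
    show "pd j (pd j f) Z $ i = 
      qe j $1$1 * partial 1 1 (\<lambda>Z. pd j f Z $ i) Z + qe j $1$2 * partial 1 2 (\<lambda>Z. pd j f Z $ i) Z
     + qe j $2$1 * partial 2 1 (\<lambda>Z. pd j f Z $ i) Z + qe j $2$2 * partial 2 2 (\<lambda>Z. pd j f Z $ i) Z"
      by (rule pd_partial[OF sm assms(3)])
    have "partial a b (\<lambda>Z. pd j f Z $ i) = partial a b ?G"
      using partial_cong[OF sG eq] by simp
    also have "\<dots> = (\<lambda>Z. qe j $1$1 * partial a b (partial 1 1 ?F) Z + qe j $1$2 * partial a b (partial 1 2 ?F) Z
     + qe j $2$1 * partial a b (partial 2 1 ?F) Z + qe j $2$2 * partial a b (partial 2 2 ?F) Z)"
      by (simp add: partial_add partial_cmult smooth_add smooth_mult smooth_const assms)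
    finally show "partial a b (\<lambda>Z. pd j f Z $ i) Z = qe j $1$1 * partial a b (partial 1 1 ?F) Z + qe j $1$2 * partial a b (partial 1 2 ?F) Z
     + qe j $2$1 * partial a b (partial 2 1 ?F) Z + qe j $2$2 * partial a b (partial 2 2 ?F) Z" by simp
  qed
  have "laplacian f Z $ i = pd 0 (pd 0 f) Z $ i + pd 1 (pd 1 f) Z $ i + pd 2 (pd 2 f) Z $ i + pd 3 (pd 3 f) Z $ i"
    unfolding laplacian_def UNIV_index4 by (simp add: add.assoc)
  also have "\<dots> = lap ?F Z"
    unfolding line part qe_nth lap_def by (simp add: algebra_simps)
  finally show ?thesis .
qed

section \<open>The Laurent algebra\<close>

lemma laurent_entry: "on_invertible (\<lambda>Z. Z $ a $ b) \<in> laurent_algebra"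
proof -
  have 1: "(\<lambda>Z. on_invertible (\<lambda>Z. c) Z * on_invertible (\<lambda>Z. coords Z $ j) Z + 
      on_invertible (\<lambda>Z. d) Z * on_invertible (\<lambda>Z. coords Z $ k) Z) \<in> laurent_algebra" for c d j k
    by (intro laurent_algebra.intros)
  have 2: "on_invertible (\<lambda>Z. Z $ a $ b) \<in> laurent_algebra" 
    if "\<And>Z. Z $ a $ b = c * coords Z $ j + d * coords Z $ k" for c d j k
    using 1[of c j d k] unfolding on_invertible_def that by (simp add: if_distrib cong: if_cong)
  have i2: "\<i> * (\<i> * x) = - x" for x by (simp add: complex_eq_iff)
  have "Z$1$1 = 1 * coords Z $ 0 + (-\<i>) * coords Z $ 3" "Z$1$2 = (-\<i>) * coords Z $ 1 + (-1) * coords Z $ 2" 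
    "Z$2$1 = (-\<i>) * coords Z $ 1 + 1 * coords Z $ 2" "Z$2$2 = 1 * coords Z $ 0 + \<i> * coords Z $ 3" for Z
    unfolding coords_nth by (simp_all add: field_simps i2)
  then show ?thesis using 2 exhaust_2_cases[of a] exhaust_2_cases[of b] by metis
qed

lemma laurent_singular: "p \<in> laurent_algebra \<Longrightarrow> det Z = 0 \<Longrightarrow> p Z = 0"
  by (induction p rule: laurent_algebra.induct) (auto simp: on_invertible_def)

lemma laurent_scale: "p \<in> laurent_algebra \<Longrightarrow> (\<lambda>Z. c * p Z) \<in> laurent_algebra"
proof -
  assume p: "p \<in> laurent_algebra"
  have "(\<lambda>Z. on_invertible (\<lambda>Z. c) Z * p Z) \<in> laurent_algebra"
    by (intro laurent_algebra.intros p)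
  moreover have "(\<lambda>Z. on_invertible (\<lambda>Z. c) Z * p Z) = (\<lambda>Z. c * p Z)"
    using laurent_singular[OF p] by (auto simp: on_invertible_def)
  ultimately show ?thesis by simp
qed

lemma laurent_entry_mult: "p \<in> laurent_algebra \<Longrightarrow> (\<lambda>Z. Z $ a $ b * p Z) \<in> laurent_algebra"
proof -
  assume p: "p \<in> laurent_algebra"
  have "(\<lambda>Z. on_invertible (\<lambda>Z. Z $ a $ b) Z * p Z) \<in> laurent_algebra"
    by (intro laurent_algebra.intros p laurent_entry)
  moreover have "(\<lambda>Z. on_invertible (\<lambda>Z. Z $ a $ b) Z * p Z) = (\<lambda>Z. Z $ a $ b * p Z)"
    using laurent_singular[OF p] by (auto simp: on_invertible_def)
  ultimately show ?thesis by simp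
qed

lemma has_cgrad_coords: "\<exists>g. \<forall>Z. has_cgrad (\<lambda>Z. coords Z $ j) g Z"
proof -
  have 0: "j = 0 \<or> j = 1 \<or> j = 2 \<or> j = 3" using UNIV_index4 by auto
  have 1: "\<exists>g. \<forall>Z. has_cgrad F g Z" if "\<And>Z. F Z = c * Z$1$1 + d * Z$1$2 + e * Z$2$1 + h * Z$2$2" for F c d e h
  proof -
    have "has_cgrad F (cmul c (unit_mat 1 1) + cmul d (unit_mat 1 2) + cmul e (unit_mat 2 1) + cmul h (unit_mat 2 2)) Z" for Z
    proof -
      have F: "F = (\<lambda>Z. c * Z$1$1 + d * Z$1$2 + e * Z$2$1 + h * Z$2$2)" using that by auto
      show ?thesis unfolding F by (intro has_cgrad_add has_cgrad_cmult has_cgrad_entry)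
    qed
    then show ?thesis by blast
  qed
  from 0 show ?thesis
  proof (elim disjE)
    assume "j = 0" then show ?thesis by (intro 1[of _ "1/2" 0 0 "1/2"]) (simp add: coords_nth field_simps)
  next
    assume "j = 1" then show ?thesis by (intro 1[of _ 0 "\<i>/2" "\<i>/2" 0]) (simp add: coords_nth field_simps)
  next
    assume "j = 2" then show ?thesis by (intro 1[of _ 0 "-1/2" "1/2" 0]) (simp add: coords_nth field_simps)
  next
    assume "j = 3" then show ?thesis by (intro 1[of _ "\<i>/2" 0 0 "-\<i>/2"]) (simp add: coords_nth field_simps)
  qed
qed

text \<open>Closure of the Laurent algebra under differentiation is what allows second and third order
  operators to be composed freely below.\<close>

lemma laurent_smooth_partial:
  "p \<in> laurent_algebra \<Longrightarrow> smooth p \<and> (\<forall>a b. partial a b p \<in> laurent_algebra)"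
proof (induction p rule: laurent_algebra.induct)
  case (const c)
  have "partial a b (on_invertible (\<lambda>Z. c)) = on_invertible (\<lambda>Z. 0)" for a b
    by (rule partialI[OF has_cgrad_on_invertible[OF has_cgrad_const]]) (auto simp: on_invertible_def)
  then show ?case using laurent_algebra.const smooth_on_invertible[OF smooth_const] by simp
next
  case (coord j)
  obtain g where g: "\<And>Z. has_cgrad (\<lambda>Z. coords Z $ j) g Z" using has_cgrad_coords by blast
  have "partial a b (on_invertible (\<lambda>Z. coords Z $ j)) = on_invertible (\<lambda>Z. g $ a $ b)" for a b
    by (rule partialI[OF has_cgrad_on_invertible[OF g]]) (auto simp: on_invertible_def)
  moreover have "smooth (on_invertible (\<lambda>Z. coords Z $ j))" using has_cgrad_on_invertible[OF g] smooth_def by blast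
  ultimately show ?case using laurent_algebra.const by simp
next
  case inverse_det
  have inv: "on_invertible (\<lambda>Z::hc. inverse (det Z)) = on_invertible (\<lambda>Z. det Z powi (-1))" by (simp add: power_int_minus)
  have "partial a b (on_invertible (\<lambda>Z. inverse (det Z))) = 
     (\<lambda>Z. (-1) * (on_invertible (\<lambda>Z. inverse (det Z)) Z * on_invertible (\<lambda>Z. inverse (det Z)) Z) * on_invertible (\<lambda>Z. adj Z $ b $ a) Z)" for a b
    unfolding inv
    by (rule partialI[OF has_cgrad_on_invertible[OF has_cgrad_powi_det]]) 
       (auto simp: on_invertible_def power_int_def transpose_def power2_eq_square)
  moreover have "on_invertible (\<lambda>Z. adj Z $ b $ a) \<in> laurent_algebra" for a b
  proof -
    have "on_invertible (\<lambda>Z. - (Z $ c $ d)) \<in> laurent_algebra" for c d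
      using laurent_scale[OF laurent_entry[of c d], of "-1"]
      by (simp add: on_invertible_def[abs_def] if_distrib cong: if_cong)
    then show ?thesis using laurent_entry exhaust_2_cases[of a] exhaust_2_cases[of b] by auto
  qed
  ultimately have "partial a b (on_invertible (\<lambda>Z. inverse (det Z))) \<in> laurent_algebra" for a b
    using laurent_algebra.mult[OF laurent_scale[OF laurent_algebra.mult[OF laurent_algebra.inverse_det laurent_algebra.inverse_det], of "-1"]]
    by presburger
  moreover have "smooth (on_invertible (\<lambda>Z. inverse (det Z)))"
    unfolding inv by (rule smooth_on_invertible[OF smooth_powi_det])
  ultimately show ?case by blast
next
  case (add p q)
  then show ?case using smooth_add[of p q] by (simp add: partial_add laurent_algebra.add)
next
  case (mult p q)
  then show ?case using smooth_mult[of p q] by (simp add: partial_mult laurent_algebra.add laurent_algebra.mult)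
qed

section \<open>Homogeneous harmonic functions times powers of the determinant\<close>

definition mat2 :: "complex \<Rightarrow> complex \<Rightarrow> complex \<Rightarrow> complex \<Rightarrow> hc" where
  "mat2 a b c d = vector [vector [a, b], vector [c, d]]"

lemma mat2_nth [simp]:
  "mat2 a b c d $ 1 $ 1 = a" "mat2 a b c d $ 1 $ 2 = b" "mat2 a b c d $ 2 $ 1 = c" "mat2 a b c d $ 2 $ 2 = d"
  by (simp_all add: mat2_def)

lemma unit_mat_nth: "unit_mat a b $ i $ j = (if i = a \<and> j = b then 1 else 0)"
  by (simp add: unit_mat_def)

lemma unit_mat_nths:
  "unit_mat 1 1 $ 1 $ 1 = 1" "unit_mat 1 1 $ 1 $ 2 = 0" "unit_mat 1 1 $ 2 $ 1 = 0" "unit_mat 1 1 $ 2 $ 2 = 0"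
  "unit_mat 1 2 $ 1 $ 1 = 0" "unit_mat 1 2 $ 1 $ 2 = 1" "unit_mat 1 2 $ 2 $ 1 = 0" "unit_mat 1 2 $ 2 $ 2 = 0"
  "unit_mat 2 1 $ 1 $ 1 = 0" "unit_mat 2 1 $ 1 $ 2 = 0" "unit_mat 2 1 $ 2 $ 1 = 1" "unit_mat 2 1 $ 2 $ 2 = 0"
  "unit_mat 2 2 $ 1 $ 1 = 0" "unit_mat 2 2 $ 1 $ 2 = 0" "unit_mat 2 2 $ 2 $ 1 = 0" "unit_mat 2 2 $ 2 $ 2 = 1"
  by (simp_all add: unit_mat_nth)

lemma tcoef_rec1_all: "b \<noteq> 0 \<Longrightarrow> Z$1$1 * tcoef (k - 1) (i - 1) (b - 1) Z + Z$2$1 * tcoef (k - 1) i (b - 1) Z = tcoef k i b Z"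
  using tcoef_rec1'[of b Z k i] by simp

lemma tcoef_rec2_all: "b \<noteq> k \<Longrightarrow> Z$1$2 * tcoef (k - 1) (i - 1) b Z + Z$2$2 * tcoef (k - 1) i b Z = tcoef k i b Z"
  using tcoef_rec2'[of k b Z i] by simp

definition tgrad :: "int \<Rightarrow> int \<Rightarrow> int \<Rightarrow> hc \<Rightarrow> hc" where
  "tgrad k i b Z = mat2 (of_int b * tcoef (k - 1) (i - 1) (b - 1) Z) (of_int (k - b) * tcoef (k - 1) (i - 1) b Z)
     (of_int b * tcoef (k - 1) i (b - 1) Z) (of_int (k - b) * tcoef (k - 1) i b Z)"

lemma has_cgrad_tcoef: "has_cgrad (tcoef k i b) (tgrad k i b Z) Z"
proof -
  have out: "has_cgrad (tcoef k i b) (tgrad k i b Z) Z" if "b < 0 \<or> b > k" for k i b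
  proof -
    have "tcoef k i b = (\<lambda>Z. 0)" using that by (auto simp: tcoef_outside)
    moreover have "tgrad k i b Z = 0"
      by (rule hc_eqI) (use that in \<open>auto simp: tcoef_outside tgrad_def\<close>)
    ultimately show ?thesis using has_cgrad_const by simp
  qed
  have "has_cgrad (tcoef (int n) i b) (tgrad (int n) i b Z) Z" for n i b
  proof (induction n arbitrary: i b)
    case 0
    have "tcoef 0 i 0 = (\<lambda>Z. if i = 0 then 1 else 0)"
      by (rule ext) (cases "i = 0"; cases "i < 0"; auto simp: tcoef_000 tcoef_outside)
    moreover have "tgrad 0 i 0 Z = 0"
      by (rule hc_eqI) (auto simp: tcoef_outside tgrad_def)
    ultimately show ?case
      using out[of b 0 i] has_cgrad_const by (cases "b = 0"; cases "b < 0") auto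
  next
    case (Suc n)
    have pred: "int (Suc n) - 1 = int n" and isuc: "int (Suc n) = int n + 1" by simp_all
    note lin = vector_add_component cmul_nth tgrad_def mat2_nth unit_mat_nths
    consider "b < 0 \<or> b > int (Suc n)" | "0 < b" | "b = 0" by linarith
    then show ?case
    proof cases
      case 1 then show ?thesis by (rule out)
    next
      case 2
      then have b: "b \<noteq> 0" by simp
      have e: "(\<lambda>Z. Z$1$1 * tcoef (int n) (i - 1) (b - 1) Z + Z$2$1 * tcoef (int n) i (b - 1) Z) = tcoef (int (Suc n)) i b"
        using tcoef_rec1_all[OF b, of _ "int (Suc n)" i] by (simp add: pred fun_eq_iff)
      show ?thesis
        unfolding e[symmetric]
        apply (rule has_cgrad_eq[OF has_cgrad_add[OF has_cgrad_mult[OF has_cgrad_entry Suc.IH] has_cgrad_mult[OF has_cgrad_entry Suc.IH]]])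
        apply (rule hc_eqI)
        subgoal using tcoef_rec1'[of "b - 1" Z "int n" "i - 1"]
          unfolding lin of_int_diff of_int_1 isuc of_int_add add_diff_cancel_right' by algebra
        subgoal unfolding lin isuc add_diff_cancel_right' tcoef_rec1_all[OF b, of Z "int n" "i - 1", symmetric]
          by (simp add: algebra_simps)
        subgoal using tcoef_rec1'[of "b - 1" Z "int n" "i"]
          unfolding lin of_int_diff of_int_1 isuc of_int_add add_diff_cancel_right' by algebra
        subgoal unfolding lin isuc add_diff_cancel_right' tcoef_rec1_all[OF b, of Z "int n" "i", symmetric]
          by (simp add: algebra_simps)
        done
    next
      case 3
      then have b: "b \<noteq> int (Suc n)" by simp
      have e: "(\<lambda>Z. Z$1$2 * tcoef (int n) (i - 1) 0 Z + Z$2$2 * tcoef (int n) i 0 Z) = tcoef (int (Suc n)) i b"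
        using tcoef_rec2_all[OF b, of _ i] 3 by (simp add: pred fun_eq_iff)
      show ?thesis
        unfolding e[symmetric]
        apply (rule has_cgrad_eq[OF has_cgrad_add[OF has_cgrad_mult[OF has_cgrad_entry Suc.IH] has_cgrad_mult[OF has_cgrad_entry Suc.IH]]])
        apply (rule hc_eqI)
        subgoal by (simp add: lin 3)
        subgoal using tcoef_rec2'[of "int n" 0 Z "i - 1"]
          unfolding lin 3 of_int_diff of_int_1 of_int_0 isuc of_int_add add_diff_cancel_right' by algebra
        subgoal by (simp add: lin 3)
        subgoal using tcoef_rec2'[of "int n" 0 Z "i"]
          unfolding lin 3 of_int_diff of_int_1 of_int_0 isuc of_int_add add_diff_cancel_right' by algebra
        done
    qed
  qed
  from this[of "nat k" i b] out[of b k i] show ?thesis by (cases "b < 0 \<or> b > k") auto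
qed

text \<open>Powers of the determinant times matrix coefficients; these functions span the Laurent algebra.\<close>

definition lmono :: "int \<Rightarrow> int \<Rightarrow> int \<Rightarrow> int \<Rightarrow> hc \<Rightarrow> complex" where
  "lmono j k i b = on_invertible (\<lambda>Z. det Z powi j * tcoef k i b Z)"

lemma lmono_singular: "det Z = 0 \<Longrightarrow> lmono j k i b Z = 0"
  by (simp add: lmono_def on_invertible_def)

lemma lmono_eq: "det Z \<noteq> 0 \<Longrightarrow> lmono j k i b Z = det Z powi j * tcoef k i b Z"
  by (simp add: lmono_def on_invertible_def)

lemma lmono_outside: "i < 0 \<or> i > k \<or> b < 0 \<or> b > k \<Longrightarrow> lmono j k i b = (\<lambda>Z. 0)"
  by (rule ext) (simp add: lmono_def on_invertible_def tcoef_outside)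

lemma lmono_negative: "k < 0 \<Longrightarrow> lmono j k i b = (\<lambda>Z. 0)"
  by (rule lmono_outside) linarith

lemma has_cgrad_lmono:
  assumes "det Z \<noteq> 0"
  shows "has_cgrad (lmono j k i b) (cmul (det Z powi j) (tgrad k i b Z)
    + cmul (tcoef k i b Z) (cmul (of_int j * det Z powi (j - 1)) (transpose (adj Z)))) Z"
  unfolding lmono_def
  by (rule has_cgrad_on_invertible[OF has_cgrad_mult[OF has_cgrad_powi_det[OF assms] has_cgrad_tcoef] assms])

lemma smooth_lmono: "smooth (lmono j k i b)"
  using has_cgrad_lmono smooth_def by blast

lemma det_mult_lmono: "det Z * lmono j k i b Z = lmono (j + 1) k i b Z"
  by (cases "det Z = 0") (simp_all add: lmono_singular lmono_eq power_int_add)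

lemma partial_lmono:
  "partial 1 1 (lmono j k i b) = (\<lambda>Z. of_int b * lmono j (k - 1) (i - 1) (b - 1) Z + of_int j * (Z$2$2 * lmono (j - 1) k i b Z))"
  "partial 1 2 (lmono j k i b) = (\<lambda>Z. of_int (k - b) * lmono j (k - 1) (i - 1) b Z - of_int j * (Z$2$1 * lmono (j - 1) k i b Z))"
  "partial 2 1 (lmono j k i b) = (\<lambda>Z. of_int b * lmono j (k - 1) i (b - 1) Z - of_int j * (Z$1$2 * lmono (j - 1) k i b Z))"
  "partial 2 2 (lmono j k i b) = (\<lambda>Z. of_int (k - b) * lmono j (k - 1) i b Z + of_int j * (Z$1$1 * lmono (j - 1) k i b Z))"
  by (rule partialI[OF has_cgrad_lmono]; simp add: lmono_singular lmono_eq tgrad_def transpose_def)+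

lemma euler_tcoef:
  "Z$1$1 * (of_int b * tcoef (k - 1) (i - 1) (b - 1) Z) + Z$1$2 * (of_int (k - b) * tcoef (k - 1) (i - 1) b Z)
    + Z$2$1 * (of_int b * tcoef (k - 1) i (b - 1) Z) + Z$2$2 * (of_int (k - b) * tcoef (k - 1) i b Z)
   = of_int k * tcoef k i b Z"
  using tcoef_rec1'[of b Z k i] tcoef_rec2'[of k b Z i] unfolding of_int_diff by algebra

lemma smooth_lin:
  "smooth F \<Longrightarrow> smooth (\<lambda>Z. c * F Z)" "smooth F \<Longrightarrow> smooth (\<lambda>Z. Z $ a $ d * F Z)"
  by (intro smooth_mult smooth_const smooth_entry; assumption)+

lemma smooth_diff: "smooth F \<Longrightarrow> smooth G \<Longrightarrow> smooth (\<lambda>Z. F Z - G Z)"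
  using smooth_add[of F "\<lambda>Z. -1 * G Z"] smooth_lin(1)[of G "-1"] by simp

lemma partial_diff:
  assumes "smooth F" "smooth G"
  shows "partial a b (\<lambda>Z. F Z - G Z) = (\<lambda>Z. partial a b F Z - partial a b G Z)"
  using partial_add[OF assms(1) smooth_lin(1)[OF assms(2)], of a b "-1"] partial_cmult[OF assms(2), of a b "-1"]
  by simp

text \<open>Matrix coefficients are harmonic and \<open>\<box>\<close> acts on radial factors by \<open>j (j + k + 1)\<close>; in particular
  both \<open>j = 0\<close> and \<open>j = - k - 1\<close> give harmonic functions.\<close>

lemma lap_lmono: "lap (lmono j k i b) Z = 4 * of_int (j * (j + k + 1)) * lmono (j - 1) k i b Z"
proof (cases "det Z = 0")
  case True
  then show ?thesis by (simp add: lap_def lmono_singular)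
next
  case False
  define x where "x = det Z powi (j - 2)"
  have x: "det Z powi (j - 1 - 1) = x" "det Z powi (j - 1) = x * det Z" "det Z powi j = x * det Z * det Z"
    using False power_int_add[of "det Z" "j - 2" 1] power_int_add[of "det Z" "j - 2" 2]
    unfolding x_def by (simp_all add: power2_eq_square)
  note sm = smooth_lmono smooth_lin smooth_diff smooth_add
  have c: "k - 1 - (b - 1) = k - b" by simp
  show ?thesis
    unfolding lap_def partial_lmono using euler_tcoef[of Z b k i]
    by (simp only: partial_add partial_diff partial_cmult sm partial_entry_mult[OF _ False] partial_lmono
       lmono_eq[OF False] x c num1_eq_iff if_True if_False simp_thms)
       (simp add: det_2, algebra)
qed

section \<open>Spinor-valued eigenfunctions\<close>

interpretation fs: vector_space fscale by (rule vector_space_fscale)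

definition spin :: "(hc \<Rightarrow> complex) \<Rightarrow> (hc \<Rightarrow> complex) \<Rightarrow> hc \<Rightarrow> spinor" where
  "spin F G Z = vector [F Z, G Z]"

lemma spin_nth [simp]: "spin F G Z $ 1 = F Z" "spin F G Z $ 2 = G Z"
  by (simp_all add: spin_def)

lemma spinor_eqI: "(x::spinor) $ 1 = y $ 1 \<Longrightarrow> x $ 2 = y $ 2 \<Longrightarrow> x = y"
  by (simp add: vec_eq_iff forall_2)

lemma fscale_nth [simp]: "fscale c f Z $ i = c * f Z $ i"
  by (simp add: fscale_def)

text \<open>The two ways in which a spinor index couples to the row index of a matrix coefficient: the spin of
  the left representation is raised by one half in \<open>afun\<close> and lowered by one half in \<open>bfun\<close>. The
  basis functions of the spaces of columns are multiples of these.\<close>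

definition afun :: "int \<Rightarrow> int \<Rightarrow> int \<Rightarrow> int \<Rightarrow> hc \<Rightarrow> spinor" where
  "afun j k i b = spin (lmono j k i b) (\<lambda>Z. - lmono j k (i - 1) b Z)"

definition bfun :: "int \<Rightarrow> int \<Rightarrow> int \<Rightarrow> int \<Rightarrow> hc \<Rightarrow> spinor" where
  "bfun j k i b = spin (\<lambda>Z. of_int (i + 1) * lmono j k (i + 1) b Z) (\<lambda>Z. of_int (k - i) * lmono j k i b Z)"

definition laurent_spinors :: "(hc \<Rightarrow> spinor) set" where
  "laurent_spinors = {f. \<forall>i. (\<lambda>Z. f Z $ i) \<in> laurent_algebra}"

lemma laurent_uminus: "p \<in> laurent_algebra \<Longrightarrow> (\<lambda>Z. - p Z) \<in> laurent_algebra"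
  using laurent_scale[of p "-1"] by simp

lemma laurent_lmono: "lmono j k i b \<in> laurent_algebra"
proof -
  have t: "on_invertible (tcoef (int n) i b) \<in> laurent_algebra" for n i b
  proof (induction n arbitrary: i b)
    case 0
    have "tcoef 0 i b = (\<lambda>Z. if i = 0 \<and> b = 0 then 1 else 0)"
      by (rule ext) (cases "i = 0"; cases "i < 0"; cases "b = 0"; cases "b < 0"; auto simp: tcoef_000 tcoef_outside)
    then show ?case using laurent_algebra.const by simp
  next
    case (Suc n)
    have pred: "int (Suc n) - 1 = int n" by simp
    have *: "on_invertible (\<lambda>Z. Z $ p $ q * F Z + Z $ r $ t * G Z) \<in> laurent_algebra" 
      if "on_invertible F \<in> laurent_algebra" "on_invertible G \<in> laurent_algebra" for p q r t F G
    proof -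
      have "(\<lambda>Z. Z $ p $ q * on_invertible F Z + Z $ r $ t * on_invertible G Z) \<in> laurent_algebra"
        by (intro laurent_algebra.add laurent_entry_mult that)
      moreover have "(\<lambda>Z. Z $ p $ q * on_invertible F Z + Z $ r $ t * on_invertible G Z) = on_invertible (\<lambda>Z. Z $ p $ q * F Z + Z $ r $ t * G Z)"
        by (auto simp: on_invertible_def)
      ultimately show ?thesis by simp
    qed
    show ?case
    proof (cases "b = 0")
      case False
      show ?thesis using *[OF Suc.IH Suc.IH, of 1 1 "i - 1" "b - 1" 2 1 i "b - 1"] 
          tcoef_rec1_all[OF False, of _ "int (Suc n)" i] unfolding pred by simp
    next
      case True
      then have "b \<noteq> int (Suc n)" by simp
      show ?thesis using *[OF Suc.IH Suc.IH, of 1 2 "i - 1" "b" 2 2 i "b"] 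
          tcoef_rec2_all[OF \<open>b \<noteq> int (Suc n)\<close>, of _ i] unfolding pred by simp
    qed
  qed
  have t': "on_invertible (tcoef k i b) \<in> laurent_algebra"
  proof (cases "k < 0")
    case True
    then have "tcoef k i b = (\<lambda>Z. 0)" by (auto simp: tcoef_def)
    then show ?thesis using laurent_algebra.const by simp
  qed (use t[of "nat k"] in simp)
  have det: "on_invertible (det :: hc \<Rightarrow> complex) \<in> laurent_algebra"
  proof -
    have "(\<lambda>Z. Z$1$1 * on_invertible (\<lambda>Z. Z$2$2) Z + (-1) * (Z$1$2 * on_invertible (\<lambda>Z. Z$2$1) Z)) \<in> laurent_algebra"
      by (intro laurent_algebra.add laurent_entry_mult laurent_scale laurent_entry)
    moreover have "(\<lambda>Z. Z$1$1 * on_invertible (\<lambda>Z. Z$2$2) Z + (-1) * (Z$1$2 * on_invertible (\<lambda>Z. Z$2$1) Z)) = on_invertible det"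
      by (auto simp: on_invertible_def det_2)
    ultimately show ?thesis by simp
  qed
  have pow: "on_invertible (\<lambda>Z. F Z ^ n) \<in> laurent_algebra" if "on_invertible F \<in> laurent_algebra" for F n
  proof (induction n)
    case 0 then show ?case using laurent_algebra.const[of 1] by simp
  next
    case (Suc n)
    have "(\<lambda>Z. on_invertible F Z * on_invertible (\<lambda>Z. F Z ^ n) Z) \<in> laurent_algebra"
      by (intro laurent_algebra.mult that Suc)
    moreover have "(\<lambda>Z. on_invertible F Z * on_invertible (\<lambda>Z. F Z ^ n) Z) = on_invertible (\<lambda>Z. F Z ^ Suc n)"
      by (auto simp: on_invertible_def)
    ultimately show ?case by simp
  qed
  have "on_invertible (\<lambda>Z. det Z powi j) \<in> laurent_algebra"
    using pow[OF det, of "nat j"] pow[OF laurent_algebra.inverse_det, of "nat (-j)"] 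
    by (cases "j \<ge> 0") (auto simp: power_int_def power_inverse)
  then have "(\<lambda>Z. on_invertible (\<lambda>Z. det Z powi j) Z * on_invertible (tcoef k i b) Z) \<in> laurent_algebra"
    by (rule laurent_algebra.mult[OF _ t'])
  moreover have "(\<lambda>Z. on_invertible (\<lambda>Z. det Z powi j) Z * on_invertible (tcoef k i b) Z) = lmono j k i b"
    by (auto simp: on_invertible_def lmono_def)
  ultimately show ?thesis by simp
qed

lemma laurent_spinorsI:
  "F \<in> laurent_algebra \<Longrightarrow> G \<in> laurent_algebra \<Longrightarrow> spin F G \<in> laurent_spinors"
  unfolding laurent_spinors_def by (auto simp: forall_2)

lemma afun_laurent: "afun j k i b \<in> laurent_spinors"
  unfolding afun_def by (intro laurent_spinorsI laurent_uminus laurent_lmono)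

lemma bfun_laurent: "bfun j k i b \<in> laurent_spinors"
  unfolding bfun_def by (intro laurent_spinorsI laurent_scale laurent_lmono)

lemma laurent_zero: "(\<lambda>Z. 0) \<in> laurent_algebra"
  using laurent_algebra.const[of 0] by (simp add: on_invertible_def[abs_def])

lemma subspace_laurent_spinors: "fs.subspace laurent_spinors"
  unfolding fs.subspace_def laurent_spinors_def
  by (auto simp: laurent_zero intro: laurent_algebra.add laurent_scale)

lemma laurent_spinors_singular: "f \<in> laurent_spinors \<Longrightarrow> det Z = 0 \<Longrightarrow> f Z = 0"
  unfolding laurent_spinors_def using laurent_singular by (fastforce simp: vec_eq_iff)

text \<open>Spans of scalar functions, generated by multiples of generators and sums, so that operators need
  only be examined on these.\<close>

inductive_set lin_span :: "(hc \<Rightarrow> complex) set \<Rightarrow> (hc \<Rightarrow> complex) set" for S where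
  base: "x \<in> S \<Longrightarrow> (\<lambda>Z. c * x Z) \<in> lin_span S"
| plus: "p \<in> lin_span S \<Longrightarrow> q \<in> lin_span S \<Longrightarrow> (\<lambda>Z. p Z + q Z) \<in> lin_span S"

lemma lin_span_in: "x \<in> S \<Longrightarrow> x \<in> lin_span S"
  using lin_span.base[of x S 1] by simp

lemma lin_span_scale: "p \<in> lin_span S \<Longrightarrow> (\<lambda>Z. c * p Z) \<in> lin_span S"
  by (induction p rule: lin_span.induct)
     (auto simp: distrib_left mult.assoc[symmetric] intro: lin_span.intros)

lemma lin_span_map:
  assumes "p \<in> lin_span S" "\<And>x. x \<in> S \<Longrightarrow> L x \<in> lin_span T"
    "\<And>p q. p \<in> lin_span S \<Longrightarrow> q \<in> lin_span S \<Longrightarrow> L (\<lambda>Z. p Z + q Z) = (\<lambda>Z. L p Z + L q Z)"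
    "\<And>p c. p \<in> S \<Longrightarrow> L (\<lambda>Z. c * p Z) = (\<lambda>Z. c * L p Z)"
  shows "L p \<in> lin_span T"
  using assms(1) by induction (use assms in \<open>auto intro: lin_span.intros lin_span_scale\<close>)

definition lmonos :: "(hc \<Rightarrow> complex) set" where
  "lmonos = {lmono j k i b |j k i b. True}"

lemma lmono_in: "lmono j k i b \<in> lin_span lmonos"
  by (rule lin_span_in) (auto simp: lmonos_def)

lemma lmono_entry_mult: "(\<lambda>Z. Z $ p $ q * lmono j k i b Z) \<in> lin_span lmonos"
proof (cases "0 \<le> b \<and> b \<le> k")
  case False
  then have "lmono j k i b = (\<lambda>Z. 0)" by (auto simp: lmono_def on_invertible_def tcoef_outside)
  then show ?thesis using lin_span.base[OF lin_span_in, of "lmono 0 0 0 0" lmonos 0] lin_span.base[of "lmono 0 0 0 0" lmonos 0]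
    by (auto simp: lmonos_def)
next
  case True
  then have k: "of_int (k + 1) \<noteq> (0::complex)" by (simp flip: of_int_add add: of_int_eq_0_iff del: of_int_add)
  have *: "(\<lambda>Z. (c * lmono j k' i' b' Z + d * lmono (j + 1) k'' i'' b'' Z) / of_int (k + 1)) \<in> lin_span lmonos" for c k' i' b' d k'' i'' b''
    using lin_span_scale[OF lin_span.plus[OF lin_span_scale[OF lmono_in[of j k' i' b'], of c] lin_span_scale[OF lmono_in[of "j + 1" k'' i'' b''], of d]], of "1 / of_int (k + 1)"]
    by simp
  have **: "(\<lambda>Z. Z $ p $ q * lmono j k i b Z) \<in> lin_span lmonos" 
    if "\<And>Z. of_int (k + 1) * (Z $ p $ q * tcoef k i b Z) = c * tcoef k' i' b' Z + d * (det Z * tcoef k'' i'' b'' Z)" for p q c k' i' b' d k'' i'' b''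
  proof -
    have "Z $ p $ q * lmono j k i b Z = (c * lmono j k' i' b' Z + d * lmono (j + 1) k'' i'' b'' Z) / of_int (k + 1)" for Z
    proof (cases "det Z = 0")
      case False
      have "Z $ p $ q * tcoef k i b Z = (c * tcoef k' i' b' Z + d * (det Z * tcoef k'' i'' b'' Z)) / of_int (k + 1)"
        using that[of Z] k by (metis nonzero_mult_div_cancel_left)
      then have "det Z powi j * (Z $ p $ q * tcoef k i b Z) = det Z powi j * ((c * tcoef k' i' b' Z + d * (det Z * tcoef k'' i'' b'' Z)) / of_int (k + 1))"
        by simp
      then show ?thesis
        unfolding lmono_eq[OF False] power_int_add[of "det Z" j 1, OF disjI1[OF False]] power_int_1_right
        by (simp add: mult.left_commute distrib_left mult.assoc)
    qed (simp add: lmono_singular)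
    then show ?thesis using * by presburger
  qed
  have b: "0 \<le> b" "b \<le> k" using True by auto
  note m = tcoef_mult_entry[OF b, of _ i]
  have "(\<lambda>Z. Z $ 1 $ 1 * lmono j k i b Z) \<in> lin_span lmonos" by (rule **[OF m(1)])
  moreover have "(\<lambda>Z. Z $ 1 $ 2 * lmono j k i b Z) \<in> lin_span lmonos" 
    by (rule **[of 1 2 "of_int (i + 1)" "k + 1" "i + 1" b "- of_int b" "k - 1" i "b - 1"]) (subst m(2), simp)
  moreover have "(\<lambda>Z. Z $ 2 $ 1 * lmono j k i b Z) \<in> lin_span lmonos" 
    by (rule **[of 2 1 "of_int (k + 1 - i)" "k + 1" i "b + 1" "- of_int (k - b)" "k - 1" "i - 1" b]) (subst m(3), simp only: mult_minus_left diff_conv_add_uminus)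
  moreover have "(\<lambda>Z. Z $ 2 $ 2 * lmono j k i b Z) \<in> lin_span lmonos" by (rule **[OF m(4)])
  ultimately show ?thesis using exhaust_2_cases[of p] exhaust_2_cases[of q] by auto
qed

text \<open>The span of the functions \<open>lmono j k i b\<close> contains the constants, is closed under multiplication
  by matrix entries (by the Clebsch-Gordan decomposition) and by the inverse of the determinant, hence
  under products with all elements of the algebra.\<close>

lemma laurent_subset_span: "p \<in> laurent_algebra \<Longrightarrow> p \<in> lin_span lmonos"
proof -
  have entry: "(\<lambda>Z. Z $ r $ t * q Z) \<in> lin_span lmonos" if "q \<in> lin_span lmonos" for q r t
  proof (rule lin_span_map[OF that])
    fix x assume "x \<in> lmonos"
    then show "(\<lambda>Z. Z $ r $ t * x Z) \<in> lin_span lmonos" using lmono_entry_mult unfolding lmonos_def by blast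
  qed (auto simp: distrib_left mult.left_commute)
  have sing: "q Z = 0" if "q \<in> lin_span lmonos" "det Z = 0" for q Z
    using that by induction (auto simp: lmonos_def lmono_singular)
  have "\<forall>q\<in>lin_span lmonos. (\<lambda>Z. p Z * q Z) \<in> lin_span lmonos" if "p \<in> laurent_algebra" for p
    using that
  proof (induction p rule: laurent_algebra.induct)
    case (const c)
    show ?case
    proof
      fix q assume q: "q \<in> lin_span lmonos"
      have "(\<lambda>Z. on_invertible (\<lambda>Z. c) Z * q Z) = (\<lambda>Z. c * q Z)" using sing[OF q] by (auto simp: on_invertible_def)
      then show "(\<lambda>Z. on_invertible (\<lambda>Z. c) Z * q Z) \<in> lin_span lmonos" using lin_span_scale[OF q] by simp
    qed
  next
    case (coord j)
    show ?case
    proof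
      fix q assume q: "q \<in> lin_span lmonos"
      have comb: "(\<lambda>Z. c * (Z$1$1 * q Z) + d * (Z$1$2 * q Z) + e * (Z$2$1 * q Z) + f * (Z$2$2 * q Z)) \<in> lin_span lmonos" for c d e f
        by (intro lin_span.plus lin_span_scale entry q)
      then have *: "(\<lambda>Z. on_invertible F Z * q Z) \<in> lin_span lmonos" if "\<And>Z. F Z = c * Z$1$1 + d * Z$1$2 + e * Z$2$1 + f * Z$2$2" for F c d e f
      proof -
        have "on_invertible F Z * q Z = c * (Z$1$1 * q Z) + d * (Z$1$2 * q Z) + e * (Z$2$1 * q Z) + f * (Z$2$2 * q Z)" for Z
          using sing[OF q, of Z] that by (cases "det Z = 0") (simp_all add: on_invertible_def algebra_simps)
        then show ?thesis using comb[of c d e f] by simp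
      qed
      have "j = 0 \<or> j = 1 \<or> j = 2 \<or> j = 3" using UNIV_index4 by auto
      then show "(\<lambda>Z. on_invertible (\<lambda>Z. coords Z $ j) Z * q Z) \<in> lin_span lmonos"
      proof (elim disjE)
        assume "j = 0" then show ?thesis by (intro *[of _ "1/2" 0 0 "1/2"]) (simp add: coords_nth field_simps)
      next
        assume "j = 1" then show ?thesis by (intro *[of _ 0 "\<i>/2" "\<i>/2" 0]) (simp add: coords_nth field_simps)
      next
        assume "j = 2" then show ?thesis by (intro *[of _ 0 "-1/2" "1/2" 0]) (simp add: coords_nth field_simps)
      next
        assume "j = 3" then show ?thesis by (intro *[of _ "\<i>/2" 0 0 "-\<i>/2"]) (simp add: coords_nth field_simps)
      qed
    qed
  next
    case inverse_det
    show ?case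
    proof
      fix q assume q: "q \<in> lin_span lmonos"
      have e: "(\<lambda>Z. on_invertible (\<lambda>Z. inverse (det Z)) Z * lmono j k i b Z) = lmono (j - 1) k i b" for j k i b
        by (auto simp: on_invertible_def lmono_def power_int_diff field_simps)
      show "(\<lambda>Z. on_invertible (\<lambda>Z. inverse (det Z)) Z * q Z) \<in> lin_span lmonos"
      proof (rule lin_span_map[OF q])
        fix x assume "x \<in> lmonos"
        then show "(\<lambda>Z. on_invertible (\<lambda>Z. inverse (det Z)) Z * x Z) \<in> lin_span lmonos" using lmono_in e unfolding lmonos_def by fastforce
      qed (auto simp: distrib_left mult.left_commute)
    qed
  next
    case (add p q)
    then show ?case by (auto simp: distrib_right intro: lin_span.plus)
  next
    case (mult p q)
    then show ?case by (auto simp: mult.assoc)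
  qed
  moreover assume p: "p \<in> laurent_algebra"
  ultimately have "(\<lambda>Z. p Z * lmono 0 0 0 0 Z) \<in> lin_span lmonos" using lmono_in by blast
  moreover have "(\<lambda>Z. p Z * lmono 0 0 0 0 Z) = p"
  proof
    fix Z show "p Z * lmono 0 0 0 0 Z = p Z"
      using laurent_singular[OF p, of Z] by (cases "det Z = 0") (simp_all add: lmono_eq tcoef_000)
  qed
  ultimately show ?thesis by simp
qed

definition eigenfuns :: "(hc \<Rightarrow> spinor) set" where
  "eigenfuns = {afun j k i b |j k i b. 0 \<le> k} \<union> {bfun j k i b |j k i b. 1 \<le> k}"

text \<open>The two-by-two system that expresses \<open>afun\<close> and \<open>bfun\<close> by matrix coefficients times basis spinors
  has determinant \<open>k + 1\<close>, so it can be inverted.\<close>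

lemma spin_lmono_span:
  "spin (lmono j k i b) (\<lambda>Z. 0) \<in> fs.span eigenfuns" "spin (\<lambda>Z. 0) (lmono j k i b) \<in> fs.span eigenfuns"
proof -
  have out: "spin (\<lambda>Z. 0) (\<lambda>Z. 0) = (0 :: hc \<Rightarrow> spinor)" by (rule ext, rule spinor_eqI) auto
  have "spin (lmono j k i b) (\<lambda>Z. 0) \<in> fs.span eigenfuns \<and> spin (\<lambda>Z. 0) (lmono j k i b) \<in> fs.span eigenfuns"
  proof (cases "0 \<le> k")
    case False
    then have "lmono j k i b = (\<lambda>Z. 0)" by (simp add: lmono_negative)
    then show ?thesis using fs.span_zero out by auto
  next
    case True
    then have k: "of_int (k + 1) \<noteq> (0::complex)" by (simp flip: of_int_add add: of_int_eq_0_iff del: of_int_add)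
    have bspan: "bfun j k i b \<in> fs.span eigenfuns" for i
    proof (cases "1 \<le> k")
      case False
      then have "k = 0" using True by simp
      have "bfun j k i b = 0"
        by (rule ext, rule spinor_eqI) 
           (cases "i < 0"; cases "i = 0"; cases "i = -1"; simp add: \<open>k = 0\<close> bfun_def lmono_outside)+
      then show ?thesis using fs.span_zero by simp
    next
      case True
      then have "bfun j k i b \<in> eigenfuns" unfolding eigenfuns_def by blast
      then show ?thesis by (rule fs.span_base)
    qed
    have aspan: "afun j k i b \<in> fs.span eigenfuns" for i
    proof (rule fs.span_base)
      show "afun j k i b \<in> eigenfuns" using True unfolding eigenfuns_def by blast
    qed
    have div: "X \<in> fs.span eigenfuns" if "fscale (of_int (k + 1)) X = Y" "Y \<in> fs.span eigenfuns" for X Y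
    proof -
      have "X = fscale (1 / of_int (k + 1)) (fscale (of_int (k + 1)) X)" using k by (simp add: fs.scale_scale del: of_int_add)
      then show ?thesis using that fs.span_scale by metis
    qed
    have "fscale (of_int (k + 1)) (spin (lmono j k i b) (\<lambda>Z. 0)) = fscale (of_int (k + 1 - i)) (afun j k i b) + bfun j k (i - 1) b"
      by (rule ext, rule spinor_eqI) (simp_all add: afun_def bfun_def algebra_simps)
    moreover have "fscale (of_int (k + 1)) (spin (\<lambda>Z. 0) (lmono j k i b)) = fscale (- of_int (i + 1)) (afun j k (i + 1) b) + bfun j k i b"
      by (rule ext, rule spinor_eqI) (simp_all add: afun_def bfun_def algebra_simps)
    ultimately show ?thesis
      using div[OF _ fs.span_add[OF fs.span_scale[OF aspan] bspan]] by blast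
  qed
  then show "spin (lmono j k i b) (\<lambda>Z. 0) \<in> fs.span eigenfuns" "spin (\<lambda>Z. 0) (lmono j k i b) \<in> fs.span eigenfuns" by auto
qed

lemma laurent_spinors_span: "laurent_spinors = fs.span eigenfuns"
proof (rule subset_antisym)
  show "fs.span eigenfuns \<subseteq> laurent_spinors"
    by (rule fs.span_minimal[OF _ subspace_laurent_spinors])
       (auto simp: eigenfuns_def afun_laurent bfun_laurent)
  show "laurent_spinors \<subseteq> fs.span eigenfuns"
  proof
    fix f assume f: "f \<in> laurent_spinors"
    have 1: "spin F (\<lambda>Z. 0) \<in> fs.span eigenfuns" if "F \<in> lin_span lmonos" for F
      using that
    proof induction
      case (base x c)
      then have "spin x (\<lambda>Z. 0) \<in> fs.span eigenfuns" using spin_lmono_span by (auto simp: lmonos_def)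
      moreover have "spin (\<lambda>Z. c * x Z) (\<lambda>Z. 0) = fscale c (spin x (\<lambda>Z. 0))"
        by (rule ext, rule spinor_eqI) auto
      ultimately show ?case by (simp add: fs.span_scale)
    next
      case (plus p q)
      have e: "spin (\<lambda>Z. p Z + q Z) (\<lambda>Z. 0) = spin p (\<lambda>Z. 0) + spin q (\<lambda>Z. 0)"
        by (rule ext, rule spinor_eqI) auto
      show ?case unfolding e by (rule fs.span_add[OF plus.IH])
    qed
    have 2: "spin (\<lambda>Z. 0) F \<in> fs.span eigenfuns" if "F \<in> lin_span lmonos" for F
      using that
    proof induction
      case (base x c)
      then have "spin (\<lambda>Z. 0) x \<in> fs.span eigenfuns" using spin_lmono_span by (auto simp: lmonos_def)
      moreover have "spin (\<lambda>Z. 0) (\<lambda>Z. c * x Z) = fscale c (spin (\<lambda>Z. 0) x)"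
        by (rule ext, rule spinor_eqI) auto
      ultimately show ?case by (simp add: fs.span_scale)
    next
      case (plus p q)
      have e: "spin (\<lambda>Z. 0) (\<lambda>Z. p Z + q Z) = spin (\<lambda>Z. 0) p + spin (\<lambda>Z. 0) q"
        by (rule ext, rule spinor_eqI) auto
      show ?case unfolding e by (rule fs.span_add[OF plus.IH])
    qed
    have e: "f = spin (\<lambda>Z. f Z $ 1) (\<lambda>Z. 0) + spin (\<lambda>Z. 0) (\<lambda>Z. f Z $ 2)"
      by (rule ext, rule spinor_eqI) auto
    have "(\<lambda>Z. f Z $ i) \<in> lin_span lmonos" for i
      using f by (simp add: laurent_spinors_def laurent_subset_span)
    then show "f \<in> fs.span eigenfuns"
      by (subst e) (intro fs.span_add 1 2)
  qed
qed

section \<open>Quasi anti-regular functions\<close>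

lemma laurent_spinors_smooth: "f \<in> laurent_spinors \<Longrightarrow> smooth (\<lambda>Z. f Z $ i)"
  unfolding laurent_spinors_def using laurent_smooth_partial by blast

lemma laurent_spinors_partial: "f \<in> laurent_spinors \<Longrightarrow> partial a b (\<lambda>Z. f Z $ i) \<in> laurent_algebra"
  unfolding laurent_spinors_def using laurent_smooth_partial by blast

lemma laurent_partial: "p \<in> laurent_algebra \<Longrightarrow> partial a b p \<in> laurent_algebra"
  using laurent_smooth_partial by blast

lemma laurent_smooth: "p \<in> laurent_algebra \<Longrightarrow> smooth p"
  using laurent_smooth_partial by blast

lemma laurent_diff: "p \<in> laurent_algebra \<Longrightarrow> q \<in> laurent_algebra \<Longrightarrow> (\<lambda>Z. p Z - q Z) \<in> laurent_algebra"
  using laurent_algebra.add[OF _ laurent_uminus, of p q] by simp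

lemma lap_laurent: 
  assumes "p \<in> laurent_algebra"
  shows "lap p \<in> laurent_algebra"
proof -
  have "(\<lambda>Z. 2 * (partial 1 1 (partial 2 2 p) Z + partial 2 2 (partial 1 1 p) Z
     - partial 1 2 (partial 2 1 p) Z - partial 2 1 (partial 1 2 p) Z)) \<in> laurent_algebra"
    by (intro laurent_scale laurent_diff laurent_algebra.add laurent_partial assms)
  then show ?thesis by (simp add: lap_def[abs_def])
qed

lemma lap_add:
  assumes "p \<in> laurent_algebra" "q \<in> laurent_algebra"
  shows "lap (\<lambda>Z. p Z + q Z) Z = lap p Z + lap q Z"
  by (simp add: lap_def partial_add laurent_smooth laurent_partial assms algebra_simps)

lemma lap_scale:
  assumes "p \<in> laurent_algebra"
  shows "lap (\<lambda>Z. c * p Z) Z = c * lap p Z"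
  by (simp add: lap_def partial_cmult laurent_smooth laurent_partial assms algebra_simps)

text \<open>The Laplacian with the zero extension to singular matrices built in, in contrast to
  \<^const>\<open>laplacian\<close>.\<close>

definition lapS :: "(hc \<Rightarrow> spinor) \<Rightarrow> hc \<Rightarrow> spinor" where
  "lapS f Z = (\<chi> i. lap (\<lambda>W. f W $ i) Z)"

text \<open>Multiplication by \<open>Z\<close> makes the first order operator degree-preserving and lets it map columns to
  columns, so that it can have eigenfunctions.\<close>

definition dirac :: "(hc \<Rightarrow> spinor) \<Rightarrow> hc \<Rightarrow> spinor" where
  "dirac f = on_invertible (\<lambda>Z. Z *v nabla f Z)"

lemma lapS_laurent: "f \<in> laurent_spinors \<Longrightarrow> lapS f \<in> laurent_spinors"
  unfolding laurent_spinors_def lapS_def by (simp add: lap_laurent)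

lemma laplacian_lapS: "f \<in> laurent_spinors \<Longrightarrow> det Z \<noteq> 0 \<Longrightarrow> laplacian f Z = lapS f Z"
  unfolding vec_eq_iff lapS_def
  by (simp add: laplacian_partial laurent_spinors_smooth laurent_smooth laurent_spinors_partial)

lemma nabla_cong:
  assumes "det Z \<noteq> 0" "\<And>W. det W \<noteq> 0 \<Longrightarrow> f W = g W"
  shows "nabla f Z = nabla g Z"
  unfolding nabla_def using pd_cong[OF assms] by simp

lemma nabla_right_cong:
  assumes "det Z \<noteq> 0" "\<And>W. det W \<noteq> 0 \<Longrightarrow> f W = g W"
  shows "nabla_right f Z = nabla_right g Z"
  unfolding nabla_right_def using pd_cong[OF assms] by simp

lemma dirac_nth:
  assumes "f \<in> laurent_spinors" "det Z \<noteq> 0"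
  shows "dirac f Z $ 1 = 2 * (Z$1$1 * (partial 1 1 (\<lambda>Z. f Z $ 1) Z + partial 2 1 (\<lambda>Z. f Z $ 2) Z)
      + Z$1$2 * (partial 1 2 (\<lambda>Z. f Z $ 1) Z + partial 2 2 (\<lambda>Z. f Z $ 2) Z))"
    and "dirac f Z $ 2 = 2 * (Z$2$1 * (partial 1 1 (\<lambda>Z. f Z $ 1) Z + partial 2 1 (\<lambda>Z. f Z $ 2) Z)
      + Z$2$2 * (partial 1 2 (\<lambda>Z. f Z $ 1) Z + partial 2 2 (\<lambda>Z. f Z $ 2) Z))"
  using assms(2) nabla_partial[OF laurent_spinors_smooth[OF assms(1)] assms(2)]
  by (simp_all add: dirac_def on_invertible_def matrix_vector_2 algebra_simps)

lemma dirac_singular: "det Z = 0 \<Longrightarrow> dirac f Z = 0"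
  by (simp add: dirac_def on_invertible_def)

lemma dirac_zero_iff:
  assumes "det Z \<noteq> 0"
  shows "dirac f Z = 0 \<longleftrightarrow> nabla f Z = 0"
proof
  assume a: "dirac f Z = 0"
  let ?v = "nabla f Z"
  have "Z$1$1 * ?v $ 1 + Z$1$2 * ?v $ 2 = 0" "Z$2$1 * ?v $ 1 + Z$2$2 * ?v $ 2 = 0"
    using a assms by (simp_all add: dirac_def on_invertible_def matrix_vector_2[symmetric])
  then have "det Z * ?v $ 1 = 0" "det Z * ?v $ 2 = 0"
    unfolding det_2 by algebra+
  then show "nabla f Z = 0" using assms by (intro spinor_eqI) auto
next
  assume "nabla f Z = 0"
  then show "dirac f Z = 0" by (simp add: dirac_def on_invertible_def)
qed

lemma dirac_add:
  assumes f: "f \<in> laurent_spinors" and g: "g \<in> laurent_spinors"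
  shows "dirac (f + g) = dirac f + dirac g"
proof (rule ext)
  fix Z
  have fg: "f + g \<in> laurent_spinors" using fs.subspace_add[OF subspace_laurent_spinors f g] .
  show "dirac (f + g) Z = (dirac f + dirac g) Z"
  proof (cases "det Z = 0")
    case False
    note s = partial_add[OF laurent_spinors_smooth[OF f] laurent_spinors_smooth[OF g]]
    show ?thesis
      by (rule spinor_eqI) (simp_all add: dirac_nth[OF f False] dirac_nth[OF g False] dirac_nth[OF fg False] s algebra_simps)
  qed (simp add: dirac_singular)
qed

lemma dirac_scale:
  assumes f: "f \<in> laurent_spinors"
  shows "dirac (fscale c f) = fscale c (dirac f)"
proof (rule ext)
  fix Z
  have fg: "fscale c f \<in> laurent_spinors" using fs.subspace_scale[OF subspace_laurent_spinors f] .
  show "dirac (fscale c f) Z = fscale c (dirac f) Z"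
  proof (cases "det Z = 0")
    case False
    note s = partial_cmult[OF laurent_spinors_smooth[OF f]]
    show ?thesis
      by (rule spinor_eqI) (simp_all add: dirac_nth[OF f False] dirac_nth[OF fg False] s algebra_simps)
  qed (simp add: dirac_singular fscale_def)
qed

lemma lapS_add:
  assumes f: "f \<in> laurent_spinors" and g: "g \<in> laurent_spinors"
  shows "lapS (f + g) = lapS f + lapS g"
  using assms by (simp add: fun_eq_iff vec_eq_iff lapS_def lap_add laurent_spinors_def)

lemma lapS_scale:
  assumes f: "f \<in> laurent_spinors"
  shows "lapS (fscale c f) = fscale c (lapS f)"
  using assms by (simp add: fun_eq_iff vec_eq_iff lapS_def lap_scale laurent_spinors_def)

lemma partial_uminus: "smooth F \<Longrightarrow> partial a b (\<lambda>Z. - F Z) = (\<lambda>Z. - partial a b F Z)"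
  using partial_cmult[of F a b "-1"] by simp

lemma lmono_lower:
  "of_int b * (Z$1$1 * lmono j (k - 1) i (b - 1) Z) + of_int (k - b) * (Z$1$2 * lmono j (k - 1) i b Z)
     = of_int (i + 1) * lmono j k (i + 1) b Z"
proof (cases "det Z = 0")
  case False
  then show ?thesis unfolding lmono_eq[OF False] using tcoef_lower[of b Z k i] by algebra
qed (simp add: lmono_singular)

lemma lmono_raise:
  "of_int b * (Z$2$1 * lmono j (k - 1) i (b - 1) Z) + of_int (k - b) * (Z$2$2 * lmono j (k - 1) i b Z)
     = of_int (k - i) * lmono j k i b Z"
proof (cases "det Z = 0")
  case False
  then show ?thesis unfolding lmono_eq[OF False] using tcoef_raise[of b Z k i] by algebra
qed (simp add: lmono_singular)

text \<open>Up to the factor \<open>2\<close> the operator measures \<open>j\<close> on the first coupling and \<open>j + k + 1\<close> on the second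
  one, by the raising and lowering identities.\<close>

lemma dirac_afun: "dirac (afun j k i b) = fscale (2 * of_int j) (afun j k i b)"
proof (rule ext)
  fix Z
  show "dirac (afun j k i b) Z = fscale (2 * of_int j) (afun j k i b) Z"
  proof (cases "det Z = 0")
    case True
    then show ?thesis using laurent_spinors_singular[OF afun_laurent True] by (simp add: dirac_singular fscale_def)
  next
    case False
    have d: "lmono j k i b Z = det Z * lmono (j - 1) k i b Z" for i by (simp add: det_mult_lmono)
    note s = dirac_nth[OF afun_laurent False, unfolded afun_def] afun_def spin_nth partial_lmono partial_uminus[OF smooth_lmono] fscale_nth
    show ?thesis
      apply (rule spinor_eqI)
      subgoal unfolding s using d[of i] d[of "i - 1"] unfolding det_2 by algebra
      subgoal unfolding s using d[of i] d[of "i - 1"] unfolding det_2 by algebra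
      done
  qed
qed

lemma dirac_bfun: "dirac (bfun j k i b) = fscale (2 * of_int (j + k + 1)) (bfun j k i b)"
proof (rule ext)
  fix Z
  show "dirac (bfun j k i b) Z = fscale (2 * of_int (j + k + 1)) (bfun j k i b) Z"
  proof (cases "det Z = 0")
    case True
    then show ?thesis using laurent_spinors_singular[OF bfun_laurent True] by (simp add: dirac_singular fscale_def)
  next
    case False
    have d: "lmono j k i b Z = det Z * lmono (j - 1) k i b Z" for i by (simp add: det_mult_lmono)
    note r = lmono_lower[of b Z j k i] lmono_raise[of b Z j k i]
    note s = dirac_nth[OF bfun_laurent False, unfolded bfun_def] bfun_def spin_nth partial_lmono partial_cmult[OF smooth_lmono] add_diff_cancel_right' fscale_nth
    show ?thesis
      apply (rule spinor_eqI)
      subgoal unfolding s using r(1) d[of i] d[of "i + 1"] unfolding det_2 of_int_add of_int_diff of_int_1 by algebra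
      subgoal unfolding s using r(2) d[of i] d[of "i + 1"] unfolding det_2 of_int_add of_int_diff of_int_1 by algebra
      done
  qed
qed

lemma lap_uminus_lmono: "lap (\<lambda>Z. - lmono j k i b Z) Z = - (4 * of_int (j * (j + k + 1)) * lmono (j - 1) k i b Z)"
  using lap_scale[OF laurent_lmono, of "-1" j k i b Z] by (simp add: lap_lmono)

lemma lapS_afun: "lapS (afun j k i b) = fscale (4 * of_int (j * (j + k + 1))) (afun (j - 1) k i b)"
  by (rule ext, rule spinor_eqI) (simp_all add: lapS_def afun_def lap_lmono lap_uminus_lmono)

lemma lapS_bfun: "lapS (bfun j k i b) = fscale (4 * of_int (j * (j + k + 1))) (bfun (j - 1) k i b)"
  by (rule ext, rule spinor_eqI) (simp_all only: lapS_def vec_lambda_beta bfun_def spin_nth lap_scale[OF laurent_lmono] lap_lmono fscale_nth mult_ac)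

text \<open>The defining equation of quasi anti-regular functions in a degree-preserving form.\<close>

definition wave :: "(hc \<Rightarrow> spinor) \<Rightarrow> hc \<Rightarrow> spinor" where
  "wave f Z = det Z *s dirac (lapS f) Z"

lemma wave_add: "f \<in> laurent_spinors \<Longrightarrow> g \<in> laurent_spinors \<Longrightarrow> wave (f + g) = wave f + wave g"
  unfolding wave_def[abs_def] by (simp add: lapS_add dirac_add lapS_laurent fun_eq_iff vec_eq_iff algebra_simps)

lemma wave_scale: "f \<in> laurent_spinors \<Longrightarrow> wave (fscale c f) = fscale c (wave f)"
  unfolding wave_def[abs_def] by (simp add: lapS_scale dirac_scale lapS_laurent fun_eq_iff vec_eq_iff algebra_simps)

text \<open>The zeros \<open>j = 0, 1, - k - 1\<close> of this eigenvalue and \<open>j = 0, - k - 1, - k\<close> of the next one are the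
  six series of basis functions: three of nonnegative and three of negative degree.\<close>

lemma wave_afun: "wave (afun j k i b) = fscale (8 * of_int (j * (j - 1) * (j + k + 1))) (afun j k i b)"
  unfolding wave_def[abs_def] lapS_afun dirac_scale[OF afun_laurent] dirac_afun
  by (rule ext, rule spinor_eqI)
     (simp_all add: afun_def det_mult_lmono[of _ "j - 1", unfolded diff_add_cancel, symmetric] fs.scale_scale)

lemma wave_bfun: "wave (bfun j k i b) = fscale (8 * of_int (j * (j + k + 1) * (j + k))) (bfun j k i b)"
  unfolding wave_def[abs_def] lapS_bfun dirac_scale[OF bfun_laurent] dirac_bfun
  by (rule ext, rule spinor_eqI)
     (simp_all add: bfun_def det_mult_lmono[of _ "j - 1", unfolded diff_add_cancel, symmetric] fs.scale_scale)

lemma quasi_antiregular_iff: "f \<in> quasi_antiregular \<longleftrightarrow> f \<in> laurent_spinors \<and> wave f = 0"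
proof -
  have "nabla (laplacian f) Z = nabla (lapS f) Z" if "f \<in> laurent_spinors" "det Z \<noteq> 0" for Z
    by (rule nabla_cong[OF that(2)]) (rule laplacian_lapS[OF that(1)])
  then have "nabla (laplacian f) Z = 0 \<longleftrightarrow> wave f Z = 0" if "f \<in> laurent_spinors" "det Z \<noteq> 0" for Z
    using that by (simp add: wave_def dirac_zero_iff)
  moreover have "wave f Z = 0" if "det Z = 0" for Z
    using that by (simp add: wave_def)
  ultimately show ?thesis
    unfolding quasi_antiregular_def laurent_spinors_def fun_eq_iff by auto
qed

text \<open>The kernel of an operator is spanned by the eigenvectors with eigenvalue \<open>0\<close> among any spanning set
  of eigenvectors. The spanning set need not be independent: in a sum of eigenvectors those with equal
  eigenvalues are grouped, and the groups with nonzero eigenvalue cancel.\<close>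

lemma kernel_diagonal:
  assumes V: "fs.subspace V" and S: "S \<subseteq> V"
    and add: "\<And>f g. f \<in> V \<Longrightarrow> g \<in> V \<Longrightarrow> P (f + g) = P f + P g"
    and scale: "\<And>c f. f \<in> V \<Longrightarrow> P (fscale c f) = fscale c (P f)"
    and eig: "\<And>x. x \<in> S \<Longrightarrow> \<exists>m. P x = fscale m x \<and> (m = 0 \<longrightarrow> x \<in> S0)"
    and f: "f \<in> fs.span S" "P f = 0"
  shows "f \<in> fs.span S0"
proof -
  have P0: "P 0 = 0" using scale[of 0 0] fs.subspace_0[OF V] by (simp add: fs.scale_zero_left)
  have sub: "fs.span T \<subseteq> V" if "T \<subseteq> S" for T
    using fs.span_minimal[OF _ V] that S by blast
  have inv: "P g \<in> fs.span T" if T: "T \<subseteq> S" and "g \<in> fs.span T" for g T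
  proof -
    have "g \<in> V \<and> P g \<in> fs.span T" using that(2)
    proof (induction rule: fs.span_induct_alt)
      case base show ?case unfolding P0 using fs.span_zero fs.subspace_0[OF V] by blast
    next
      case (step c x y)
      have x: "x \<in> V" "y \<in> V" "x \<in> S" using step S T by auto
      obtain m where m: "P x = fscale m x" using eig[OF x(3)] by blast
      have "P (fscale c x + y) = fscale c (fscale m x) + P y"
        using add[OF fs.subspace_scale[OF V x(1)] x(2)] scale[OF x(1)] m by simp
      also have "\<dots> \<in> fs.span T"
        using step by (blast intro: fs.span_add fs.span_scale fs.span_base)
      finally show ?case using fs.subspace_add[OF V fs.subspace_scale[OF V x(1)] x(2)] by blast
    qed
    then show ?thesis ..
  qed
  let ?Z = "{x \<in> S. x \<in> S0}"
  have main: "\<forall>f. f \<in> fs.span (X \<union> ?Z) \<longrightarrow> P f = 0 \<longrightarrow> f \<in> fs.span S0" if "finite X" "X \<subseteq> S" for X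
    using that
  proof (induction X rule: finite_induct)
    case empty
    then show ?case using fs.span_mono[of ?Z S0] by auto
  next
    case (insert x X)
    have XS: "X \<union> ?Z \<subseteq> S" using insert by auto
    have "X \<subseteq> S" using insert by blast
    note IH = insert.IH[OF this, rule_format]
    obtain m where m: "P x = fscale m x" "m = 0 \<longrightarrow> x \<in> S0" using eig insert by blast
    show ?case
    proof (intro allI impI)
      fix f assume f: "f \<in> fs.span (insert x X \<union> ?Z)" "P f = 0"
      show "f \<in> fs.span S0"
      proof (cases "m = 0")
        case True
        then have "insert x X \<union> ?Z = X \<union> ?Z" using m insert by auto
        then show ?thesis using IH[of f] f by metis
      next
        case False
        obtain k where k: "f - fscale k x \<in> fs.span (X \<union> ?Z)"
          using fs.span_breakdown_eq[of f x "X \<union> ?Z"] f by auto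
        let ?g = "f - fscale k x"
        have xV: "x \<in> V" using insert S by auto
        have gV: "?g \<in> V" using k sub[OF XS] by blast
        have fe: "f = ?g + fscale k x" by simp
        have "P f = P ?g + fscale k (fscale m x)"
          using add[OF gV fs.subspace_scale[OF V xV], of k] scale[OF xV] m(1) by (simp flip: fe)
        then have Pg: "P ?g = - fscale k (fscale m x)" using f(2) by (simp add: eq_neg_iff_add_eq_0)
        have "P ?g - fscale m ?g = fscale (- m) f"
          unfolding Pg by (simp add: fs.scale_right_diff_distrib fs.scale_scale fs.scale_minus_left mult.commute)
        moreover have "P ?g - fscale m ?g \<in> fs.span (X \<union> ?Z)"
          by (intro fs.span_diff inv[OF XS k] fs.span_scale k)
        ultimately have "fscale (- (1 / m)) (fscale (- m) f) \<in> fs.span (X \<union> ?Z)"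
          by (simp only: fs.span_scale)
        then have "f \<in> fs.span (X \<union> ?Z)" using False by (simp add: fs.scale_scale)
        then show ?thesis using IH[OF _ f(2)] by blast
      qed
    qed
  qed
  obtain X where X: "finite X" "X \<subseteq> S" "f \<in> fs.span X"
    using f(1) unfolding fs.span_explicit by (auto intro: fs.span_sum fs.span_scale fs.span_base)
  then have "f \<in> fs.span (X \<union> ?Z)" using fs.span_mono[of X "X \<union> ?Z"] by blast
  then show ?thesis using main[OF X(1,2)] f(2) by blast
qed

section \<open>Homogeneity and bases of the four spaces\<close>

text \<open>The Euler operator; its eigenvalue is the degree of homogeneity.\<close>

definition euler :: "(hc \<Rightarrow> complex) \<Rightarrow> hc \<Rightarrow> complex" where
  "euler F Z = Z$1$1 * partial 1 1 F Z + Z$1$2 * partial 1 2 F Z + Z$2$1 * partial 2 1 F Z + Z$2$2 * partial 2 2 F Z"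

lemma euler_lmono0: "euler (lmono 0 k i b) Z = of_int k * lmono 0 k i b Z"
  using euler_tcoef[of Z b k i] 
  by (cases "det Z = 0") (simp_all add: euler_def partial_lmono lmono_singular lmono_eq)

lemma euler_homogeneous:
  assumes f: "f \<in> laurent_spinors" and h: "homogeneous d f"
  shows "(\<chi> i. euler (\<lambda>Z. f Z $ i) Z) = of_int d *s f Z"
proof (cases "det Z = 0")
  case True
  then show ?thesis using laurent_spinors_singular[OF f True] by (simp add: vec_eq_iff euler_def)
next
  case False
  have "euler (\<lambda>Z. f Z $ i) Z = of_int d * f Z $ i" for i
  proof -
    have 1: "((\<lambda>w. f (Z + cmul w Z) $ i) has_field_derivative euler (\<lambda>Z. f Z $ i) Z) (at 0)"
      using has_cgrad_line[OF smoothD[OF laurent_spinors_smooth[OF f, of i] False], of Z] unfolding euler_def by simp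
    have "((\<lambda>w. (1 + w) powi d * f Z $ i) has_field_derivative of_int d * f Z $ i) (at 0)"
      by (auto intro!: derivative_eq_intros)
    then have 2: "((\<lambda>w. f (Z + cmul w Z) $ i) has_field_derivative of_int d * f Z $ i) (at 0)"
    proof (rule has_field_derivative_transform_within_open[of _ _ _ "- {-1}"])
      fix w :: complex assume "w \<in> - {-1}"
      then have w: "1 + w \<noteq> 0" by (auto simp: add_eq_0_iff)
      have "Z + cmul w Z = cmul (1 + w) Z" by (simp add: vec_eq_iff algebra_simps)
      then show "(1 + w) powi d * f Z $ i = f (Z + cmul w Z) $ i"
        using h w by (simp add: homogeneous_def)
    qed auto
    show ?thesis using DERIV_unique[OF 1 2] .
  qed
  then show ?thesis by (simp add: vec_eq_iff)
qed

lemma det_cmul: "det (cmul c (Z::hc)) = c\<^sup>2 * det Z"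
  by (simp add: det_2 power2_eq_square algebra_simps)

lemma lmono_cmul:
  assumes "c \<noteq> 0"
  shows "lmono j k i b (cmul c Z) = c powi (2 * j + k) * lmono j k i b Z"
proof (cases "0 \<le> b \<and> b \<le> k")
  case True
  have "c ^ nat k = c powi k" using True by (simp add: power_int_def)
  moreover have "(c\<^sup>2 * det Z) powi j = c powi (2 * j) * det Z powi j"
    unfolding power_int_mult_distrib power_int_mult[of c 2 j] power_int_numeral ..
  ultimately show ?thesis
    using assms True tcoef_cmul[of b k i c Z]
    by (cases "det Z = 0") (simp_all add: lmono_def on_invertible_def det_cmul power_int_add)
next
  case False
  then have "lmono j k i b = (\<lambda>Z. 0)" by (intro lmono_outside) auto
  then show ?thesis by simp
qed

lemma homogeneous_afun: "homogeneous (2 * j + k) (afun j k i b)"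
  unfolding homogeneous_def by (auto simp: lmono_cmul afun_def intro!: spinor_eqI)

lemma homogeneous_bfun: "homogeneous (2 * j + k) (bfun j k i b)"
  unfolding homogeneous_def by (auto simp: lmono_cmul bfun_def intro!: spinor_eqI)

definition plus_basis :: "(hc \<Rightarrow> spinor) set" where
  "plus_basis = {afun j k i b |j k i b. 0 \<le> k \<and> (j = 0 \<or> j = 1)} \<union> {bfun 0 k i b |k i b. 1 \<le> k}"

definition minus_basis :: "(hc \<Rightarrow> spinor) set" where
  "minus_basis = {afun (- k - 1) k i b |k i b. 0 \<le> k} \<union> {bfun j k i b |j k i b. 1 \<le> k \<and> (j = - k - 1 \<or> j = - k)}"

lemma basis_laurent: "plus_basis \<subseteq> laurent_spinors" "minus_basis \<subseteq> laurent_spinors"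
  unfolding plus_basis_def minus_basis_def using afun_laurent bfun_laurent by blast+

lemma plus_basis_props: "x \<in> plus_basis \<Longrightarrow> x \<in> quasi_antiregular \<and> (\<exists>d\<ge>0. homogeneous d x)"
proof -
  have z: "fscale 0 f = 0" for f by (rule fs.scale_zero_left)
  assume "x \<in> plus_basis"
  then consider j k i b where "x = afun j k i b" "0 \<le> k" "j = 0 \<or> j = 1" | k i b where "x = bfun 0 k i b" "1 \<le> k"
    unfolding plus_basis_def by blast
  then show ?thesis
  proof cases
    case 1
    then have "wave x = 0" using z by (auto simp: wave_afun)
    moreover have "0 \<le> 2 * j + k" using 1 by auto
    ultimately show ?thesis using 1 homogeneous_afun afun_laurent quasi_antiregular_iff by blast
  next
    case 2
    then have "wave x = 0" using z by (auto simp: wave_bfun)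
    moreover have "0 \<le> 2 * 0 + k" using 2 by auto
    ultimately show ?thesis using 2 homogeneous_bfun bfun_laurent quasi_antiregular_iff by blast
  qed
qed

lemma minus_basis_props: "x \<in> minus_basis \<Longrightarrow> x \<in> quasi_antiregular \<and> (\<exists>d<0. homogeneous d x)"
proof -
  have z: "fscale 0 f = 0" for f by (rule fs.scale_zero_left)
  assume "x \<in> minus_basis"
  then consider k i b where "x = afun (- k - 1) k i b" "0 \<le> k" | j k i b where "x = bfun j k i b" "1 \<le> k" "j = - k - 1 \<or> j = - k"
    unfolding minus_basis_def by blast
  then show ?thesis
  proof cases
    case 1
    then have "wave x = 0" using z by (auto simp: wave_afun)
    moreover have "2 * (- k - 1) + k < 0" using 1 by auto
    ultimately show ?thesis using 1 homogeneous_afun afun_laurent quasi_antiregular_iff by blast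
  next
    case 2
    then have "wave x = 0" using z by (auto simp: wave_bfun)
    moreover have "2 * j + k < 0" using 2 by auto
    ultimately show ?thesis using 2 homogeneous_bfun bfun_laurent quasi_antiregular_iff by blast
  qed
qed

lemma quasi_antiregular_span:
  assumes "f \<in> quasi_antiregular"
  shows "f \<in> fs.span (plus_basis \<union> minus_basis)"
proof (rule kernel_diagonal[where P = wave and V = laurent_spinors and S = eigenfuns])
  show "eigenfuns \<subseteq> laurent_spinors"
    unfolding eigenfuns_def using afun_laurent bfun_laurent by blast
  show "f \<in> fs.span eigenfuns" "wave f = 0"
    using assms laurent_spinors_span quasi_antiregular_iff by auto
next
  fix x assume "x \<in> eigenfuns"
  then consider j k i b where "x = afun j k i b" "0 \<le> k" | j k i b where "x = bfun j k i b" "1 \<le> k"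
    unfolding eigenfuns_def by blast
  then show "\<exists>m. wave x = fscale m x \<and> (m = 0 \<longrightarrow> x \<in> plus_basis \<union> minus_basis)"
  proof cases
    case 1
    have "x \<in> plus_basis \<union> minus_basis" if "8 * of_int (j * (j - 1) * (j + k + 1)) = (0::complex)"
    proof -
      have "j * (j - 1) * (j + k + 1) = 0" using that of_int_eq_0_iff by (metis mult_eq_0_iff zero_neq_numeral)
      then have "j = 0 \<or> j = 1 \<or> j = - k - 1" by auto
      then show ?thesis using 1 unfolding plus_basis_def minus_basis_def by blast
    qed
    then show ?thesis using wave_afun 1 by blast
  next
    case 2
    have "x \<in> plus_basis \<union> minus_basis" if "8 * of_int (j * (j + k + 1) * (j + k)) = (0::complex)"
    proof -
      have "j * (j + k + 1) * (j + k) = 0" using that of_int_eq_0_iff by (metis mult_eq_0_iff zero_neq_numeral)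
      then have "j = 0 \<or> j = - k - 1 \<or> j = - k" by auto
      then show ?thesis using 2 unfolding plus_basis_def minus_basis_def by blast
    qed
    then show ?thesis using wave_bfun 2 by blast
  qed
qed (simp_all add: subspace_laurent_spinors wave_add wave_scale)

text \<open>A homogeneous function in the span of homogeneous functions needs only those of its own degree,
  being in the kernel of the Euler operator minus the degree.\<close>

lemma homogeneous_in_span:
  assumes S: "S \<subseteq> laurent_spinors" and hom: "\<And>x. x \<in> S \<Longrightarrow> \<exists>e. homogeneous e x \<and> (e = d \<longrightarrow> x \<in> T)"
    and f: "f \<in> fs.span S" "homogeneous d f"
  shows "f \<in> fs.span T"
proof (rule kernel_diagonal[where P = "\<lambda>f Z. (\<chi> i. euler (\<lambda>Z. f Z $ i) Z) - of_int d *s f Z" and V = laurent_spinors and S = S])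
  have "f \<in> laurent_spinors"
    using f(1) fs.span_minimal[OF S subspace_laurent_spinors] by blast
  then show "(\<lambda>Z. (\<chi> i. euler (\<lambda>Z. f Z $ i) Z) - of_int d *s f Z) = 0"
    using euler_homogeneous[OF _ f(2)] by (simp add: fun_eq_iff)
next
  fix x assume x: "x \<in> S"
  then obtain e where e: "homogeneous e x" "e = d \<longrightarrow> x \<in> T" using hom by blast
  have xl: "x \<in> laurent_spinors" using x S by blast
  have "(\<lambda>Z. (\<chi> i. euler (\<lambda>Z. x Z $ i) Z) - of_int d *s x Z) = fscale (of_int (e - d)) x"
    using euler_homogeneous[OF xl e(1)] by (simp add: fun_eq_iff fscale_def vec_eq_iff algebra_simps)
  then show "\<exists>m. (\<lambda>Z. (\<chi> i. euler (\<lambda>Z. x Z $ i) Z) - of_int d *s x Z) = fscale m x \<and> (m = 0 \<longrightarrow> x \<in> T)"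
    using e(2) by (metis eq_iff_diff_eq_0 of_int_eq_0_iff)
qed (use assms in \<open>simp_all add: subspace_laurent_spinors fun_eq_iff vec_eq_iff euler_def partial_add partial_cmult laurent_spinors_smooth algebra_simps\<close>)

theorem U_plus_span: "U_plus = fs.span plus_basis"
proof (rule subset_antisym)
  show "fs.span plus_basis \<subseteq> U_plus"
    unfolding U_plus_def by (rule fs.span_mono) (use plus_basis_props in auto)
  have "f \<in> fs.span plus_basis" if "f \<in> quasi_antiregular" "homogeneous d f" "d \<ge> 0" for f d
  proof (rule homogeneous_in_span[OF _ _ quasi_antiregular_span[OF that(1)] that(2)])
    show "plus_basis \<union> minus_basis \<subseteq> laurent_spinors" using basis_laurent by blast
    show "\<exists>e. homogeneous e x \<and> (e = d \<longrightarrow> x \<in> plus_basis)" if "x \<in> plus_basis \<union> minus_basis" for x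
      using plus_basis_props[of x] minus_basis_props[of x] that \<open>d \<ge> 0\<close> by force
  qed
  then show "U_plus \<subseteq> fs.span plus_basis"
    unfolding U_plus_def by (intro fs.span_minimal fs.subspace_span) auto
qed

theorem U_minus_span: "U_minus = fs.span minus_basis"
proof (rule subset_antisym)
  show "fs.span minus_basis \<subseteq> U_minus"
    unfolding U_minus_def by (rule fs.span_mono) (use minus_basis_props in auto)
  have "f \<in> fs.span minus_basis" if "f \<in> quasi_antiregular" "homogeneous d f" "d < 0" for f d
  proof (rule homogeneous_in_span[OF _ _ quasi_antiregular_span[OF that(1)] that(2)])
    show "plus_basis \<union> minus_basis \<subseteq> laurent_spinors" using basis_laurent by blast
    show "\<exists>e. homogeneous e x \<and> (e = d \<longrightarrow> x \<in> minus_basis)" if "x \<in> plus_basis \<union> minus_basis" for x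
      using plus_basis_props[of x] minus_basis_props[of x] that \<open>d < 0\<close> by force
  qed
  then show "U_minus \<subseteq> fs.span minus_basis"
    unfolding U_minus_def by (intro fs.span_minimal fs.subspace_span) auto
qed

section \<open>Integration over the unit sphere\<close>

text \<open>The real quaternions, characterized by their entries.\<close>

definition is_quat :: "hc \<Rightarrow> bool" where
  "is_quat A \<longleftrightarrow> A$2$2 = cnj (A$1$1) \<and> A$2$1 = - cnj (A$1$2)"

definition to_real4 :: "hc \<Rightarrow> real^4" where
  "to_real4 A = (\<chi> j. Re (coords A $ j))"

lemma real_quat_nth:
  "real_quat x $ 1 $ 1 = Complex (x $ 0) (- x $ 3)"
  "real_quat x $ 1 $ 2 = Complex (- x $ 2) (- x $ 1)"
  "real_quat x $ 2 $ 1 = Complex (x $ 2) (- x $ 1)"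
  "real_quat x $ 2 $ 2 = Complex (x $ 0) (x $ 3)"
  by (simp_all add: real_quat_def quat_nth complex_eq_iff)

lemma is_quat_real_quat: "is_quat (real_quat x)"
  by (simp add: is_quat_def real_quat_nth complex_eq_iff)

lemma index4_cases: "(j::4) = 0 \<or> j = 1 \<or> j = 2 \<or> j = 3"
  using UNIV_index4 by auto

lemma vec4_eqI: "x $ 0 = y $ 0 \<Longrightarrow> x $ 1 = y $ 1 \<Longrightarrow> x $ 2 = y $ 2 \<Longrightarrow> x $ 3 = y $ 3 \<Longrightarrow> x = (y :: 'a^4)"
  unfolding vec_eq_iff using index4_cases by metis

lemma to_real4_nth:
  "to_real4 A $ 0 = Re (A$1$1 + A$2$2) / 2"
  "to_real4 A $ 1 = - Im (A$1$2 + A$2$1) / 2"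
  "to_real4 A $ 2 = Re (A$2$1 - A$1$2) / 2"
  "to_real4 A $ 3 = - Im (A$1$1 - A$2$2) / 2"
  by (simp_all add: to_real4_def coords_nth)

lemma real_quat_to_real4: "is_quat A \<Longrightarrow> real_quat (to_real4 A) = A"
  by (rule hc_eqI) (simp_all add: real_quat_nth to_real4_nth is_quat_def complex_eq_iff)

lemma real_quat_linear:
  "real_quat (x + y) = real_quat x + real_quat y"
  "real_quat (r *\<^sub>R x) = r *\<^sub>R real_quat x"
  by (rule hc_eqI; simp add: real_quat_nth complex_eq_iff)+

lemma to_real4_linear:
  "to_real4 (A + B) = to_real4 A + to_real4 B"
  "to_real4 (r *\<^sub>R A) = r *\<^sub>R to_real4 A"
  by (rule vec4_eqI; simp add: to_real4_nth field_simps)+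

lemma continuous_real_quat: "continuous_on UNIV (\<lambda>x. real_quat x $ a $ b)"
proof -
  have "linear (\<lambda>x. real_quat x $ a $ b)"
    by (rule linearI) (simp_all add: real_quat_linear)
  then show ?thesis by (rule linear_continuous_on[OF linear_conv_bounded_linear[THEN iffD1]])
qed

subsection \<open>Invariance of the measure under orthogonal transformations\<close>

lemma sets_sphere_measure [simp, measurable_cong]: "sets (sphere_measure :: (real^4) measure) = sets borel"
  by (simp add: sphere_measure_def)

lemma space_sphere_measure [simp]: "space (sphere_measure :: (real^4) measure) = UNIV"
  using sets_eq_imp_space_eq[OF sets_sphere_measure] by simp

lemma emeasure_sphere_set:
  assumes "A \<in> sets borel"
  shows "emeasure (sphere_measure :: (real^4) measure) A = 4 * emeasure lborel {x \<in> cball 0 1. sgn x \<in> A}"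
proof -
  have s: "sgn \<in> measurable (restrict_space lborel (cball (0::real^4) 1)) borel"
    by (rule measurable_restrict_space1) (simp add: sgn_borel_measurable)
  have "emeasure (sphere_measure :: (real^4) measure) A = 4 * emeasure (restrict_space lborel (cball (0::real^4) 1)) (sgn -` A \<inter> cball 0 1)"
    using assms s by (simp add: sphere_measure_def emeasure_distr space_restrict_space)
  also have "\<dots> = 4 * emeasure lborel (sgn -` A \<inter> cball (0::real^4) 1)"
    by (subst emeasure_restrict_space) auto
  also have "sgn -` A \<inter> cball (0::real^4) 1 = {x \<in> cball 0 1. sgn x \<in> A}" by auto
  finally show ?thesis .
qed

lemma sgn_set_borel: "A \<in> sets borel \<Longrightarrow> {x \<in> cball (0::real^4) 1. sgn x \<in> A} \<in> sets borel"
proof -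
  assume A: "A \<in> sets borel"
  have "{x \<in> cball (0::real^4) 1. sgn x \<in> A} = cball 0 1 \<inter> (sgn -` A \<inter> space borel)" by auto
  then show ?thesis using measurable_sets[OF sgn_borel_measurable A] by simp
qed

lemma finite_measure_sphere: "finite_measure (sphere_measure :: (real^4) measure)"
  by (rule finite_measureI) (simp add: emeasure_sphere_measure)

lemma AE_sphere: "AE x in (sphere_measure :: (real^4) measure). x \<noteq> 0 \<longrightarrow> norm x = 1"
proof (rule AE_I)
  let ?N = "{x::real^4. \<not> (x \<noteq> 0 \<longrightarrow> norm x = 1)}"
  have "?N = - {0} \<inter> {x. norm x \<noteq> 1}" by auto
  moreover have "open {x::real^4. norm x \<noteq> 1}"
    by (intro open_Collect_neq continuous_intros)
  ultimately have N: "?N \<in> sets borel" by (auto intro!: borel_open open_Int)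
  then show "?N \<in> sets (sphere_measure :: (real^4) measure)" by simp
  have e: "{x \<in> cball (0::real^4) 1. sgn x \<in> ?N} = {}"
    by (auto simp: norm_sgn split: if_splits)
  then show "emeasure (sphere_measure :: (real^4) measure) ?N = 0"
    unfolding emeasure_sphere_set[OF N] e by simp
qed auto

lemma AE_sphere_nonzero: "AE x in (sphere_measure :: (real^4) measure). norm x = 1"
proof -
  have "AE x in (sphere_measure :: (real^4) measure). x \<noteq> 0"
  proof (rule AE_I)
    have "{x \<in> cball (0::real^4) 1. sgn x \<in> {0}} = {0}" by (auto simp: sgn_zero_iff)
    then show "emeasure (sphere_measure :: (real^4) measure) {0} = 0"
      by (subst emeasure_sphere_set) auto
  qed auto
  then show ?thesis using AE_sphere by eventually_elim simp
qed

text \<open>The cone over a set is carried to the cone over its image, and Lebesgue measure is invariant under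
  orthogonal transformations.\<close>

lemma distr_sphere_orthogonal:
  fixes L :: "real^4 \<Rightarrow> real^4"
  assumes L: "orthogonal_transformation L"
  shows "distr sphere_measure borel L = sphere_measure"
proof (rule measure_eqI)
  fix A assume "A \<in> sets (distr (sphere_measure :: (real^4) measure) borel L)"
  then have A: "A \<in> sets borel" by simp
  have lin: "linear L" using L orthogonal_transformation_linear by blast
  have Lm: "L \<in> borel_measurable borel"
    by (rule borel_measurable_continuous_onI) (rule linear_continuous_on[OF lin[unfolded linear_conv_bounded_linear]])
  have pre: "L -` A \<in> sets borel" using measurable_sets[OF Lm A] by simp
  let ?B = "{x \<in> cball (0::real^4) 1. sgn x \<in> A}"
  let ?C = "{x \<in> cball (0::real^4) 1. sgn x \<in> L -` A}"
  have nL: "norm (L x) = norm x" for x using L orthogonal_transformation_norm by blast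
  have "sgn (L x) = L (sgn x)" for x
    by (simp add: sgn_div_norm nL linear_cmul[OF lin])
  then have img: "L ` ?C = ?B"
    using orthogonal_transformation_surj[OF L] by (auto simp: nL image_iff) (metis nL surj_f_inv_f)
  have Bb: "?B \<in> sets borel" "?C \<in> sets borel" using sgn_set_borel[OF A] sgn_set_borel[OF pre] by blast+
  have fin: "?C \<in> lmeasurable"
  proof (rule bounded_set_imp_lmeasurable)
    show "bounded ?C" by (rule bounded_subset[OF bounded_cball[of 0 1]]) auto
    show "?C \<in> sets lebesgue" using Bb(2) sets_completionI_sets[of _ lborel] by simp
  qed
  have "measure lebesgue ?B = measure lebesgue ?C"
    using measure_orthogonal_image[OF L fin] img by simp
  moreover have "emeasure lebesgue ?B = ennreal (measure lebesgue ?B)" "emeasure lebesgue ?C = ennreal (measure lebesgue ?C)"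
    using measurable_orthogonal_image[OF L fin] fin unfolding img
    by (simp_all add: emeasure_eq_measure2)
  ultimately have "emeasure lborel ?B = emeasure lborel ?C"
    using Bb by simp
  then show "emeasure (distr sphere_measure borel L) A = emeasure sphere_measure A"
    using A pre Lm by (subst emeasure_distr) (simp_all add: emeasure_sphere_set)
qed simp

text \<open>A sufficient condition for integrability over the sphere. Measurability is required on
  all of \<open>\<real>\<^sup>4\<close> because the surface measure lives on the Borel sets of \<open>\<real>\<^sup>4\<close>.\<close>

definition sphere_bounded :: "(hc \<Rightarrow> complex) \<Rightarrow> bool" where
  "sphere_bounded F \<longleftrightarrow> (\<lambda>x. F (real_quat x)) \<in> borel_measurable borel \<and> (\<exists>C. \<forall>x. norm x = 1 \<longrightarrow> norm (F (real_quat x)) \<le> C)"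

lemma sphere_bounded_integrable: "sphere_bounded F \<Longrightarrow> integrable sphere_measure (\<lambda>x::real^4. F (real_quat x))"
proof -
  assume "sphere_bounded F"
  then obtain C where C: "(\<lambda>x. F (real_quat x)) \<in> borel_measurable borel" "\<And>x. norm x = 1 \<Longrightarrow> norm (F (real_quat x)) \<le> C"
    unfolding sphere_bounded_def by blast
  interpret finite_measure "sphere_measure :: (real^4) measure" by (rule finite_measure_sphere)
  have "AE x in (sphere_measure :: (real^4) measure). norm (F (real_quat x)) \<le> C"
    using AE_sphere_nonzero by eventually_elim (rule C(2))
  then show ?thesis
    by (rule integrable_const_bound) (use C(1) in measurable)
qed

lemma borel_measurable_sphere: "borel_measurable (sphere_measure :: (real^4) measure) = borel_measurable borel"
  by (rule measurable_cong_sets) simp_all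

lemma sphere_bounded_const: "sphere_bounded (\<lambda>Z. c)"
  unfolding sphere_bounded_def by auto

lemma sphere_bounded_add: "sphere_bounded F \<Longrightarrow> sphere_bounded G \<Longrightarrow> sphere_bounded (\<lambda>Z. F Z + G Z)"
  unfolding sphere_bounded_def by (auto intro!: borel_measurable_add) (meson add_mono norm_triangle_le)

lemma sphere_bounded_mult: "sphere_bounded F \<Longrightarrow> sphere_bounded G \<Longrightarrow> sphere_bounded (\<lambda>Z. F Z * G Z)"
proof -
  assume "sphere_bounded F" "sphere_bounded G"
  then obtain C D where m: "(\<lambda>x. F (real_quat x)) \<in> borel_measurable borel" "(\<lambda>x. G (real_quat x)) \<in> borel_measurable borel"
    and b: "\<And>x. norm x = 1 \<Longrightarrow> norm (F (real_quat x)) \<le> C" "\<And>x. norm x = 1 \<Longrightarrow> norm (G (real_quat x)) \<le> D"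
    unfolding sphere_bounded_def by blast
  have "norm (F (real_quat x) * G (real_quat x)) \<le> C * D" if "norm x = 1" for x
    unfolding norm_mult using b[OF that] order_trans[OF norm_ge_zero b(1)[OF that]] by (intro mult_mono) auto
  then show ?thesis unfolding sphere_bounded_def using borel_measurable_times[OF m] by blast
qed

lemma sphere_bounded_cnj: "sphere_bounded F \<Longrightarrow> sphere_bounded (\<lambda>Z. cnj (F Z))"
proof -
  assume F: "sphere_bounded F"
  have "(\<lambda>z. cnj z) \<in> borel_measurable borel"
    by (intro borel_measurable_continuous_onI continuous_intros)
  from measurable_compose[OF _ this] F show ?thesis
    unfolding sphere_bounded_def by auto
qed

lemma det_real_quat_eq_0: "det (real_quat x) = 0 \<longleftrightarrow> x = 0"
  unfolding det_real_quat by simp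

lemma sphere_bounded_on_invertible: "sphere_bounded F \<Longrightarrow> sphere_bounded (on_invertible F)"
proof -
  assume F: "sphere_bounded F"
  then have m: "(\<lambda>x. F (real_quat x)) \<in> borel_measurable borel" unfolding sphere_bounded_def by blast
  have "(\<lambda>x. on_invertible F (real_quat x)) = (\<lambda>x. if x = 0 then 0 else F (real_quat x))"
    by (auto simp: on_invertible_def det_real_quat_eq_0)
  moreover have "(\<lambda>x. if x = 0 then 0 else F (real_quat x)) \<in> borel_measurable borel"
    using m by measurable
  ultimately show ?thesis using F
    unfolding sphere_bounded_def by (auto simp: on_invertible_def) (metis norm_ge_zero order_trans)
qed

lemma sphere_bounded_entry: "sphere_bounded (\<lambda>Z. Z $ a $ b)"
proof -
  have "norm (real_quat x $ a $ b) \<le> 2 * norm x" for x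
  proof -
    have "cmod (Complex r s) \<le> \<bar>r\<bar> + \<bar>s\<bar>" for r s using cmod_le[of "Complex r s"] by simp
    moreover have "\<bar>x $ j\<bar> \<le> norm x" for j by (rule component_le_norm_cart)
    moreover have "\<exists>j k. norm (real_quat x $ a $ b) \<le> \<bar>x $ j\<bar> + \<bar>x $ k\<bar>"
    proof -
      have "norm (real_quat x $ 1 $ 1) \<le> \<bar>x $ 0\<bar> + \<bar>x $ 3\<bar>" "norm (real_quat x $ 1 $ 2) \<le> \<bar>x $ 2\<bar> + \<bar>x $ 1\<bar>"
        "norm (real_quat x $ 2 $ 1) \<le> \<bar>x $ 2\<bar> + \<bar>x $ 1\<bar>" "norm (real_quat x $ 2 $ 2) \<le> \<bar>x $ 0\<bar> + \<bar>x $ 3\<bar>"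
        unfolding real_quat_nth by (rule order_trans[OF calculation(1)]; simp)+
      then show ?thesis using exhaust_2_cases[of a] exhaust_2_cases[of b] by auto
    qed
    ultimately show ?thesis by (smt (verit))
  qed
  then have "norm x = 1 \<longrightarrow> norm (real_quat x $ a $ b) \<le> 2" for x by (metis mult.right_neutral)
  then show ?thesis
    unfolding sphere_bounded_def using borel_measurable_continuous_onI[OF continuous_real_quat] by blast
qed

lemma laurent_sphere_bounded: "p \<in> laurent_algebra \<Longrightarrow> sphere_bounded p"
proof (induction p rule: laurent_algebra.induct)
  case (coord j)
  have *: "sphere_bounded (\<lambda>Z. c * Z$1$1 + d * Z$1$2 + e * Z$2$1 + f * Z$2$2)" for c d e f
    by (intro sphere_bounded_add sphere_bounded_mult sphere_bounded_const sphere_bounded_entry)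
  have "sphere_bounded (\<lambda>Z. coords Z $ j)"
    using index4_cases[of j] *[of "1/2" 0 0 "1/2"] *[of 0 "\<i>/2" "\<i>/2" 0] *[of 0 "-1/2" "1/2" 0] *[of "\<i>/2" 0 0 "-\<i>/2"]
    by (elim disjE) (simp_all add: coords_nth add_divide_distrib diff_divide_distrib distrib_left right_diff_distrib)
  then show ?case by (rule sphere_bounded_on_invertible)
next
  case inverse_det
  have d: "(\<lambda>x. det (real_quat x)) \<in> borel_measurable borel"
    unfolding det_real_quat by measurable
  then have "(\<lambda>x. inverse (det (real_quat x))) \<in> borel_measurable borel" by measurable
  moreover have "\<forall>x. norm x = 1 \<longrightarrow> norm (inverse (det (real_quat x))) \<le> 1"
    unfolding det_real_quat by simp
  ultimately have "sphere_bounded (\<lambda>Z. inverse (det Z))" unfolding sphere_bounded_def by blast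
  then show ?case by (rule sphere_bounded_on_invertible)
qed (auto intro: sphere_bounded_on_invertible sphere_bounded_const sphere_bounded_add sphere_bounded_mult)

lemma integral_S3_add: "sphere_bounded F \<Longrightarrow> sphere_bounded G \<Longrightarrow> integral_S3 (\<lambda>Z. F Z + G Z) = integral_S3 F + integral_S3 G"
  unfolding integral_S3_def by (simp add: sphere_bounded_integrable)

lemma integral_S3_cmult: "integral_S3 (\<lambda>Z. c * F Z) = c * integral_S3 F"
  unfolding integral_S3_def by simp

lemma integral_S3_cnj: "integral_S3 (\<lambda>Z. cnj (F Z)) = cnj (integral_S3 F)"
  unfolding integral_S3_def by simp

lemma integral_S3_const: "integral_S3 (\<lambda>Z. c) = 2 * (of_real pi)\<^sup>2 * c"
proof -
  have "measure (sphere_measure :: (real^4) measure) UNIV = 2 * pi\<^sup>2"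
    by (simp add: measure_def emeasure_sphere_measure)
  then show ?thesis unfolding integral_S3_def by (simp add: scaleR_conv_of_real)
qed

lemma integral_S3_cong:
  assumes "sphere_bounded F" "sphere_bounded G" "\<And>X. is_quat X \<Longrightarrow> det X = 1 \<Longrightarrow> F X = G X"
  shows "integral_S3 F = integral_S3 G"
  unfolding integral_S3_def
proof (rule integral_cong_AE)
  show "AE x in (sphere_measure :: (real^4) measure). F (real_quat x) = G (real_quat x)"
    using AE_sphere_nonzero by eventually_elim (simp add: assms(3) is_quat_real_quat det_real_quat)
qed (use assms in \<open>simp_all add: sphere_bounded_def borel_measurable_sphere\<close>)

text \<open>On quaternions the determinant is the square of the norm, so a real-linear map that preserves
  quaternions and determinants is orthogonal.\<close>

lemma integral_S3_invariant:
  assumes lin: "\<And>A B. \<Psi> (A + B) = \<Psi> A + \<Psi> B" "\<And>r A. \<Psi> (r *\<^sub>R A) = r *\<^sub>R \<Psi> A"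
    and quat: "\<And>A. is_quat A \<Longrightarrow> is_quat (\<Psi> A)" and det: "\<And>A. is_quat A \<Longrightarrow> det (\<Psi> A) = det A"
    and F: "sphere_bounded F"
  shows "integral_S3 (\<lambda>Z. F (\<Psi> Z)) = integral_S3 F"
proof -
  let ?L = "\<lambda>x. to_real4 (\<Psi> (real_quat x))"
  have rq: "real_quat (?L x) = \<Psi> (real_quat x)" for x
    by (rule real_quat_to_real4[OF quat[OF is_quat_real_quat]])
  have "norm (?L x) = norm x" for x
  proof -
    have "det (real_quat (?L x)) = det (real_quat x)" unfolding rq by (rule det[OF is_quat_real_quat])
    then have "(norm (?L x))\<^sup>2 = (norm x)\<^sup>2" unfolding det_real_quat by (simp only: of_real_eq_iff)
    then show ?thesis by (simp add: power2_eq_iff_nonneg)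
  qed
  moreover have "linear ?L"
    by (rule linearI) (simp_all add: real_quat_linear lin to_real4_linear)
  ultimately have "orthogonal_transformation ?L" by (simp add: orthogonal_transformation)
  note d = distr_sphere_orthogonal[OF this]
  have Lm: "?L \<in> measurable sphere_measure borel"
    using borel_measurable_continuous_onI[OF linear_continuous_on[OF \<open>linear ?L\<close>[unfolded linear_conv_bounded_linear]]]
    unfolding borel_measurable_sphere .
  have "integral_S3 F = integral\<^sup>L (distr sphere_measure borel ?L) (\<lambda>x. F (real_quat x))"
    unfolding d integral_S3_def ..
  also have "\<dots> = integral\<^sup>L sphere_measure (\<lambda>x. F (real_quat (?L x)))"
    by (rule integral_distr[OF Lm]) (use F in \<open>simp add: sphere_bounded_def\<close>)
  finally show ?thesis unfolding rq integral_S3_def by simp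
qed

section \<open>Orthogonality of the matrix coefficients\<close>

lemma has_derivative_vecI:
  fixes f :: "'a::real_normed_vector \<Rightarrow> 'b::euclidean_space ^ 'n"
  assumes "\<And>i. ((\<lambda>x. f x $ i) has_derivative (\<lambda>x. f' x $ i)) (at a within S)"
  shows "(f has_derivative f') (at a within S)"
  unfolding has_derivative_componentwise_within[of f]
proof
  fix v :: "'b^'n" assume "v \<in> Basis"
  then obtain i u where v: "v = axis i u" "u \<in> Basis" by (auto simp: Basis_vec_def)
  show "((\<lambda>x. f x \<bullet> v) has_derivative (\<lambda>x. f' x \<bullet> v)) (at a within S)"
    unfolding v(1) inner_axis using has_derivative_inner_left[OF assms[of i], of u] by simp
qed

lemma has_derivative_hcI:
  fixes f :: "'a::real_normed_vector \<Rightarrow> hc"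
  assumes "\<And>i j. ((\<lambda>x. f x $ i $ j) has_derivative (\<lambda>x. f' x $ i $ j)) (at a within S)"
  shows "(f has_derivative f') (at a within S)"
  by (intro has_derivative_vecI assms)

text \<open>Families of functions depending on a parameter \<open>t\<close> through finitely many scalar coefficients. For
  these, differentiation under the integral sign reduces to linearity of the integral.\<close>

inductive_set flow :: "(real \<Rightarrow> hc \<Rightarrow> complex) set" where
  base: "(a has_vector_derivative a') (at 0) \<Longrightarrow> p \<in> laurent_algebra \<Longrightarrow> q \<in> laurent_algebra \<Longrightarrow>
    (\<lambda>t Z. a t * (p Z * cnj (q Z))) \<in> flow"
| plus: "P \<in> flow \<Longrightarrow> Q \<in> flow \<Longrightarrow> (\<lambda>t Z. P t Z + Q t Z) \<in> flow"

lemma flow_mult: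
  assumes "P \<in> flow" "Q \<in> flow"
  shows "(\<lambda>t Z. P t Z * Q t Z) \<in> flow"
  using assms(1)
proof induction
  case (base a a' p q)
  show ?case using assms(2)
  proof induction
    case (base b b' r s)
    have "((\<lambda>t. a t * b t) has_vector_derivative (a 0 * b' + a' * b 0)) (at 0)"
      by (rule has_vector_derivative_mult) fact+
    from flow.base[OF this laurent_algebra.mult[OF \<open>p \<in> _\<close> \<open>r \<in> _\<close>] laurent_algebra.mult[OF \<open>q \<in> _\<close> \<open>s \<in> _\<close>]]
    show ?case by (simp add: mult_ac)
  next
    case (plus P Q)
    then show ?case using flow.plus by (simp add: distrib_left)
  qed
next
  case (plus P R)
  then show ?case using flow.plus by (simp add: distrib_right)
qed

lemma flow_cnj: "P \<in> flow \<Longrightarrow> (\<lambda>t Z. cnj (P t Z)) \<in> flow"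
proof (induction rule: flow.induct)
  case (base a a' p q)
  from flow.base[OF has_vector_derivative_cnj[OF base(1)] base(3) base(2)]
  show ?case by (simp add: mult_ac)
next
  case (plus P Q)
  then show ?case using flow.plus by simp
qed

lemma flow_scale: "P \<in> flow \<Longrightarrow> (\<lambda>t Z. c * P t Z) \<in> flow"
proof (induction rule: flow.induct)
  case (base a a' p q)
  from flow.base[OF base(1) laurent_scale[OF base(2)] base(3)]
  show ?case by (simp add: mult_ac)
next
  case (plus P Q)
  then show ?case using flow.plus by (simp add: distrib_left)
qed

lemma matrix_mult_2: "((A::hc) ** B) $ a $ b = A$a$1 * B$1$b + A$a$2 * B$2$b"
  by (simp add: matrix_matrix_mult_def sum_2)

lemma flow_laurent:
  assumes h: "\<And>a b. ((\<lambda>t. h t $ a $ b) has_vector_derivative \<xi> $ a $ b) (at 0)" and det: "\<And>t. det (h t) = 1"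
    and p: "p \<in> laurent_algebra"
  shows "(\<lambda>t Z. p (Z ** h t)) \<in> flow"
  using p
proof (induction p rule: laurent_algebra.induct)
  have one: "on_invertible (\<lambda>Z. 1) \<in> laurent_algebra" by (rule laurent_algebra.const)
  have iff: "det (Z ** h t) = det Z" for Z t by (simp add: det_mul det)
  have entry: "(\<lambda>t Z. on_invertible (\<lambda>Z. Z $ a $ b) (Z ** h t)) \<in> flow" for a b
  proof -
    have "(\<lambda>t Z. h t $ 1 $ b * (on_invertible (\<lambda>Z. Z $ a $ 1) Z * cnj (on_invertible (\<lambda>Z. 1) Z))
       + h t $ 2 $ b * (on_invertible (\<lambda>Z. Z $ a $ 2) Z * cnj (on_invertible (\<lambda>Z. 1) Z))) \<in> flow"
      by (intro flow.plus flow.base[OF h] laurent_entry one)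
    moreover have "(\<lambda>t Z. h t $ 1 $ b * (on_invertible (\<lambda>Z. Z $ a $ 1) Z * cnj (on_invertible (\<lambda>Z. 1) Z))
       + h t $ 2 $ b * (on_invertible (\<lambda>Z. Z $ a $ 2) Z * cnj (on_invertible (\<lambda>Z. 1) Z)))
       = (\<lambda>t Z. on_invertible (\<lambda>Z. Z $ a $ b) (Z ** h t))"
      by (auto simp: fun_eq_iff on_invertible_def iff matrix_mult_2 mult.commute)
    ultimately show ?thesis by simp
  qed
  have time_indep: "(\<lambda>t. q) \<in> flow" if "q \<in> laurent_algebra" for q
  proof -
    have "(\<lambda>t Z. 1 * (q Z * cnj (on_invertible (\<lambda>Z. 1) Z))) \<in> flow"
      by (rule flow.base[OF _ that one]) (rule has_vector_derivative_const)
    moreover have "(\<lambda>t Z. 1 * (q Z * cnj (on_invertible (\<lambda>Z. 1) Z))) = (\<lambda>t. q)"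
      using laurent_singular[OF that] by (auto simp: fun_eq_iff on_invertible_def)
    ultimately show ?thesis by (rule back_subst[of "\<lambda>x. x \<in> flow"])
  qed
  {
    case (const c)
    have "(\<lambda>t Z. on_invertible (\<lambda>Z. c) (Z ** h t)) = (\<lambda>t. on_invertible (\<lambda>Z. c))"
      by (simp add: fun_eq_iff on_invertible_def iff)
    then show ?case using time_indep[OF laurent_algebra.const] by simp
  next
    case inverse_det
    have "(\<lambda>t Z. on_invertible (\<lambda>Z. inverse (det Z)) (Z ** h t)) = (\<lambda>t. on_invertible (\<lambda>Z. inverse (det Z)))"
      by (simp add: fun_eq_iff on_invertible_def iff)
    then show ?case using time_indep[OF laurent_algebra.inverse_det] by simp
  next
    case (coord j)
    have comb: "(\<lambda>t Z. c * on_invertible (\<lambda>Z. Z $ 1 $ 1) (Z ** h t) + d * on_invertible (\<lambda>Z. Z $ 1 $ 2) (Z ** h t)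
       + e * on_invertible (\<lambda>Z. Z $ 2 $ 1) (Z ** h t) + f * on_invertible (\<lambda>Z. Z $ 2 $ 2) (Z ** h t)) \<in> flow" for c d e f
      by (intro flow.plus flow_scale entry)
    have *: "(\<lambda>t Z. on_invertible F (Z ** h t)) \<in> flow" if "\<And>Z. F Z = c * Z$1$1 + d * Z$1$2 + e * Z$2$1 + f * Z$2$2" for F c d e f
    proof -
      have "(\<lambda>t Z. on_invertible F (Z ** h t)) = (\<lambda>t Z. c * on_invertible (\<lambda>Z. Z $ 1 $ 1) (Z ** h t) + d * on_invertible (\<lambda>Z. Z $ 1 $ 2) (Z ** h t)
       + e * on_invertible (\<lambda>Z. Z $ 2 $ 1) (Z ** h t) + f * on_invertible (\<lambda>Z. Z $ 2 $ 2) (Z ** h t))"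
        by (auto simp: fun_eq_iff on_invertible_def that)
      then show ?thesis using comb by simp
    qed
    show ?case using index4_cases[of j]
    proof (elim disjE)
      assume "j = 0" then show ?thesis by (intro *[of _ "1/2" 0 0 "1/2"]) (simp add: coords_nth field_simps)
    next
      assume "j = 1" then show ?thesis by (intro *[of _ 0 "\<i>/2" "\<i>/2" 0]) (simp add: coords_nth field_simps)
    next
      assume "j = 2" then show ?thesis by (intro *[of _ 0 "-1/2" "1/2" 0]) (simp add: coords_nth field_simps)
    next
      assume "j = 3" then show ?thesis by (intro *[of _ "\<i>/2" 0 0 "-\<i>/2"]) (simp add: coords_nth field_simps)
    qed
  next
    case (add p q) then show ?case using flow.plus by simp
  next
    case (mult p q) then show ?case using flow_mult by simp
  }
qed

lemma flow_integral:
  "P \<in> flow \<Longrightarrow> \<exists>D. (\<forall>Z. ((\<lambda>t. P t Z) has_vector_derivative D Z) (at 0)) \<and>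
    ((\<lambda>t. integral_S3 (P t)) has_vector_derivative integral_S3 D) (at 0) \<and> sphere_bounded D \<and> (\<forall>t. sphere_bounded (P t))"
proof (induction rule: flow.induct)
  case (base a a' p q)
  have b: "sphere_bounded (\<lambda>Z. c * (p Z * cnj (q Z)))" for c
    by (intro sphere_bounded_mult sphere_bounded_const sphere_bounded_cnj laurent_sphere_bounded base)
  have m: "((\<lambda>t. a t * w) has_vector_derivative a' * w) (at 0)" for w
    using has_vector_derivative_mult[OF base(1) has_vector_derivative_const[of w]] by simp
  show ?case
    by (intro exI[of _ "\<lambda>Z. a' * (p Z * cnj (q Z))"]) (simp add: m b integral_S3_cmult)
next
  case (plus P Q)
  then obtain D E where D: "\<forall>Z. ((\<lambda>t. P t Z) has_vector_derivative D Z) (at 0)"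
    "((\<lambda>t. integral_S3 (P t)) has_vector_derivative integral_S3 D) (at 0)" "sphere_bounded D" "\<forall>t. sphere_bounded (P t)"
    and E: "\<forall>Z. ((\<lambda>t. Q t Z) has_vector_derivative E Z) (at 0)"
    "((\<lambda>t. integral_S3 (Q t)) has_vector_derivative integral_S3 E) (at 0)" "sphere_bounded E" "\<forall>t. sphere_bounded (Q t)"
    by metis
  show ?case
  proof (intro exI[of _ "\<lambda>Z. D Z + E Z"] conjI allI)
    show "((\<lambda>t. integral_S3 (\<lambda>Z. P t Z + Q t Z)) has_vector_derivative integral_S3 (\<lambda>Z. D Z + E Z)) (at 0)"
      using has_vector_derivative_add[OF D(2) E(2)] D E by (simp add: integral_S3_add)
  qed (use D E in \<open>auto intro!: has_vector_derivative_add sphere_bounded_add\<close>)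
qed

text \<open>The vector fields generating right translations \<open>Z \<mapsto> Z h\<close>.\<close>

definition rop :: "2 \<Rightarrow> 2 \<Rightarrow> (hc \<Rightarrow> complex) \<Rightarrow> hc \<Rightarrow> complex" where
  "rop c d F Z = Z$1$c * partial 1 d F Z + Z$2$c * partial 2 d F Z"

definition rdir :: "hc \<Rightarrow> (hc \<Rightarrow> complex) \<Rightarrow> hc \<Rightarrow> complex" where
  "rdir \<xi> F Z = \<xi>$1$1 * rop 1 1 F Z + \<xi>$1$2 * rop 1 2 F Z + \<xi>$2$1 * rop 2 1 F Z + \<xi>$2$2 * rop 2 2 F Z"

text \<open>Right translation by a curve in \<open>SU(2)\<close> leaves the integral unchanged; the derivative at \<open>t = 0\<close> is
  computed by the chain rule.\<close>

lemma infinitesimal_invariance: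
  assumes h: "\<And>a b. ((\<lambda>t. h t $ a $ b) has_vector_derivative \<xi> $ a $ b) (at 0)" and det: "\<And>t. det (h t) = 1"
    and h0: "h 0 = mat 1" and q: "\<And>t. is_quat (h t)"
    and F: "F \<in> laurent_algebra" and G: "G \<in> laurent_algebra"
  shows "integral_S3 (\<lambda>Z. rdir \<xi> F Z * cnj (G Z) + F Z * cnj (rdir \<xi> G Z)) = 0"
proof -
  let ?P = "\<lambda>t Z. F (Z ** h t) * cnj (G (Z ** h t))"
  have "?P \<in> flow"
    by (intro flow_mult flow_cnj flow_laurent[OF h det] F G)
  from flow_integral[OF this] obtain D where D: "\<And>Z. ((\<lambda>t. ?P t Z) has_vector_derivative D Z) (at 0)"
    "((\<lambda>t. integral_S3 (?P t)) has_vector_derivative integral_S3 D) (at 0)" by blast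
  have "integral_S3 (?P t) = integral_S3 (\<lambda>Z. F Z * cnj (G Z))" for t
  proof (rule integral_S3_invariant[of "\<lambda>Z. Z ** h t" "\<lambda>Z. F Z * cnj (G Z)"])
    show "(A + B) ** h t = A ** h t + B ** h t" for A B :: hc
      by (rule hc_eqI) (simp_all add: matrix_mult_2 algebra_simps)
    show "(r *\<^sub>R A) ** h t = r *\<^sub>R (A ** h t)" for r and A :: hc
      by (rule hc_eqI) (simp_all add: matrix_mult_2 scaleR_right_distrib)
    show "is_quat (A ** h t)" if "is_quat A" for A
      using that q[of t] by (simp add: is_quat_def matrix_mult_2)
    show "det (A ** h t) = det A" for A by (simp add: det_mul det)
    show "sphere_bounded (\<lambda>Z. F Z * cnj (G Z))"
      by (intro sphere_bounded_mult sphere_bounded_cnj laurent_sphere_bounded F G)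
  qed
  then have "((\<lambda>t. integral_S3 (?P t)) has_vector_derivative 0) (at 0)" by simp
  then have I0: "integral_S3 D = 0" using D(2) vector_derivative_unique_at by blast
  have chain: "((\<lambda>t. K (Z ** h t)) has_vector_derivative rdir \<xi> K Z) (at 0)" if "K \<in> laurent_algebra" "det Z \<noteq> 0" for K Z
  proof -
    have "((\<lambda>t. Z ** h t) has_derivative (\<lambda>s. s *\<^sub>R (Z ** \<xi>))) (at 0)"
    proof (rule has_derivative_hcI)
      fix i j
      show "((\<lambda>t. (Z ** h t) $ i $ j) has_derivative (\<lambda>s. (s *\<^sub>R (Z ** \<xi>)) $ i $ j)) (at 0)"
        unfolding matrix_mult_2 using h[of 1 j] h[of 2 j] unfolding has_vector_derivative_def
        by (auto intro!: derivative_eq_intros simp: matrix_mult_2 algebra_simps)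
    qed
    moreover have "(K has_derivative (\<lambda>V. V$1$1 * partial 1 1 K Z + V$1$2 * partial 1 2 K Z + V$2$1 * partial 2 1 K Z + V$2$2 * partial 2 2 K Z)) (at (Z ** h 0))"
      using smoothD[OF laurent_smooth[OF that(1)] that(2)] by (simp add: has_cgrad_def h0)
    ultimately have "((\<lambda>t. K (Z ** h t)) has_derivative (\<lambda>s. s *\<^sub>R rdir \<xi> K Z)) (at 0)"
      by (rule has_derivative_eq_rhs[OF has_derivative_compose])
         (auto simp: fun_eq_iff rdir_def rop_def matrix_mult_2 algebra_simps)
    then show ?thesis by (simp add: has_vector_derivative_def)
  qed
  have "D Z = rdir \<xi> F Z * cnj (G Z) + F Z * cnj (rdir \<xi> G Z)" for Z
  proof (cases "det Z = 0")
    case True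
    have "(\<lambda>t. ?P t Z) = (\<lambda>t. 0)"
      using laurent_singular[OF F, of "Z ** h _"] True by (auto simp: fun_eq_iff det_mul)
    then have "D Z = 0" using D(1)[of Z] vector_derivative_unique_at[OF _ has_vector_derivative_const[of 0]] by metis
    then show ?thesis using True laurent_singular[OF F True] by (simp add: rdir_def rop_def)
  next
    case False
    have "((\<lambda>t. ?P t Z) has_vector_derivative (F (Z ** h 0) * cnj (rdir \<xi> G Z) + rdir \<xi> F Z * cnj (G (Z ** h 0)))) (at 0)"
      by (intro has_vector_derivative_mult has_vector_derivative_cnj chain F G False)
    from vector_derivative_unique_at[OF D(1) this] show ?thesis by (simp add: h0)
  qed
  then have "D = (\<lambda>Z. rdir \<xi> F Z * cnj (G Z) + F Z * cnj (rdir \<xi> G Z))" by auto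
  then show ?thesis using I0 by simp
qed

lemma rop_lmono:
  "rop 1 1 (lmono 0 k i b) = (\<lambda>Z. of_int b * lmono 0 k i b Z)"
  "0 \<le> b \<Longrightarrow> rop 1 2 (lmono 0 k i b) = (\<lambda>Z. of_int (k - b) * lmono 0 k i (b + 1) Z)"
  "b \<le> k \<Longrightarrow> rop 2 1 (lmono 0 k i b) = (\<lambda>Z. of_int b * lmono 0 k i (b - 1) Z)"
  "rop 2 2 (lmono 0 k i b) = (\<lambda>Z. of_int (k - b) * lmono 0 k i b Z)"
proof -
  have z: "rop c d F Z = 0" if "det Z = 0" for c d F Z using that by (simp add: rop_def)
  show "rop 1 1 (lmono 0 k i b) = (\<lambda>Z. of_int b * lmono 0 k i b Z)"
  proof
    fix Z show "rop 1 1 (lmono 0 k i b) Z = of_int b * lmono 0 k i b Z"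
      using tcoef_rec1'[of b Z k i] by (cases "det Z = 0") (simp_all add: z lmono_singular lmono_eq rop_def partial_lmono algebra_simps)
  qed
  show "rop 2 2 (lmono 0 k i b) = (\<lambda>Z. of_int (k - b) * lmono 0 k i b Z)"
  proof
    fix Z show "rop 2 2 (lmono 0 k i b) Z = of_int (k - b) * lmono 0 k i b Z"
    proof (cases "det Z = 0")
      case False
      show ?thesis unfolding rop_def partial_lmono lmono_eq[OF False] using tcoef_rec2'[of k b Z i] by (simp add: mult.left_commute distrib_left del: of_int_diff)
    qed (simp add: z lmono_singular)
  qed
  show "rop 1 2 (lmono 0 k i b) = (\<lambda>Z. of_int (k - b) * lmono 0 k i (b + 1) Z)" if "0 \<le> b"
  proof
    fix Z show "rop 1 2 (lmono 0 k i b) Z = of_int (k - b) * lmono 0 k i (b + 1) Z"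
    proof (cases "det Z = 0")
      case False
      have "b + 1 \<noteq> 0" using that by simp
      from tcoef_rec1_all[OF this, of Z k i, symmetric] show ?thesis
        unfolding rop_def partial_lmono lmono_eq[OF False] by (simp add: mult.left_commute distrib_left del: of_int_diff)
    qed (simp add: z lmono_singular)
  qed
  show "rop 2 1 (lmono 0 k i b) = (\<lambda>Z. of_int b * lmono 0 k i (b - 1) Z)" if "b \<le> k"
  proof
    fix Z show "rop 2 1 (lmono 0 k i b) Z = of_int b * lmono 0 k i (b - 1) Z"
    proof (cases "det Z = 0")
      case False
      have "b - 1 \<noteq> k" using that by simp
      from tcoef_rec2_all[OF this, of Z i, symmetric] show ?thesis
        unfolding rop_def partial_lmono lmono_eq[OF False] by (simp add: mult.left_commute distrib_left del: of_int_diff)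
    qed (simp add: z lmono_singular)
  qed
qed

definition gram :: "int \<Rightarrow> int \<Rightarrow> int \<Rightarrow> int \<Rightarrow> int \<Rightarrow> int \<Rightarrow> complex" where
  "gram k i b k' i' b' = integral_S3 (\<lambda>Z. lmono 0 k i b Z * cnj (lmono 0 k' i' b' Z))"

lemma sphere_bounded_prod: "p \<in> laurent_algebra \<Longrightarrow> q \<in> laurent_algebra \<Longrightarrow> sphere_bounded (\<lambda>Z. p Z * cnj (q Z))"
  by (intro sphere_bounded_mult sphere_bounded_cnj laurent_sphere_bounded)

lemma gram_cnj: "gram k' i' b' k i b = cnj (gram k i b k' i' b')"
  unfolding gram_def integral_S3_cnj[symmetric] by (simp add: mult.commute)

lemma gram_outside: "i < 0 \<or> i > k \<or> b < 0 \<or> b > k \<or> i' < 0 \<or> i' > k' \<or> b' < 0 \<or> b' > k' \<Longrightarrow> gram k i b k' i' b' = 0"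
  unfolding gram_def using lmono_outside[of i k b 0] lmono_outside[of i' k' b' 0] integral_S3_const[of 0] by auto

text \<open>Invariance under the diagonal torus of \<open>SU(2)\<close>, which separates the weights.\<close>

lemma gram_torus: "of_int (2 * b - k - (2 * b' - k')) * gram k i b k' i' b' = 0"
proof -
  let ?h = "\<lambda>t. mat2 (exp (\<i> * of_real t)) 0 0 (exp (- \<i> * of_real t))"
  let ?\<xi> = "mat2 \<i> 0 0 (- \<i>)"
  have e: "((\<lambda>t. exp (c * of_real t)) has_vector_derivative c) (at 0)" for c :: complex
    by (rule has_vector_derivative_real_field) (auto intro!: derivative_eq_intros)
  have "integral_S3 (\<lambda>Z. rdir ?\<xi> (lmono 0 k i b) Z * cnj (lmono 0 k' i' b' Z) + lmono 0 k i b Z * cnj (rdir ?\<xi> (lmono 0 k' i' b') Z)) = 0"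
  proof (rule infinitesimal_invariance[of ?h])
    show "((\<lambda>t. ?h t $ a $ c) has_vector_derivative ?\<xi> $ a $ c) (at 0)" for a c
      using exhaust_2_cases[of a] exhaust_2_cases[of c] e[of "\<i>"] e[of "-\<i>"] by (auto simp: has_vector_derivative_const)
    show "det (?h t) = 1" for t by (simp add: det_2 flip: exp_add)
    show "?h 0 = mat 1" by (rule hc_eqI) (simp_all add: mat_def)
    show "is_quat (?h t)" for t by (simp add: is_quat_def exp_cnj)
  qed (rule laurent_lmono)+
  also have "(\<lambda>Z. rdir ?\<xi> (lmono 0 k i b) Z * cnj (lmono 0 k' i' b' Z) + lmono 0 k i b Z * cnj (rdir ?\<xi> (lmono 0 k' i' b') Z))
     = (\<lambda>Z. (\<i> * of_int (2 * b - k - (2 * b' - k'))) * (lmono 0 k i b Z * cnj (lmono 0 k' i' b' Z)))"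
    by (rule ext) (simp add: rdir_def rop_lmono algebra_simps)
  finally show ?thesis unfolding integral_S3_cmult gram_def by simp
qed

lemma gram_weight: "gram k i b k' i' b' \<noteq> 0 \<Longrightarrow> 2 * b - k = 2 * b' - k'"
  using gram_torus[of b k b' k' i i'] unfolding mult_eq_0_iff of_int_eq_0_iff by simp

text \<open>Invariance under real rotations. After separation of the weights, the four terms reduce to the two
  of the next lemma.\<close>

lemma gram_rotation:
  assumes b: "0 \<le> b" "b \<le> k" "0 \<le> b'" "b' \<le> k'"
  shows "of_int (k - b) * gram k i (b + 1) k' i' b' - of_int b * gram k i (b - 1) k' i' b'
     + of_int (k' - b') * gram k i b k' i' (b' + 1) - of_int b' * gram k i b k' i' (b' - 1) = 0"
proof -
  let ?h = "\<lambda>t. mat2 (cos (of_real t)) (sin (of_real t)) (- sin (of_real t)) (cos (of_real t))"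
  let ?\<xi> = "mat2 0 1 (- 1) 0"
  have e: "((\<lambda>t. cos (of_real t) :: complex) has_vector_derivative 0) (at 0)"
    by (rule has_vector_derivative_real_field) (auto intro!: derivative_eq_intros)
  have f: "((\<lambda>t. sin (of_real t) :: complex) has_vector_derivative 1) (at 0)"
    by (rule has_vector_derivative_real_field) (auto intro!: derivative_eq_intros)
  have g: "((\<lambda>t. - sin (of_real t) :: complex) has_vector_derivative -1) (at 0)"
    by (rule has_vector_derivative_minus[OF f])
  have "integral_S3 (\<lambda>Z. rdir ?\<xi> (lmono 0 k i b) Z * cnj (lmono 0 k' i' b' Z) + lmono 0 k i b Z * cnj (rdir ?\<xi> (lmono 0 k' i' b') Z)) = 0"
  proof (rule infinitesimal_invariance[of ?h])
    show "((\<lambda>t. ?h t $ a $ c) has_vector_derivative ?\<xi> $ a $ c) (at 0)" for a c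
      using exhaust_2_cases[of a] exhaust_2_cases[of c] e f g by auto
    show "det (?h t) = 1" for t 
      using sin_cos_squared_add[of "complex_of_real t"] by (simp add: det_2 power2_eq_square add.commute)
    show "?h 0 = mat 1" by (rule hc_eqI) (simp_all add: mat_def)
    show "is_quat (?h t)" for t unfolding is_quat_def mat2_nth cos_of_real sin_of_real by simp
  qed (rule laurent_lmono)+
  also have "(\<lambda>Z. rdir ?\<xi> (lmono 0 k i b) Z * cnj (lmono 0 k' i' b' Z) + lmono 0 k i b Z * cnj (rdir ?\<xi> (lmono 0 k' i' b') Z))
     = (\<lambda>Z. (of_int (k - b) * (lmono 0 k i (b + 1) Z * cnj (lmono 0 k' i' b' Z)) + - of_int b * (lmono 0 k i (b - 1) Z * cnj (lmono 0 k' i' b' Z)))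
        + (of_int (k' - b') * (lmono 0 k i b Z * cnj (lmono 0 k' i' (b' + 1) Z)) + - of_int b' * (lmono 0 k i b Z * cnj (lmono 0 k' i' (b' - 1) Z))))"
    by (rule ext) (simp add: rdir_def rop_lmono b algebra_simps)
  also have "integral_S3 \<dots> = (of_int (k - b) * gram k i (b + 1) k' i' b' + - of_int b * gram k i (b - 1) k' i' b')
     + (of_int (k' - b') * gram k i b k' i' (b' + 1) + - of_int b' * gram k i b k' i' (b' - 1))"
  proof -
    have sb: "sphere_bounded (\<lambda>Z. c * (lmono 0 k i x Z * cnj (lmono 0 k' i' y Z)))" for c x y
      by (intro sphere_bounded_mult sphere_bounded_const sphere_bounded_prod laurent_lmono)
    show ?thesis
      unfolding integral_S3_add[OF sphere_bounded_add[OF sb sb] sphere_bounded_add[OF sb sb]] integral_S3_add[OF sb sb]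
        integral_S3_cmult gram_def[symmetric] ..
  qed
  finally show ?thesis by (simp only: add.assoc diff_conv_add_uminus mult_minus_left)
qed

lemma gram_step:
  assumes b: "0 \<le> b" "b \<le> k" "0 \<le> b'" "b' \<le> k'" and w: "2 * b + 2 - k = 2 * b' - k'"
  shows "of_int (k - b) * gram k i (b + 1) k' i' b' = of_int b' * gram k i b k' i' (b' - 1)"
proof -
  have "gram k i (b - 1) k' i' b' = 0" "gram k i b k' i' (b' + 1) = 0"
    using gram_weight[of k i "b - 1" k' i' b'] gram_weight[of k i b k' i' "b' + 1"] w by fastforce+
  then show ?thesis using gram_rotation[OF b, of i i'] by simp
qed

lemma integral_S3_sesq: "integral_S3 (\<lambda>Z. (c * F Z) * cnj (d * G Z)) = c * cnj d * integral_S3 (\<lambda>Z. F Z * cnj (G Z))"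
  unfolding integral_S3_cmult[symmetric] by (simp add: mult_ac)

lemma gram_transpose:
  "of_nat (nat k choose nat b) * of_nat (nat k' choose nat b') * gram k i b k' i' b'
   = of_nat (nat k choose nat i) * of_nat (nat k' choose nat i') * gram k b i k' b' i'"
proof -
  have t: "of_nat (nat k choose nat b) * lmono 0 k i b (transpose Z) = of_nat (nat k choose nat i) * lmono 0 k b i Z" for k i b Z
    using tcoef_transpose[of k b i Z] by (cases "det Z = 0") (simp_all add: lmono_def on_invertible_def)
  have "integral_S3 (\<lambda>Z. lmono 0 k i b (transpose Z) * cnj (lmono 0 k' i' b' (transpose Z))) = gram k i b k' i' b'"
    unfolding gram_def
    by (rule integral_S3_invariant[of transpose "\<lambda>Z. lmono 0 k i b Z * cnj (lmono 0 k' i' b' Z)"])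
       (auto simp: transpose_def vec_eq_iff is_quat_def det_2 sphere_bounded_prod laurent_lmono)
  then have "of_nat (nat k choose nat b) * of_nat (nat k' choose nat b') * gram k i b k' i' b'
    = integral_S3 (\<lambda>Z. (of_nat (nat k choose nat b) * lmono 0 k i b (transpose Z)) * cnj (of_nat (nat k' choose nat b') * lmono 0 k' i' b' (transpose Z)))"
    unfolding integral_S3_sesq by simp
  also have "\<dots> = of_nat (nat k choose nat i) * of_nat (nat k' choose nat i') * gram k b i k' b' i'"
    unfolding t gram_def integral_S3_sesq by simp
  finally show ?thesis .
qed

text \<open>Schur orthogonality for representations of different dimension, by an elementary argument: the
  relation between neighbouring weights is followed to the end of the shorter weight string, where
  one of its coefficients vanishes.\<close>

lemma gram_degree:
  assumes "k \<noteq> k'"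
  shows "gram k i b k' i' b' = 0"
proof -
  have lt: "gram k i b k' i' b' = 0" if "k < k'" for k i b k' i' b'
  proof (rule ccontr)
    assume n: "gram k i b k' i' b' \<noteq> 0"
    have "gram k i b k' i' b' = 0" if "2 * b - k = 2 * b' - k'" "0 \<le> b" "b \<le> k" "0 \<le> b'" "b' \<le> k'" "nat (k - b) = n" for n b b'
      using that
    proof (induction n arbitrary: b b')
      case 0
      then have "b = k" by simp
      then have "of_int (b' + 1) * gram k i b k' i' b' = 0"
        using gram_step[of b k "b' + 1" k' i i'] 0 \<open>k < k'\<close> by simp
      moreover have "of_int (b' + 1) \<noteq> (0::complex)" unfolding of_int_eq_0_iff using 0 by linarith
      ultimately show ?case by simp
    next
      case (Suc n)
      have 1: "gram k i (b + 1) k' i' (b' + 1) = 0"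
        using Suc.prems \<open>k < k'\<close> by (intro Suc.IH) auto
      have "of_int (b' + 1) * gram k i b k' i' b' = 0"
        using gram_step[of b k "b' + 1" k' i i'] Suc.prems \<open>k < k'\<close> 1 by simp
      moreover have "of_int (b' + 1) \<noteq> (0::complex)" unfolding of_int_eq_0_iff using Suc.prems(4) by linarith
      ultimately show ?case by simp
    qed
    moreover have "0 \<le> b" "b \<le> k" "0 \<le> b'" "b' \<le> k'"
      using n gram_outside[of i k b i' k' b'] by (meson not_le)+
    ultimately show False using gram_weight[OF n] n by blast
  qed
  show ?thesis using lt[of k k' i b i' b'] lt[of k' k i' b' i b] gram_cnj[of k i b k' i' b'] assms
    by (cases "k < k'") auto
qed

text \<open>Within one representation the norms are determined by the norm of the lowest weight vector.\<close>

lemma gram_diag: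
  assumes "0 \<le> b" "b \<le> k"
  shows "of_nat (nat k choose nat b) * gram k i b k i b = gram k i 0 k i 0"
proof -
  have "of_nat (nat k choose n) * gram k i (int n) k i (int n) = gram k i 0 k i 0" if "int n \<le> k" for n
    using that
  proof (induction n)
    case (Suc n)
    have s: "of_int (k - int n) * gram k i (int n + 1) k i (int n + 1) = of_int (int n + 1) * gram k i (int n) k i (int n)"
      using gram_step[of "int n" k "int n + 1" k i i] Suc.prems by simp
    have "Suc n * (nat k choose Suc n) = (nat k - n) * (nat k choose n)"
      using binomial_absorb_comp[of "nat k" n] binomial_absorption[of n "nat k"] by simp
    then have "of_nat (Suc n * (nat k choose Suc n)) = (of_nat ((nat k - n) * (nat k choose n)) :: complex)"
      by (rule arg_cong)
    moreover have "of_nat (nat k - n) = (of_int (k - int n) :: complex)"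
      using Suc.prems by (simp add: of_nat_diff)
    ultimately have c: "of_nat (Suc n) * of_nat (nat k choose Suc n) = (of_int (k - int n) * of_nat (nat k choose n) :: complex)"
      by (simp only: of_nat_mult)
    have e: "of_int (int n + 1) = (of_nat (Suc n) :: complex)" "int (Suc n) = int n + 1" by simp_all
    have IH: "of_nat (nat k choose n) * gram k i (int n) k i (int n) = gram k i 0 k i 0"
      using Suc by simp
    have "of_nat (Suc n) * (of_nat (nat k choose Suc n) * gram k i (int n + 1) k i (int n + 1))
        = of_nat (Suc n) * gram k i 0 k i 0"
      unfolding IH[symmetric] using c s[unfolded e(1)] by algebra
    then show ?case unfolding e(2) by (simp only: mult_cancel_left of_nat_eq_0_iff nat.distinct simp_thms)
  qed simp
  from this[of "nat b"] assms show ?thesis by simp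
qed

text \<open>The normalization. On the sphere the squares of the entries of a row of the representation matrix,
  weighted by binomial coefficients, add up to \<open>(|x\<^sub>2\<^sub>1|\<^sup>2 + |x\<^sub>2\<^sub>2|\<^sup>2)\<^sup>k = 1\<close>, and the \<open>k + 1\<close> summands have
  equal integrals.\<close>

lemma gram_norm:
  assumes "0 \<le> k"
  shows "of_int (k + 1) * gram k 0 0 k 0 0 = 2 * (of_real pi)\<^sup>2"
proof -
  define n where "n = nat k"
  have k: "k = int n" using assms by (simp add: n_def)
  let ?F = "\<lambda>b Z. of_nat (n choose b) * (lmono 0 k 0 (int b) Z * cnj (lmono 0 k 0 (int b) Z))"
  have sb: "sphere_bounded (?F b)" for b
    by (intro sphere_bounded_mult sphere_bounded_const sphere_bounded_prod laurent_lmono)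
  have sum: "integral_S3 (\<lambda>Z. \<Sum>b\<in>B. ?F b Z) = (\<Sum>b\<in>B. integral_S3 (?F b)) \<and> sphere_bounded (\<lambda>Z. \<Sum>b\<in>B. ?F b Z)" if "finite B" for B
    using that
  proof induction
    case empty then show ?case using integral_S3_const[of 0] sphere_bounded_const[of 0] by simp
  next
    case (insert b B) 
    then show ?case using sb[of b] by (simp add: integral_S3_add sphere_bounded_add)
  qed
  \<comment> \<open>the binomial theorem for the squared entries of the second row\<close>
  have val: "(\<Sum>b\<le>n. ?F b X) = 1" if X: "is_quat X" "det X = 1" for X
  proof -
    have d: "det X \<noteq> 0" using X by simp
    have t: "lmono 0 k 0 (int b) X = X$2$1 ^ b * X$2$2 ^ (n - b)" if "b \<le> n" for b
    proof -
      have "nat (int n - int b) = n - b" by linarith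
      then show ?thesis
        unfolding lmono_eq[OF d] tcoef_def k using that by (simp add: coeff_mult coeff_0_power)
    qed
    have "(\<Sum>b\<le>n. ?F b X) = (\<Sum>b\<le>n. of_nat (n choose b) * (X$2$1 * cnj (X$2$1)) ^ b * (X$2$2 * cnj (X$2$2)) ^ (n - b))"
      by (rule sum.cong) (simp_all add: t power_mult_distrib mult_ac)
    also have "\<dots> = (X$2$1 * cnj (X$2$1) + X$2$2 * cnj (X$2$2)) ^ n"
      by (simp add: binomial_ring)
    also have "X$2$1 * cnj (X$2$1) + X$2$2 * cnj (X$2$2) = 1"
      using X by (simp add: is_quat_def det_2 mult.commute add.commute)
    finally show ?thesis by simp
  qed
  have "(\<Sum>b\<le>n. integral_S3 (?F b)) = integral_S3 (\<lambda>Z. \<Sum>b\<le>n. ?F b Z)" using sum[of "{..n}"] by simp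
  also have "\<dots> = integral_S3 (\<lambda>Z. 1)"
    by (rule integral_S3_cong) (use sum[of "{..n}"] val sphere_bounded_const in auto)
  also have "\<dots> = 2 * (of_real pi)\<^sup>2" using integral_S3_const[of 1] by simp
  also have "(\<Sum>b\<le>n. integral_S3 (?F b)) = (\<Sum>b\<le>n. gram k 0 0 k 0 0)"
  proof (rule sum.cong)
    fix b assume "b \<in> {..n}"
    then show "integral_S3 (?F b) = gram k 0 0 k 0 0"
      using gram_diag[of "int b" k 0] unfolding integral_S3_cmult gram_def[symmetric] by (simp add: k)
  qed simp
  also have "\<dots> = of_int (k + 1) * gram k 0 0 k 0 0" by (simp add: k)
  finally show ?thesis .
qed

text \<open>Orthogonality in the second column index follows from the weights of right translations;
  transposition gives the same for the row index.\<close>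

theorem gram_orthogonal:
  assumes "0 \<le> i" "i \<le> k" "0 \<le> b" "b \<le> k"
  shows "of_int (k + 1) * gram k i b k' i' b' =
    (if k' = k \<and> i' = i \<and> b' = b then 2 * (of_real pi)\<^sup>2 * of_nat (nat k choose nat i) / of_nat (nat k choose nat b) else 0)"
proof (cases "gram k i b k' i' b' = 0 \<or> \<not> (0 \<le> i' \<and> i' \<le> k' \<and> 0 \<le> b' \<and> b' \<le> k')")
  case False
  have pos: "of_nat (nat k choose nat j) \<noteq> (0 :: complex)" if "0 \<le> j" "j \<le> k" for j k
    using that by (simp add: binomial_eq_0_iff)
  have k: "k' = k" using gram_degree False by metis
  have b: "b' = b" using gram_weight[of k i b k' i' b'] False k by auto
  have "gram k b i k' b' i' \<noteq> 0"
    using gram_transpose[of k b k' b' i i'] False assms pos by auto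
  then have i: "i' = i" using gram_weight[of k b i k' b' i'] k by auto
  have 1: "of_nat (nat k choose nat b) * gram k i b k i b = gram k i 0 k i 0" by (rule gram_diag) fact+
  have 2: "gram k i 0 k i 0 = of_nat (nat k choose nat i) * of_nat (nat k choose nat i) * gram k 0 i k 0 i"
    using gram_transpose[of k 0 k 0 i i] by simp
  have 3: "of_nat (nat k choose nat i) * gram k 0 i k 0 i = gram k 0 0 k 0 0" by (rule gram_diag) fact+
  have 4: "of_int (k + 1) * gram k 0 0 k 0 0 = 2 * (of_real pi)\<^sup>2" by (rule gram_norm) (use assms in linarith)
  have "of_nat (nat k choose nat b) * (of_int (k + 1) * gram k i b k i b) = 2 * (of_real pi)\<^sup>2 * of_nat (nat k choose nat i)"
    using 1 2 3 4 by algebra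
  then show ?thesis using i b k pos[OF assms(3,4)] by (simp add: field_simps)
next
  case True
  then have z: "gram k i b k' i' b' = 0" using gram_outside by (metis not_le)
  have "gram k i b k i b \<noteq> 0"
  proof
    assume g: "gram k i b k i b = 0"
    have 1: "of_nat (nat k choose nat b) * gram k i b k i b = gram k i 0 k i 0" by (rule gram_diag) fact+
    have 2: "gram k i 0 k i 0 = of_nat (nat k choose nat i) * of_nat (nat k choose nat i) * gram k 0 i k 0 i"
      using gram_transpose[of k 0 k 0 i i] by simp
    have 3: "of_nat (nat k choose nat i) * gram k 0 i k 0 i = gram k 0 0 k 0 0" by (rule gram_diag) fact+
    have "of_nat (nat k choose nat i) * gram k 0 0 k 0 0 = 0" using 1 2 3 g by algebra
    then have "gram k 0 0 k 0 0 = 0" using assms by (simp add: binomial_eq_0_iff)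
    then show False using gram_norm[of k] assms by simp
  qed
  then show ?thesis using z by auto
qed

section \<open>The unitary structure on scalar harmonic polynomials\<close>

definition hpoly :: "(hc \<Rightarrow> complex) set" where
  "hpoly = lin_span {lmono 0 k i b |k i b. 0 \<le> i \<and> i \<le> k \<and> 0 \<le> b \<and> b \<le> k}"

lemma hpoly_add: "p \<in> hpoly \<Longrightarrow> q \<in> hpoly \<Longrightarrow> (\<lambda>Z. p Z + q Z) \<in> hpoly"
  unfolding hpoly_def by (rule lin_span.plus)

lemma hpoly_scale: "p \<in> hpoly \<Longrightarrow> (\<lambda>Z. c * p Z) \<in> hpoly"
  unfolding hpoly_def by (rule lin_span_scale)

lemma hpoly_lmono: "lmono 0 k i b \<in> hpoly"
proof (cases "0 \<le> i \<and> i \<le> k \<and> 0 \<le> b \<and> b \<le> k")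
  case True
  then have "lmono 0 k i b \<in> {lmono 0 k i b |k i b. 0 \<le> i \<and> i \<le> k \<and> 0 \<le> b \<and> b \<le> k}" by blast
  then show ?thesis unfolding hpoly_def by (rule lin_span_in)
next
  case False
  have "lmono 0 0 0 0 \<in> {lmono 0 k i b |k i b. 0 \<le> i \<and> i \<le> k \<and> 0 \<le> b \<and> b \<le> k}" by force
  then have "(\<lambda>Z. 0 * lmono 0 0 0 0 Z) \<in> hpoly" unfolding hpoly_def by (rule lin_span.base)
  moreover have "lmono 0 k i b = (\<lambda>Z. 0 * lmono 0 0 0 0 Z)" using lmono_outside[of i k b 0] False by auto
  ultimately show ?thesis by simp
qed

lemma hpoly_zero: "(\<lambda>Z. 0) \<in> hpoly"
  using hpoly_scale[OF hpoly_lmono, of 0] by simp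

lemma hpoly_uminus: "p \<in> hpoly \<Longrightarrow> (\<lambda>Z. - p Z) \<in> hpoly"
  using hpoly_scale[of p "-1"] by simp

lemma hpoly_induct [consumes 1, case_names mono add]:
  assumes "p \<in> hpoly"
    and mono: "\<And>c k i b. 0 \<le> i \<Longrightarrow> i \<le> k \<Longrightarrow> 0 \<le> b \<Longrightarrow> b \<le> k \<Longrightarrow> P (\<lambda>Z. c * lmono 0 k i b Z)"
    and add: "\<And>p q. p \<in> hpoly \<Longrightarrow> q \<in> hpoly \<Longrightarrow> P p \<Longrightarrow> P q \<Longrightarrow> P (\<lambda>Z. p Z + q Z)"
  shows "P p"
  using assms(1) unfolding hpoly_def
proof induction
  case (base x c)
  then show ?case using mono by blast
next
  case (plus p q)
  then show ?case using add unfolding hpoly_def by blast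
qed

lemma hpoly_laurent: "p \<in> hpoly \<Longrightarrow> p \<in> laurent_algebra"
  by (induction rule: hpoly_induct) (auto intro: laurent_scale laurent_lmono laurent_algebra.add)

lemma hpoly_smooth: "p \<in> hpoly \<Longrightarrow> smooth p"
  using hpoly_laurent laurent_smooth by blast

lemma hpoly_harmonic: "p \<in> hpoly \<Longrightarrow> lap p Z = 0"
  by (induction rule: hpoly_induct) (simp_all add: lap_scale laurent_lmono lap_lmono lap_add hpoly_laurent)

subsection \<open>The scalar conformal Lie algebra\<close>

definition linear_op :: "((hc \<Rightarrow> complex) \<Rightarrow> hc \<Rightarrow> complex) \<Rightarrow> bool" where
  "linear_op T \<longleftrightarrow> (\<forall>p\<in>hpoly. \<forall>q\<in>hpoly. T (\<lambda>Z. p Z + q Z) = (\<lambda>Z. T p Z + T q Z)) \<and>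
     (\<forall>p\<in>hpoly. \<forall>c. T (\<lambda>Z. c * p Z) = (\<lambda>Z. c * T p Z)) \<and> (\<forall>p\<in>hpoly. T p \<in> hpoly)"

lemma linear_opI:
  assumes "\<And>p q. p \<in> hpoly \<Longrightarrow> q \<in> hpoly \<Longrightarrow> T (\<lambda>Z. p Z + q Z) = (\<lambda>Z. T p Z + T q Z)"
    and "\<And>p c. p \<in> hpoly \<Longrightarrow> T (\<lambda>Z. c * p Z) = (\<lambda>Z. c * T p Z)"
    and "\<And>k i b. 0 \<le> i \<Longrightarrow> i \<le> k \<Longrightarrow> 0 \<le> b \<Longrightarrow> b \<le> k \<Longrightarrow> T (lmono 0 k i b) \<in> hpoly"
  shows "linear_op T"
proof -
  have "T p \<in> hpoly" if "p \<in> hpoly" for p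
    using that by (induction rule: hpoly_induct) (simp_all add: assms hpoly_lmono hpoly_scale hpoly_add)
  then show ?thesis unfolding linear_op_def using assms by blast
qed

lemma linear_op_add: "linear_op T \<Longrightarrow> p \<in> hpoly \<Longrightarrow> q \<in> hpoly \<Longrightarrow> T (\<lambda>Z. p Z + q Z) = (\<lambda>Z. T p Z + T q Z)"
  and linear_op_scale: "linear_op T \<Longrightarrow> p \<in> hpoly \<Longrightarrow> T (\<lambda>Z. c * p Z) = (\<lambda>Z. c * T p Z)"
  and linear_op_in: "linear_op T \<Longrightarrow> p \<in> hpoly \<Longrightarrow> T p \<in> hpoly"
  unfolding linear_op_def by blast+

text \<open>Together with \<open>partial\<close> and \<open>rop\<close>, the operators \<open>lop\<close> and \<open>kop\<close> form the differential of
  the scalar representation \<open>F \<mapsto> N(a' - Z c')\<^sup>-\<^sup>1 F((a' - Z c')\<^sup>-\<^sup>1 (- b' + Z d'))\<close>: the left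
  translations, shifted by the multiplier, and the special conformal transformations.\<close>

definition lop :: "2 \<Rightarrow> 2 \<Rightarrow> (hc \<Rightarrow> complex) \<Rightarrow> hc \<Rightarrow> complex" where
  "lop a b F Z = (if a = b then F Z else 0) + Z$b$1 * partial a 1 F Z + Z$b$2 * partial a 2 F Z"

definition kop :: "2 \<Rightarrow> 2 \<Rightarrow> (hc \<Rightarrow> complex) \<Rightarrow> hc \<Rightarrow> complex" where
  "kop a b F Z = Z$b$a * F Z + Z$b$1 * rop a 1 F Z + Z$b$2 * rop a 2 F Z"

lemma partial_lmono0:
  "partial 1 1 (lmono 0 k i b) = (\<lambda>Z. of_int b * lmono 0 (k - 1) (i - 1) (b - 1) Z)"
  "partial 1 2 (lmono 0 k i b) = (\<lambda>Z. of_int (k - b) * lmono 0 (k - 1) (i - 1) b Z)"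
  "partial 2 1 (lmono 0 k i b) = (\<lambda>Z. of_int b * lmono 0 (k - 1) i (b - 1) Z)"
  "partial 2 2 (lmono 0 k i b) = (\<lambda>Z. of_int (k - b) * lmono 0 (k - 1) i b Z)"
  by (simp_all add: partial_lmono)

lemma lop_lmono:
  "lop 1 1 (lmono 0 k i b) = (\<lambda>Z. of_int (i + 1) * lmono 0 k i b Z)"
  "lop 1 2 (lmono 0 k i b) = (\<lambda>Z. of_int (k - i + 1) * lmono 0 k (i - 1) b Z)"
  "lop 2 1 (lmono 0 k i b) = (\<lambda>Z. of_int (i + 1) * lmono 0 k (i + 1) b Z)"
  "lop 2 2 (lmono 0 k i b) = (\<lambda>Z. of_int (k - i + 1) * lmono 0 k i b Z)"
proof -
  have n: "(1::2) \<noteq> 2" "(2::2) \<noteq> 1" by simp_all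
  show "lop 1 1 (lmono 0 k i b) = (\<lambda>Z. of_int (i + 1) * lmono 0 k i b Z)"
  proof
    fix Z show "lop 1 1 (lmono 0 k i b) Z = of_int (i + 1) * lmono 0 k i b Z"
      using lmono_lower[of b Z 0 k "i - 1"] unfolding lop_def partial_lmono0 diff_add_cancel of_int_add of_int_1 if_P[OF refl] by algebra
  qed
  show "lop 1 2 (lmono 0 k i b) = (\<lambda>Z. of_int (k - i + 1) * lmono 0 k (i - 1) b Z)"
  proof
    fix Z 
    have e: "k - i + 1 = k - (i - 1)" by simp
    show "lop 1 2 (lmono 0 k i b) Z = of_int (k - i + 1) * lmono 0 k (i - 1) b Z"
      using lmono_raise[of b Z 0 k "i - 1"] unfolding lop_def partial_lmono0 e if_not_P[OF n(1)] by algebra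
  qed
  show "lop 2 1 (lmono 0 k i b) = (\<lambda>Z. of_int (i + 1) * lmono 0 k (i + 1) b Z)"
  proof
    fix Z show "lop 2 1 (lmono 0 k i b) Z = of_int (i + 1) * lmono 0 k (i + 1) b Z"
      using lmono_lower[of b Z 0 k i] unfolding lop_def partial_lmono0 if_not_P[OF n(2)] by algebra
  qed
  show "lop 2 2 (lmono 0 k i b) = (\<lambda>Z. of_int (k - i + 1) * lmono 0 k i b Z)"
  proof
    fix Z show "lop 2 2 (lmono 0 k i b) Z = of_int (k - i + 1) * lmono 0 k i b Z"
      using lmono_raise[of b Z 0 k i] unfolding lop_def partial_lmono0 of_int_add of_int_1 if_P[OF refl] by algebra
  qed
qed

text \<open>Multiplication by a matrix entry does not preserve harmonicity; the first order term of the special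
  conformal operators is what corrects this.\<close>

lemma kop_lmono:
  assumes b: "0 \<le> b" "b \<le> k"
  shows "kop 1 1 (lmono 0 k i b) = (\<lambda>Z. of_int (i + 1) * lmono 0 (k + 1) (i + 1) (b + 1) Z)"
  "kop 1 2 (lmono 0 k i b) = (\<lambda>Z. of_int (k + 1 - i) * lmono 0 (k + 1) i (b + 1) Z)"
  "kop 2 1 (lmono 0 k i b) = (\<lambda>Z. of_int (i + 1) * lmono 0 (k + 1) (i + 1) b Z)"
  "kop 2 2 (lmono 0 k i b) = (\<lambda>Z. of_int (k + 1 - i) * lmono 0 (k + 1) i b Z)"
proof -
  have e: "k + 1 - 1 = k" "b + 1 - 1 = b" "k + 1 - (b + 1) = k - b" by simp_all
  note l = lmono_lower[of "b + 1" _ 0 "k + 1" i, unfolded e] lmono_lower[of b _ 0 "k + 1" i, unfolded e]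
    lmono_raise[of "b + 1" _ 0 "k + 1" i, unfolded e] lmono_raise[of b _ 0 "k + 1" i, unfolded e]
  note s = kop_def rop_lmono(1)[of k i b] rop_lmono(2)[OF b(1), of k i] rop_lmono(3)[OF b(2), of i] rop_lmono(4)[of k i b]
  show "kop 1 1 (lmono 0 k i b) = (\<lambda>Z. of_int (i + 1) * lmono 0 (k + 1) (i + 1) (b + 1) Z)"
    unfolding fun_eq_iff s l(1)[symmetric] by (simp add: algebra_simps)
  show "kop 1 2 (lmono 0 k i b) = (\<lambda>Z. of_int (k + 1 - i) * lmono 0 (k + 1) i (b + 1) Z)"
    unfolding fun_eq_iff s l(3)[symmetric] by (simp add: algebra_simps)
  show "kop 2 1 (lmono 0 k i b) = (\<lambda>Z. of_int (i + 1) * lmono 0 (k + 1) (i + 1) b Z)"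
    unfolding fun_eq_iff s l(2)[symmetric] by (simp add: algebra_simps)
  show "kop 2 2 (lmono 0 k i b) = (\<lambda>Z. of_int (k + 1 - i) * lmono 0 (k + 1) i b Z)"
    unfolding fun_eq_iff s l(4)[symmetric] by (simp add: algebra_simps)
qed

lemma linear_op_partial: "linear_op (partial a b)"
  by (rule linear_opI)
     (use exhaust_2_cases[of a] exhaust_2_cases[of b] in \<open>auto simp: partial_add partial_cmult hpoly_smooth partial_lmono0 hpoly_scale hpoly_lmono simp del: of_int_diff\<close>)

lemma linear_op_rop: "linear_op (rop a b)"
proof (rule linear_opI)
  show "rop a b (lmono 0 k i b') \<in> hpoly" if "0 \<le> b'" "b' \<le> k" for k i b'
    using exhaust_2_cases[of a] exhaust_2_cases[of b] that
    by (auto simp: rop_lmono hpoly_scale hpoly_lmono simp del: of_int_diff)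
qed (auto simp: rop_def fun_eq_iff partial_add partial_cmult hpoly_smooth algebra_simps)

lemma linear_op_lop: "linear_op (lop a b)"
proof (rule linear_opI)
  show "lop a b (lmono 0 k i b') \<in> hpoly" for k i b'
    using exhaust_2_cases[of a] exhaust_2_cases[of b]
    by (auto simp: lop_lmono hpoly_scale hpoly_lmono simp del: of_int_diff of_int_add)
qed (auto simp: lop_def fun_eq_iff partial_add partial_cmult hpoly_smooth algebra_simps)

lemma linear_op_kop: "linear_op (kop a b)"
proof (rule linear_opI)
  show "kop a b (lmono 0 k i b') \<in> hpoly" if "0 \<le> b'" "b' \<le> k" for k i b'
    using exhaust_2_cases[of a] exhaust_2_cases[of b] that
    by (auto simp: kop_lmono hpoly_scale hpoly_lmono simp del: of_int_diff of_int_add)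
qed (auto simp: kop_def rop_def fun_eq_iff partial_add partial_cmult hpoly_smooth algebra_simps)

text \<open>The factor \<open>k + 1\<close> on degree \<open>k\<close> is produced by \<open>1\<close> plus the Euler operator. With it the special
  conformal operators become adjoint to the partial derivatives.\<close>

definition hform :: "(hc \<Rightarrow> complex) \<Rightarrow> (hc \<Rightarrow> complex) \<Rightarrow> complex" where
  "hform p q = 1 / (2 * (of_real pi)\<^sup>2) * integral_S3 (\<lambda>Z. (p Z + euler p Z) * cnj (q Z))"

lemma euler_laurent: "p \<in> laurent_algebra \<Longrightarrow> euler p \<in> laurent_algebra"
proof -
  assume p: "p \<in> laurent_algebra"
  have "(\<lambda>Z. Z$1$1 * partial 1 1 p Z + Z$1$2 * partial 1 2 p Z + Z$2$1 * partial 2 1 p Z + Z$2$2 * partial 2 2 p Z) \<in> laurent_algebra"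
    by (intro laurent_algebra.add laurent_entry_mult laurent_partial p)
  then show ?thesis by (simp add: euler_def[abs_def])
qed

lemma euler_shift_laurent: "p \<in> hpoly \<Longrightarrow> (\<lambda>Z. p Z + euler p Z) \<in> laurent_algebra"
  by (intro laurent_algebra.add euler_laurent hpoly_laurent)

lemma hform_add_left:
  assumes "p \<in> hpoly" "q \<in> hpoly" "r \<in> hpoly"
  shows "hform (\<lambda>Z. p Z + q Z) r = hform p r + hform q r"
proof -
  have "(\<lambda>Z. ((p Z + q Z) + euler (\<lambda>Z. p Z + q Z) Z) * cnj (r Z))
    = (\<lambda>Z. (p Z + euler p Z) * cnj (r Z) + (q Z + euler q Z) * cnj (r Z))"
    using assms by (simp add: fun_eq_iff euler_def partial_add hpoly_smooth algebra_simps)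
  then show ?thesis
    unfolding hform_def using assms
    by (simp add: integral_S3_add sphere_bounded_prod euler_shift_laurent hpoly_laurent distrib_left)
qed

lemma hform_add_right:
  assumes "p \<in> hpoly" "q \<in> hpoly" "r \<in> hpoly"
  shows "hform r (\<lambda>Z. p Z + q Z) = hform r p + hform r q"
  unfolding hform_def using assms
  by (simp add: integral_S3_add sphere_bounded_prod euler_shift_laurent hpoly_laurent distrib_left)

lemma hform_scale_left:
  assumes "p \<in> hpoly"
  shows "hform (\<lambda>Z. c * p Z) r = c * hform p r"
proof -
  have "(\<lambda>Z. (c * p Z + euler (\<lambda>Z. c * p Z) Z) * cnj (r Z)) = (\<lambda>Z. c * ((p Z + euler p Z) * cnj (r Z)))"
    using assms by (simp add: fun_eq_iff euler_def partial_cmult hpoly_smooth algebra_simps)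
  then show ?thesis unfolding hform_def by (simp add: integral_S3_cmult)
qed

lemma hform_scale_right: "hform r (\<lambda>Z. c * p Z) = cnj c * hform r p"
proof -
  have "(\<lambda>Z. (r Z + euler r Z) * cnj (c * p Z)) = (\<lambda>Z. cnj c * ((r Z + euler r Z) * cnj (p Z)))"
    by (simp add: fun_eq_iff algebra_simps)
  then show ?thesis unfolding hform_def by (simp add: integral_S3_cmult)
qed

text \<open>The squared norms of the orthogonal basis of matrix coefficients.\<close>

definition tnorm :: "int \<Rightarrow> int \<Rightarrow> int \<Rightarrow> real" where
  "tnorm k i b = (if 0 \<le> i \<and> i \<le> k \<and> 0 \<le> b \<and> b \<le> k then real (nat k choose nat i) / real (nat k choose nat b) else 0)"

lemma hform_lmono_left: "hform (lmono 0 k i b) q = of_int (k + 1) / (2 * (of_real pi)\<^sup>2) * integral_S3 (\<lambda>Z. lmono 0 k i b Z * cnj (q Z))"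
proof -
  have "(\<lambda>Z. (lmono 0 k i b Z + euler (lmono 0 k i b) Z) * cnj (q Z)) = (\<lambda>Z. of_int (k + 1) * (lmono 0 k i b Z * cnj (q Z)))"
    by (simp add: fun_eq_iff euler_lmono0 algebra_simps)
  then show ?thesis unfolding hform_def integral_S3_cmult by (simp add: integral_S3_cmult)
qed

lemma hform_lmono: "hform (lmono 0 k i b) (lmono 0 k' i' b') = (if k' = k \<and> i' = i \<and> b' = b then of_real (tnorm k i b) else 0)"
proof (cases "0 \<le> i \<and> i \<le> k \<and> 0 \<le> b \<and> b \<le> k")
  case True
  then show ?thesis
    using gram_orthogonal[of i k b k' i' b'] unfolding hform_lmono_left gram_def[symmetric]
    by (auto simp: tnorm_def)
next
  case False
  then have "lmono 0 k i b = (\<lambda>Z. 0)" by (intro lmono_outside) auto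
  then have "hform (lmono 0 k i b) (lmono 0 k' i' b') = 0"
    using hform_lmono_left[of k i b "lmono 0 k' i' b'"] integral_S3_const[of 0] by simp
  then show ?thesis using False by (auto simp: tnorm_def)
qed

text \<open>Adjointness of two operators needs to be verified on the basis only.\<close>

lemma sesquilinear_eq:
  assumes S: "linear_op S" and T: "linear_op T"
    and eq: "\<And>k i b k' i' b'. 0 \<le> i \<Longrightarrow> i \<le> k \<Longrightarrow> 0 \<le> b \<Longrightarrow> b \<le> k \<Longrightarrow> 0 \<le> i' \<Longrightarrow> i' \<le> k' \<Longrightarrow> 0 \<le> b' \<Longrightarrow> b' \<le> k' \<Longrightarrow>
      hform (S (lmono 0 k i b)) (lmono 0 k' i' b') = hform (lmono 0 k i b) (T (lmono 0 k' i' b'))"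
    and p: "p \<in> hpoly" and q: "q \<in> hpoly"
  shows "hform (S p) q = hform p (T q)"
  using p
proof (induction rule: hpoly_induct)
  case (mono c k i b)
  note v = mono
  have "hform (S (lmono 0 k i b)) q = hform (lmono 0 k i b) (T q)"
    using q
  proof (induction rule: hpoly_induct)
    case (mono c k' i' b')
    then show ?case using eq v by (simp add: linear_op_scale[OF T] hform_scale_right hpoly_lmono)
  next
    case (add p q)
    then show ?case by (simp add: linear_op_add[OF T] hform_add_right hpoly_lmono linear_op_in[OF S] linear_op_in[OF T])
  qed
  then show ?case by (simp add: linear_op_scale[OF S] hform_scale_left hpoly_lmono linear_op_in[OF S])
next
  case (add p q')
  then show ?case using q by (simp add: linear_op_add[OF S] hform_add_left linear_op_in[OF S] linear_op_in[OF T])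
qed

lemma hform_hermitian:
  assumes "p \<in> hpoly" and q: "q \<in> hpoly"
  shows "hform q p = cnj (hform p q)"
  using assms(1)
proof (induction rule: hpoly_induct)
  case (mono c k i b)
  have "hform q (lmono 0 k i b) = cnj (hform (lmono 0 k i b) q)"
    using q
  proof (induction rule: hpoly_induct)
    case (mono c k' i' b')
    then show ?case by (simp add: hform_scale_left hform_scale_right hpoly_lmono hform_lmono)
  next
    case (add p q)
    then show ?case by (simp add: hform_add_left hform_add_right hpoly_lmono)
  qed
  then show ?case by (simp add: hform_scale_left hform_scale_right hpoly_lmono)
next
  case (add p q')
  then show ?case using q by (simp add: hform_add_left hform_add_right)
qed

lemma choose_shift:
  assumes "0 \<le> i" "i \<le> k"
  shows "real_of_int (i + 1) * real (nat (k + 1) choose nat (i + 1)) = real_of_int (k + 1) * real (nat k choose nat i)"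
    and "real_of_int (k + 1 - i) * real (nat (k + 1) choose nat i) = real_of_int (k + 1) * real (nat k choose nat i)"
proof -
  obtain n j where n: "k = int n" "i = int j" using assms by (metis nonneg_int_cases order_trans)
  have e: "nat (k + 1) = Suc n" "nat (i + 1) = Suc j" "nat k = n" "nat i = j" using n by auto
  have "Suc j * (Suc n choose Suc j) = Suc n * (n choose j)" by (rule Suc_times_binomial)
  then have "real (Suc j * (Suc n choose Suc j)) = real (Suc n * (n choose j))" by (rule arg_cong)
  then show "real_of_int (i + 1) * real (nat (k + 1) choose nat (i + 1)) = real_of_int (k + 1) * real (nat k choose nat i)"
    unfolding e of_nat_mult using n by (simp add: add.commute)
  have "(Suc n - j) * (Suc n choose j) = Suc n * (n choose j)" using binomial_absorb_comp[of "Suc n" j] by simp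
  then have "real ((Suc n - j) * (Suc n choose j)) = real (Suc n * (n choose j))" by (rule arg_cong)
  moreover have "real (Suc n - j) = real_of_int (k + 1 - i)" using n assms by (simp add: of_nat_diff)
  ultimately show "real_of_int (k + 1 - i) * real (nat (k + 1) choose nat i) = real_of_int (k + 1) * real (nat k choose nat i)"
    unfolding e of_nat_mult using n by (simp add: add.commute)
qed

lemma choose_step:
  assumes "0 \<le> i" "i < k"
  shows "real_of_int (i + 1) * real (nat k choose nat (i + 1)) = real_of_int (k - i) * real (nat k choose nat i)"
proof -
  have "real_of_int (i + 1) * real (nat (k - 1 + 1) choose nat (i + 1)) = real_of_int (k - 1 + 1 - i) * real (nat (k - 1 + 1) choose nat i)"
    using choose_shift[of i "k - 1"] assms by simp
  then show ?thesis by simp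
qed

lemma choose_pos: "0 \<le> i \<Longrightarrow> i \<le> k \<Longrightarrow> real (nat k choose nat i) > 0"
  by (simp add: zero_less_binomial_iff nat_mono)

lemma fraction_eq:
  fixes x y z c d c' d' :: real
  assumes "y * c' = z * c" "x * d' = z * d" "d > 0" "d' > 0"
  shows "x * (c / d) = y * (c' / d')"
proof -
  have "x * (c / d) = (x * d') * c / (d * d')" using assms by (simp add: field_simps)
  also have "\<dots> = d * (y * c') / (d * d')" using assms by simp
  also have "\<dots> = y * (c' / d')" using assms by (simp add: field_simps)
  finally show ?thesis .
qed

lemma tnorm_shift:
  assumes v: "0 \<le> i" "i \<le> k" "0 \<le> b" "b \<le> k"
  shows "real_of_int (b + 1) * tnorm k i b = real_of_int (i + 1) * tnorm (k + 1) (i + 1) (b + 1)"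
    and "real_of_int (k + 1 - b) * tnorm k i b = real_of_int (i + 1) * tnorm (k + 1) (i + 1) b"
    and "real_of_int (b + 1) * tnorm k i b = real_of_int (k + 1 - i) * tnorm (k + 1) i (b + 1)"
    and "real_of_int (k + 1 - b) * tnorm k i b = real_of_int (k + 1 - i) * tnorm (k + 1) i b"
proof -
  note pos = choose_pos[OF v(3,4)] choose_pos[of "b + 1" "k + 1"] choose_pos[of b "k + 1"]
  show "real_of_int (b + 1) * tnorm k i b = real_of_int (i + 1) * tnorm (k + 1) (i + 1) (b + 1)"
    using fraction_eq[OF choose_shift(1)[OF v(1,2)] choose_shift(1)[OF v(3,4)]] pos v by (simp add: tnorm_def)
  show "real_of_int (k + 1 - b) * tnorm k i b = real_of_int (i + 1) * tnorm (k + 1) (i + 1) b"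
    using fraction_eq[OF choose_shift(1)[OF v(1,2)] choose_shift(2)[OF v(3,4)]] pos v by (simp add: tnorm_def)
  show "real_of_int (b + 1) * tnorm k i b = real_of_int (k + 1 - i) * tnorm (k + 1) i (b + 1)"
    using fraction_eq[OF choose_shift(2)[OF v(1,2)] choose_shift(1)[OF v(3,4)]] pos v by (simp add: tnorm_def)
  show "real_of_int (k + 1 - b) * tnorm k i b = real_of_int (k + 1 - i) * tnorm (k + 1) i b"
    using fraction_eq[OF choose_shift(2)[OF v(1,2)] choose_shift(2)[OF v(3,4)]] pos v by (simp add: tnorm_def)
qed

lemma tnorm_step_right:
  assumes v: "0 \<le> i" "i \<le> k" "0 \<le> b" "b < k"
  shows "real_of_int (k - b) * tnorm k i (b + 1) = real_of_int (b + 1) * tnorm k i b"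
proof -
  have "real (nat k choose nat b) > 0" "real (nat k choose nat (b + 1)) > 0" using v by (intro choose_pos; simp)+
  then show ?thesis
    using fraction_eq[OF refl choose_step[OF v(3,4), symmetric], of "real (nat k choose nat i)"] v by (simp add: tnorm_def)
qed

lemma tnorm_step_left:
  assumes v: "0 \<le> i" "i < k" "0 \<le> b" "b \<le> k"
  shows "real_of_int (i + 1) * tnorm k (i + 1) b = real_of_int (k - i) * tnorm k i b"
proof -
  have "real (nat k choose nat b) > 0" using v by (intro choose_pos; simp)
  then show ?thesis
    using fraction_eq[OF choose_step[OF v(1,2), symmetric] refl, of "real (nat k choose nat b)"] v by (simp add: tnorm_def)
qed

lemma of_real_cong: "x = y \<Longrightarrow> (of_real x :: complex) = of_real y" by simp

text \<open>On the basis both sides are multiples of a single squared norm, and the identity is a recursion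
  between binomial coefficients.\<close>

lemma adjoint_partial_kop:
  assumes p: "p \<in> hpoly" and q: "q \<in> hpoly"
  shows "hform (partial a b p) q = hform p (kop b a q)"
proof (rule sesquilinear_eq[OF linear_op_partial linear_op_kop _ p q])
  fix k i c k' i' c' :: int
  assume v: "0 \<le> i" "i \<le> k" "0 \<le> c" "c \<le> k" "0 \<le> i'" "i' \<le> k'" "0 \<le> c'" "c' \<le> k'"
  note t = tnorm_shift[OF v(5-8), THEN of_real_cong]
  note s = hform_scale_left[OF hpoly_lmono] hform_scale_right hform_lmono partial_lmono0 kop_lmono[OF v(7,8)]
  have "hform (partial 1 1 (lmono 0 k i c)) (lmono 0 k' i' c') = hform (lmono 0 k i c) (kop 1 1 (lmono 0 k' i' c'))"
    using t(1) unfolding s by (cases "k = k' + 1 \<and> i = i' + 1 \<and> c = c' + 1") auto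
  moreover have "hform (partial 1 2 (lmono 0 k i c)) (lmono 0 k' i' c') = hform (lmono 0 k i c) (kop 2 1 (lmono 0 k' i' c'))"
    using t(2) unfolding s by (cases "k = k' + 1 \<and> i = i' + 1 \<and> c = c'") auto
  moreover have "hform (partial 2 1 (lmono 0 k i c)) (lmono 0 k' i' c') = hform (lmono 0 k i c) (kop 1 2 (lmono 0 k' i' c'))"
    using t(3) unfolding s by (cases "k = k' + 1 \<and> i = i' \<and> c = c' + 1") auto
  moreover have "hform (partial 2 2 (lmono 0 k i c)) (lmono 0 k' i' c') = hform (lmono 0 k i c) (kop 2 2 (lmono 0 k' i' c'))"
    using t(4) unfolding s by (cases "k = k' + 1 \<and> i = i' \<and> c = c'") auto
  ultimately show "hform (partial a b (lmono 0 k i c)) (lmono 0 k' i' c') = hform (lmono 0 k i c) (kop b a (lmono 0 k' i' c'))"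
    using exhaust_2_cases[of a] exhaust_2_cases[of b] by auto
qed

lemma adjoint_kop_partial:
  assumes p: "p \<in> hpoly" and q: "q \<in> hpoly"
  shows "hform (kop b a p) q = hform p (partial a b q)"
  using adjoint_partial_kop[OF q p, of a b] hform_hermitian[OF linear_op_in[OF linear_op_kop p] q, of b a]
    hform_hermitian[OF p linear_op_in[OF linear_op_partial q], of a b] 
  by (metis complex_cnj_cnj)

lemma adjoint_lop:
  assumes p: "p \<in> hpoly" and q: "q \<in> hpoly"
  shows "hform (lop a b p) q = hform p (lop b a q)"
proof (rule sesquilinear_eq[OF linear_op_lop linear_op_lop _ p q])
  fix k i c k' i' c' :: int
  assume v: "0 \<le> i" "i \<le> k" "0 \<le> c" "c \<le> k" "0 \<le> i'" "i' \<le> k'" "0 \<le> c'" "c' \<le> k'"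
  note s = hform_scale_left[OF hpoly_lmono] hform_scale_right hform_lmono lop_lmono
  have "hform (lop 1 1 (lmono 0 k i c)) (lmono 0 k' i' c') = hform (lmono 0 k i c) (lop 1 1 (lmono 0 k' i' c'))"
    unfolding s by auto
  moreover have "hform (lop 2 2 (lmono 0 k i c)) (lmono 0 k' i' c') = hform (lmono 0 k i c) (lop 2 2 (lmono 0 k' i' c'))"
    unfolding s by auto
  moreover have "hform (lop 1 2 (lmono 0 k i c)) (lmono 0 k' i' c') = hform (lmono 0 k i c) (lop 2 1 (lmono 0 k' i' c'))"
    using tnorm_step_left[of i' k' c', THEN of_real_cong] v unfolding s by (cases "k = k' \<and> i = i' + 1 \<and> c = c'") auto
  moreover have "hform (lop 2 1 (lmono 0 k i c)) (lmono 0 k' i' c') = hform (lmono 0 k i c) (lop 1 2 (lmono 0 k' i' c'))"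
    using tnorm_step_left[of i k c, THEN of_real_cong] v unfolding s by (cases "k = k' \<and> i' = i + 1 \<and> c = c'") auto
  ultimately show "hform (lop a b (lmono 0 k i c)) (lmono 0 k' i' c') = hform (lmono 0 k i c) (lop b a (lmono 0 k' i' c'))"
    using exhaust_2_cases[of a] exhaust_2_cases[of b] by auto
qed

lemma adjoint_rop:
  assumes p: "p \<in> hpoly" and q: "q \<in> hpoly"
  shows "hform (rop a b p) q = hform p (rop b a q)"
proof (rule sesquilinear_eq[OF linear_op_rop linear_op_rop _ p q])
  fix k i c k' i' c' :: int
  assume v: "0 \<le> i" "i \<le> k" "0 \<le> c" "c \<le> k" "0 \<le> i'" "i' \<le> k'" "0 \<le> c'" "c' \<le> k'"
  note s = hform_scale_left[OF hpoly_lmono] hform_scale_right hform_lmono rop_lmono(1) rop_lmono(4) rop_lmono(2)[OF v(3)] rop_lmono(3)[OF v(4)]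
     rop_lmono(2)[OF v(7)] rop_lmono(3)[OF v(8)]
  have "hform (rop 1 1 (lmono 0 k i c)) (lmono 0 k' i' c') = hform (lmono 0 k i c) (rop 1 1 (lmono 0 k' i' c'))"
    unfolding s by auto
  moreover have "hform (rop 2 2 (lmono 0 k i c)) (lmono 0 k' i' c') = hform (lmono 0 k i c) (rop 2 2 (lmono 0 k' i' c'))"
    unfolding s by auto
  moreover have "hform (rop 1 2 (lmono 0 k i c)) (lmono 0 k' i' c') = hform (lmono 0 k i c) (rop 2 1 (lmono 0 k' i' c'))"
    using tnorm_step_right[of i k c, THEN of_real_cong] v unfolding s by (cases "k = k' \<and> i = i' \<and> c' = c + 1") auto
  moreover have "hform (rop 2 1 (lmono 0 k i c)) (lmono 0 k' i' c') = hform (lmono 0 k i c) (rop 1 2 (lmono 0 k' i' c'))"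
    using tnorm_step_right[of i' k' c', THEN of_real_cong] v unfolding s by (cases "k = k' \<and> i = i' \<and> c = c' + 1") auto
  ultimately show "hform (rop a b (lmono 0 k i c)) (lmono 0 k' i' c') = hform (lmono 0 k i c) (rop b a (lmono 0 k' i' c'))"
    using exhaust_2_cases[of a] exhaust_2_cases[of b] by auto
qed

text \<open>A finite combination of the orthogonal basis vectors is tested against each of them.\<close>

lemma hform_nondegenerate:
  assumes p: "p \<in> hpoly" and z: "\<And>q. q \<in> hpoly \<Longrightarrow> hform p q = 0"
  shows "p = (\<lambda>Z. 0)"
proof -
  define V where "V = {(k::int, i::int, b::int). 0 \<le> i \<and> i \<le> k \<and> 0 \<le> b \<and> b \<le> k}"
  let ?T = "\<lambda>(k, i, b). lmono 0 k i b"
  have "\<exists>X c. finite X \<and> X \<subseteq> V \<and> p = (\<lambda>Z. \<Sum>x\<in>X. c x * ?T x Z)"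
    using p
  proof (induction rule: hpoly_induct)
    case (mono c k i b)
    then show ?case by (intro exI[of _ "{(k, i, b)}"] exI[of _ "\<lambda>_. c"]) (auto simp: V_def)
  next
    case (add p q)
    from add(3) obtain X c where X: "finite X" "X \<subseteq> V" "p = (\<lambda>Z. \<Sum>x\<in>X. c x * ?T x Z)" by blast
    from add(4) obtain Y d where Y: "finite Y" "Y \<subseteq> V" "q = (\<lambda>Z. \<Sum>x\<in>Y. d x * ?T x Z)" by blast
    let ?e = "\<lambda>x. (if x \<in> X then c x else 0) + (if x \<in> Y then d x else 0)"
    have "(\<Sum>x\<in>X \<union> Y. ?e x * ?T x Z) = p Z + q Z" for Z
    proof -
      have "(\<Sum>x\<in>X \<union> Y. ?e x * ?T x Z) = (\<Sum>x\<in>X \<union> Y. if x \<in> X then c x * ?T x Z else 0) + (\<Sum>x\<in>X \<union> Y. if x \<in> Y then d x * ?T x Z else 0)"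
        unfolding sum.distrib[symmetric] by (rule sum.cong) (auto simp: distrib_right)
      also have "\<dots> = p Z + q Z"
        using X Y by (simp add: sum.If_cases Int_absorb1)
      finally show ?thesis .
    qed
    then show ?case using X Y by (intro exI[of _ "X \<union> Y"] exI[of _ ?e]) auto
  qed
  then obtain X c where X: "finite X" "X \<subseteq> V" and pe: "p = (\<lambda>Z. \<Sum>x\<in>X. c x * ?T x Z)" by blast
  have sum: "(\<lambda>Z. \<Sum>x\<in>Y. c x * ?T x Z) \<in> hpoly \<and> (\<forall>y. hform (\<lambda>Z. \<Sum>x\<in>Y. c x * ?T x Z) (?T y) = (\<Sum>x\<in>Y. c x * hform (?T x) (?T y)))" if "finite Y" for Y
    using that
  proof induction
    case empty
    then show ?case using hpoly_zero hform_scale_left[OF hpoly_zero, of 0] by auto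
  next
    case (insert x Y)
    have "?T x \<in> hpoly" "\<And>y. ?T y \<in> hpoly" by (auto split: prod.splits intro: hpoly_lmono)
    then show ?case using insert by (simp add: hpoly_add hpoly_scale hform_add_left hform_scale_left)
  qed
  have "c y = 0" if "y \<in> X" for y
  proof -
    obtain k i b where y: "y = (k, i, b)" by (cases y)
    have v: "0 \<le> i" "i \<le> k" "0 \<le> b" "b \<le> k" using that X(2) y unfolding V_def by auto
    have "0 = hform p (?T y)" using z hpoly_lmono y by simp
    also have "\<dots> = (\<Sum>x\<in>X. c x * hform (?T x) (?T y))" using sum[OF X(1), THEN conjunct2, rule_format, of y] unfolding pe .
    also have "\<dots> = (\<Sum>x\<in>X. if x = y then c y * of_real (tnorm k i b) else 0)"
    proof (rule sum.cong)
      fix x :: "int \<times> int \<times> int"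
      obtain k' i' b' where x: "x = (k', i', b')" by (cases x)
      show "c x * hform (?T x) (?T y) = (if x = y then c y * of_real (tnorm k i b) else 0)"
        unfolding x y by (cases "k' = k \<and> i' = i \<and> b' = b") (auto simp: hform_lmono)
    qed simp
    also have "\<dots> = c y * of_real (tnorm k i b)" using X(1) that by simp
    finally show ?thesis using v choose_pos[of i k] choose_pos[of b k] by (simp add: tnorm_def)
  qed
  then show ?thesis using pe by (simp add: fun_eq_iff)
qed

section \<open>The invariant form on pairs of harmonic spinors\<close>

definition hspin :: "(hc \<Rightarrow> spinor) set" where
  "hspin = {f. \<forall>i. (\<lambda>Z. f Z $ i) \<in> hpoly}"

lemma hspin_nth: "f \<in> hspin \<Longrightarrow> (\<lambda>Z. f Z $ i) \<in> hpoly"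
  by (simp add: hspin_def)

lemma hspinI: "(\<lambda>Z. f Z $ 1) \<in> hpoly \<Longrightarrow> (\<lambda>Z. f Z $ 2) \<in> hpoly \<Longrightarrow> f \<in> hspin"
  by (simp add: hspin_def forall_2)

lemma subspace_hspin: "fs.subspace hspin"
  unfolding fs.subspace_def hspin_def by (auto simp: hpoly_zero intro: hpoly_add hpoly_scale)

lemma hspin_laurent: "f \<in> hspin \<Longrightarrow> f \<in> laurent_spinors"
  by (simp add: hspin_def laurent_spinors_def hpoly_laurent)

lemma hspin_singular: "f \<in> hspin \<Longrightarrow> det Z = 0 \<Longrightarrow> f Z = 0"
  using laurent_spinors_singular[OF hspin_laurent] .

definition sform :: "(hc \<Rightarrow> spinor) \<Rightarrow> (hc \<Rightarrow> spinor) \<Rightarrow> complex" where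
  "sform f g = hform (\<lambda>Z. f Z $ 1) (\<lambda>Z. g Z $ 1) + hform (\<lambda>Z. f Z $ 2) (\<lambda>Z. g Z $ 2)"

lemma sform_add_left: "f \<in> hspin \<Longrightarrow> g \<in> hspin \<Longrightarrow> h \<in> hspin \<Longrightarrow> sform (f + g) h = sform f h + sform g h"
  by (simp add: sform_def hform_add_left hspin_nth)

lemma sform_scale_left: "f \<in> hspin \<Longrightarrow> sform (fscale c f) h = c * sform f h"
  by (simp add: sform_def hform_scale_left hspin_nth distrib_left)

lemma sform_scale_right: "sform h (fscale c f) = cnj c * sform h f"
  by (simp add: sform_def hform_scale_right distrib_left)

lemma sform_hermitian: "f \<in> hspin \<Longrightarrow> g \<in> hspin \<Longrightarrow> sform g f = cnj (sform f g)"
  unfolding sform_def using hform_hermitian[OF hspin_nth hspin_nth, of f g 1 1] hform_hermitian[OF hspin_nth hspin_nth, of f g 2 2] by simp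

type_synonym bispinor = "(hc \<Rightarrow> spinor) \<times> (hc \<Rightarrow> spinor)"

definition bispin :: "bispinor set" where "bispin = hspin \<times> hspin"

text \<open>The tensor product of the form on harmonic polynomials with the form of signature \<open>(2,2)\<close> on
  \<open>\<complex>\<^sup>4\<close>, the two summands of \<open>\<complex>\<^sup>4\<close> being written as the components of a pair.\<close>

definition wform :: "bispinor \<Rightarrow> bispinor \<Rightarrow> complex" where
  "wform u v = sform (fst u) (fst v) - sform (snd u) (snd v)"

definition wscale :: "complex \<Rightarrow> bispinor \<Rightarrow> bispinor" where
  "wscale c u = (fscale c (fst u), fscale c (snd u))"

lemma bispin_add: "u \<in> bispin \<Longrightarrow> v \<in> bispin \<Longrightarrow> u + v \<in> bispin"
  by (auto simp: bispin_def fs.subspace_add[OF subspace_hspin])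

lemma bispin_diff: "u \<in> bispin \<Longrightarrow> v \<in> bispin \<Longrightarrow> u - v \<in> bispin"
  by (auto simp: bispin_def fs.subspace_diff[OF subspace_hspin])

lemma bispin_scale: "u \<in> bispin \<Longrightarrow> wscale c u \<in> bispin"
  by (auto simp: bispin_def wscale_def fs.subspace_scale[OF subspace_hspin])

lemma wform_add_left: "u \<in> bispin \<Longrightarrow> v \<in> bispin \<Longrightarrow> w \<in> bispin \<Longrightarrow> wform (u + v) w = wform u w + wform v w"
  by (auto simp: bispin_def wform_def sform_add_left)

lemma wform_scale_left: "u \<in> bispin \<Longrightarrow> wform (wscale c u) w = c * wform u w"
  by (auto simp: bispin_def wform_def wscale_def sform_scale_left algebra_simps)

lemma wform_hermitian: "u \<in> bispin \<Longrightarrow> v \<in> bispin \<Longrightarrow> wform v u = cnj (wform u v)"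
  unfolding bispin_def wform_def using sform_hermitian[of "fst u" "fst v"] sform_hermitian[of "snd u" "snd v"] by auto

lemma wform_diff_left: "u \<in> bispin \<Longrightarrow> v \<in> bispin \<Longrightarrow> w \<in> bispin \<Longrightarrow> wform (u - v) w = wform u w - wform v w"
  using wform_add_left[OF bispin_diff, of u v v w] by (simp add: algebra_simps)

lemma wform_nondegenerate:
  assumes u: "u \<in> bispin" and z: "\<And>v. v \<in> bispin \<Longrightarrow> wform u v = 0"
  shows "fst u = 0" "snd u = 0"
proof -
  have zero: "0 \<in> hspin" using fs.subspace_0[OF subspace_hspin] .
  have hz: "hform p (\<lambda>Z. 0) = 0" for p using hform_scale_right[of p 0 "\<lambda>Z. 0"] by simp
  have uf: "fst u \<in> hspin" "snd u \<in> hspin" using u by (auto simp: bispin_def)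
  have s: "spin q (\<lambda>Z. 0) \<in> hspin" "spin (\<lambda>Z. 0) q \<in> hspin" if "q \<in> hpoly" for q
    using that hpoly_zero by (auto intro!: hspinI)
  have f: "hform (\<lambda>Z. fst u Z $ i) q = 0 \<and> hform (\<lambda>Z. snd u Z $ i) q = 0" if "q \<in> hpoly" for q i
    using z[of "(spin q (\<lambda>Z. 0), 0)"] z[of "(spin (\<lambda>Z. 0) q, 0)"] z[of "(0, spin q (\<lambda>Z. 0))"] z[of "(0, spin (\<lambda>Z. 0) q)"]
      s[OF that] zero exhaust_2_cases[of i]
    by (auto simp: bispin_def wform_def sform_def hz)
  have n: "(\<lambda>Z. fst u Z $ i) = (\<lambda>Z. 0)" "(\<lambda>Z. snd u Z $ i) = (\<lambda>Z. 0)" for i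
    using hform_nondegenerate[OF hspin_nth[OF uf(1)], of i] hform_nondegenerate[OF hspin_nth[OF uf(2)], of i] f by blast+
  show "fst u = 0" "snd u = 0" 
    using fun_cong[OF n(1)] fun_cong[OF n(2)] by (auto simp: fun_eq_iff vec_eq_iff)
qed

definition evalmap :: "bispinor \<Rightarrow> hc \<Rightarrow> spinor" where
  "evalmap u Z = fst u Z + Z *v snd u Z"

lemma evalmap_add: "evalmap (u + v) = evalmap u + evalmap v"
  by (simp add: fun_eq_iff evalmap_def matrix_vector_right_distrib)

lemma evalmap_scale: "evalmap (wscale c u) = fscale c (evalmap u)"
  by (rule ext, rule spinor_eqI) (simp_all add: evalmap_def wscale_def matrix_vector_2 algebra_simps)

lemma evalmap_diff: "evalmap (u - v) = evalmap u - evalmap v"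
  by (rule ext, rule spinor_eqI) (simp_all add: evalmap_def matrix_vector_2 algebra_simps)

lemma evalmap_nth:
  "evalmap u Z $ 1 = fst u Z $ 1 + Z$1$1 * snd u Z $ 1 + Z$1$2 * snd u Z $ 2"
  "evalmap u Z $ 2 = fst u Z $ 2 + Z$2$1 * snd u Z $ 1 + Z$2$2 * snd u Z $ 2"
  by (simp_all add: evalmap_def matrix_vector_2)

text \<open>The analogues of \<open>bfun\<close> and \<open>afun\<close> in which the spinor index couples to the column index of the
  matrix coefficient. They are the second components of pairs.\<close>

definition rfun :: "int \<Rightarrow> int \<Rightarrow> int \<Rightarrow> hc \<Rightarrow> spinor" where
  "rfun k i b = spin (\<lambda>Z. of_int b * lmono 0 (k - 1) i (b - 1) Z) (\<lambda>Z. of_int (k - b) * lmono 0 (k - 1) i b Z)"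

definition cfun :: "int \<Rightarrow> int \<Rightarrow> int \<Rightarrow> hc \<Rightarrow> spinor" where
  "cfun k i b = spin (lmono 0 (k + 1) i b) (\<lambda>Z. - lmono 0 (k + 1) i (b + 1) Z)"

lemma hspin_basis: "afun 0 k i b \<in> hspin" "bfun 0 k i b \<in> hspin" "rfun k i b \<in> hspin" "cfun k i b \<in> hspin"
  unfolding afun_def bfun_def rfun_def cfun_def
  by (rule hspinI; simp add: hpoly_lmono hpoly_scale hpoly_uminus del: of_int_diff of_int_add)+

text \<open>Hence the pairs \<open>(bfun 0 k i b, - rfun k i b)\<close> lie in the kernel of the evaluation map.\<close>

lemma mult_rfun: "Z *v rfun k i b Z = bfun 0 k i b Z"
  by (rule spinor_eqI)
     (use lmono_lower[of b Z 0 k i] lmono_raise[of b Z 0 k i] in \<open>simp_all add: matrix_vector_2 rfun_def bfun_def mult.left_commute del: of_int_diff of_int_add\<close>)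

text \<open>The cross relations between neighbouring matrix coefficients, in matrix form.\<close>

lemma cfun_adj:
  assumes "0 \<le> b" "b \<le> k"
  shows "cfun k i b Z = adj Z *v afun 0 k i b Z"
proof (cases "det Z = 0")
  case True
  then show ?thesis by (intro spinor_eqI) (simp_all add: cfun_def afun_def lmono_singular matrix_vector_2)
next
  case False
  show ?thesis
    by (rule spinor_eqI)
       (use tcoef_rec1[OF assms, of i Z] tcoef_rec2[OF assms, of i Z] in \<open>simp_all add: cfun_def afun_def lmono_eq[OF False] matrix_vector_2 algebra_simps\<close>)
qed

lemma mult_adj: "Z *v (adj Z *v x) = det Z *s x"
  by (rule spinor_eqI) (simp_all add: matrix_vector_2 det_2 algebra_simps)

lemma mult_cfun:
  assumes "0 \<le> b" "b \<le> k"
  shows "Z *v cfun k i b Z = afun 1 k i b Z"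
  unfolding cfun_adj[OF assms] mult_adj
  by (rule spinor_eqI) (simp_all add: afun_def det_mult_lmono)

subsection \<open>The image of the evaluation map\<close>

lemma bfun_range: "\<not> (0 \<le> b \<and> b \<le> k) \<Longrightarrow> bfun j k i b = 0" "\<not> (0 \<le> b \<and> b \<le> k) \<Longrightarrow> afun j k i b = 0"
  using lmono_outside[of i k b j] lmono_outside[of "i + 1" k b j] lmono_outside[of "i - 1" k b j]
  by (auto simp: fun_eq_iff bfun_def afun_def intro!: spinor_eqI)

lemma afun_plus: "j = 0 \<or> j = 1 \<Longrightarrow> afun j k i b \<in> U_plus"
proof -
  assume j: "j = 0 \<or> j = 1"
  show ?thesis
  proof (cases "0 \<le> k")
    case True
    then have "afun j k i b \<in> plus_basis" using j unfolding plus_basis_def by blast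
    then show ?thesis unfolding U_plus_span by (rule fs.span_base)
  next
    case False
    then have "afun j k i b = 0" by (intro bfun_range) auto
    then show ?thesis unfolding U_plus_span using fs.span_zero by simp
  qed
qed

lemma bfun_plus: "bfun 0 k i b \<in> U_plus"
proof (cases "1 \<le> k")
  case True
  then have "bfun 0 k i b \<in> plus_basis" unfolding plus_basis_def by blast
  then show ?thesis unfolding U_plus_span by (rule fs.span_base)
next
  case False
  have "bfun 0 k i b = 0"
  proof (cases "k = 0")
    case True
    show ?thesis
      by (rule ext, rule spinor_eqI) 
         (cases "i < 0"; cases "i = 0"; cases "i = -1"; simp add: True bfun_def lmono_outside)+
  next
    case False
    then show ?thesis using \<open>\<not> 1 \<le> k\<close> by (intro bfun_range) auto
  qed
  then show ?thesis unfolding U_plus_span using fs.span_zero by simp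
qed

lemma subspace_U_plus: "fs.subspace U_plus"
  unfolding U_plus_span by (rule fs.subspace_span)

text \<open>A matrix coefficient times a basis spinor is a combination of \<open>afun\<close> and \<open>bfun\<close>, and also one of
  \<open>cfun\<close> and \<open>rfun\<close>. The former decomposition is used in first components, the latter in second
  components, where multiplication by \<open>Z\<close> leads back to \<open>afun\<close> and \<open>bfun\<close>.\<close>

lemma evalmap_U_plus:
  assumes "u \<in> bispin"
  shows "evalmap u \<in> U_plus"
proof -
  note add = fs.subspace_add[OF subspace_U_plus] and scale = fs.subspace_scale[OF subspace_U_plus]
  have div: "X \<in> U_plus" if "fscale (of_int (k + 1)) X = Y" "Y \<in> U_plus" "0 \<le> k" for X Y k
  proof -
    have k: "of_int (k + 1) \<noteq> (0::complex)" unfolding of_int_eq_0_iff using that by linarith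
    have "X = fscale (1 / of_int (k + 1)) (fscale (of_int (k + 1)) X)" using k by (simp add: fs.scale_scale del: of_int_add)
    then show ?thesis using that scale by metis
  qed
  have first: "spin (lmono 0 k i b) (\<lambda>Z. 0) \<in> U_plus" "spin (\<lambda>Z. 0) (lmono 0 k i b) \<in> U_plus" if k: "0 \<le> k" for k i b
  proof -
    have "fscale (of_int (k + 1)) (spin (lmono 0 k i b) (\<lambda>Z. 0)) = fscale (of_int (k + 1 - i)) (afun 0 k i b) + bfun 0 k (i - 1) b"
      by (rule ext, rule spinor_eqI) (simp_all add: afun_def bfun_def algebra_simps)
    from div[OF this _ k] show "spin (lmono 0 k i b) (\<lambda>Z. 0) \<in> U_plus" by (simp add: add scale afun_plus bfun_plus)
    have "fscale (of_int (k + 1)) (spin (\<lambda>Z. 0) (lmono 0 k i b)) = fscale (- of_int (i + 1)) (afun 0 k (i + 1) b) + bfun 0 k i b"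
      by (rule ext, rule spinor_eqI) (simp_all add: afun_def bfun_def algebra_simps)
    from div[OF this _ k] show "spin (\<lambda>Z. 0) (lmono 0 k i b) \<in> U_plus" by (simp add: add scale afun_plus bfun_plus)
  qed
  have second: "evalmap (0, spin (lmono 0 k i b) (\<lambda>Z. 0)) \<in> U_plus" "evalmap (0, spin (\<lambda>Z. 0) (lmono 0 k i b)) \<in> U_plus" 
    if k: "0 \<le> b" "b \<le> k" for k i b
  proof -
    have k0: "0 \<le> k" using k by simp
    have e1: "fscale (of_int (k + 1)) (spin (lmono 0 k i b) (\<lambda>Z. 0)) = rfun (k + 1) i (b + 1) + fscale (of_int (k - b)) (cfun (k - 1) i b)"
      by (rule ext, rule spinor_eqI) (simp_all add: rfun_def cfun_def algebra_simps)
    have e2: "fscale (of_int (k + 1)) (spin (\<lambda>Z. 0) (lmono 0 k i b)) = rfun (k + 1) i b + fscale (- of_int b) (cfun (k - 1) i (b - 1))"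
      by (rule ext, rule spinor_eqI) (simp_all add: rfun_def cfun_def algebra_simps)
    have m: "evalmap (0, fscale c f) = fscale c (evalmap (0, f))" for c f
      using evalmap_scale[of c "(0, f)"] by (simp add: wscale_def fs.scale_zero_right)
    have a: "evalmap (0, f + g) = evalmap (0, f) + evalmap (0, g)" for f g
      using evalmap_add[of "(0, f)" "(0, g)"] by simp
    have r: "evalmap (0, rfun k i b) = bfun 0 k i b" for k i b
      by (simp add: fun_eq_iff evalmap_def mult_rfun)
    have c: "evalmap (0, cfun k i b) = afun 1 k i b" if "0 \<le> b" "b \<le> k" for k i b
      using that by (simp add: fun_eq_iff evalmap_def mult_cfun)
    have c1: "fscale (of_int (k - b)) (evalmap (0, cfun (k - 1) i b)) \<in> U_plus"
    proof (cases "b = k")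
      case True then show ?thesis using fs.subspace_0[OF subspace_U_plus] by (simp add: fs.scale_zero_left)
    next
      case False then show ?thesis using c[of b "k - 1" i] k by (simp add: scale afun_plus del: of_int_diff)
    qed
    have c2: "fscale (- of_int b) (evalmap (0, cfun (k - 1) i (b - 1))) \<in> U_plus"
    proof (cases "b = 0")
      case True then show ?thesis using fs.subspace_0[OF subspace_U_plus] by (simp add: fs.scale_zero_left)
    next
      case False
      then have e: "evalmap (0, cfun (k - 1) i (b - 1)) = afun 1 (k - 1) i (b - 1)" using k by (intro c) auto
      show ?thesis unfolding e by (intro scale afun_plus) simp
    qed
    have "fscale (of_int (k + 1)) (evalmap (0, spin (lmono 0 k i b) (\<lambda>Z. 0))) = bfun 0 (k + 1) i (b + 1) + fscale (of_int (k - b)) (evalmap (0, cfun (k - 1) i b))"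
      unfolding m[symmetric] e1 a r ..
    from div[OF this add[OF bfun_plus c1] k0] show "evalmap (0, spin (lmono 0 k i b) (\<lambda>Z. 0)) \<in> U_plus" .
    have "fscale (of_int (k + 1)) (evalmap (0, spin (\<lambda>Z. 0) (lmono 0 k i b))) = bfun 0 (k + 1) i b + fscale (- of_int b) (evalmap (0, cfun (k - 1) i (b - 1)))"
      unfolding m[symmetric] e2 a r ..
    from div[OF this add[OF bfun_plus c2] k0] show "evalmap (0, spin (\<lambda>Z. 0) (lmono 0 k i b)) \<in> U_plus" .
  qed
  have ind: "T p \<in> U_plus" if "p \<in> hpoly" "\<And>k i b. 0 \<le> i \<Longrightarrow> i \<le> k \<Longrightarrow> 0 \<le> b \<Longrightarrow> b \<le> k \<Longrightarrow> T (lmono 0 k i b) \<in> U_plus" 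
    "\<And>p q. T (\<lambda>Z. p Z + q Z) = T p + T q" "\<And>c p. T (\<lambda>Z. c * p Z) = fscale c (T p)" for T p
    using that(1) by (induction rule: hpoly_induct) (simp_all only: that scale add)
  have u: "fst u \<in> hspin" "snd u \<in> hspin" using assms by (auto simp: bispin_def)
  have 1: "spin p (\<lambda>Z. 0) \<in> U_plus" if "p \<in> hpoly" for p
    by (rule ind[OF that]) (auto simp: first fun_eq_iff intro!: spinor_eqI)
  have 2: "spin (\<lambda>Z. 0) p \<in> U_plus" if "p \<in> hpoly" for p
    by (rule ind[OF that]) (auto simp: first fun_eq_iff intro!: spinor_eqI)
  have 3: "evalmap (0, spin p (\<lambda>Z. 0)) \<in> U_plus" if "p \<in> hpoly" for p
  proof (rule ind[OF that])
    show "evalmap (0, spin (lmono 0 k i b) (\<lambda>Z. 0)) \<in> U_plus" if "0 \<le> b" "b \<le> k" for k i b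
      by (rule second(1)[OF that])
  qed (rule ext, rule spinor_eqI; simp add: evalmap_nth algebra_simps)+
  have 4: "evalmap (0, spin (\<lambda>Z. 0) p) \<in> U_plus" if "p \<in> hpoly" for p
  proof (rule ind[OF that])
    show "evalmap (0, spin (\<lambda>Z. 0) (lmono 0 k i b)) \<in> U_plus" if "0 \<le> b" "b \<le> k" for k i b
      by (rule second(2)[OF that])
  qed (rule ext, rule spinor_eqI; simp add: evalmap_nth algebra_simps)+
  have "evalmap u = (spin (\<lambda>Z. fst u Z $ 1) (\<lambda>Z. 0) + spin (\<lambda>Z. 0) (\<lambda>Z. fst u Z $ 2))
      + (evalmap (0, spin (\<lambda>Z. snd u Z $ 1) (\<lambda>Z. 0)) + evalmap (0, spin (\<lambda>Z. 0) (\<lambda>Z. snd u Z $ 2)))"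
    by (rule ext, rule spinor_eqI) (simp_all add: evalmap_nth)
  then show ?thesis using 1 2 3 4 hspin_nth u add by metis
qed

subsection \<open>The orthogonal complement of the kernel\<close>

definition kernel_ortho :: "bispinor set" where
  "kernel_ortho = {w \<in> bispin. \<forall>r\<in>bispin. evalmap r = 0 \<longrightarrow> wform w r = 0}"

lemma hform_lmono_right:
  assumes "p \<in> hpoly"
  shows "hform p (lmono 0 k i b) = of_int (k + 1) / (2 * (of_real pi)\<^sup>2) * integral_S3 (\<lambda>Z. p Z * cnj (lmono 0 k i b Z))"
proof -
  have "hform p (lmono 0 k i b) = cnj (of_int (k + 1) / (2 * (of_real pi)\<^sup>2) * integral_S3 (\<lambda>Z. lmono 0 k i b Z * cnj (p Z)))"
    unfolding hform_hermitian[OF hpoly_lmono assms] hform_lmono_left ..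
  also have "\<dots> = of_int (k + 1) / (2 * (of_real pi)\<^sup>2) * integral_S3 (\<lambda>Z. cnj (lmono 0 k i b Z * cnj (p Z)))"
    unfolding integral_S3_cnj by simp
  finally show ?thesis by (simp add: mult.commute)
qed

text \<open>Spinors both of whose components are multiples of single basis functions of degree \<open>k\<close>; on these the
  forms are explicit multiples of integrals.\<close>

definition homog :: "int \<Rightarrow> (hc \<Rightarrow> spinor) \<Rightarrow> bool" where
  "homog k g \<longleftrightarrow> (\<forall>i. \<exists>c x y. (\<lambda>Z. g Z $ i) = (\<lambda>Z. c * lmono 0 k x y Z))"

lemma sform_homog:
  assumes f: "f \<in> hspin" and g: "homog k g"
  shows "sform f g = of_int (k + 1) / (2 * (of_real pi)\<^sup>2) * integral_S3 (\<lambda>Z. hdot (f Z) (g Z))"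
    and "sform g f = of_int (k + 1) / (2 * (of_real pi)\<^sup>2) * integral_S3 (\<lambda>Z. hdot (g Z) (f Z))"
proof -
  have 1: "hform (\<lambda>Z. f Z $ i) (\<lambda>Z. g Z $ i) = of_int (k + 1) / (2 * (of_real pi)\<^sup>2) * integral_S3 (\<lambda>Z. f Z $ i * cnj (g Z $ i))"
   and 2: "hform (\<lambda>Z. g Z $ i) (\<lambda>Z. f Z $ i) = of_int (k + 1) / (2 * (of_real pi)\<^sup>2) * integral_S3 (\<lambda>Z. g Z $ i * cnj (f Z $ i))"
   and 3: "sphere_bounded (\<lambda>Z. f Z $ i * cnj (g Z $ i))" and 4: "sphere_bounded (\<lambda>Z. g Z $ i * cnj (f Z $ i))" for i
  proof -
    obtain c x y where e: "(\<lambda>Z. g Z $ i) = (\<lambda>Z. c * lmono 0 k x y Z)" using g unfolding homog_def by blast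
    have e': "g Z $ i = c * lmono 0 k x y Z" for Z using fun_cong[OF e] .
    show "hform (\<lambda>Z. f Z $ i) (\<lambda>Z. g Z $ i) = of_int (k + 1) / (2 * (of_real pi)\<^sup>2) * integral_S3 (\<lambda>Z. f Z $ i * cnj (g Z $ i))"
      unfolding e e' hform_scale_right hform_lmono_right[OF hspin_nth[OF f]] 
      using integral_S3_sesq[of 1 "\<lambda>Z. f Z $ i" c "lmono 0 k x y"] by simp
    show "hform (\<lambda>Z. g Z $ i) (\<lambda>Z. f Z $ i) = of_int (k + 1) / (2 * (of_real pi)\<^sup>2) * integral_S3 (\<lambda>Z. g Z $ i * cnj (f Z $ i))"
      unfolding e e' hform_scale_left[OF hpoly_lmono] hform_lmono_left
      using integral_S3_sesq[of c "lmono 0 k x y" 1 "\<lambda>Z. f Z $ i"] by simp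
    show "sphere_bounded (\<lambda>Z. f Z $ i * cnj (g Z $ i))" "sphere_bounded (\<lambda>Z. g Z $ i * cnj (f Z $ i))"
      unfolding e' by (intro sphere_bounded_prod hpoly_laurent hspin_nth f hpoly_scale hpoly_lmono)+
  qed
  show "sform f g = of_int (k + 1) / (2 * (of_real pi)\<^sup>2) * integral_S3 (\<lambda>Z. hdot (f Z) (g Z))"
    unfolding sform_def 1 hdot_def sum_2 using 3 by (simp add: integral_S3_add distrib_left mult.commute)
  show "sform g f = of_int (k + 1) / (2 * (of_real pi)\<^sup>2) * integral_S3 (\<lambda>Z. hdot (g Z) (f Z))"
    unfolding sform_def 2 hdot_def sum_2 using 4 by (simp add: integral_S3_add distrib_left mult.commute)
qed

lemma homog_basis: "homog k (afun 0 k i b)" "homog k (bfun 0 k i b)" "homog (k - 1) (rfun k i b)" "homog (k + 1) (cfun k i b)"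
proof -
  have 1: "\<exists>c x y. (\<lambda>Z. lmono 0 k a d Z) = (\<lambda>Z. c * lmono 0 k x y Z)" for k a d
    by (rule exI[of _ 1]) auto
  have 2: "\<exists>c x y. (\<lambda>Z. - lmono 0 k a d Z) = (\<lambda>Z. c * lmono 0 k x y Z)" for k a d
    by (rule exI[of _ "-1"]) auto
  have 3: "\<exists>e x y. (\<lambda>Z. c * lmono 0 k a d Z) = (\<lambda>Z. e * lmono 0 k x y Z)" for c k a d
    by blast
  show "homog k (afun 0 k i b)" "homog k (bfun 0 k i b)" "homog (k - 1) (rfun k i b)" "homog (k + 1) (cfun k i b)"
    unfolding homog_def afun_def bfun_def rfun_def cfun_def forall_2 spin_nth
    using 1 2 3 by blast+
qed

lemma hdot_sphere_bounded:
  assumes "f \<in> laurent_spinors" "g \<in> laurent_spinors"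
  shows "sphere_bounded (\<lambda>Z. hdot (f Z) (g Z))"
proof -
  have "sphere_bounded (\<lambda>Z. f Z $ 1 * cnj (g Z $ 1) + f Z $ 2 * cnj (g Z $ 2))"
    using assms unfolding laurent_spinors_def by (intro sphere_bounded_add sphere_bounded_prod) auto
  then show ?thesis by (simp add: hdot_def sum_2 mult.commute)
qed

lemma hdot_unitary:
  assumes "is_quat X" "det X = 1"
  shows "hdot (X *v x) (X *v y) = hdot x y" "hdot x (X *v y) = hdot (adj X *v x) y" "hdot (adj X *v x) (adj X *v y) = hdot x y"
proof -
  have q: "X$2$2 = cnj (X$1$1)" "X$2$1 = - cnj (X$1$2)" using assms(1) by (auto simp: is_quat_def)
  have d: "X$1$1 * cnj (X$1$1) + X$1$2 * cnj (X$1$2) = 1" using assms(2) unfolding det_2 q by simp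
  show "hdot (X *v x) (X *v y) = hdot x y"
    unfolding hdot_def sum_2 matrix_vector_2 q complex_cnj_add complex_cnj_mult complex_cnj_minus complex_cnj_cnj using d by algebra
  show "hdot x (X *v y) = hdot (adj X *v x) y"
    unfolding hdot_def sum_2 matrix_vector_2 adj_nth q complex_cnj_add complex_cnj_mult complex_cnj_minus complex_cnj_cnj by algebra
  show "hdot (adj X *v x) (adj X *v y) = hdot x y"
    unfolding hdot_def sum_2 matrix_vector_2 adj_nth q complex_cnj_add complex_cnj_mult complex_cnj_minus complex_cnj_cnj using d by algebra
qed

text \<open>For a pair in the kernel, \<open>Z\<close> times the second component is harmonic, being minus the first
  component. As the second component is harmonic itself, the product rule leaves first order relations.\<close>

lemma kernel_relation:
  assumes r: "r \<in> bispin" "evalmap r = 0"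
  shows "partial 2 2 (\<lambda>Z. snd r Z $ 1) = partial 2 1 (\<lambda>Z. snd r Z $ 2)"
    and "partial 1 2 (\<lambda>Z. snd r Z $ 1) = partial 1 1 (\<lambda>Z. snd r Z $ 2)"
proof -
  have h: "fst r \<in> hspin" "snd r \<in> hspin" using r by (auto simp: bispin_def)
  let ?p = "\<lambda>Z. snd r Z $ 1" and ?q = "\<lambda>Z. snd r Z $ 2"
  have pq: "?p \<in> hpoly" "?q \<in> hpoly" using hspin_nth[OF h(2)] by auto
  have sm: "smooth ?p" "smooth ?q" "smooth (partial a b ?p)" "smooth (partial a b ?q)" for a b
    using pq hpoly_smooth hpoly_laurent laurent_partial laurent_smooth by blast+
  have z: "fst r Z $ i + Z $ i $ 1 * ?p Z + Z $ i $ 2 * ?q Z = 0" for Z i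
    using fun_cong[OF r(2), of Z] evalmap_nth[of r Z] exhaust_2_cases[of i] by (auto simp: )
  \<comment> \<open>the combination is minus a component of the harmonic first entry of the pair\<close>
  have L: "lap (\<lambda>Z. Z $ i $ 1 * ?p Z + Z $ i $ 2 * ?q Z) Z = 0" for Z i
  proof -
    have "(\<lambda>Z. Z $ i $ 1 * ?p Z + Z $ i $ 2 * ?q Z) = (\<lambda>Z. (-1) * fst r Z $ i)"
      using z by (auto simp: fun_eq_iff add_eq_0_iff add.assoc)
    then show ?thesis using lap_scale[OF hpoly_laurent[OF hspin_nth[OF h(1)]], of "-1" i Z] hpoly_harmonic[OF hspin_nth[OF h(1)], of i Z] by simp
  qed
  have sml: "(\<lambda>Z. Z $ a $ b * ?p Z) \<in> laurent_algebra" "(\<lambda>Z. Z $ a $ b * ?q Z) \<in> laurent_algebra" for a b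
    using pq by (intro laurent_entry_mult hpoly_laurent; simp)+
  have lapm: "lap (\<lambda>Z. Z $ a $ b * F Z) Z = Z $ a $ b * lap F Z + 4 * (if a = 1 \<and> b = 1 then partial 2 2 F Z else if a = 1 \<and> b = 2 then - partial 2 1 F Z
     else if a = 2 \<and> b = 1 then - partial 1 2 F Z else partial 1 1 F Z)" if F: "F \<in> laurent_algebra" and d: "det Z \<noteq> 0" for F a b Z
  proof -
    have sF: "smooth F" "smooth (partial c e F)" for c e using F laurent_partial laurent_smooth by blast+
    have 1: "partial c e (\<lambda>Z. Z $ a $ b * F Z) = (\<lambda>Z. (if c = a \<and> e = b then 1 else 0) * F Z + Z $ a $ b * partial c e F Z)" for c e
    proof
      fix Z show "partial c e (\<lambda>Z. Z $ a $ b * F Z) Z = (if c = a \<and> e = b then 1 else 0) * F Z + Z $ a $ b * partial c e F Z"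
        using partial_entry_mult[OF sF(1), of Z c e a b] laurent_singular[OF F, of Z] by (cases "det Z = 0") auto
    qed
    have 2: "partial c' e' (partial c e (\<lambda>Z. Z $ a $ b * F Z)) Z = (if c = a \<and> e = b then 1 else 0) * partial c' e' F Z
       + (if c' = a \<and> e' = b then 1 else 0) * partial c e F Z + Z $ a $ b * partial c' e' (partial c e F) Z" for c e c' e'
      unfolding 1 using partial_entry_mult[OF sF(2)[of c e] d, of c' e' a b]
      by (simp add: partial_add partial_cmult sF smooth_lin)
    show ?thesis unfolding lap_def 2 using exhaust_2_cases[of a] exhaust_2_cases[of b] by (auto simp: algebra_simps)
  qed
  show "partial 2 2 ?p = partial 2 1 ?q"
  proof
    fix Z show "partial 2 2 ?p Z = partial 2 1 ?q Z"
    proof (cases "det Z = 0")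
      case False
      then show ?thesis using L[of 1 Z] lap_add[OF sml, of 1 1 1 2 Z] lapm[OF hpoly_laurent[OF pq(1)] False, of 1 1] lapm[OF hpoly_laurent[OF pq(2)] False, of 1 2]
        hpoly_harmonic[OF pq(1), of Z] hpoly_harmonic[OF pq(2), of Z] by simp
    qed simp
  qed
  show "partial 1 2 ?p = partial 1 1 ?q"
  proof
    fix Z show "partial 1 2 ?p Z = partial 1 1 ?q Z"
    proof (cases "det Z = 0")
      case False
      then show ?thesis using L[of 2 Z] lap_add[OF sml, of 2 1 2 2 Z] lapm[OF hpoly_laurent[OF pq(1)] False, of 2 1] lapm[OF hpoly_laurent[OF pq(2)] False, of 2 2]
        hpoly_harmonic[OF pq(1), of Z] hpoly_harmonic[OF pq(2), of Z] by simp
    qed simp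
  qed
qed

text \<open>The first order relations are moved to the other side of the form, where partial derivatives become
  special conformal operators. One of the factors \<open>k + 1 - i\<close> and \<open>i\<close> obtained in this way is nonzero.\<close>

lemma kernel_cfun:
  assumes r: "r \<in> bispin" "evalmap r = 0" and b: "0 \<le> b" "b \<le> k"
  shows "sform (snd r) (cfun k i b) = 0"
proof -
  let ?p = "\<lambda>Z. snd r Z $ 1" and ?q = "\<lambda>Z. snd r Z $ 2"
  have pq: "?p \<in> hpoly" "?q \<in> hpoly" using r by (auto simp: bispin_def hspin_nth)
  let ?s = "hform ?p (lmono 0 (k + 1) i b) - hform ?q (lmono 0 (k + 1) i (b + 1))"
  have "hform (partial 2 2 ?p) (lmono 0 k i b) = hform (partial 2 1 ?q) (lmono 0 k i b)"
    unfolding kernel_relation(1)[OF r] ..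
  then have 1: "of_int (k + 1 - i) * ?s = 0"
    unfolding adjoint_partial_kop[OF pq(1) hpoly_lmono] adjoint_partial_kop[OF pq(2) hpoly_lmono] kop_lmono[OF b] hform_scale_right
    by (simp add: right_diff_distrib del: of_int_diff of_int_add)
  have "hform (partial 1 2 ?p) (lmono 0 k (i - 1) b) = hform (partial 1 1 ?q) (lmono 0 k (i - 1) b)"
    unfolding kernel_relation(2)[OF r] ..
  then have 2: "of_int i * ?s = 0"
    unfolding adjoint_partial_kop[OF pq(1) hpoly_lmono] adjoint_partial_kop[OF pq(2) hpoly_lmono] kop_lmono[OF b] hform_scale_right
    by (simp add: right_diff_distrib)
  have "?s = 0"
  proof (cases "i = 0")
    case True
    then show ?thesis using 1 b by (simp del: of_int_diff of_int_add)
  next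
    case False
    then show ?thesis using 2 by simp
  qed
  then show ?thesis
    using hform_scale_right[of ?q "-1" "lmono 0 (k + 1) i (b + 1)"] by (simp add: sform_def cfun_def)
qed

lemma hdot_minus: "hdot x (- y) = - hdot x y" "hdot (- x) y = - hdot x y"
  by (simp_all add: hdot_def sum_2)

lemma kernel_fst:
  assumes "evalmap r = 0"
  shows "fst r Z = - (Z *v snd r Z)"
  using fun_cong[OF assms, of Z] by (simp add: evalmap_def eq_neg_iff_add_eq_0)

lemma hspin_zero: "0 \<in> hspin"
  using fs.subspace_0[OF subspace_hspin] .

lemma sform_zero: "sform f 0 = 0" "sform 0 f = 0"
  using sform_scale_right[of f 0 0] sform_scale_left[OF hspin_zero, of 0 f] by (simp_all add: fs.scale_zero_left)

text \<open>On the sphere the first component of a kernel element is minus \<open>Z\<close> times the second one, and the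
  adjoint of \<open>Z\<close> turns \<open>afun\<close> into \<open>cfun\<close>; so the claim reduces to the previous relation.\<close>

lemma lift_afun:
  assumes b: "0 \<le> b" "b \<le> k"
  shows "(afun 0 k i b, 0) \<in> kernel_ortho"
  unfolding kernel_ortho_def
proof (intro CollectI conjI ballI impI)
  show "(afun 0 k i b, 0) \<in> bispin" by (simp add: bispin_def hspin_basis hspin_zero)
  fix r assume r: "r \<in> bispin" "evalmap r = 0"
  then have h: "fst r \<in> hspin" "snd r \<in> hspin" by (auto simp: bispin_def)
  have "sform (cfun k i b) (snd r) = 0"
    using kernel_cfun[OF r b] sform_hermitian[OF h(2) hspin_basis(4)] by simp
  moreover have "of_int (k + 1 + 1) / (2 * (of_real pi)\<^sup>2) \<noteq> (0 :: complex)"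
    using b by (simp del: of_int_add)
  ultimately have "integral_S3 (\<lambda>Z. hdot (cfun k i b Z) (snd r Z)) = 0"
    unfolding sform_homog(2)[OF h(2) homog_basis(4)] by (metis mult_eq_0_iff)
  also have "integral_S3 (\<lambda>Z. hdot (cfun k i b Z) (snd r Z)) = integral_S3 (\<lambda>Z. (-1) * hdot (afun 0 k i b Z) (fst r Z))"
  proof (rule integral_S3_cong)
    fix X assume X: "is_quat X" "det X = 1"
    show "hdot (cfun k i b X) (snd r X) = (-1) * hdot (afun 0 k i b X) (fst r X)"
      unfolding kernel_fst[OF r(2)] cfun_adj[OF b] hdot_minus hdot_unitary(2)[OF X] by simp
  qed (intro sphere_bounded_mult sphere_bounded_const hdot_sphere_bounded hspin_laurent h hspin_basis)+
  finally have "integral_S3 (\<lambda>Z. hdot (afun 0 k i b Z) (fst r Z)) = 0"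
    unfolding integral_S3_cmult by simp
  then show "wform (afun 0 k i b, 0) r = 0"
    by (simp add: wform_def sform_homog(2)[OF h(1) homog_basis(1)] sform_zero)
qed

lemma lift_cfun:
  assumes b: "0 \<le> b" "b \<le> k"
  shows "(0, cfun k i b) \<in> kernel_ortho"
  unfolding kernel_ortho_def
proof (intro CollectI conjI ballI impI)
  show "(0, cfun k i b) \<in> bispin" by (simp add: bispin_def hspin_basis hspin_zero)
  fix r assume r: "r \<in> bispin" "evalmap r = 0"
  then have h: "fst r \<in> hspin" "snd r \<in> hspin" by (auto simp: bispin_def)
  show "wform (0, cfun k i b) r = 0"
    using kernel_cfun[OF r b] sform_hermitian[OF h(2) hspin_basis(4)] by (simp add: wform_def sform_zero)
qed

text \<open>The weights are chosen to balance \<open>(k + 1) / (2 \<pi>\<^sup>2)\<close> and \<open>k / (2 \<pi>\<^sup>2)\<close>, the factors of the form in the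
  degrees \<open>k\<close> and \<open>k - 1\<close> of the two components, against each other; they add up to \<open>1\<close> so that the
  evaluation map gives \<open>bfun\<close>.\<close>

definition blift :: "int \<Rightarrow> int \<Rightarrow> int \<Rightarrow> bispinor" where
  "blift k i b = (fscale (- of_int k) (bfun 0 k i b), fscale (of_int (k + 1)) (rfun k i b))"

lemma blift_bispin: "blift k i b \<in> bispin"
  unfolding blift_def bispin_def
  by (intro SigmaI fs.subspace_scale[OF subspace_hspin] hspin_basis)

lemma lift_bfun: "blift k i b \<in> kernel_ortho"
  unfolding kernel_ortho_def
proof (intro CollectI conjI ballI impI)
  show "blift k i b \<in> bispin" by (rule blift_bispin)
  fix r assume r: "r \<in> bispin" "evalmap r = 0"
  then have h: "fst r \<in> hspin" "snd r \<in> hspin" by (auto simp: bispin_def)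
  have "integral_S3 (\<lambda>Z. hdot (bfun 0 k i b Z) (fst r Z)) = integral_S3 (\<lambda>Z. (-1) * hdot (rfun k i b Z) (snd r Z))"
  proof (rule integral_S3_cong)
    fix X assume X: "is_quat X" "det X = 1"
    show "hdot (bfun 0 k i b X) (fst r X) = (-1) * hdot (rfun k i b X) (snd r X)"
      unfolding kernel_fst[OF r(2)] mult_rfun[symmetric] hdot_minus hdot_unitary(1)[OF X] by simp
  qed (intro sphere_bounded_mult sphere_bounded_const hdot_sphere_bounded hspin_laurent h hspin_basis)+
  then have e: "integral_S3 (\<lambda>Z. hdot (bfun 0 k i b Z) (fst r Z)) = - integral_S3 (\<lambda>Z. hdot (rfun k i b Z) (snd r Z))"
    unfolding integral_S3_cmult by simp
  show "wform (blift k i b) r = 0"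
    unfolding wform_def blift_def fst_conv snd_conv sform_scale_left[OF hspin_basis(2)] sform_scale_left[OF hspin_basis(3)]
      sform_homog(2)[OF h(1) homog_basis(2)] sform_homog(2)[OF h(2) homog_basis(3)] e
    by simp
qed

lemma evalmap_lifts:
  "evalmap (afun 0 k i b, 0) = afun 0 k i b"
  "evalmap (blift k i b) = bfun 0 k i b"
  "0 \<le> b \<Longrightarrow> b \<le> k \<Longrightarrow> evalmap (0, cfun k i b) = afun 1 k i b"
proof -
  show "evalmap (afun 0 k i b, 0) = afun 0 k i b" by (simp add: fun_eq_iff evalmap_def)
  show "evalmap (0, cfun k i b) = afun 1 k i b" if "0 \<le> b" "b \<le> k"
    using that by (simp add: fun_eq_iff evalmap_def mult_cfun)
  have "Z *v (c *s x) = c *s (Z *v x)" for Z :: hc and c x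
    by (rule spinor_eqI) (simp_all add: matrix_vector_2 algebra_simps)
  then show "evalmap (blift k i b) = bfun 0 k i b"
    by (simp add: fun_eq_iff evalmap_def blift_def fscale_def mult_rfun vec_eq_iff algebra_simps)
qed

lemma kernel_ortho_bispin: "w \<in> kernel_ortho \<Longrightarrow> w \<in> bispin"
  by (simp add: kernel_ortho_def)

lemma kernel_ortho_add: "u \<in> kernel_ortho \<Longrightarrow> v \<in> kernel_ortho \<Longrightarrow> u + v \<in> kernel_ortho"
  by (simp add: kernel_ortho_def bispin_add wform_add_left)

lemma kernel_ortho_scale: "u \<in> kernel_ortho \<Longrightarrow> wscale c u \<in> kernel_ortho"
  by (simp add: kernel_ortho_def bispin_scale wform_scale_left)

lemma kernel_ortho_zero: "0 \<in> kernel_ortho"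
  using kernel_ortho_scale[OF lift_bfun, of 0] by (simp add: wscale_def fs.scale_zero_left zero_prod_def)

lemma evalmap_zero: "evalmap 0 = 0"
  by (simp add: fun_eq_iff evalmap_def)

lemma lift_exists:
  assumes "u \<in> U_plus"
  shows "\<exists>w\<in>kernel_ortho. evalmap w = u"
  using assms unfolding U_plus_span
proof (induction rule: fs.span_induct_alt)
  case base
  then show ?case using kernel_ortho_zero evalmap_zero by blast
next
  case (step c x y)
  then obtain w where w: "w \<in> kernel_ortho" "evalmap w = y" by blast
  have "\<exists>v\<in>kernel_ortho. evalmap v = x"
  proof -
    have A: "\<exists>v\<in>kernel_ortho. evalmap v = afun j k i b" if "j = 0 \<or> j = 1" for j k i b
    proof (cases "0 \<le> b \<and> b \<le> k")
      case True
      then show ?thesis using that lift_afun lift_cfun evalmap_lifts by metis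
    next
      case False
      then show ?thesis using bfun_range(2)[of b k j i] kernel_ortho_zero evalmap_zero by metis
    qed
    then show ?thesis using step(1) lift_bfun evalmap_lifts(2) unfolding plus_basis_def by blast
  qed
  then obtain v where v: "v \<in> kernel_ortho" "evalmap v = x" by blast
  show ?case
    using kernel_ortho_add[OF kernel_ortho_scale[OF v(1), of c] w(1)] by (metis evalmap_add evalmap_scale v(2) w(2))
qed

text \<open>Any two lifts orthogonal to the kernel have the same products with such lifts, so the choice does
  not matter.\<close>

definition lift :: "(hc \<Rightarrow> spinor) \<Rightarrow> bispinor" where
  "lift u = (SOME w. w \<in> kernel_ortho \<and> evalmap w = u)"

definition plus_form :: "(hc \<Rightarrow> spinor) \<Rightarrow> (hc \<Rightarrow> spinor) \<Rightarrow> complex" where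
  "plus_form u v = wform (lift u) (lift v)"

lemma lift: "u \<in> U_plus \<Longrightarrow> lift u \<in> kernel_ortho" "u \<in> U_plus \<Longrightarrow> evalmap (lift u) = u"
  using someI_ex[of "\<lambda>w. w \<in> kernel_ortho \<and> evalmap w = u"] lift_exists[of u] unfolding lift_def by blast+

text \<open>One of the two arguments may be any lift as long as the other one is orthogonal to the kernel. This
  makes \<open>plus_form\<close> independent of choices.\<close>

lemma wform_lift_left:
  assumes "w \<in> bispin" "w' \<in> bispin" "evalmap w = evalmap w'" "v \<in> kernel_ortho"
  shows "wform w v = wform w' v" "wform v w = wform v w'"
proof -
  have v: "v \<in> bispin" using kernel_ortho_bispin[OF assms(4)] .
  have d: "w - w' \<in> bispin" using bispin_diff assms by blast
  have "evalmap (w - w') = 0" using assms(3) evalmap_diff by simp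
  then have "wform v (w - w') = 0" using assms(4) d unfolding kernel_ortho_def by blast
  then have "wform (w - w') v = 0" using wform_hermitian[OF v d] by simp
  then show 1: "wform w v = wform w' v" using wform_diff_left[OF assms(1,2) v] by simp
  show "wform v w = wform v w'" using wform_hermitian[OF assms(1) v] wform_hermitian[OF assms(2) v] 1 by simp
qed

lemma plus_form_eq:
  assumes "w \<in> kernel_ortho" "w' \<in> kernel_ortho"
  shows "plus_form (evalmap w) (evalmap w') = wform w w'"
proof -
  note b = kernel_ortho_bispin
  have U: "evalmap w \<in> U_plus" "evalmap w' \<in> U_plus" using evalmap_U_plus b assms by blast+
  show ?thesis unfolding plus_form_def
    using wform_lift_left(1)[OF b[OF lift(1)[OF U(1)]] b[OF assms(1)] lift(2)[OF U(1)] lift(1)[OF U(2)]]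
      wform_lift_left(2)[OF b[OF lift(1)[OF U(2)]] b[OF assms(2)] lift(2)[OF U(2)] assms(1)] by simp
qed

lemma sform_afun_pos: "sform (afun 0 0 0 0) (afun 0 0 0 0) = 1"
proof -
  have "lmono 0 0 (-1) 0 = (\<lambda>Z. 0)" by (rule lmono_outside) simp
  then have "(\<lambda>Z. afun 0 0 0 0 Z $ 2) = (\<lambda>Z. 0 * lmono 0 0 0 0 Z)" by (simp add: afun_def)
  moreover have "(\<lambda>Z. afun 0 0 0 0 Z $ 1) = lmono 0 0 0 0" by (simp add: afun_def)
  ultimately show ?thesis unfolding sform_def
    by (simp only: hform_scale_left[OF hpoly_lmono] hform_lmono) (simp add: tnorm_def)
qed

lemma sform_cfun_pos: "sform (cfun 0 0 0) (cfun 0 0 0) = 2"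
proof -
  have "(\<lambda>Z. cfun 0 0 0 Z $ 2) = (\<lambda>Z. (-1) * lmono 0 1 0 1 Z)" "(\<lambda>Z. cfun 0 0 0 Z $ 1) = lmono 0 1 0 0" by (simp_all add: cfun_def)
  then show ?thesis unfolding sform_def
    by (simp only: hform_scale_left[OF hpoly_lmono] hform_scale_right hform_lmono) (simp add: tnorm_def)
qed

text \<open>A function whose products vanish has a lift orthogonal to all pairs, so nondegeneracy is inherited.
  The constant spinors and their products with \<open>N(Z)\<close> show that the form is indefinite.\<close>

lemma plus_form_pseudounitary: "pseudounitary U_plus plus_form"
  unfolding pseudounitary_def
proof (intro conjI ballI allI impI)
  fix u v w assume u: "u \<in> U_plus" and v: "v \<in> U_plus" and w: "w \<in> U_plus"
  note l = lift[OF u] lift[OF v] lift[OF w]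
  show "plus_form (u + v) w = plus_form u w + plus_form v w"
    using plus_form_eq[OF kernel_ortho_add[OF l(1) l(3)] l(5)] plus_form_eq[OF l(1) l(5)] plus_form_eq[OF l(3) l(5)]
    unfolding evalmap_add l by (simp add: wform_add_left kernel_ortho_bispin l)
next
  fix c u w assume u: "u \<in> U_plus" and w: "w \<in> U_plus"
  note l = lift[OF u] lift[OF w]
  show "plus_form (fscale c u) w = c * plus_form u w"
    using plus_form_eq[OF kernel_ortho_scale[OF l(1)] l(3), of c] plus_form_eq[OF l(1) l(3)]
    unfolding evalmap_scale l by (simp add: wform_scale_left kernel_ortho_bispin l)
next
  fix u w assume u: "u \<in> U_plus" and w: "w \<in> U_plus"
  show "plus_form w u = cnj (plus_form u w)"
    unfolding plus_form_def by (intro wform_hermitian kernel_ortho_bispin lift u w)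
next
  fix u assume u: "u \<in> U_plus" and z: "\<forall>w\<in>U_plus. plus_form u w = 0"
  have "wform (lift u) v = 0" if v: "v \<in> bispin" for v
  proof -
    have U: "evalmap v \<in> U_plus" by (rule evalmap_U_plus[OF v])
    have "wform (lift u) v = wform (lift u) (lift (evalmap v))"
      by (rule wform_lift_left(2)[OF v kernel_ortho_bispin[OF lift(1)[OF U]] lift(2)[OF U, symmetric] lift(1)[OF u]])
    then show ?thesis using z U unfolding plus_form_def by simp
  qed
  from wform_nondegenerate[OF kernel_ortho_bispin[OF lift(1)[OF u]] this]
  have "lift u = 0" by (simp add: prod_eq_iff)
  then show "u = 0" using lift(2)[OF u] evalmap_zero by simp
next
  have "plus_form (afun 0 0 0 0) (afun 0 0 0 0) = 1"
    using plus_form_eq[OF lift_afun lift_afun, of 0 0 0 0 0 0] unfolding evalmap_lifts by (simp add: wform_def sform_afun_pos sform_zero)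
  then show "\<exists>u\<in>U_plus. 0 < Re (plus_form u u)" by (intro bexI[of _ "afun 0 0 0 0"] afun_plus) auto
next
  have "plus_form (afun 1 0 0 0) (afun 1 0 0 0) = - 2"
    using plus_form_eq[OF lift_cfun lift_cfun, of 0 0 0 0 0 0] by (simp add: evalmap_lifts(3) wform_def sform_cfun_pos sform_zero)
  then show "\<exists>u\<in>U_plus. Re (plus_form u u) < 0" by (intro bexI[of _ "afun 1 0 0 0"] afun_plus) auto
qed

subsection \<open>Values on the bases\<close>

lemma plus_form_values:
  assumes b: "0 \<le> b" "b \<le> k" "0 \<le> b'" "b' \<le> k'"
  shows "plus_form (afun 0 k i b) (afun 0 k' i' b') = of_int (k + 1) / (2 * (of_real pi)\<^sup>2) * integral_S3 (\<lambda>X. hdot (afun 0 k i b X) (afun 0 k' i' b' X))"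
    and "plus_form (afun 1 k i b) (afun 1 k' i' b') = - of_int (k + 2) / (2 * (of_real pi)\<^sup>2) * integral_S3 (\<lambda>X. hdot (afun 1 k i b X) (afun 1 k' i' b' X))"
    and "plus_form (bfun 0 k i b) (bfun 0 k' i' b') = - of_int (k * (k + 1)) / (2 * (of_real pi)\<^sup>2) * integral_S3 (\<lambda>X. hdot (bfun 0 k i b X) (bfun 0 k' i' b' X))"
    and "plus_form (afun 0 k i b) (bfun 0 k' i' b') = 0" "plus_form (afun 0 k i b) (afun 1 k' i' b') = 0" "plus_form (bfun 0 k i b) (afun 1 k' i' b') = 0"
    and "plus_form (bfun 0 k i b) (afun 0 k' i' b') = 0" "plus_form (afun 1 k i b) (afun 0 k' i' b') = 0" "plus_form (afun 1 k i b) (bfun 0 k' i' b') = 0"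
proof -
  \<comment> \<open>orthogonality to these kernel elements separates the second family from the other two\<close>
  have kern: "(bfun 0 k i b, fscale (-1) (rfun k i b)) \<in> bispin" "evalmap (bfun 0 k i b, fscale (-1) (rfun k i b)) = 0" for k i b
  proof -
    show "(bfun 0 k i b, fscale (-1) (rfun k i b)) \<in> bispin"
      unfolding bispin_def by (intro SigmaI fs.subspace_scale[OF subspace_hspin] hspin_basis)
    show "evalmap (bfun 0 k i b, fscale (-1) (rfun k i b)) = 0"
      by (rule ext, rule spinor_eqI) (simp_all add: evalmap_nth mult_rfun[symmetric] matrix_vector_2)
  qed
  have ab: "sform (afun 0 k i b) (bfun 0 k' i' b') = 0" if "0 \<le> b" "b \<le> k" for k i b k' i' b'
    using lift_afun[OF that, of i] kern[of k' i' b'] unfolding kernel_ortho_def by (fastforce simp: wform_def sform_zero)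
  have cr: "sform (cfun k i b) (rfun k' i' b') = 0" if "0 \<le> b" "b \<le> k" for k i b k' i' b'
  proof -
    have "wform (0, cfun k i b) (bfun 0 k' i' b', fscale (-1) (rfun k' i' b')) = 0"
      using lift_cfun[OF that, of i] kern[of k' i' b'] unfolding kernel_ortho_def by blast
    then show ?thesis unfolding wform_def fst_conv snd_conv sform_zero sform_scale_right by simp
  qed
  have ba: "sform (bfun 0 k' i' b') (afun 0 k i b) = 0" if "0 \<le> b" "b \<le> k" for k i b k' i' b'
    using ab[OF that, of i k' i' b'] sform_hermitian[OF hspin_basis(1) hspin_basis(2)] by simp
  have rc: "sform (rfun k' i' b') (cfun k i b) = 0" if "0 \<le> b" "b \<le> k" for k i b k' i' b'
    using cr[OF that, of i k' i' b'] sform_hermitian[OF hspin_basis(4) hspin_basis(3)] by simp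
  note A = lift_afun[OF b(1,2), of i] lift_afun[OF b(3,4), of i']
  note C = lift_cfun[OF b(1,2), of i] lift_cfun[OF b(3,4), of i']
  note B = lift_bfun[of k i b] lift_bfun[of k' i' b']
  note e = evalmap_lifts(1) evalmap_lifts(2) evalmap_lifts(3)[OF b(1,2)] evalmap_lifts(3)[OF b(3,4)]
  note w = wform_def fst_conv snd_conv blift_def sform_zero sform_scale_right sform_scale_left[OF hspin_basis(2)] sform_scale_left[OF hspin_basis(3)]
  show "plus_form (afun 0 k i b) (afun 0 k' i' b') = of_int (k + 1) / (2 * (of_real pi)\<^sup>2) * integral_S3 (\<lambda>X. hdot (afun 0 k i b X) (afun 0 k' i' b' X))"
    using plus_form_eq[OF A(1) A(2)] unfolding e w sform_homog(2)[OF hspin_basis(1) homog_basis(1)] by simp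
  have 1: "integral_S3 (\<lambda>X. hdot (afun 1 k i b X) (afun 1 k' i' b' X)) = integral_S3 (\<lambda>X. hdot (cfun k i b X) (cfun k' i' b' X))"
  proof (rule integral_S3_cong)
    fix X assume X: "is_quat X" "det X = 1"
    show "hdot (afun 1 k i b X) (afun 1 k' i' b' X) = hdot (cfun k i b X) (cfun k' i' b' X)"
      unfolding mult_cfun[OF b(1,2), symmetric] mult_cfun[OF b(3,4), symmetric] hdot_unitary(1)[OF X] ..
  qed (intro hdot_sphere_bounded hspin_laurent hspin_basis afun_laurent)+
  show "plus_form (afun 1 k i b) (afun 1 k' i' b') = - of_int (k + 2) / (2 * (of_real pi)\<^sup>2) * integral_S3 (\<lambda>X. hdot (afun 1 k i b X) (afun 1 k' i' b' X))"
  proof -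
    have "k + 1 + 1 = k + 2" by simp
    then show ?thesis
      using plus_form_eq[OF C(1) C(2)] unfolding e w sform_homog(2)[OF hspin_basis(4) homog_basis(4)] 1
      by (simp only: diff_0 minus_mult_left minus_divide_left)
  qed
  have 2: "integral_S3 (\<lambda>X. hdot (bfun 0 k i b X) (bfun 0 k' i' b' X)) = integral_S3 (\<lambda>X. hdot (rfun k i b X) (rfun k' i' b' X))"
  proof (rule integral_S3_cong)
    fix X assume X: "is_quat X" "det X = 1"
    show "hdot (bfun 0 k i b X) (bfun 0 k' i' b' X) = hdot (rfun k i b X) (rfun k' i' b' X)"
      unfolding mult_rfun[symmetric] hdot_unitary(1)[OF X] ..
  qed (intro hdot_sphere_bounded hspin_laurent hspin_basis)+
  \<comment> \<open>for \<open>x = k\<close> and \<open>y = k'\<close>: the contributions of the two components of the lifts combine\<close>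
  have gen: "- y * (- x * ((x + 1) * w * I)) - (y + 1) * ((x + 1) * ((x - 1 + 1) * w * I)) = - (x * (x + 1)) * w * I" for x y w I :: complex
    by algebra
  show "plus_form (bfun 0 k i b) (bfun 0 k' i' b') = - of_int (k * (k + 1)) / (2 * (of_real pi)\<^sup>2) * integral_S3 (\<lambda>X. hdot (bfun 0 k i b X) (bfun 0 k' i' b' X))"
    using plus_form_eq[OF B(1) B(2)] unfolding e unfolding w sform_homog(2)[OF hspin_basis(2) homog_basis(2)] sform_homog(2)[OF hspin_basis(3) homog_basis(3)] 2
    unfolding complex_cnj_minus complex_cnj_of_int of_int_add of_int_mult of_int_1 of_int_diff divide_inverse
      complex_cnj_add complex_cnj_one gen .
  show "plus_form (afun 0 k i b) (bfun 0 k' i' b') = 0"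
    using plus_form_eq[OF A(1) B(2)] unfolding e unfolding w ab[OF b(1,2)] by simp
  show "plus_form (afun 0 k i b) (afun 1 k' i' b') = 0"
    using plus_form_eq[OF A(1) C(2)] unfolding e w by simp
  show "plus_form (bfun 0 k i b) (afun 1 k' i' b') = 0"
    using plus_form_eq[OF B(1) C(2)] unfolding e unfolding w rc[OF b(3,4)] by simp
  show "plus_form (bfun 0 k i b) (afun 0 k' i' b') = 0"
    using plus_form_eq[OF B(1) A(2)] unfolding e unfolding w ba[OF b(3,4)] by simp
  show "plus_form (afun 1 k i b) (afun 0 k' i' b') = 0"
    using plus_form_eq[OF C(1) A(2)] unfolding e w by simp
  show "plus_form (afun 1 k i b) (bfun 0 k' i' b') = 0"
    using plus_form_eq[OF C(1) B(2)] unfolding e unfolding w cr[OF b(1,2)] by simp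
qed

section \<open>The action of the Lie algebra on pairs of harmonic spinors\<close>

definition rho_part :: "gl2hc \<Rightarrow> 2 \<Rightarrow> 2 \<Rightarrow> (hc \<Rightarrow> complex) \<Rightarrow> hc \<Rightarrow> complex" where
  "rho_part Y a b F Z = ll Y $ a $ b * kop a b F Z + (- ur Y $ a $ b) * partial a b F Z
     + (- ul Y $ a $ b) * lop a b F Z + lr Y $ a $ b * rop a b F Z"

text \<open>The differential of the scalar representation, arranged by the entries of \<open>Y\<close>.\<close>

definition rho :: "gl2hc \<Rightarrow> (hc \<Rightarrow> complex) \<Rightarrow> hc \<Rightarrow> complex" where
  "rho Y F Z = rho_part Y 1 1 F Z + rho_part Y 1 2 F Z + rho_part Y 2 1 F Z + rho_part Y 2 2 F Z"

lemma rho_part_hpoly: "p \<in> hpoly \<Longrightarrow> rho_part Y a b p \<in> hpoly"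
  unfolding rho_part_def[abs_def]
  by (intro hpoly_add hpoly_scale linear_op_in[OF linear_op_kop] linear_op_in[OF linear_op_partial]
      linear_op_in[OF linear_op_lop] linear_op_in[OF linear_op_rop])

lemma rho_hpoly: "p \<in> hpoly \<Longrightarrow> rho Y p \<in> hpoly"
  unfolding rho_def[abs_def] by (intro hpoly_add rho_part_hpoly)

lemma hform_comb4_left:
  assumes "p \<in> hpoly" "q \<in> hpoly" "r \<in> hpoly" "s \<in> hpoly" "t \<in> hpoly"
  shows "hform (\<lambda>Z. a * p Z + b * q Z + c * r Z + d * s Z) t = a * hform p t + b * hform q t + c * hform r t + d * hform s t"
  using assms by (simp add: hform_add_left hform_scale_left hpoly_add hpoly_scale)

lemma hform_comb4_right:
  assumes "p \<in> hpoly" "q \<in> hpoly" "r \<in> hpoly" "s \<in> hpoly" "t \<in> hpoly"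
  shows "hform t (\<lambda>Z. a * p Z + b * q Z + c * r Z + d * s Z) = cnj a * hform t p + cnj b * hform t q + cnj c * hform t r + cnj d * hform t s"
  using assms by (simp add: hform_add_right hform_scale_right hpoly_add hpoly_scale)

lemma u22_entries:
  assumes "Y \<in> u22"
  shows "ul Y $ a $ b = - cnj (ul Y $ b $ a)" "lr Y $ a $ b = - cnj (lr Y $ b $ a)" "ll Y $ a $ b = cnj (ur Y $ b $ a)"
proof -
  have e: "ul Y = - conj_transpose (ul Y)" "lr Y = - conj_transpose (lr Y)" "ll Y = conj_transpose (ur Y)"
    using assms by (auto simp: u22_def)
  show "ul Y $ a $ b = - cnj (ul Y $ b $ a)"
    using arg_cong[OF e(1), of "\<lambda>M. M $ a $ b"] unfolding conj_transpose_def vector_uminus_component vec_lambda_beta .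
  show "lr Y $ a $ b = - cnj (lr Y $ b $ a)"
    using arg_cong[OF e(2), of "\<lambda>M. M $ a $ b"] unfolding conj_transpose_def vector_uminus_component vec_lambda_beta .
  show "ll Y $ a $ b = cnj (ur Y $ b $ a)"
    using arg_cong[OF e(3), of "\<lambda>M. M $ a $ b"] unfolding conj_transpose_def vec_lambda_beta .
qed

text \<open>Skew-adjointness is the combination of the adjointness relations with the symmetries of the entries
  of elements of \<open>u(2,2)\<close>: the diagonal blocks are skew-Hermitian, and the off-diagonal blocks are
  exchanged together with the two kinds of operators.\<close>

lemma rho_part_adjoint:
  assumes Y: "Y \<in> u22" and p: "p \<in> hpoly" and q: "q \<in> hpoly"
  shows "hform (rho_part Y a b p) q + hform p (rho_part Y b a q) = 0"
proof -
  note m = linear_op_in[OF linear_op_kop] linear_op_in[OF linear_op_partial] linear_op_in[OF linear_op_lop] linear_op_in[OF linear_op_rop]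
  have l: "hform (rho_part Y a b p) q = ll Y $ a $ b * hform p (partial b a q) + (- ur Y $ a $ b) * hform p (kop b a q)
     + (- ul Y $ a $ b) * hform p (lop b a q) + lr Y $ a $ b * hform p (rop b a q)"
    unfolding rho_part_def[abs_def] hform_comb4_left[OF m(1)[OF p] m(2)[OF p] m(3)[OF p] m(4)[OF p] q]
      adjoint_kop_partial[OF p q] adjoint_partial_kop[OF p q] adjoint_lop[OF p q] adjoint_rop[OF p q] ..
  have r: "hform p (rho_part Y b a q) = cnj (ll Y $ b $ a) * hform p (kop b a q) + cnj (- ur Y $ b $ a) * hform p (partial b a q)
     + cnj (- ul Y $ b $ a) * hform p (lop b a q) + cnj (lr Y $ b $ a) * hform p (rop b a q)"
    unfolding rho_part_def[abs_def] hform_comb4_right[OF m(1)[OF q] m(2)[OF q] m(3)[OF q] m(4)[OF q] p] ..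
  show ?thesis
    unfolding l r u22_entries(1)[OF Y, of a b] u22_entries(2)[OF Y, of a b] u22_entries(3)[OF Y, of a b] u22_entries(3)[OF Y, of b a]
    by (simp add: algebra_simps)
qed

lemma rho_adjoint:
  assumes Y: "Y \<in> u22" and p: "p \<in> hpoly" and q: "q \<in> hpoly"
  shows "hform (rho Y p) q + hform p (rho Y q) = 0"
proof -
  have l: "hform (rho Y p) q = hform (rho_part Y 1 1 p) q + hform (rho_part Y 1 2 p) q + hform (rho_part Y 2 1 p) q + hform (rho_part Y 2 2 p) q"
    unfolding rho_def[abs_def] using p q by (simp add: hform_add_left hpoly_add rho_part_hpoly)
  have r: "hform p (rho Y q) = hform p (rho_part Y 1 1 q) + hform p (rho_part Y 1 2 q) + hform p (rho_part Y 2 1 q) + hform p (rho_part Y 2 2 q)"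
    unfolding rho_def[abs_def] using p q by (simp add: hform_add_right hpoly_add rho_part_hpoly)
  show ?thesis unfolding l r
    using rho_part_adjoint[OF Y p q, of 1 1] rho_part_adjoint[OF Y p q, of 1 2] rho_part_adjoint[OF Y p q, of 2 1] rho_part_adjoint[OF Y p q, of 2 2]
    by algebra
qed

text \<open>The tensor product action: \<open>rho\<close> on each component, plus the matrix \<open>Y\<close> with its off-diagonal blocks
  negated acting on \<open>\<complex>\<^sup>4\<close>.\<close>

definition wact :: "gl2hc \<Rightarrow> bispinor \<Rightarrow> bispinor" where
  "wact Y w =
    (\<lambda>Z. \<chi> i. rho Y (\<lambda>Z. fst w Z $ i) Z + (ul Y $ i $ 1 * fst w Z $ 1 + ul Y $ i $ 2 * fst w Z $ 2 + (- ur Y $ i $ 1) * snd w Z $ 1 + (- ur Y $ i $ 2) * snd w Z $ 2),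
     \<lambda>Z. \<chi> i. rho Y (\<lambda>Z. snd w Z $ i) Z + ((- ll Y $ i $ 1) * fst w Z $ 1 + (- ll Y $ i $ 2) * fst w Z $ 2 + lr Y $ i $ 1 * snd w Z $ 1 + lr Y $ i $ 2 * snd w Z $ 2))"

lemma wact_bispin:
  assumes "w \<in> bispin"
  shows "wact Y w \<in> bispin"
proof -
  have h: "fst w \<in> hspin" "snd w \<in> hspin" using assms by (auto simp: bispin_def)
  show ?thesis unfolding wact_def bispin_def hspin_def mem_Times_iff fst_conv snd_conv mem_Collect_eq vec_lambda_beta
    by (intro conjI allI hpoly_add hpoly_scale rho_hpoly hspin_nth h)
qed

text \<open>The scalar part is skew by \<open>rho_adjoint\<close>, the matrix part because elements of \<open>u(2,2)\<close> preserve the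
  form of signature \<open>(2,2)\<close>.\<close>

lemma wform_invariant:
  assumes Y: "Y \<in> u22" and u: "u \<in> bispin" and v: "v \<in> bispin"
  shows "wform (wact Y u) v + wform u (wact Y v) = 0"
proof -
  have hu: "(\<lambda>Z. fst u Z $ i) \<in> hpoly" "(\<lambda>Z. snd u Z $ i) \<in> hpoly" for i using u by (auto simp: bispin_def hspin_nth)
  have hv: "(\<lambda>Z. fst v Z $ i) \<in> hpoly" "(\<lambda>Z. snd v Z $ i) \<in> hpoly" for i using v by (auto simp: bispin_def hspin_nth)
  have l: "hform (\<lambda>Z. rho Y p Z + (a * fst u Z $ 1 + b * fst u Z $ 2 + c * snd u Z $ 1 + d * snd u Z $ 2)) q
     = hform (rho Y p) q + (a * hform (\<lambda>Z. fst u Z $ 1) q + b * hform (\<lambda>Z. fst u Z $ 2) q + c * hform (\<lambda>Z. snd u Z $ 1) q + d * hform (\<lambda>Z. snd u Z $ 2) q)"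
    if "p \<in> hpoly" "q \<in> hpoly" for p q a b c d
    using that hu by (subst hform_add_left) (auto intro!: hpoly_add hpoly_scale rho_hpoly simp: hform_comb4_left)
  have r: "hform q (\<lambda>Z. rho Y p Z + (a * fst v Z $ 1 + b * fst v Z $ 2 + c * snd v Z $ 1 + d * snd v Z $ 2))
     = hform q (rho Y p) + (cnj a * hform q (\<lambda>Z. fst v Z $ 1) + cnj b * hform q (\<lambda>Z. fst v Z $ 2) + cnj c * hform q (\<lambda>Z. snd v Z $ 1) + cnj d * hform q (\<lambda>Z. snd v Z $ 2))"
    if "p \<in> hpoly" "q \<in> hpoly" for p q a b c d
    using that hv by (subst hform_add_right) (auto intro!: hpoly_add hpoly_scale rho_hpoly simp: hform_comb4_right)
  note ad = rho_adjoint[OF Y hu(1) hv(1), of 1 1] rho_adjoint[OF Y hu(1) hv(1), of 2 2] rho_adjoint[OF Y hu(2) hv(2), of 1 1] rho_adjoint[OF Y hu(2) hv(2), of 2 2]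
  note Ye = u22_entries(1)[OF Y, of 1 1] u22_entries(1)[OF Y, of 2 1] u22_entries(1)[OF Y, of 2 2] 
    u22_entries(2)[OF Y, of 1 1] u22_entries(2)[OF Y, of 2 1] u22_entries(2)[OF Y, of 2 2]
    u22_entries(3)[OF Y]
  have cA: "cnj (ul Y $ a $ b) = - ul Y $ b $ a" "cnj (lr Y $ a $ b) = - lr Y $ b $ a" "cnj (ur Y $ a $ b) = ll Y $ b $ a" "cnj (ll Y $ a $ b) = ur Y $ b $ a" for a b
    using u22_entries(1)[OF Y, of b a] u22_entries(2)[OF Y, of b a] u22_entries(3)[OF Y, of b a] u22_entries(3)[OF Y, of a b] by simp_all
  show ?thesis
    unfolding wform_def sform_def wact_def fst_conv snd_conv vec_lambda_beta l[OF hu(1) hv(1)] l[OF hu(2) hv(2)] r[OF hv(1) hu(1)] r[OF hv(2) hu(2)]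
      complex_cnj_minus cA
    using ad by algebra
qed

definition dirX :: "hc \<Rightarrow> (hc \<Rightarrow> complex) \<Rightarrow> hc \<Rightarrow> complex" where
  "dirX X F Z = X$1$1 * partial 1 1 F Z + X$1$2 * partial 1 2 F Z + X$2$1 * partial 2 1 F Z + X$2$2 * partial 2 2 F Z"

text \<open>The vector field of the fractional linear action \<open>Z \<mapsto> (a' - Z c')\<^sup>-\<^sup>1 (- b' + Z d')\<close>.\<close>

definition lieX :: "gl2hc \<Rightarrow> hc \<Rightarrow> hc" where
  "lieX Y Z = - ur Y + Z ** lr Y - ul Y ** Z + Z ** ll Y ** Z"

text \<open>The differential of \<^const>\<open>pi_l\<close>, as a first order differential operator.\<close>

definition lie :: "gl2hc \<Rightarrow> (hc \<Rightarrow> spinor) \<Rightarrow> hc \<Rightarrow> spinor" where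
  "lie Y f Z = (ul Y - Z ** ll Y) *v f Z - trace (ul Y - Z ** ll Y) *s f Z + (\<chi> i. dirX (lieX Y Z) (\<lambda>Z. f Z $ i) Z)"

lemma trace_2: "trace (A :: hc) = A$1$1 + A$2$2"
  by (simp add: trace_def sum_2)

lemma lieX_nth: "lieX Y Z $ i $ j = - ur Y $ i $ j + (Z$i$1 * lr Y $ 1 $ j + Z$i$2 * lr Y $ 2 $ j) - (ul Y $ i $ 1 * Z$1$j + ul Y $ i $ 2 * Z$2$j)
   + ((Z$i$1 * ll Y $ 1 $ 1 + Z$i$2 * ll Y $ 2 $ 1) * Z$1$j + (Z$i$1 * ll Y $ 1 $ 2 + Z$i$2 * ll Y $ 2 $ 2) * Z$2$j)"
  by (simp add: lieX_def matrix_mult_2)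

lemma rho_dir: "rho Y F Z = - trace (ul Y - Z ** ll Y) * F Z + dirX (lieX Y Z) F Z"
  unfolding rho_def rho_part_def kop_def lop_def rop_def dirX_def lieX_nth trace_2 matrix_mult_2 vector_minus_component
  by (simp add: algebra_simps)

text \<open>The intertwining property that makes the tensor product act on the quotient. It is a polynomial
  identity once the derivatives of \<open>Z\<close> times the second component are expanded.\<close>

lemma lie_evalmap:
  assumes w: "w \<in> bispin" and Z: "det Z \<noteq> 0"
  shows "lie Y (evalmap w) Z = evalmap (wact Y w) Z"
proof -
  have h: "smooth (\<lambda>Z. fst w Z $ i)" "smooth (\<lambda>Z. snd w Z $ i)" for i
    using w by (auto simp: bispin_def hspin_nth hpoly_smooth)
  have d: "dirX X (\<lambda>Z. fst w Z $ i + Z$i$1 * snd w Z $ 1 + Z$i$2 * snd w Z $ 2) Z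
    = dirX X (\<lambda>Z. fst w Z $ i) Z + (X$i$1 * snd w Z $ 1 + Z$i$1 * dirX X (\<lambda>Z. snd w Z $ 1) Z) + (X$i$2 * snd w Z $ 2 + Z$i$2 * dirX X (\<lambda>Z. snd w Z $ 2) Z)" for X i
    using exhaust_2_cases[of i]
    by (auto simp: dirX_def partial_add smooth_add smooth_lin h partial_entry_mult[OF h(1) Z] partial_entry_mult[OF h(2) Z] algebra_simps)
  have e: "(\<lambda>Z. evalmap w Z $ i) = (\<lambda>Z. fst w Z $ i + Z$i$1 * snd w Z $ 1 + Z$i$2 * snd w Z $ 2)" for i
    using exhaust_2_cases[of i] by (auto simp: evalmap_nth)
  show ?thesis
  proof (rule spinor_eqI)
    show "lie Y (evalmap w) Z $ 1 = evalmap (wact Y w) Z $ 1"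
      unfolding lie_def vector_add_component vector_minus_component vector_smult_component vec_lambda_beta e d
        evalmap_nth wact_def fst_conv snd_conv rho_dir matrix_vector_2 matrix_mult_2 trace_2 lieX_nth
      by algebra
    show "lie Y (evalmap w) Z $ 2 = evalmap (wact Y w) Z $ 2"
      unfolding lie_def vector_add_component vector_minus_component vector_smult_component vec_lambda_beta e d
        evalmap_nth wact_def fst_conv snd_conv rho_dir matrix_vector_2 matrix_mult_2 trace_2 lieX_nth
      by algebra
  qed
qed

lemma evalmap_singular: "w \<in> bispin \<Longrightarrow> det Z = 0 \<Longrightarrow> evalmap w Z = 0"
  by (auto simp: evalmap_def bispin_def hspin_singular)

text \<open>Applying the action to a lift need not give a lift orthogonal to the kernel, but it suffices that the
  other argument is one.\<close>

lemma plus_form_invariant: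
  assumes "u \<in> U_plus"
  shows "on_invertible (lie Y u) \<in> U_plus"
    and "Y \<in> u22 \<Longrightarrow> v \<in> U_plus \<Longrightarrow> plus_form (on_invertible (lie Y u)) v + plus_form u (on_invertible (lie Y v)) = 0"
proof -
  note b = kernel_ortho_bispin[OF lift(1)]
  have act: "on_invertible (lie Y u) = evalmap (wact Y (lift u))" if "u \<in> U_plus" for u
  proof
    fix Z show "on_invertible (lie Y u) Z = evalmap (wact Y (lift u)) Z"
      using lie_evalmap[OF b[OF that], of Z Y] evalmap_singular[OF wact_bispin[OF b[OF that]], of Z Y]
      unfolding lift(2)[OF that] by (simp add: on_invertible_def)
  qed
  show "on_invertible (lie Y u) \<in> U_plus"
    unfolding act[OF assms] by (intro evalmap_U_plus wact_bispin b assms)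
  have f: "plus_form (evalmap (wact Y (lift u))) v = wform (wact Y (lift u)) (lift v)" 
     "plus_form v (evalmap (wact Y (lift u))) = wform (lift v) (wact Y (lift u))" if "u \<in> U_plus" "v \<in> U_plus" for u v
  proof -
    have U: "evalmap (wact Y (lift u)) \<in> U_plus" by (intro evalmap_U_plus wact_bispin b that)
    show "plus_form (evalmap (wact Y (lift u))) v = wform (wact Y (lift u)) (lift v)" 
      unfolding plus_form_def by (rule wform_lift_left(1)[OF b[OF U] wact_bispin[OF b[OF that(1)]] lift(2)[OF U] lift(1)[OF that(2)]])
    show "plus_form v (evalmap (wact Y (lift u))) = wform (lift v) (wact Y (lift u))" 
      unfolding plus_form_def by (rule wform_lift_left(2)[OF b[OF U] wact_bispin[OF b[OF that(1)]] lift(2)[OF U] lift(1)[OF that(2)]])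
  qed
  show "plus_form (on_invertible (lie Y u)) v + plus_form u (on_invertible (lie Y v)) = 0" if "Y \<in> u22" "v \<in> U_plus"
    unfolding act[OF assms] act[OF that(2)] f[OF assms that(2)] f[OF that(2) assms]
    by (rule wform_invariant[OF that(1) b[OF assms] b[OF that(2)]])
qed

section \<open>The differential of the group actions\<close>

lemma matrix_inv_eq:
  fixes A B :: "complex^'n^'n"
  assumes "A ** B = mat 1"
  shows "matrix_inv A = B"
proof -
  have BA: "B ** A = mat 1" using assms matrix_left_right_inverse by blast
  have "A ** matrix_inv A = mat 1"
    unfolding matrix_inv_def by (rule someI2[of _ B]) (use assms BA in auto)
  then have "B ** (A ** matrix_inv A) = B" by simp
  then show ?thesis by (simp add: matrix_mul_assoc BA)
qed

lemma matrix_inv_inverse: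
  fixes A :: "complex^'n^'n"
  assumes "det A \<noteq> 0"
  shows "A ** matrix_inv A = mat 1" "matrix_inv A ** A = mat 1"
proof -
  obtain B where "A ** B = mat 1" using assms invertible_det_nz[of A] unfolding invertible_def by blast
  then show "A ** matrix_inv A = mat 1" "matrix_inv A ** A = mat 1"
    using matrix_inv_eq matrix_left_right_inverse by metis+
qed

lemma matrix_inv_adj:
  fixes A :: hc
  assumes "det A \<noteq> 0"
  shows "matrix_inv A = cmul (inverse (det A)) (adj A)"
proof (rule matrix_inv_eq, rule hc_eqI)
  have "inverse (det A) * (A$1$1 * A$2$2 - A$1$2 * A$2$1) = 1" using assms by (simp add: det_2)
  then show "(A ** cmul (inverse (det A)) (adj A)) $ 1 $ 1 = (mat 1 :: hc) $ 1 $ 1" "(A ** cmul (inverse (det A)) (adj A)) $ 2 $ 2 = (mat 1 :: hc) $ 2 $ 2"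
    "(A ** cmul (inverse (det A)) (adj A)) $ 1 $ 2 = (mat 1 :: hc) $ 1 $ 2" "(A ** cmul (inverse (det A)) (adj A)) $ 2 $ 1 = (mat 1 :: hc) $ 2 $ 1"
    by (simp_all add: matrix_mult_2 mat_def algebra_simps)
qed

lemma matrix_diff_distrib:
  fixes A :: "complex^'n^'m"
  shows "A ** (B - C) = A ** B - A ** C" "A ** (- B + C) = A ** C - A ** B"
  by (simp_all add: matrix_matrix_mult_def vec_eq_iff algebra_simps sum_subtractf sum.distrib)

lemma matrix_diff_distrib_right:
  fixes C :: "complex^'n^'m"
  shows "(A - B) ** C = A ** C - B ** C"
  by (simp add: matrix_matrix_mult_def vec_eq_iff algebra_simps sum_subtractf)

lemma transpose_nth: "transpose A $ a $ b = A $ b $ a" by (simp add: transpose_def)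

lemma blocks_mat1:
  "ul (mat 1) = mat 1" "ur (mat 1) = 0" "ll (mat 1) = 0" "lr (mat 1) = mat 1"
  by (simp_all add: ul_def ur_def ll_def lr_def mat_def vec_eq_iff)

lemma entry_bounded_linear: "bounded_linear (\<lambda>h::gl2hc. h $ a $ b)"
  using bounded_linear_compose[OF bounded_linear_vec_nth[of b] bounded_linear_vec_nth[of a]] .

lemma block_derivative:
  "((\<lambda>h. ul h $ a $ b) has_derivative (\<lambda>Y. ul Y $ a $ b)) F" "((\<lambda>h. ur h $ a $ b) has_derivative (\<lambda>Y. ur Y $ a $ b)) F"
  "((\<lambda>h. ll h $ a $ b) has_derivative (\<lambda>Y. ll Y $ a $ b)) F" "((\<lambda>h. lr h $ a $ b) has_derivative (\<lambda>Y. lr Y $ a $ b)) F"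
  unfolding ul_def ur_def ll_def lr_def vec_lambda_beta
  by (intro bounded_linear_imp_has_derivative entry_bounded_linear)+

text \<open>Numerator and denominator of the fractional linear action, as functions of the group element.\<close>

definition denom :: "hc \<Rightarrow> gl2hc \<Rightarrow> hc" where "denom Z h = ul h - Z ** ll h"
definition numer :: "hc \<Rightarrow> gl2hc \<Rightarrow> hc" where "numer Z h = - ur h + Z ** lr h"

lemma denom_numer_mat1: "denom Z (mat 1) = mat 1" "numer Z (mat 1) = Z"
  unfolding denom_def numer_def blocks_mat1 by simp_all

lemma denom_derivative: "((\<lambda>h. denom Z h $ a $ b) has_derivative (\<lambda>Y. denom Z Y $ a $ b)) F"
  unfolding denom_def vector_minus_component matrix_mult_2
  by (auto intro!: derivative_eq_intros block_derivative)

lemma numer_derivative: "((\<lambda>h. numer Z h $ a $ b) has_derivative (\<lambda>Y. numer Z Y $ a $ b)) F"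
  unfolding numer_def vector_add_component vector_uminus_component matrix_mult_2
  by (auto intro!: derivative_eq_intros block_derivative)

lemma mat1_nth: "(mat 1 :: hc) $ 1 $ 1 = 1" "(mat 1 :: hc) $ 1 $ 2 = 0" "(mat 1 :: hc) $ 2 $ 1 = 0" "(mat 1 :: hc) $ 2 $ 2 = 1"
  by (simp_all add: mat_def)

lemma eventually_det_nonzero:
  fixes f :: "gl2hc \<Rightarrow> hc"
  assumes f: "\<And>a b. ((\<lambda>h. f h $ a $ b) has_derivative f' a b) (at (mat 1))" and d: "det (f (mat 1)) \<noteq> 0"
  shows "\<forall>\<^sub>F h in nhds (mat 1). det (f h) \<noteq> 0"
proof -
  have c: "isCont (\<lambda>h. f h $ a $ b) (mat 1)" for a b using has_derivative_continuous[OF f] by simp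
  have "isCont (\<lambda>h. det (f h)) (mat 1)"
    unfolding det_2 by (intro continuous_intros c)
  then have "((\<lambda>h. det (f h)) \<longlongrightarrow> det (f (mat 1))) (nhds (mat 1))"
    unfolding isCont_def by (rule tendsto_at_iff_tendsto_nhds[THEN iffD1])
  then show ?thesis using d by (rule tendsto_imp_eventually_ne)
qed

lemma eventually_denom: "\<forall>\<^sub>F h in nhds (mat 1). det (denom Z h) \<noteq> 0"
  by (rule eventually_det_nonzero[OF denom_derivative]) (simp add: denom_numer_mat1)

lemma eventually_numer: "det Z \<noteq> 0 \<Longrightarrow> \<forall>\<^sub>F h in nhds (mat 1). det (numer Z h) \<noteq> 0"
  by (rule eventually_det_nonzero[OF numer_derivative]) (simp add: denom_numer_mat1)

lemma pi_l_eq: "pi_l h F Z = cmul (inverse (det (denom Z h))) (denom Z h) *v F (matrix_inv (denom Z h) ** numer Z h)"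
  by (simp add: pi_l_def Let_def denom_def numer_def)

definition mobius :: "hc \<Rightarrow> gl2hc \<Rightarrow> hc" where
  "mobius Z h = cmul (inverse (det (denom Z h))) (adj (denom Z h)) ** numer Z h"

lemma mobius_mat1: "mobius Z (mat 1) = Z"
  unfolding mobius_def denom_numer_mat1 by (rule hc_eqI) (simp_all add: matrix_mult_2 mat1_nth det_2)

lemma mobius_derivative: "(mobius Z has_derivative (\<lambda>Y. lieX Y Z)) (at (mat 1))"
proof (rule has_derivative_hcI)
  fix i j
  note m1 = denom_numer_mat1 mat1_nth
  have inv: "((\<lambda>h. inverse (det (denom Z h))) has_derivative (\<lambda>Y. - (denom Z Y $ 1 $ 1 + denom Z Y $ 2 $ 2))) (at (mat 1))"
    unfolding det_2
    by (rule has_derivative_eq_rhs[OF Deriv.has_derivative_inverse[OF _ has_derivative_diff[OF has_derivative_mult[OF denom_derivative denom_derivative] has_derivative_mult[OF denom_derivative denom_derivative]]]])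
       (auto simp: m1)
  have aij: "((\<lambda>h. adj (denom Z h) $ a $ b) has_derivative (\<lambda>Y. adj (denom Z Y) $ a $ b)) (at (mat 1))" for a b
    using exhaust_2_cases[of a] exhaust_2_cases[of b] by (auto intro!: derivative_eq_intros denom_derivative)
  show "((\<lambda>h. mobius Z h $ i $ j) has_derivative (\<lambda>Y. lieX Y Z $ i $ j)) (at (mat 1))"
    unfolding mobius_def matrix_mult_2 cmul_nth
    apply (rule has_derivative_eq_rhs[OF has_derivative_add[OF has_derivative_mult[OF has_derivative_mult[OF inv aij] numer_derivative]
       has_derivative_mult[OF has_derivative_mult[OF inv aij] numer_derivative]]])
    unfolding fun_eq_iff m1 det_2
    using exhaust_2_cases[of i] 
    by (auto simp: lieX_nth denom_def numer_def matrix_mult_2 m1 algebra_simps)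
qed

text \<open>Near the identity the denominator is invertible, and its inverse is given by the adjugate formula,
  which is differentiated entry by entry.\<close>

lemma pi_l_derivative:
  assumes F: "\<And>i. smooth (\<lambda>Z. F Z $ i)" and Z: "det Z \<noteq> 0"
  shows "((\<lambda>h. pi_l h F Z) has_derivative (\<lambda>Y. lie Y F Z)) (at (mat 1))"
proof (rule has_derivative_transform_eventually)
  note m1 = denom_numer_mat1 mat1_nth
  show "\<forall>\<^sub>F h in at (mat 1). cmul (inverse (det (denom Z h))) (denom Z h) *v F (mobius Z h) = pi_l h F Z"
    using eventually_nhds_conv_at[THEN iffD1, OF eventually_denom[of Z], THEN conjunct1]
    by eventually_elim (simp add: pi_l_eq mobius_def matrix_inv_adj)
  show "cmul (inverse (det (denom Z (mat 1)))) (denom Z (mat 1)) *v F (mobius Z (mat 1)) = pi_l (mat 1) F Z"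
    by (simp add: pi_l_eq mobius_def matrix_inv_adj denom_numer_mat1)
  show "((\<lambda>h. cmul (inverse (det (denom Z h))) (denom Z h) *v F (mobius Z h)) has_derivative (\<lambda>Y. lie Y F Z)) (at (mat 1))"
  proof (rule has_derivative_vecI)
    fix i :: 2
    have inv: "((\<lambda>h. inverse (det (denom Z h))) has_derivative (\<lambda>Y. - (denom Z Y $ 1 $ 1 + denom Z Y $ 2 $ 2))) (at (mat 1))"
      unfolding det_2
      by (rule has_derivative_eq_rhs[OF Deriv.has_derivative_inverse[OF _ has_derivative_diff[OF has_derivative_mult[OF denom_derivative denom_derivative] has_derivative_mult[OF denom_derivative denom_derivative]]]])
         (auto simp: m1)
    have Fd: "((\<lambda>h. F (mobius Z h) $ j) has_derivative (\<lambda>Y. dirX (lieX Y Z) (\<lambda>Z. F Z $ j) Z)) (at (mat 1))" for j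
    proof -
      have "((\<lambda>Z. F Z $ j) has_derivative (\<lambda>V. V$1$1 * partial 1 1 (\<lambda>Z. F Z $ j) Z + V$1$2 * partial 1 2 (\<lambda>Z. F Z $ j) Z
          + V$2$1 * partial 2 1 (\<lambda>Z. F Z $ j) Z + V$2$2 * partial 2 2 (\<lambda>Z. F Z $ j) Z)) (at (mobius Z (mat 1)))"
        unfolding mobius_mat1 using smoothD[OF F Z, of j] by (simp add: has_cgrad_def)
      from has_derivative_compose[OF mobius_derivative this] show ?thesis by (simp add: dirX_def)
    qed
    have comp: "(cmul c A *v x) $ i = c * A $ i $ 1 * x $ 1 + c * A $ i $ 2 * x $ 2" for c and A :: hc and x
      using exhaust_2_cases[of i] by (auto simp: matrix_vector_2)
    have compA: "(A *v x) $ i = A $ i $ 1 * x $ 1 + A $ i $ 2 * x $ 2" for A :: hc and x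
      using exhaust_2_cases[of i] by (auto simp: matrix_vector_2)
    show "((\<lambda>h. (cmul (inverse (det (denom Z h))) (denom Z h) *v F (mobius Z h)) $ i) has_derivative (\<lambda>Y. lie Y F Z $ i)) (at (mat 1))"
      unfolding comp
      apply (rule has_derivative_eq_rhs[OF has_derivative_add[OF has_derivative_mult[OF has_derivative_mult[OF inv denom_derivative] Fd]
         has_derivative_mult[OF has_derivative_mult[OF inv denom_derivative] Fd]]])
      unfolding fun_eq_iff mobius_mat1 m1 det_2
      using exhaust_2_cases[of i]
      by (auto simp: lie_def matrix_vector_2 trace_2 denom_def m1 algebra_simps)
  qed
qed simp

lemma differentiated_eq:
  assumes "\<And>Z. det Z \<noteq> 0 \<Longrightarrow> ((\<lambda>h. act h F Z) has_derivative (\<lambda>Y. G Y Z)) (at (mat 1))"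
  shows "differentiated act Y F = on_invertible (G Y)"
  unfolding differentiated_def on_invertible_def
  using frechet_derivative_at[OF assms, symmetric] by (auto simp: fun_eq_iff)

lemma differentiated_pi_l:
  assumes F: "\<And>i. smooth (\<lambda>Z. F Z $ i)"
  shows "differentiated pi_l Y F = on_invertible (lie Y F)"
  by (rule differentiated_eq) (rule pi_l_derivative[OF F])

subsection \<open>Inversion\<close>

text \<open>The action of the group element with zero diagonal blocks and identity off-diagonal blocks, up to
  sign. It is an involution on functions vanishing on the singular matrices.\<close>

definition inversion :: "(hc \<Rightarrow> spinor) \<Rightarrow> hc \<Rightarrow> spinor" where
  "inversion f = on_invertible (\<lambda>Z. cmul (inverse (det Z)) Z *v f (matrix_inv Z))"

definition flip :: "2 + 2 \<Rightarrow> 2 + 2" where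
  "flip s = (case s of Inl a \<Rightarrow> Inr a | Inr a \<Rightarrow> Inl a)"

definition block_swap :: "gl2hc \<Rightarrow> gl2hc" where
  "block_swap h = (\<chi> i j. h $ flip i $ flip j)"

lemma block_swap_blocks:
  "ul (block_swap h) = lr h" "ur (block_swap h) = ll h" "ll (block_swap h) = ur h" "lr (block_swap h) = ul h"
  by (simp_all add: block_swap_def ul_def ur_def ll_def lr_def flip_def)

lemma block_swap_mat1: "block_swap (mat 1) = mat 1"
  by (auto simp: block_swap_def mat_def vec_eq_iff flip_def split: sum.splits)

lemma u22_iff:
  "Y \<in> u22 \<longleftrightarrow> (\<forall>a b. ul Y $ a $ b = - cnj (ul Y $ b $ a)) \<and> (\<forall>a b. lr Y $ a $ b = - cnj (lr Y $ b $ a))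
     \<and> (\<forall>a b. ll Y $ a $ b = cnj (ur Y $ b $ a))"
  by (simp only: u22_def mem_Collect_eq vec_eq_iff conj_transpose_def vec_lambda_beta vector_uminus_component)

lemma block_swap_u22: "Y \<in> u22 \<Longrightarrow> block_swap Y \<in> u22"
  unfolding u22_iff block_swap_blocks by (metis complex_cnj_cnj)

lemma det_matrix_inv: "det (Z::hc) \<noteq> 0 \<Longrightarrow> det (matrix_inv Z) = inverse (det Z)"
  using det_mul[of "matrix_inv Z" Z] by (simp add: matrix_inv_inverse field_simps)

lemma matrix_inv_matrix_inv: "det (Z::hc) \<noteq> 0 \<Longrightarrow> matrix_inv (matrix_inv Z) = Z"
  by (rule matrix_inv_eq) (rule matrix_inv_inverse)

lemma det_mat_inv_nz: "det (Z::hc) \<noteq> 0 \<Longrightarrow> det (matrix_inv Z) \<noteq> 0"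
  by (simp add: det_matrix_inv)

lemma cmul_matrix: "cmul c (A::hc) ** B = cmul c (A ** B)" "A ** cmul c B = cmul c (A ** (B::hc))" "cmul c (cmul d A) = cmul (c * d) A"
proof -
  show "cmul c A ** B = cmul c (A ** B)" by (rule hc_eqI; simp add: matrix_mult_2 algebra_simps)
  show "A ** cmul c B = cmul c (A ** B)" by (rule hc_eqI; simp add: matrix_mult_2 algebra_simps)
  show "cmul c (cmul d A) = cmul (c * d) A" by (rule hc_eqI; simp)
qed

lemma inversion_nz: "det Z \<noteq> 0 \<Longrightarrow> inversion f Z = cmul (inverse (det Z)) Z *v f (matrix_inv Z)"
  by (simp add: inversion_def on_invertible_def)

lemma inversion_singular: "det Z = 0 \<Longrightarrow> inversion f Z = 0"
  by (simp add: inversion_def on_invertible_def)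

text \<open>The conjugation property of the inversion at group level, valid where both numerator and denominator
  of the fractional linear map are invertible.\<close>

lemma pi_l_inversion:
  assumes Z: "det Z \<noteq> 0" and M: "det (denom Z h) \<noteq> 0" and P: "det (numer Z h) \<noteq> 0"
  shows "pi_l h (inversion f) Z = cmul (inverse (det Z)) Z *v pi_l (block_swap h) f (matrix_inv Z)"
proof -
  let ?M = "denom Z h" and ?P = "numer Z h" and ?M2 = "denom (matrix_inv Z) (block_swap h)" and ?P2 = "numer (matrix_inv Z) (block_swap h)"
  note inv = matrix_inv_inverse
  have ZM2: "Z ** ?M2 = ?P"
    unfolding denom_def numer_def block_swap_blocks
    by (simp add: matrix_diff_distrib matrix_mul_assoc inv[OF Z])
  have ZP2: "Z ** ?P2 = ?M"
    unfolding denom_def numer_def block_swap_blocks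
    by (simp add: matrix_diff_distrib matrix_mul_assoc inv[OF Z])
  have dM2: "det ?M2 \<noteq> 0" "det Z * det ?M2 = det ?P" using P ZM2 by (metis det_mul mult_eq_0_iff)+
  let ?W = "matrix_inv ?M ** ?P"
  have dW: "det ?W \<noteq> 0" using P M by (simp add: det_mul det_mat_inv_nz)
  have MW: "?M ** ?W = ?P" by (simp add: matrix_mul_assoc inv[OF M])
  have dMW: "det ?M * det ?W = det ?P" using MW by (metis det_mul)
  have Winv: "matrix_inv ?W = matrix_inv ?M2 ** ?P2"
  proof (rule matrix_inv_eq)
    have "?P ** matrix_inv ?M2 = Z" unfolding ZM2[symmetric] matrix_mul_assoc[symmetric] by (simp add: inv[OF dM2(1)])
    then have "?W ** (matrix_inv ?M2 ** ?P2) = matrix_inv ?M ** (Z ** ?P2)"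
      by (metis matrix_mul_assoc)
    then show "?W ** (matrix_inv ?M2 ** ?P2) = mat 1" unfolding ZP2 by (simp add: inv[OF M])
  qed
  have "pi_l h (inversion f) Z = (cmul (inverse (det ?M)) ?M ** cmul (inverse (det ?W)) ?W) *v f (matrix_inv ?W)"
    unfolding pi_l_eq inversion_nz[OF dW] matrix_vector_mul_assoc ..
  also have "cmul (inverse (det ?M)) ?M ** cmul (inverse (det ?W)) ?W = cmul (inverse (det ?P)) ?P"
    unfolding cmul_matrix MW dMW[symmetric] by (simp add: mult.commute)
  also have "\<dots> = cmul (inverse (det Z)) Z ** cmul (inverse (det ?M2)) ?M2"
    unfolding cmul_matrix ZM2 dM2(2)[symmetric] by (simp add: mult.commute)
  also have "\<dots> *v f (matrix_inv ?W) = cmul (inverse (det Z)) Z *v pi_l (block_swap h) f (matrix_inv Z)"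
    unfolding pi_l_eq Winv matrix_vector_mul_assoc ..
  finally show ?thesis .
qed

lemma block_swap_bounded_linear: "bounded_linear block_swap"
proof -
  have "linear block_swap"
    by (rule linearI) (simp_all add: block_swap_def vec_eq_iff)
  then show ?thesis by (simp add: linear_conv_bounded_linear)
qed

lemma matrix_vector_bounded_linear: "bounded_linear (\<lambda>x. (A::hc) *v x)"
proof -
  have "linear (\<lambda>x. A *v x)"
    by (rule linearI; rule spinor_eqI) (simp_all add: matrix_vector_2 algebra_simps)
  then show ?thesis by (simp add: linear_conv_bounded_linear)
qed

lemma differentiated_inversion:
  assumes f: "\<And>i. smooth (\<lambda>Z. f Z $ i)"
  shows "differentiated pi_l Y (inversion f) = inversion (differentiated pi_l (block_swap Y) f)"
proof -
  have "((\<lambda>h. pi_l h (inversion f) Z) has_derivative (\<lambda>Y. cmul (inverse (det Z)) Z *v lie (block_swap Y) f (matrix_inv Z))) (at (mat 1))" if Z: "det Z \<noteq> 0" for Z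
  proof (rule has_derivative_transform_eventually)
    have d: "((\<lambda>h. pi_l h f (matrix_inv Z)) has_derivative (\<lambda>Y. lie Y f (matrix_inv Z))) (at (block_swap (mat 1)))"
      unfolding block_swap_mat1 by (rule pi_l_derivative[OF f det_mat_inv_nz[OF Z]])
    show "((\<lambda>h. cmul (inverse (det Z)) Z *v pi_l (block_swap h) f (matrix_inv Z)) has_derivative (\<lambda>Y. cmul (inverse (det Z)) Z *v lie (block_swap Y) f (matrix_inv Z))) (at (mat 1))"
      by (rule bounded_linear.has_derivative[OF matrix_vector_bounded_linear has_derivative_compose[OF bounded_linear_imp_has_derivative[OF block_swap_bounded_linear] d]])
    have ev: "\<forall>\<^sub>F h in nhds (mat 1). det (denom Z h) \<noteq> 0 \<and> det (numer Z h) \<noteq> 0"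
      using eventually_denom eventually_numer[OF Z] by (rule eventually_conj)
    then have ev': "\<forall>\<^sub>F h in nhds (mat 1). cmul (inverse (det Z)) Z *v pi_l (block_swap h) f (matrix_inv Z) = pi_l h (inversion f) Z"
      by (rule eventually_mono) (simp add: pi_l_inversion[OF Z])
    show "\<forall>\<^sub>F h in at (mat 1). cmul (inverse (det Z)) Z *v pi_l (block_swap h) f (matrix_inv Z) = pi_l h (inversion f) Z"
      "cmul (inverse (det Z)) Z *v pi_l (block_swap (mat 1)) f (matrix_inv Z) = pi_l (mat 1) (inversion f) Z"
      using ev' unfolding eventually_nhds_conv_at by auto
  qed simp
  then have "differentiated pi_l Y (inversion f) = on_invertible (\<lambda>Z. cmul (inverse (det Z)) Z *v lie (block_swap Y) f (matrix_inv Z))"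
    by (rule differentiated_eq)
  then show ?thesis
    unfolding differentiated_pi_l[OF f] inversion_def
    by (auto simp: fun_eq_iff on_invertible_def det_mat_inv_nz)
qed

subsection \<open>Transposition\<close>

definition transposed :: "(hc \<Rightarrow> spinor) \<Rightarrow> hc \<Rightarrow> spinor" where
  "transposed f Z = f (transpose Z)"

text \<open>The adjoint for a symplectic form, \<open>k \<mapsto> J k\<^sup>T J\<^sup>-\<^sup>1\<close> with \<open>J\<close> having off-diagonal blocks \<open>1\<close> and \<open>- 1\<close>. It is
  an antiautomorphism, and its composition with the inverse relates the actions on columns and on
  rows.\<close>

definition block_adjugate :: "gl2hc \<Rightarrow> gl2hc" where
  "block_adjugate k = (\<chi> i j. case (i, j) of (Inl a, Inl b) \<Rightarrow> lr k $ b $ a | (Inl a, Inr b) \<Rightarrow> - ur k $ b $ a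
     | (Inr a, Inl b) \<Rightarrow> - ll k $ b $ a | (Inr a, Inr b) \<Rightarrow> ul k $ b $ a)"

lemma block_adjugate_blocks:
  "ul (block_adjugate k) = transpose (lr k)" "ur (block_adjugate k) = - transpose (ur k)"
  "ll (block_adjugate k) = - transpose (ll k)" "lr (block_adjugate k) = transpose (ul k)"
  unfolding block_adjugate_def
  by (simp_all add: ul_def[of "vec_lambda _"] ur_def[of "vec_lambda _"] ll_def[of "vec_lambda _"] lr_def[of "vec_lambda _"] transpose_def vec_eq_iff)

lemma gl2hc_eqI: "ul h = ul k \<Longrightarrow> ur h = ur k \<Longrightarrow> ll h = ll k \<Longrightarrow> lr h = lr k \<Longrightarrow> h = k"
proof -
  assume a: "ul h = ul k" "ur h = ur k" "ll h = ll k" "lr h = lr k"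
  have "h $ i $ j = k $ i $ j" for i j
    using a by (cases i; cases j) (simp_all add: ul_def ur_def ll_def lr_def vec_eq_iff)
  then show "h = k" by (simp add: vec_eq_iff)
qed

lemma block_linear:
  "ul (h + k) = ul h + ul k" "ur (h + k) = ur h + ur k" "ll (h + k) = ll h + ll k" "lr (h + k) = lr h + lr k"
  "ul (r *\<^sub>R h) = r *\<^sub>R ul h" "ur (r *\<^sub>R h) = r *\<^sub>R ur h" "ll (r *\<^sub>R h) = r *\<^sub>R ll h" "lr (r *\<^sub>R h) = r *\<^sub>R lr h"
  "ul (- h) = - ul h" "ur (- h) = - ur h" "ll (- h) = - ll h" "lr (- h) = - lr h"
  by (simp_all add: ul_def ur_def ll_def lr_def vec_eq_iff)

lemma block_adjugate_mat1: "block_adjugate (mat 1) = mat 1"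
  by (rule gl2hc_eqI) (simp_all add: block_adjugate_blocks blocks_mat1 transpose_mat vec_eq_iff transpose_nth)

lemma block_adjugate_bounded_linear: "bounded_linear block_adjugate"
proof -
  have "linear block_adjugate"
    by (rule linearI; rule gl2hc_eqI) (simp_all add: block_adjugate_blocks block_linear transpose_def vec_eq_iff)
  then show ?thesis by (simp add: linear_conv_bounded_linear)
qed

lemma block_adjugate_u22:
  assumes "Y \<in> u22"
  shows "block_adjugate (- Y) \<in> u22"
proof -
  have e: "ul Y $ a $ b = - cnj (ul Y $ b $ a)" "lr Y $ a $ b = - cnj (lr Y $ b $ a)" "ll Y $ a $ b = cnj (ur Y $ b $ a)" for a b
    using assms unfolding u22_iff by blast+
  show ?thesis
    unfolding u22_iff block_adjugate_blocks block_linear transpose_nth vector_uminus_component complex_cnj_minus minus_minus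
    by (intro conjI allI) (rule e complex_cnj_minus[symmetric] | subst e, simp)+
qed

text \<open>The error of the linear approximation is \<open>x\<^sup>2\<close> times the inverse, where \<open>x\<close> is the displacement from
  the identity, and the inverse stays bounded.\<close>

lemma matrix_inv_derivative: "((matrix_inv :: gl2hc \<Rightarrow> gl2hc) has_derivative (\<lambda>Y. - Y)) (at (mat 1))"
proof -
  have bb: "bounded_bilinear (\<lambda>(A::gl2hc) (B::gl2hc). A ** B)"
  proof -
    have "bilinear (\<lambda>(A::gl2hc) (B::gl2hc). A ** B)"
      unfolding bilinear_def
      by (auto intro!: linearI simp: matrix_matrix_mult_def vec_eq_iff sum.distrib distrib_left distrib_right scaleR_sum_right)
    then show ?thesis by (simp add: bilinear_conv_bounded_bilinear)
  qed
  from bounded_bilinear.pos_bounded[OF bb] obtain K where K: "K > 0" "\<And>(A::gl2hc) (B::gl2hc). norm (A ** B) \<le> norm A * norm B * K" by blast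
  define e :: "gl2hc" where "e = mat 1"
  define d where "d = 1 / (2 * K)"
  have cdet: "isCont (\<lambda>h::gl2hc. det h) e"
    unfolding det_def
    by (intro continuous_intros linear_continuous_at[OF entry_bounded_linear])
  have "\<forall>\<^sub>F h in nhds e. det h \<noteq> 0"
  proof -
    have "((\<lambda>h::gl2hc. det h) \<longlongrightarrow> det e) (nhds e)" using cdet by (simp add: isCont_def tendsto_at_iff_tendsto_nhds)
    moreover have "det e \<noteq> 0" by (simp add: e_def)
    ultimately show ?thesis by (rule tendsto_imp_eventually_ne)
  qed
  then obtain r where r: "r > 0" "\<And>h. dist h e < r \<Longrightarrow> det h \<noteq> 0" unfolding eventually_nhds_metric by blast
  have key: "norm (matrix_inv h - e + (h - e)) \<le> (2 * norm e * K * K) * (norm (h - e))\<^sup>2" if h: "dist h e < min r d" for h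
  proof -
    note inv = matrix_inv_inverse[OF r(2)[of h]]
    let ?x = "h - e"
    have small: "norm ?x < 1 / (2 * K)" using h by (simp add: d_def dist_norm)
    have e1: "A ** e = A" "e ** A = A" for A by (simp_all add: e_def)
    have sub: "A ** (B - C) = A ** B - A ** C" for A B C :: gl2hc by (rule matrix_diff_distrib)
    have hinv: "matrix_inv h ** h = e" using inv h by (simp add: e_def)
    have 1: "matrix_inv h ** ?x = e - matrix_inv h" unfolding sub hinv e1 ..
    have "norm (matrix_inv h) \<le> norm e + norm (matrix_inv h ** ?x)"
      unfolding 1 by (metis add.commute norm_triangle_sub norm_minus_commute)
    also have "norm (matrix_inv h ** ?x) \<le> norm (matrix_inv h) * norm ?x * K" by (rule K(2))
    also have "\<dots> \<le> norm (matrix_inv h) * (1 / (2 * K)) * K"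
      using small K(1) by (intro mult_right_mono mult_left_mono) auto
    also have "\<dots> = norm (matrix_inv h) / 2" using K(1) by simp
    finally have b: "norm (matrix_inv h) \<le> 2 * norm e" by simp
    have "matrix_inv h ** ?x ** ?x = matrix_inv h - e + ?x"
    proof -
      have "(e - matrix_inv h) ** ?x = ?x - matrix_inv h ** ?x" 
        by (simp add: matrix_diff_distrib_right e1)
      then show ?thesis unfolding 1 by simp
    qed
    then have "norm (matrix_inv h - e + ?x) \<le> norm (matrix_inv h ** ?x) * norm ?x * K" using K(2) by metis
    also have "\<dots> \<le> (norm (matrix_inv h) * norm ?x * K) * norm ?x * K"
      using K by (intro mult_right_mono) auto
    also have "\<dots> \<le> ((2 * norm e) * norm ?x * K) * norm ?x * K"
      using b K(1) by (intro mult_right_mono) auto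
    finally show ?thesis by (simp add: power2_eq_square mult_ac)
  qed
  have inv_e: "matrix_inv e = e" by (rule matrix_inv_eq) (simp add: e_def)
  have "(matrix_inv has_derivative (\<lambda>Y. - Y)) (at e)"
    unfolding has_derivative_at_alt
  proof (intro conjI allI impI)
    show "bounded_linear (\<lambda>Y::gl2hc. - Y)" by (rule bounded_linear_minus[OF bounded_linear_ident])
    fix s :: real assume s: "0 < s"
    define C where "C = 2 * norm e * K * K + 1"
    have C: "C > 0" unfolding C_def using K(1) by (simp add: add_nonneg_pos)
    have "norm (matrix_inv y - matrix_inv e - - (y - e)) \<le> s * norm (y - e)" if y: "norm (y - e) < min (min r d) (s / C)" for y
    proof -
      have "norm (matrix_inv y - matrix_inv e - - (y - e)) \<le> (2 * norm e * K * K) * (norm (y - e))\<^sup>2"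
        using key[of y] y unfolding inv_e by (simp add: dist_norm)
      also have "\<dots> \<le> C * (norm (y - e))\<^sup>2" unfolding C_def by (intro mult_right_mono) auto
      also have "\<dots> = (C * norm (y - e)) * norm (y - e)" by (simp add: power2_eq_square)
      also have "\<dots> \<le> s * norm (y - e)"
        using y C by (intro mult_right_mono) (auto simp: field_simps)
      finally show ?thesis .
    qed
    moreover have "min (min r d) (s / C) > 0" using r s C K(1) by (simp add: d_def)
    ultimately show "\<exists>d>0. \<forall>y. norm (y - e) < d \<longrightarrow> norm (matrix_inv y - matrix_inv e - - (y - e)) \<le> s * norm (y - e)" by blast
  qed
  then show ?thesis by (simp add: e_def)
qed

lemma vector_transpose_matrix_mult: "x v* (A::hc) = transpose A *v x"
  by (rule spinor_eqI) (simp_all add: matrix_vector_2 vector_matrix_2 transpose_def)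

lemma det_transpose_hc: "det (transpose (A::hc)) = det A" by (simp add: det_2 transpose_nth)

text \<open>Transposing the numerator and the denominator of the right action gives those of the left action for
  the transformed group element.\<close>

lemma pi_r_transposed:
  assumes "det (denom (transpose Z) (block_adjugate (matrix_inv h))) \<noteq> 0"
  shows "pi_r h G Z = pi_l (block_adjugate (matrix_inv h)) (transposed G) (transpose Z)"
proof -
  let ?k = "matrix_inv h"
  let ?M = "ll ?k ** Z + lr ?k" and ?P = "ul ?k ** Z + ur ?k"
  have M: "denom (transpose Z) (block_adjugate ?k) = transpose ?M"
    unfolding denom_def block_adjugate_blocks by (rule hc_eqI) (simp_all add: matrix_mult_2 transpose_nth algebra_simps)
  have P: "numer (transpose Z) (block_adjugate ?k) = transpose ?P"
    unfolding numer_def block_adjugate_blocks by (rule hc_eqI) (simp_all add: matrix_mult_2 transpose_nth algebra_simps)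
  have d: "det ?M \<noteq> 0" using assms unfolding M det_transpose_hc .
  have i: "matrix_inv (transpose ?M) = transpose (matrix_inv ?M)"
    by (rule matrix_inv_eq) (simp add: matrix_transpose_mul[symmetric] matrix_inv_inverse[OF d] transpose_mat)
  show ?thesis
    unfolding pi_r_def Let_def pi_l_eq M P det_transpose_hc transposed_def vector_transpose_matrix_mult i
      matrix_transpose_mul[symmetric] transpose_transpose
    by (rule arg_cong[where f = "\<lambda>A. A *v _"]) (rule hc_eqI; simp add: transpose_nth)
qed

lemma differentiated_pi_r:
  assumes f: "\<And>i. smooth (\<lambda>Z. transposed G Z $ i)"
  shows "differentiated pi_r Y G = transposed (differentiated pi_l (block_adjugate (- Y)) (transposed G))"
proof -
  have "((\<lambda>h. pi_r h G Z) has_derivative (\<lambda>Y. lie (block_adjugate (- Y)) (transposed G) (transpose Z))) (at (mat 1))" if Z: "det Z \<noteq> 0" for Z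
  proof (rule has_derivative_transform_eventually)
    have inv1: "matrix_inv (mat 1 :: gl2hc) = mat 1" by (rule matrix_inv_eq) simp
    have Zt: "det (transpose Z) \<noteq> 0" using Z by (simp add: det_transpose_hc)
    let ?t = "\<lambda>h. block_adjugate (matrix_inv h)"
    have t: "(?t has_derivative (\<lambda>Y. block_adjugate (- Y))) (at (mat 1))"
      by (rule bounded_linear.has_derivative[OF block_adjugate_bounded_linear matrix_inv_derivative])
    have d: "((\<lambda>h. pi_l h (transposed G) (transpose Z)) has_derivative (\<lambda>Y. lie Y (transposed G) (transpose Z))) (at (?t (mat 1)))"
      unfolding inv1 block_adjugate_mat1 by (rule pi_l_derivative[OF f Zt])
    show "((\<lambda>h. pi_l (?t h) (transposed G) (transpose Z)) has_derivative (\<lambda>Y. lie (block_adjugate (- Y)) (transposed G) (transpose Z))) (at (mat 1))"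
      by (rule has_derivative_compose[OF t d])
    have "((\<lambda>h. denom (transpose Z) (?t h) $ a $ b) has_derivative (\<lambda>Y. denom (transpose Z) (block_adjugate (- Y)) $ a $ b)) (at (mat 1))" for a b
      by (rule has_derivative_compose[OF t denom_derivative])
    from eventually_det_nonzero[OF this] have "\<forall>\<^sub>F h in nhds (mat 1). det (denom (transpose Z) (?t h)) \<noteq> 0"
      by (simp add: inv1 block_adjugate_mat1 denom_numer_mat1)
    then have ev': "\<forall>\<^sub>F h in nhds (mat 1). pi_l (?t h) (transposed G) (transpose Z) = pi_r h G Z"
      by (rule eventually_mono) (simp add: pi_r_transposed)
    show "\<forall>\<^sub>F h in at (mat 1). pi_l (?t h) (transposed G) (transpose Z) = pi_r h G Z"
      "pi_l (?t (mat 1)) (transposed G) (transpose Z) = pi_r (mat 1) G Z"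
      using ev' unfolding eventually_nhds_conv_at by auto
  qed simp
  then have "differentiated pi_r Y G = on_invertible (\<lambda>Z. lie (block_adjugate (- Y)) (transposed G) (transpose Z))"
    by (rule differentiated_eq)
  then show ?thesis
    unfolding differentiated_pi_l[OF f] by (auto simp: fun_eq_iff transposed_def on_invertible_def det_transpose_hc)
qed

section \<open>The basis functions as explicit polynomials\<close>

text \<open>Powers other than \<open>-1\<close> have a primitive off the origin.\<close>

lemma circle_power_integral:
  "((\<lambda>s. s powi m) has_contour_integral (if m = -1 then 2 * of_real pi * \<i> else 0)) (circlepath 0 1)"
proof (cases "m = -1")
  case True
  let ?f = "\<lambda>w::complex. 1 / (w - 0)"
  have c: "contour_integral (circlepath 0 1) ?f = 2 * of_real pi * \<i>"
    by (rule contour_integral_circlepath) simp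
  then have "?f contour_integrable_on circlepath 0 1"
    using not_integrable_contour_integral[of ?f "circlepath 0 1"] by fastforce
  then have "(?f has_contour_integral 2 * of_real pi * \<i>) (circlepath 0 1)"
    unfolding c[symmetric] by (rule has_contour_integral_integral)
  then show ?thesis using True by (simp add: power_int_minus divide_inverse)
next
  case False
  define d :: complex where "d = of_int (m + 1)"
  have d: "d \<noteq> 0" using False unfolding d_def of_int_eq_0_iff by linarith
  have "((\<lambda>s. s powi m) has_contour_integral 0) (circlepath 0 1)"
  proof (rule Cauchy_theorem_primitive)
    fix s :: complex assume "s \<in> - {0}"
    then show "((\<lambda>s. s powi (m + 1) / d) has_field_derivative s powi m) (at s within - {0})"
      using d by (auto intro!: derivative_eq_intros simp: d_def)
  qed (auto simp: path_image_circlepath)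
  then show ?thesis using False by simp
qed

lemma real_of_int_in_Nats: "real_of_int x \<in> \<nat> \<longleftrightarrow> 0 \<le> x"
proof
  assume "real_of_int x \<in> \<nat>"
  then obtain n where "real_of_int x = real n" by (auto elim: Nats_cases)
  then show "0 \<le> x" by linarith
next
  assume "0 \<le> x"
  then have "real_of_int x = real (nat x)" by simp
  then show "real_of_int x \<in> \<nat>" by (metis of_nat_in_Nats)
qed

text \<open>The contour integral extracts a coefficient of the generating polynomial.\<close>

lemma tf_eq_tcoef:
  assumes l: "2 * l = of_int k" and n: "l - n = of_int i" and m: "l - m = of_int b"
  shows "tf l n m Z = tcoef k i b Z"
proof -
  have lm: "l + m = of_int (k - b)" "l + n = of_int (k - i)" "n - l = of_int (- i)" using l n m by simp_all
  show ?thesis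
  proof (cases "0 \<le> i \<and> i \<le> k \<and> 0 \<le> b \<and> b \<le> k")
    case False
    then show ?thesis unfolding tf_def n m lm real_of_int_in_Nats using tcoef_outside[of i k b Z] by auto
  next
    case True
    let ?p = "[:Z$2$1, Z$1$1:] ^ nat b * [:Z$2$2, Z$1$2:] ^ nat (k - b)"
    let ?c = "poly.coeff ?p" and ?w = "2 * complex_of_real pi * \<i>"
    have "((\<lambda>s. \<Sum>j\<le>degree ?p. ?c j * s powi (int j - i - 1)) has_contour_integral
        (\<Sum>j\<le>degree ?p. ?c j * (if int j - i - 1 = -1 then ?w else 0))) (circlepath 0 1)"
      by (intro has_contour_integral_sum has_contour_integral_lmul circle_power_integral) simp
    also have "(\<Sum>j\<le>degree ?p. ?c j * (if int j - i - 1 = -1 then ?w else 0)) = (\<Sum>j\<le>degree ?p. if j = nat i then ?c j * ?w else 0)"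
      using True by (intro sum.cong) auto
    also have "\<dots> = ?c (nat i) * ?w"
      using coeff_eq_0[of ?p "nat i"] by (auto simp: sum.delta)
    finally have "((\<lambda>s. \<Sum>j\<le>degree ?p. ?c j * s powi (int j - i - 1)) has_contour_integral ?c (nat i) * ?w) (circlepath 0 1)" .
    then have "((\<lambda>s. (s * Z$1$1 + Z$2$1) ^ nat b * (s * Z$1$2 + Z$2$2) ^ nat (k - b) * s powi (- i) / s)
        has_contour_integral ?c (nat i) * ?w) (circlepath 0 1)"
    proof (rule has_contour_integral_eq)
      fix s :: complex assume "s \<in> path_image (circlepath 0 1)"
      then have s: "s \<noteq> 0" by (auto simp: path_image_circlepath)
      have pw: "s ^ j * s powi (- i) / s = s powi (int j - i - 1)" for j
        using s by (simp add: power_int_diff power_int_minus divide_inverse)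
      have "(\<Sum>j\<le>degree ?p. ?c j * s powi (int j - i - 1)) = (\<Sum>j\<le>degree ?p. ?c j * s ^ j) * (s powi (- i) / s)"
        unfolding pw[symmetric] by (simp add: sum_distrib_right sum_divide_distrib mult.assoc)
      also have "(\<Sum>j\<le>degree ?p. ?c j * s ^ j) = poly ?p s" by (rule poly_altdef[symmetric])
      also have "poly ?p s = (s * Z$1$1 + Z$2$1) ^ nat b * (s * Z$1$2 + Z$2$2) ^ nat (k - b)"
        by (simp add: poly_power add.commute)
      finally show "(\<Sum>j\<le>degree ?p. ?c j * s powi (int j - i - 1))
         = (s * Z$1$1 + Z$2$1) ^ nat b * (s * Z$1$2 + Z$2$2) ^ nat (k - b) * s powi (- i) / s" by simp
    qed
    from contour_integral_unique[OF this] show ?thesis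
      unfolding tf_def n m lm real_of_int_in_Nats floor_of_int using True by (simp add: tcoef_def)
  qed
qed

lemma stepsE:
  assumes "x \<in> steps a c"
  obtains j :: int where "x = c - of_int j" "0 \<le> j" "of_int j \<le> c - a"
proof -
  obtain n p where n: "c - x = of_nat n" "x - a = of_nat p" using assms unfolding steps_def by (auto elim!: Nats_cases)
  show thesis by (rule that[of "int n"]) (use n in simp_all)
qed

lemma ind'_iff: "(l, m, n) \<in> ind' \<alpha> \<longleftrightarrow> (l, n, m) \<in> ind \<alpha>"
  by (cases \<alpha>) auto

text \<open>All families are reparametrized by integers: the degree \<open>k\<close> of the matrix coefficients involved and
  the distances of the indices from the upper ends of their ranges. In the third family the degree is
  \<open>2 l - 2\<close>, because of the factor \<open>N(Z)\<close>.\<close>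

lemma indE:
  assumes "(l, m, n) \<in> ind \<alpha>"
  obtains (First) k i b where "\<alpha> = First" "2 * l = of_int k" "m = l - of_int b" "n = l + 1/2 - of_int i" "0 \<le> b" "b \<le> k" "0 \<le> i" "i \<le> k + 1"
  | (Second) k i b where "\<alpha> = Second" "2 * l = of_int k" "m = l - of_int b" "n = l - 1/2 - of_int i" "0 \<le> b" "b \<le> k" "0 \<le> i" "i < k"
  | (Third) k i b where "\<alpha> = Third" "2 * l = of_int (k + 2)" "m = l - 1 - of_int b" "n = l - 1/2 - of_int i" "0 \<le> b" "b \<le> k" "0 \<le> i" "i \<le> k + 1"
proof (cases \<alpha>)
  case First
  then have a: "2 * l \<in> \<nat>" "m \<in> steps (- l) l" "n \<in> steps (- l - 1/2) (l + 1/2)" using assms by auto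
  obtain n0 where "2 * l = real n0" using a(1) by (auto elim: Nats_cases)
  then have k: "2 * l = real_of_int (int n0)" by simp
  obtain b where b: "m = l - of_int b" "0 \<le> b" "of_int b \<le> l - - l" using a(2) by (rule stepsE)
  obtain i where i: "n = l + 1/2 - of_int i" "0 \<le> i" "of_int i \<le> l + 1/2 - (- l - 1/2)" using a(3) by (rule stepsE)
  have "real_of_int b \<le> real_of_int (int n0)" "real_of_int i \<le> real_of_int (int n0 + 1)" using k b i by simp_all
  then show thesis by (intro that(1)[OF First k b(1) i(1) b(2) _ i(2)]) (simp_all only: of_int_le_iff)
next
  case Second
  then have a: "2 * l \<in> \<nat>" "m \<in> steps (- l) l" "n \<in> steps (- l + 1/2) (l - 1/2)" using assms by auto
  obtain n0 where "2 * l = real n0" using a(1) by (auto elim: Nats_cases)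
  then have k: "2 * l = real_of_int (int n0)" by simp
  obtain b where b: "m = l - of_int b" "0 \<le> b" "of_int b \<le> l - - l" using a(2) by (rule stepsE)
  obtain i where i: "n = l - 1/2 - of_int i" "0 \<le> i" "of_int i \<le> l - 1/2 - (- l + 1/2)" using a(3) by (rule stepsE)
  have "real_of_int b \<le> real_of_int (int n0)" "real_of_int i < real_of_int (int n0)" using k b i by simp_all
  then show thesis by (intro that(2)[OF Second k b(1) i(1) b(2) _ i(2)]) (simp_all only: of_int_le_iff of_int_less_iff)
next
  case Third
  then have a: "2 * l \<in> \<nat>" "m \<in> steps (- l + 1) (l - 1)" "n \<in> steps (- l + 1/2) (l - 1/2)" using assms by auto
  obtain n0 where "2 * l = real n0" using a(1) by (auto elim: Nats_cases)
  then have k: "2 * l = real_of_int (int n0)" by simp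
  obtain b where b: "m = l - 1 - of_int b" "0 \<le> b" "of_int b \<le> l - 1 - (- l + 1)" using a(2) by (rule stepsE)
  obtain i where i: "n = l - 1/2 - of_int i" "0 \<le> i" "of_int i \<le> l - 1/2 - (- l + 1/2)" using a(3) by (rule stepsE)
  have k2: "2 * l = real_of_int (int n0 - 2 + 2)" using k by simp
  have "real_of_int b \<le> real_of_int (int n0 - 2)" "real_of_int i \<le> real_of_int (int n0 - 2 + 1)" using k b i by simp_all
  then show thesis by (intro that(3)[OF Third k2 b(1) i(1) b(2) _ i(2)]) (simp_all only: of_int_le_iff)
qed

lemma f_fam_First:
  assumes "2 * l = of_int k" "m = l - of_int b" "n = l + 1/2 - of_int i"
  shows "f_fam First l m n = afun 0 k i b"
proof -
  have t: "tf l (n - 1/2) m Z = tcoef k i b Z" "tf l (n + 1/2) m Z = tcoef k (i - 1) b Z" for Z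
    by (rule tf_eq_tcoef; use assms in simp)+
  show ?thesis unfolding f_fam.simps t
    by (rule ext, rule spinor_eqI) (simp_all add: afun_def lmono_def on_invertible_def)
qed

lemma f_fam_Second:
  assumes "2 * l = of_int k" "m = l - of_int b" "n = l - 1/2 - of_int i"
  shows "f_fam Second l m n = bfun 0 k i b"
proof -
  have t: "tf l (n - 1/2) m Z = tcoef k (i + 1) b Z" "tf l (n + 1/2) m Z = tcoef k i b Z" for Z
    by (rule tf_eq_tcoef; use assms in simp)+
  have "l - n + 1/2 = of_int (i + 1)" "l + n + 1/2 = of_int (k - i)" using assms by simp_all
  then have c: "complex_of_real (l - n + 1/2) = of_int (i + 1)" "complex_of_real (l + n + 1/2) = of_int (k - i)"
    by (simp_all only: of_real_of_int_eq)
  show ?thesis unfolding f_fam.simps t c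
    by (rule ext, rule spinor_eqI) (simp_all add: bfun_def lmono_def on_invertible_def)
qed

lemma f_fam_Third:
  assumes "2 * l = of_int (k + 2)" "m = l - 1 - of_int b" "n = l - 1/2 - of_int i"
  shows "f_fam Third l m n = afun 1 k i b"
proof -
  have t: "tf (l - 1) (n - 1/2) m Z = tcoef k i b Z" "tf (l - 1) (n + 1/2) m Z = tcoef k (i - 1) b Z" for Z
    by (rule tf_eq_tcoef; use assms in simp)+
  show ?thesis unfolding f_fam.simps t
    by (rule ext, rule spinor_eqI) (simp_all add: afun_def lmono_def on_invertible_def)
qed

lemma f_fam_values:
  assumes "(l, m, n) \<in> ind \<alpha>"
  shows "\<exists>k i b. 0 \<le> b \<and> b \<le> k \<and>
    (\<alpha> = First \<and> f_fam \<alpha> l m n = afun 0 k i b \<and> complex_of_real (form_coeff \<alpha> l) = of_int (k + 1) / (2 * (of_real pi)\<^sup>2)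
   \<or> \<alpha> = Second \<and> f_fam \<alpha> l m n = bfun 0 k i b \<and> complex_of_real (form_coeff \<alpha> l) = - of_int (k * (k + 1)) / (2 * (of_real pi)\<^sup>2)
   \<or> \<alpha> = Third \<and> f_fam \<alpha> l m n = afun 1 k i b \<and> complex_of_real (form_coeff \<alpha> l) = - of_int (k + 2) / (2 * (of_real pi)\<^sup>2))"
  using assms
proof (cases rule: indE)
  case (First k i b)
  then show ?thesis using f_fam_First[OF First(2-4)]
    by - (rule exI[of _ k], rule exI[of _ i], rule exI[of _ b], simp)
next
  case (Second k i b)
  then show ?thesis using f_fam_Second[OF Second(2-4)]
    by - (rule exI[of _ k], rule exI[of _ i], rule exI[of _ b], simp)
next
  case (Third k i b)
  then show ?thesis using f_fam_Third[OF Third(2-4)]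
    by - (rule exI[of _ k], rule exI[of _ i], rule exI[of _ b], simp del: of_int_add)
qed

lemma f_fam_U_plus: "(l, m, n) \<in> ind \<alpha> \<Longrightarrow> f_fam \<alpha> l m n \<in> U_plus"
  using f_fam_values[of l m n \<alpha>] afun_plus bfun_plus by metis

lemma plus_form_described: "described_on_S3 ind f_fam plus_form"
  unfolding described_on_S3_def
proof (intro conjI allI impI ballI; clarify)
  fix \<alpha> l m n l' m' n' assume a: "(l, m, n) \<in> ind \<alpha>" "(l', m', n') \<in> ind \<alpha>"
  show "plus_form (f_fam \<alpha> l m n) (f_fam \<alpha> l' m' n') = of_real (form_coeff \<alpha> l) * integral_S3 (\<lambda>X. hdot (f_fam \<alpha> l m n X) (f_fam \<alpha> l' m' n' X))"
    using f_fam_values[OF a(1)] f_fam_values[OF a(2)] by (elim exE conjE disjE) (simp_all only: plus_form_values series_index.distinct)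
next
  fix \<alpha> \<alpha>' l m n l' m' n' assume a: "(l, m, n) \<in> ind \<alpha>" "(l', m', n') \<in> ind \<alpha>'" and ne: "\<alpha> \<noteq> \<alpha>'"
  show "plus_form (f_fam \<alpha> l m n) (f_fam \<alpha>' l' m' n') = 0"
    using f_fam_values[OF a(1)] f_fam_values[OF a(2)] ne by (elim exE conjE disjE) (simp_all only: plus_form_values, simp_all)
qed

lemma U_plus_laurent: "U_plus \<subseteq> laurent_spinors"
  unfolding U_plus_span by (rule fs.span_minimal[OF basis_laurent(1) subspace_laurent_spinors])

lemma U_minus_laurent: "U_minus \<subseteq> laurent_spinors"
  unfolding U_minus_span by (rule fs.span_minimal[OF basis_laurent(2) subspace_laurent_spinors])

lemma plus_form_preserved: "preserved_by_u22 pi_l U_plus plus_form"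
proof -
  have d: "differentiated pi_l Y u = on_invertible (lie Y u)" if "u \<in> U_plus" for Y u
    by (rule differentiated_pi_l) (use that U_plus_laurent laurent_spinors_smooth in blast)
  show ?thesis unfolding preserved_by_u22_def using plus_form_invariant by (simp add: d)
qed

section \<open>Transport of forms\<close>

lemma span_map:
  assumes add: "\<And>f g. \<Phi> (f + g) = \<Phi> f + \<Phi> g" and scale: "\<And>c f. \<Phi> (fscale c f) = fscale c (\<Phi> f)"
    and W: "fs.subspace W" and S: "\<And>x. x \<in> S \<Longrightarrow> \<Phi> x \<in> W" and f: "f \<in> fs.span S"
  shows "\<Phi> f \<in> W"
proof -
  have z: "\<Phi> 0 = 0" using scale[of 0 0] by simp
  have "fs.span S \<subseteq> {f. \<Phi> f \<in> W}"
    by (rule fs.span_minimal) (use S W in \<open>auto simp: fs.subspace_def add scale z\<close>)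
  then show ?thesis using f by blast
qed

lemma hdot_scale: "hdot (c *s x) (d *s y) = c * cnj d * hdot x y"
  by (simp add: hdot_def sum_2 algebra_simps)

text \<open>The form on the new space is the pullback of the given one. An involution between the two spaces that intertwines the actions up to an
  automorphism \<open>\<tau>\<close> of \<open>u(2,2)\<close> transports invariance, and one that preserves integrals over the sphere
  and matches the bases up to scalars transports the description. The scalars need not be related,
  as both sides of the description are sesquilinear.\<close>

lemma transport_form:
  assumes add: "\<And>f g. \<Phi> (f + g) = \<Phi> f + \<Phi> g" and scale: "\<And>c f. \<Phi> (fscale c f) = fscale c (\<Phi> f)"
    and V: "fs.subspace V"
    and maps: "\<And>f. f \<in> V' \<Longrightarrow> \<Phi> f \<in> V" "\<And>f. f \<in> V \<Longrightarrow> \<Phi> f \<in> V'"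
    and inv: "\<And>f. f \<in> V \<Longrightarrow> \<Phi> (\<Phi> f) = f" "\<And>f. f \<in> V' \<Longrightarrow> \<Phi> (\<Phi> f) = f"
    and act: "\<And>Y f. f \<in> V' \<Longrightarrow> differentiated act' Y f = \<Phi> (differentiated act (\<tau> Y) (\<Phi> f))"
    and \<tau>: "\<And>Y. Y \<in> u22 \<Longrightarrow> \<tau> Y \<in> u22"
    and ix: "\<And>\<alpha> l m n. (l, m, n) \<in> ix' \<alpha> \<Longrightarrow> (l, n, m) \<in> ix \<alpha>"
    and fam: "\<And>\<alpha> l m n. (l, m, n) \<in> ix' \<alpha> \<Longrightarrow> \<exists>c. b' \<alpha> l m n = \<Phi> (fscale c (b \<alpha> l n m))"
    and bV: "\<And>\<alpha> l m n. (l, m, n) \<in> ix \<alpha> \<Longrightarrow> b \<alpha> l m n \<in> V"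
    and int: "\<And>f g. f \<in> V \<Longrightarrow> g \<in> V \<Longrightarrow> integral_S3 (\<lambda>X. hdot (\<Phi> f X) (\<Phi> g X)) = integral_S3 (\<lambda>X. hdot (f X) (g X))"
    and ex: "\<exists>B. pseudounitary V B \<and> preserved_by_u22 act V B \<and> described_on_S3 ix b B"
  shows "\<exists>B'. pseudounitary V' B' \<and> preserved_by_u22 act' V' B' \<and> described_on_S3 ix' b' B'"
proof -
  obtain B where B: "pseudounitary V B" "preserved_by_u22 act V B" "described_on_S3 ix b B" using ex by (elim exE conjE)
  define B' where "B' = (\<lambda>f g. B (\<Phi> f) (\<Phi> g))"
  note pu = B(1)[unfolded pseudounitary_def]
  have Badd: "B (u + v) w = B u w + B v w" if "u \<in> V" "v \<in> V" "w \<in> V" for u v w by (rule pu[THEN conjunct1, rule_format, OF that])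
  have Bscale: "B (fscale c u) w = c * B u w" if "u \<in> V" "w \<in> V" for c u w by (rule pu[THEN conjunct2, THEN conjunct1, rule_format, OF that])
  have Bherm: "B w u = cnj (B u w)" if "u \<in> V" "w \<in> V" for u w by (rule pu[THEN conjunct2, THEN conjunct2, THEN conjunct1, rule_format, OF that])
  have Bnd: "u = 0" if "u \<in> V" "\<And>w. w \<in> V \<Longrightarrow> B u w = 0" for u by (rule pu[THEN conjunct2, THEN conjunct2, THEN conjunct2, THEN conjunct1, rule_format, OF that])
  have Bind: "\<exists>u\<in>V. Re (B u u) > 0" "\<exists>u\<in>V. Re (B u u) < 0" by (rule pu[THEN conjunct2, THEN conjunct2, THEN conjunct2, THEN conjunct2, THEN conjunct1] pu[THEN conjunct2, THEN conjunct2, THEN conjunct2, THEN conjunct2, THEN conjunct2])+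
  have z: "\<Phi> 0 = 0" using scale[of 0 0] by simp
  have 1: "pseudounitary V' B'"
    unfolding pseudounitary_def B'_def
  proof (intro conjI ballI allI impI)
    fix u v w assume "u \<in> V'" "v \<in> V'" "w \<in> V'"
    then show "B (\<Phi> (u + v)) (\<Phi> w) = B (\<Phi> u) (\<Phi> w) + B (\<Phi> v) (\<Phi> w)" by (simp add: add Badd maps)
  next
    fix c u w assume "u \<in> V'" "w \<in> V'"
    then show "B (\<Phi> (fscale c u)) (\<Phi> w) = c * B (\<Phi> u) (\<Phi> w)" by (simp add: scale Bscale maps)
  next
    fix u w assume "u \<in> V'" "w \<in> V'"
    then show "B (\<Phi> w) (\<Phi> u) = cnj (B (\<Phi> u) (\<Phi> w))" by (intro Bherm maps)
  next
    fix u assume u: "u \<in> V'" and 0: "\<forall>w\<in>V'. B (\<Phi> u) (\<Phi> w) = 0"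
    have "\<Phi> u = 0"
    proof (rule Bnd[OF maps(1)[OF u]])
      fix w assume "w \<in> V"
      then show "B (\<Phi> u) w = 0" using 0 maps(2)[of w] inv(1)[of w] by force
    qed
    then show "u = 0" using inv(2)[OF u] z by simp
  next
    obtain u where "u \<in> V" "Re (B u u) > 0" using Bind by blast
    then show "\<exists>u\<in>V'. Re (B (\<Phi> u) (\<Phi> u)) > 0" using maps(2)[of u] inv(1)[of u] by (intro bexI[of _ "\<Phi> u"]) simp_all
    obtain u where "u \<in> V" "Re (B u u) < 0" using Bind by blast
    then show "\<exists>u\<in>V'. Re (B (\<Phi> u) (\<Phi> u)) < 0" using maps(2)[of u] inv(1)[of u] by (intro bexI[of _ "\<Phi> u"]) simp_all
  qed
  note pr = B(2)[unfolded preserved_by_u22_def]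
  have dV: "differentiated act Y u \<in> V" if "u \<in> V" for Y u using pr[THEN conjunct1] that by (elim allE ballE) auto
  have 2: "preserved_by_u22 act' V' B'"
    unfolding preserved_by_u22_def B'_def
  proof (intro conjI ballI allI)
    fix Y u assume u: "u \<in> V'"
    show "differentiated act' Y u \<in> V'" unfolding act[OF u] by (intro maps dV u)
  next
    fix Y u v assume Y: "Y \<in> u22" and u: "u \<in> V'" and v: "v \<in> V'"
    show "B (\<Phi> (differentiated act' Y u)) (\<Phi> v) + B (\<Phi> u) (\<Phi> (differentiated act' Y v)) = 0"
      unfolding act[OF u] act[OF v] using pr \<tau>[OF Y] maps(1)[OF u] maps(1)[OF v] by (simp add: inv(1) dV)
  qed
  have val: "\<exists>c d. B' (b' \<alpha> l m n) (b' \<alpha>' l' m' n') = c * cnj d * B (b \<alpha> l n m) (b \<alpha>' l' n' m') \<and>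
      integral_S3 (\<lambda>X. hdot (b' \<alpha> l m n X) (b' \<alpha>' l' m' n' X)) = c * cnj d * integral_S3 (\<lambda>X. hdot (b \<alpha> l n m X) (b \<alpha>' l' n' m' X))"
    if a: "(l, m, n) \<in> ix' \<alpha>" "(l', m', n') \<in> ix' \<alpha>'" for \<alpha> \<alpha>' l m n l' m' n'
  proof -
    obtain c d where cd: "b' \<alpha> l m n = \<Phi> (fscale c (b \<alpha> l n m))" "b' \<alpha>' l' m' n' = \<Phi> (fscale d (b \<alpha>' l' n' m'))"
      using fam[OF a(1)] fam[OF a(2)] by blast
    let ?x = "b \<alpha> l n m" and ?y = "b \<alpha>' l' n' m'"
    have xy: "?x \<in> V" "?y \<in> V" "fscale c ?x \<in> V" "fscale d ?y \<in> V"
      using bV[OF ix[OF a(1)]] bV[OF ix[OF a(2)]] by (auto intro: fs.subspace_scale[OF V])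
    have "B' (b' \<alpha> l m n) (b' \<alpha>' l' m' n') = B (fscale c ?x) (fscale d ?y)" unfolding B'_def cd using xy by (simp add: inv)
    also have "\<dots> = c * cnj d * B ?x ?y"
      using Bherm[OF xy(4) xy(1)] Bherm[OF xy(2) xy(1)] xy by (simp add: Bscale)
    finally have 1: "B' (b' \<alpha> l m n) (b' \<alpha>' l' m' n') = c * cnj d * B ?x ?y" .
    have "integral_S3 (\<lambda>X. hdot (b' \<alpha> l m n X) (b' \<alpha>' l' m' n' X)) = integral_S3 (\<lambda>X. hdot (fscale c ?x X) (fscale d ?y X))"
      unfolding cd by (rule int[OF xy(3,4)])
    also have "\<dots> = c * cnj d * integral_S3 (\<lambda>X. hdot (?x X) (?y X))"
      unfolding fscale_def hdot_scale by (rule integral_S3_cmult)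
    finally show ?thesis using 1 by blast
  qed
  note ds = B(3)[unfolded described_on_S3_def]
  have 3: "described_on_S3 ix' b' B'"
    unfolding described_on_S3_def
  proof (intro conjI allI impI ballI; clarify)
    fix \<alpha> l m n l' m' n' assume a: "(l, m, n) \<in> ix' \<alpha>" "(l', m', n') \<in> ix' \<alpha>"
    have "B (b \<alpha> l n m) (b \<alpha> l' n' m') = of_real (form_coeff \<alpha> l) * integral_S3 (\<lambda>X. hdot (b \<alpha> l n m X) (b \<alpha> l' n' m' X))"
      using ds ix[OF a(1)] ix[OF a(2)] by fastforce
    then show "B' (b' \<alpha> l m n) (b' \<alpha> l' m' n') = of_real (form_coeff \<alpha> l) * integral_S3 (\<lambda>X. hdot (b' \<alpha> l m n X) (b' \<alpha> l' m' n' X))"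
      using val[OF a] by fastforce
  next
    fix \<alpha> \<alpha>' l m n l' m' n' assume a: "(l, m, n) \<in> ix' \<alpha>" "(l', m', n') \<in> ix' \<alpha>'" and ne: "\<alpha> \<noteq> \<alpha>'"
    have "B (b \<alpha> l n m) (b \<alpha>' l' n' m') = 0"
      using ds ix[OF a(1)] ix[OF a(2)] ne by fastforce
    then show "B' (b' \<alpha> l m n) (b' \<alpha>' l' m' n') = 0" using val[OF a] by auto
  qed
  show ?thesis by (intro exI conjI) (rule 1 2 3)+
qed

subsection \<open>Inversion and the columns of negative degree\<close>

text \<open>Transposition and adjugation change the signs of some coordinates only.\<close>

lemma laurent_coords_compose:
  assumes \<Psi>: "\<And>Z j. coords (\<Psi> Z) $ j = \<epsilon> j * coords Z $ j" and det: "\<And>Z. det (\<Psi> Z) = det Z"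
    and p: "p \<in> laurent_algebra"
  shows "(\<lambda>Z. p (\<Psi> Z)) \<in> laurent_algebra"
  using p
proof induction
  case (const c)
  then show ?case using laurent_algebra.const[of c] by (simp add: on_invertible_def[abs_def] det)
next
  case (coord j)
  have "(\<lambda>Z. \<epsilon> j * on_invertible (\<lambda>Z. coords Z $ j) Z) \<in> laurent_algebra"
    by (intro laurent_scale laurent_algebra.coord)
  moreover have "(\<lambda>Z. \<epsilon> j * on_invertible (\<lambda>Z. coords Z $ j) Z) = (\<lambda>Z. on_invertible (\<lambda>Z. coords Z $ j) (\<Psi> Z))"
    by (simp add: on_invertible_def fun_eq_iff det \<Psi>)
  ultimately show ?case by simp
next
  case inverse_det
  have "(\<lambda>Z. on_invertible (\<lambda>Z. inverse (det Z)) (\<Psi> Z)) = on_invertible (\<lambda>Z. inverse (det Z))"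
    by (simp add: fun_eq_iff on_invertible_def det)
  then show ?case by (simp add: laurent_algebra.inverse_det)
qed (auto intro: laurent_algebra.add laurent_algebra.mult)

lemma laurent_transpose: "p \<in> laurent_algebra \<Longrightarrow> (\<lambda>Z. p (transpose Z)) \<in> laurent_algebra"
proof (rule laurent_coords_compose[of _ "\<lambda>j. if j = 2 then -1 else 1"])
  show "coords (transpose Z) $ j = (if j = 2 then -1 else 1) * coords Z $ j" for Z j
    using index4_cases[of j] by (auto simp: coords_nth transpose_nth add.commute)
qed (simp_all add: det_transpose_hc)

lemma det_adj: "det (adj Z) = det Z"
  by (simp add: det_2)

lemma laurent_adj: "p \<in> laurent_algebra \<Longrightarrow> (\<lambda>Z. p (adj Z)) \<in> laurent_algebra"
proof (rule laurent_coords_compose[of _ "\<lambda>j. if j = 0 then 1 else -1"])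
  show "coords (adj Z) $ j = (if j = 0 then 1 else -1) * coords Z $ j" for Z j
    using index4_cases[of j] by (auto simp: coords_nth add.commute field_simps)
qed (simp_all add: det_adj)

lemma inversion_nth:
  "inversion f Z $ 1 = inverse (det Z) * (Z$1$1 * f (matrix_inv Z) $ 1 + Z$1$2 * f (matrix_inv Z) $ 2)"
  "inversion f Z $ 2 = inverse (det Z) * (Z$2$1 * f (matrix_inv Z) $ 1 + Z$2$2 * f (matrix_inv Z) $ 2)"
  by (cases "det Z = 0"; simp add: inversion_nz inversion_singular matrix_vector_2 algebra_simps)+

lemma inversion_add: "inversion (f + g) = inversion f + inversion g"
  by (rule ext, rule spinor_eqI) (simp_all add: inversion_nth algebra_simps)

lemma inversion_scale: "inversion (fscale c f) = fscale c (inversion f)"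
  by (rule ext, rule spinor_eqI) (simp_all add: inversion_nth algebra_simps)

lemma inversion_inversion:
  assumes "f \<in> laurent_spinors"
  shows "inversion (inversion f) = f"
proof
  fix Z show "inversion (inversion f) Z = f Z"
  proof (cases "det Z = 0")
    case True
    then show ?thesis using laurent_spinors_singular[OF assms True] by (simp add: inversion_singular)
  next
    case False
    have "cmul 1 (mat 1 :: hc) *v f Z = f Z"
      by (rule spinor_eqI) (simp_all add: matrix_vector_2 mat1_nth)
    then show ?thesis using False
      by (simp add: inversion_nz det_mat_inv_nz matrix_inv_matrix_inv matrix_vector_mul_assoc cmul_matrix matrix_inv_inverse det_matrix_inv)
  qed
qed

lemma inversion_substitution:
  "inversion (on_invertible (\<lambda>Z. h (matrix_inv Z))) = on_invertible (\<lambda>Z. cmul (inverse (det Z)) Z *v h Z)"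
  by (simp add: fun_eq_iff inversion_def on_invertible_def det_mat_inv_nz matrix_inv_matrix_inv)

text \<open>The inverse is the adjugate divided by the determinant, and passing to the adjugate exchanges and
  reflects the two indices of a matrix coefficient.\<close>

lemma lmono_matrix_inv:
  assumes Z: "det Z \<noteq> 0" and b: "0 \<le> b" "b \<le> k"
  shows "of_nat (nat k choose nat b) * lmono j k i b (matrix_inv Z)
     = (-1) powi (i + b) * of_nat (nat k choose nat i) * lmono (- j - k) k (k - b) (k - i) Z"
proof -
  have "det (matrix_inv Z) powi j * inverse (det Z) ^ nat k = det Z powi (- j - k)"
    using Z b by (simp add: det_matrix_inv power_int_diff power_int_minus power_int_inverse power_inverse divide_inverse power_int_of_nat[symmetric] del: power_int_of_nat)
  moreover have "lmono j k i b (matrix_inv Z) = det (matrix_inv Z) powi j * inverse (det Z) ^ nat k * tcoef k i b (adj Z)"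
    unfolding lmono_eq[OF det_mat_inv_nz[OF Z]] by (simp add: tcoef_cmul[OF b] matrix_inv_adj[OF Z])
  ultimately show ?thesis unfolding lmono_eq[OF Z] using tcoef_adj[OF b, of i Z] by simp
qed

text \<open>Absorption identities with a factor \<open>x\<close> that is zero at the end of the range where the identity fails
  or where a negative argument is truncated.\<close>

lemma choose_absorb:
  fixes x :: complex
  assumes "0 \<le> b" "b \<le> k + 1"
  shows "(b = k + 1 \<Longrightarrow> x = 0) \<Longrightarrow> of_int (k + 1) * (of_nat (nat k choose nat b) * x) = of_int (k + 1 - b) * (of_nat (nat (k + 1) choose nat b) * x)"
    and "(b = 0 \<Longrightarrow> x = 0) \<Longrightarrow> of_int (k + 1) * (of_nat (nat k choose nat (b - 1)) * x) = of_int b * (of_nat (nat (k + 1) choose nat b) * x)"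
proof -
  assume x: "b = k + 1 \<Longrightarrow> x = 0"
  show "of_int (k + 1) * (of_nat (nat k choose nat b) * x) = of_int (k + 1 - b) * (of_nat (nat (k + 1) choose nat b) * x)"
  proof (cases "b = k + 1")
    case False
    then have "complex_of_real (real_of_int (k + 1 - b) * real (nat (k + 1) choose nat b)) = complex_of_real (real_of_int (k + 1) * real (nat k choose nat b))"
      using choose_shift(2)[of b k] assms by simp
    then have "(of_int (k + 1 - b) :: complex) * of_nat (nat (k + 1) choose nat b) = of_int (k + 1) * of_nat (nat k choose nat b)"
      unfolding of_real_mult of_real_of_int_eq of_real_of_nat_eq .
    then show ?thesis unfolding mult.assoc[symmetric] by simp
  qed (use x in simp)
next
  assume x: "b = 0 \<Longrightarrow> x = 0"
  show "of_int (k + 1) * (of_nat (nat k choose nat (b - 1)) * x) = of_int b * (of_nat (nat (k + 1) choose nat b) * x)"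
  proof (cases "b = 0")
    case False
    then have "complex_of_real (real_of_int b * real (nat (k + 1) choose nat b)) = complex_of_real (real_of_int (k + 1) * real (nat k choose nat (b - 1)))"
      using choose_shift(1)[of "b - 1" k] assms by simp
    then have "(of_int b :: complex) * of_nat (nat (k + 1) choose nat b) = of_int (k + 1) * of_nat (nat k choose nat (b - 1))"
      unfolding of_real_mult of_real_of_int_eq of_real_of_nat_eq .
    then show ?thesis unfolding mult.assoc[symmetric] by simp
  qed (use x in simp)
qed

lemma choose_nonzero: "0 \<le> i \<Longrightarrow> i \<le> k \<Longrightarrow> (of_nat (nat k choose nat i) :: complex) \<noteq> 0"
  using choose_pos[of i k] by simp

text \<open>Inversion exchanges the two couplings: the inverse matrix couples the spinor index to the column
  index, and the multiplication by \<open>Z\<close> leads back to the row index.\<close>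

lemma inversion_afun:
  assumes b: "0 \<le> b" "b \<le> k" and i: "0 \<le> i" "i \<le> k + 1"
  shows "\<exists>c. c \<noteq> 0 \<and> inversion (afun j k i b) = fscale c (bfun (- j - k - 1) (k + 1) (k - b) (k + 1 - i))"
proof -
  let ?s = "(-1 :: complex) powi (i + b)" and ?K = "of_int (k + 1) :: complex" and ?C = "of_nat (nat (k + 1) choose nat i) :: complex"
  let ?D = "of_nat (nat k choose nat b) :: complex" and ?j = "- j - k" and ?\<alpha> = "k - b" and ?\<beta> = "k + 1 - i"
  have KD: "?K * ?D \<noteq> 0" using choose_nonzero[OF b] b by (simp add: of_int_eq_0_iff[of "k + 1", symmetric] del: of_int_eq_0_iff of_int_add) (metis add.commute add_nonneg_eq_0_iff of_int_eq_0_iff order_trans zero_le_one zero_neq_one)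
  define c where "c = ?s * ?C / (?K * ?D)"
  have c0: "c \<noteq> 0" using KD choose_nonzero[OF i] by (simp add: c_def power_int_eq_0_iff)
  have "inversion (afun j k i b) Z = fscale c (bfun (- j - k - 1) (k + 1) ?\<alpha> ?\<beta>) Z" for Z
  proof (cases "det Z = 0")
    case True
    then show ?thesis using laurent_spinors_singular[OF bfun_laurent True] by (simp add: inversion_singular fscale_def)
  next
    case False
    let ?x = "afun j k i b (matrix_inv Z)"
    have z: "i = k + 1 \<Longrightarrow> lmono ?j k ?\<alpha> (k - i) Z = 0" "i = 0 \<Longrightarrow> lmono ?j k ?\<alpha> (k - (i - 1)) Z = 0"
      using lmono_outside[of ?\<alpha> k "k - i" ?j] lmono_outside[of ?\<alpha> k "k - (i - 1)" ?j] by auto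
    have ab1: "?K * (of_nat (nat k choose nat i) * lmono ?j k ?\<alpha> (k - i) Z) = of_int ?\<beta> * (?C * lmono ?j k ?\<alpha> (k - i) Z)"
      by (rule choose_absorb(1)[OF i]) (rule z)
    have ab2: "?K * (of_nat (nat k choose nat (i - 1)) * lmono ?j k ?\<alpha> (k - (i - 1)) Z) = of_int i * (?C * lmono ?j k ?\<alpha> (k - (i - 1)) Z)"
      by (rule choose_absorb(2)[OF i]) (rule z)
    \<comment> \<open>the sign cancels the minus sign in the second component of \<open>afun\<close>\<close>
    have s: "(-1 :: complex) powi (i - 1 + b) = - ?s"
      by (simp add: power_int_diff power_int_add)
    have "?K * ?D * ?x $ 1 = ?s * (?K * (of_nat (nat k choose nat i) * lmono ?j k ?\<alpha> (k - i) Z))"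
      using lmono_matrix_inv[OF False b, of j i] unfolding afun_def spin_nth by (simp add: mult_ac)
    also have "\<dots> = ?s * (of_int ?\<beta> * (?C * lmono ?j k ?\<alpha> (k - i) Z))"
      unfolding ab1 ..
    finally have 1: "?K * ?D * ?x $ 1 = ?s * ?C * (of_int ?\<beta> * lmono ?j (k + 1 - 1) ?\<alpha> (?\<beta> - 1) Z)" by (simp add: mult_ac)
    have "?K * ?D * ?x $ 2 = - (?K * (?D * lmono j k (i - 1) b (matrix_inv Z)))"
      unfolding afun_def spin_nth by (simp add: mult_ac)
    also have "\<dots> = ?s * (?K * (of_nat (nat k choose nat (i - 1)) * lmono ?j k ?\<alpha> (k - (i - 1)) Z))"
      unfolding lmono_matrix_inv[OF False b] s by (simp only: mult_ac mult_minus_left mult_minus_right minus_minus)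
    also have "\<dots> = ?s * (of_int i * (?C * lmono ?j k ?\<alpha> (k - (i - 1)) Z))"
      unfolding ab2 ..
    finally have 2: "?K * ?D * ?x $ 2 = ?s * ?C * (of_int (k + 1 - ?\<beta>) * lmono ?j (k + 1 - 1) ?\<alpha> ?\<beta> Z)"
      by (simp add: mult_ac algebra_simps)
    have low: "inverse (det Z) * lmono ?j q r t Z = lmono (- j - k - 1) q r t Z" for q r t
      using False det_mult_lmono[of Z "- j - k - 1" q r t] by (simp add: field_simps)
    have x: "?x $ 1 = c * (of_int ?\<beta> * lmono ?j (k + 1 - 1) ?\<alpha> (?\<beta> - 1) Z)" "?x $ 2 = c * (of_int (k + 1 - ?\<beta>) * lmono ?j (k + 1 - 1) ?\<alpha> ?\<beta> Z)"
      using 1 2 KD unfolding c_def by (metis nonzero_mult_div_cancel_left times_divide_eq_left)+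
    show ?thesis
    proof (rule spinor_eqI)
      have "inversion (afun j k i b) Z $ 1 = c * (inverse (det Z) * (of_int ?\<beta> * (Z$1$1 * lmono ?j (k + 1 - 1) ?\<alpha> (?\<beta> - 1) Z) + of_int (k + 1 - ?\<beta>) * (Z$1$2 * lmono ?j (k + 1 - 1) ?\<alpha> ?\<beta> Z)))"
        unfolding inversion_nth x by (simp only: distrib_left mult_ac)
      also have "\<dots> = c * (of_int (?\<alpha> + 1) * (inverse (det Z) * lmono ?j (k + 1) (?\<alpha> + 1) ?\<beta> Z))"
        unfolding lmono_lower by (simp only: mult_ac)
      finally show "inversion (afun j k i b) Z $ 1 = fscale c (bfun (- j - k - 1) (k + 1) ?\<alpha> ?\<beta>) Z $ 1"
        unfolding low fscale_nth bfun_def spin_nth .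
      have "inversion (afun j k i b) Z $ 2 = c * (inverse (det Z) * (of_int ?\<beta> * (Z$2$1 * lmono ?j (k + 1 - 1) ?\<alpha> (?\<beta> - 1) Z) + of_int (k + 1 - ?\<beta>) * (Z$2$2 * lmono ?j (k + 1 - 1) ?\<alpha> ?\<beta> Z)))"
        unfolding inversion_nth x by (simp only: distrib_left mult_ac)
      also have "\<dots> = c * (of_int (k + 1 - ?\<alpha>) * (inverse (det Z) * lmono ?j (k + 1) ?\<alpha> ?\<beta> Z))"
        unfolding lmono_raise by (simp only: mult_ac)
      finally show "inversion (afun j k i b) Z $ 2 = fscale c (bfun (- j - k - 1) (k + 1) ?\<alpha> ?\<beta>) Z $ 2"
        unfolding low fscale_nth bfun_def spin_nth .
    qed
  qed
  then show ?thesis using c0 by blast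
qed

lemma afun_zero:
  assumes "\<not> (0 \<le> b \<and> b \<le> k \<and> 0 \<le> i \<and> i \<le> k + 1)"
  shows "afun j k i b = 0"
  using assms lmono_outside[of i k b j] lmono_outside[of "i - 1" k b j]
  by (auto simp: fun_eq_iff afun_def intro!: spinor_eqI)

lemma bfun_zero:
  assumes "\<not> (0 \<le> b \<and> b \<le> k \<and> 0 \<le> i \<and> i < k)"
  shows "bfun j k i b = 0"
proof (cases "i = -1 \<or> i = k")
  case True
  then show ?thesis using lmono_outside[of i k b j] lmono_outside[of "i + 1" k b j]
    by (auto simp: fun_eq_iff bfun_def intro!: spinor_eqI)
next
  case False
  then have "lmono j k i b = (\<lambda>Z. 0)" "lmono j k (i + 1) b = (\<lambda>Z. 0)" using assms by (auto intro!: lmono_outside)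
  then show ?thesis by (auto simp: fun_eq_iff bfun_def intro!: spinor_eqI)
qed

lemma inversion_zero: "inversion 0 = 0"
  using inversion_scale[of 0 0] by simp

lemma inversion_afun_span:
  assumes "bfun (- j - k - 1) (k + 1) (k - b) (k + 1 - i) \<in> fs.span S"
  shows "inversion (afun j k i b) \<in> fs.span S"
proof (cases "0 \<le> b \<and> b \<le> k \<and> 0 \<le> i \<and> i \<le> k + 1")
  case True
  then show ?thesis using inversion_afun[of b k i j] fs.span_scale[OF assms] by metis
next
  case False
  then show ?thesis using afun_zero[OF False, of j] by (simp add: inversion_zero fs.span_zero)
qed

lemma inversion_bfun_span:
  assumes "afun (- j - k) (k - 1) (k - b) (k - 1 - i) \<in> fs.span S"
  shows "inversion (bfun j k i b) \<in> fs.span S"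
proof (cases "0 \<le> b \<and> b \<le> k \<and> 0 \<le> i \<and> i < k")
  case True
  have e: "- (- j - k) - (k - 1) - 1 = j" "k - 1 + 1 = k" "k - 1 - (k - 1 - i) = i" "k - (k - b) = b" by simp_all
  obtain c where c: "c \<noteq> 0" "inversion (afun (- j - k) (k - 1) (k - b) (k - 1 - i)) = fscale c (bfun j k i b)"
    using inversion_afun[of "k - 1 - i" "k - 1" "k - b" "- j - k", unfolded e] True by auto
  have "bfun j k i b = fscale (inverse c) (inversion (afun (- j - k) (k - 1) (k - b) (k - 1 - i)))"
    unfolding c(2) using c(1) by simp
  then have "inversion (bfun j k i b) = fscale (inverse c) (afun (- j - k) (k - 1) (k - b) (k - 1 - i))"
    by (simp add: inversion_scale inversion_inversion afun_laurent)
  then show ?thesis using fs.span_scale[OF assms] by simp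
next
  case False
  then show ?thesis using bfun_zero[OF False, of j] by (simp add: inversion_zero fs.span_zero)
qed

text \<open>The exponents \<open>0, 1\<close> of the first coupling correspond to \<open>- k, - k - 1\<close> of the second one, \<open>k\<close> being
  the degree of the matrix coefficients in the second one.\<close>

lemma inversion_U_plus:
  assumes "f \<in> U_plus"
  shows "inversion f \<in> U_minus"
  unfolding U_minus_span
proof (rule span_map[OF inversion_add inversion_scale fs.subspace_span _ assms[unfolded U_plus_span]])
  fix x assume "x \<in> plus_basis"
  then consider j k i b where "x = afun j k i b" "0 \<le> k" "j = 0 \<or> j = 1" | k i b where "x = bfun 0 k i b" "1 \<le> k"
    unfolding plus_basis_def by blast
  then show "inversion x \<in> fs.span minus_basis"
  proof cases
    case (1 j k i b)
    show ?thesis unfolding 1(1)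
      by (rule inversion_afun_span, rule fs.span_base) (use 1 in \<open>fastforce simp: minus_basis_def\<close>)
  next
    case (2 k i b)
    have e: "- 0 - k = - (k - 1) - 1" by simp
    show ?thesis unfolding 2(1)
      by (rule inversion_bfun_span, rule fs.span_base, unfold e minus_basis_def, rule UnI1, intro CollectI exI conjI, rule refl) (use 2 in simp)
  qed
qed

lemma inversion_U_minus:
  assumes "f \<in> U_minus"
  shows "inversion f \<in> U_plus"
  unfolding U_plus_span
proof (rule span_map[OF inversion_add inversion_scale fs.subspace_span _ assms[unfolded U_minus_span]])
  fix x assume "x \<in> minus_basis"
  then consider k i b where "x = afun (- k - 1) k i b" "0 \<le> k" | j k i b where "x = bfun j k i b" "1 \<le> k" "j = - k - 1 \<or> j = - k"
    unfolding minus_basis_def by blast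
  then show "inversion x \<in> fs.span plus_basis"
  proof cases
    case (1 k i b)
    have e: "- (- k - 1) - k - 1 = 0" by simp
    show ?thesis unfolding 1(1)
      by (rule inversion_afun_span, rule fs.span_base, unfold e plus_basis_def, rule UnI2, intro CollectI exI conjI, rule refl) (use 1 in simp)
  next
    case (2 j k i b)
    have e: "- j - k = 0 \<or> - j - k = 1" using 2 by auto
    show ?thesis unfolding 2(1)
      by (rule inversion_bfun_span, rule fs.span_base) (use 2 e in \<open>fastforce simp: plus_basis_def\<close>)
  qed
qed

text \<open>On the sphere the inverse is the adjugate, which is an orthogonal transformation, and the factor \<open>Z\<close>
  is unitary.\<close>

lemma integral_inversion:
  assumes f: "f \<in> laurent_spinors" "inversion f \<in> laurent_spinors" and g: "g \<in> laurent_spinors" "inversion g \<in> laurent_spinors"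
  shows "integral_S3 (\<lambda>X. hdot (inversion f X) (inversion g X)) = integral_S3 (\<lambda>X. hdot (f X) (g X))"
proof -
  have a: "(\<lambda>X. h (adj X)) \<in> laurent_spinors" if "h \<in> laurent_spinors" for h
    using that unfolding laurent_spinors_def by (auto intro: laurent_adj)
  have "integral_S3 (\<lambda>X. hdot (inversion f X) (inversion g X)) = integral_S3 (\<lambda>X. hdot (f (adj X)) (g (adj X)))"
  proof (rule integral_S3_cong)
    fix X assume X: "is_quat X" "det X = 1"
    have "inversion h X = X *v h (adj X)" for h
      by (rule spinor_eqI) (simp_all add: inversion_nz X matrix_inv_adj matrix_vector_2 cmul_def)
    then show "hdot (inversion f X) (inversion g X) = hdot (f (adj X)) (g (adj X))" by (simp add: hdot_unitary(1) X)
  qed (intro hdot_sphere_bounded f g a)+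
  also have "\<dots> = integral_S3 (\<lambda>X. hdot (f X) (g X))"
  proof (rule integral_S3_invariant)
    show "adj (A + B) = adj A + adj B" "adj (r *\<^sub>R A) = r *\<^sub>R adj A" for A B r by (rule hc_eqI; simp)+
  qed (use f g in \<open>auto simp: is_quat_def det_adj intro: hdot_sphere_bounded\<close>)
  finally show ?thesis .
qed

lemma det_mult_afun: "det Z *s afun j k i b Z = afun (j + 1) k i b Z"
  by (rule spinor_eqI) (simp_all add: afun_def det_mult_lmono)

text \<open>The bases of the space of negative degree are normalized so that they correspond exactly, with the
  indices \<open>m\<close> and \<open>n\<close> exchanged.\<close>

lemma inversion_ft_fam:
  assumes "(l, m, n) \<in> ind' \<alpha>"
  shows "inversion (ft_fam \<alpha> l m n) = f_fam \<alpha> l n m"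
  using assms[unfolded ind'_iff]
proof (cases rule: indE)
  case (First k i b)
  have t: "tf (l + 1/2) m (n + 1/2) Z = tcoef (k + 1) i b Z" "tf (l + 1/2) m (n - 1/2) Z = tcoef (k + 1) i (b + 1) Z" for Z
    by (rule tf_eq_tcoef; use First in simp)+
  have "ft_fam \<alpha> l m n = on_invertible (\<lambda>Z. cfun k i b (matrix_inv Z))"
    unfolding First(1) ft_fam.simps t
    by (rule ext, rule spinor_eqI) (simp_all add: cfun_def lmono_def on_invertible_def det_mat_inv_nz)
  then have "inversion (ft_fam \<alpha> l m n) = on_invertible (\<lambda>Z. cmul (inverse (det Z)) Z *v cfun k i b Z)"
    by (simp only: inversion_substitution)
  also have "\<dots> = afun 0 k i b"
  proof
    fix Z
    have "cmul (inverse (det Z)) Z *v cfun k i b Z = inverse (det Z) *s afun 1 k i b Z"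
      unfolding mult_cfun[OF First(5,6), symmetric] by (rule spinor_eqI) (simp_all add: matrix_vector_2 algebra_simps)
    also have "\<dots> = inverse (det Z) *s (det Z *s afun 0 k i b Z)" by (simp add: det_mult_afun)
    finally show "on_invertible (\<lambda>Z. cmul (inverse (det Z)) Z *v cfun k i b Z) Z = afun 0 k i b Z"
      using laurent_spinors_singular[OF afun_laurent, of Z] by (simp add: on_invertible_def)
  qed
  finally show ?thesis using f_fam_First[OF First(2-4)] First(1) by simp
next
  case (Second k i b)
  have t: "tf (l - 1/2) m (n + 1/2) Z = tcoef (k - 1) i (b - 1) Z" "tf (l - 1/2) m (n - 1/2) Z = tcoef (k - 1) i b Z" for Z
    by (rule tf_eq_tcoef; use Second in simp)+
  have "l - n = of_int b" "l + n = of_int (k - b)" using Second by simp_all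
  then have c: "complex_of_real (l - n) = of_int b" "complex_of_real (l + n) = of_int (k - b)" by (simp_all only: of_real_of_int_eq)
  have "ft_fam \<alpha> l m n = on_invertible (\<lambda>Z. det (matrix_inv Z) *s rfun k i b (matrix_inv Z))"
    unfolding Second(1) ft_fam.simps t c
    by (rule ext, rule spinor_eqI) (simp_all add: rfun_def lmono_def on_invertible_def det_matrix_inv del: of_int_diff)
  then have "inversion (ft_fam \<alpha> l m n) = on_invertible (\<lambda>Z. cmul (inverse (det Z)) Z *v (det Z *s rfun k i b Z))"
    by (simp only: inversion_substitution[of "\<lambda>Z. det Z *s rfun k i b Z"])
  also have "\<dots> = bfun 0 k i b"
  proof
    fix Z
    have "cmul (inverse (det Z)) Z *v (det Z *s rfun k i b Z) = bfun 0 k i b Z" if "det Z \<noteq> 0"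
      unfolding mult_rfun[symmetric] using that by (intro spinor_eqI) (simp_all add: matrix_vector_2 field_simps)
    then show "on_invertible (\<lambda>Z. cmul (inverse (det Z)) Z *v (det Z *s rfun k i b Z)) Z = bfun 0 k i b Z"
      using laurent_spinors_singular[OF bfun_laurent, of Z] by (simp add: on_invertible_def)
  qed
  finally show ?thesis using f_fam_Second[OF Second(2-4)] Second(1) by simp
next
  case (Third k i b)
  have t: "tf (l - 1/2) m (n + 1/2) Z = tcoef (k + 1) i b Z" "tf (l - 1/2) m (n - 1/2) Z = tcoef (k + 1) i (b + 1) Z" for Z
    by (rule tf_eq_tcoef; use Third in simp)+
  have "ft_fam \<alpha> l m n = on_invertible (\<lambda>Z. det (matrix_inv Z) *s cfun k i b (matrix_inv Z))"
    unfolding Third(1) ft_fam.simps t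
    by (rule ext, rule spinor_eqI) (simp_all add: cfun_def lmono_def on_invertible_def det_matrix_inv)
  then have "inversion (ft_fam \<alpha> l m n) = on_invertible (\<lambda>Z. cmul (inverse (det Z)) Z *v (det Z *s cfun k i b Z))"
    by (simp only: inversion_substitution[of "\<lambda>Z. det Z *s cfun k i b Z"])
  also have "\<dots> = afun 1 k i b"
  proof
    fix Z
    have "cmul (inverse (det Z)) Z *v (det Z *s cfun k i b Z) = afun 1 k i b Z" if "det Z \<noteq> 0"
      unfolding mult_cfun[OF Third(5,6), symmetric] using that by (intro spinor_eqI) (simp_all add: matrix_vector_2 field_simps)
    then show "on_invertible (\<lambda>Z. cmul (inverse (det Z)) Z *v (det Z *s cfun k i b Z)) Z = afun 1 k i b Z"
      using laurent_spinors_singular[OF afun_laurent, of Z] by (simp add: on_invertible_def)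
  qed
  finally show ?thesis using f_fam_Third[OF Third(2-4)] Third(1) by simp
qed

lemma inversion_f_fam:
  assumes "(l, m, n) \<in> ind' \<alpha>"
  shows "inversion (f_fam \<alpha> l n m) = ft_fam \<alpha> l m n"
proof
  fix Z
  have d: "ft_fam \<alpha> l m n Z = 0" if "det Z = 0" for Z using that by (cases \<alpha>) (simp_all add: on_invertible_def)
  have "inversion (inversion (ft_fam \<alpha> l m n)) Z = ft_fam \<alpha> l m n Z"
  proof (cases "det Z = 0")
    case False
    have "cmul 1 (mat 1 :: hc) *v ft_fam \<alpha> l m n Z = ft_fam \<alpha> l m n Z"
      by (rule spinor_eqI) (simp_all add: matrix_vector_2 mat1_nth)
    then show ?thesis using False
      by (simp add: inversion_nz det_mat_inv_nz matrix_inv_matrix_inv matrix_vector_mul_assoc cmul_matrix matrix_inv_inverse det_matrix_inv)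
  qed (simp add: d inversion_singular)
  then show "inversion (f_fam \<alpha> l n m) Z = ft_fam \<alpha> l m n Z" unfolding inversion_ft_fam[OF assms] .
qed

lemma ft_fam_U_minus: "(l, m, n) \<in> ind' \<alpha> \<Longrightarrow> ft_fam \<alpha> l m n \<in> U_minus"
  unfolding inversion_f_fam[symmetric] by (intro inversion_U_plus f_fam_U_plus) (simp add: ind'_iff)

subsection \<open>Transposition and the rows\<close>

lemma transposed_transposed: "transposed (transposed f) = f"
  by (simp add: transposed_def fun_eq_iff transpose_transpose)

lemma transposed_add: "transposed (f + g) = transposed f + transposed g"
  by (simp add: transposed_def fun_eq_iff)

lemma transposed_scale: "transposed (fscale c f) = fscale c (transposed f)"
  by (simp add: transposed_def fun_eq_iff fscale_def)

lemma transposed_laurent: "f \<in> laurent_spinors \<Longrightarrow> transposed f \<in> laurent_spinors"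
  unfolding laurent_spinors_def transposed_def by (auto intro: laurent_transpose)

lemma partial_transpose:
  assumes "smooth F"
  shows "partial a b (\<lambda>Z. F (transpose Z)) = (\<lambda>Z. partial b a F (transpose Z))"
proof (rule partialI)
  fix Z :: hc assume Z: "det Z \<noteq> 0"
  have lin: "bounded_linear (transpose :: hc \<Rightarrow> hc)"
  proof -
    have "linear (transpose :: hc \<Rightarrow> hc)"
      by (rule linearI; rule hc_eqI) (simp_all add: transpose_nth)
    then show ?thesis by (simp add: linear_conv_bounded_linear)
  qed
  have d: "has_cgrad F (\<chi> a b. partial a b F (transpose Z)) (transpose Z)"
    using smoothD[OF assms, of "transpose Z"] Z by (simp add: det_transpose_hc)
  show "has_cgrad (\<lambda>Z. F (transpose Z)) (transpose (\<chi> a b. partial a b F (transpose Z))) Z"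
    unfolding has_cgrad_def
    by (rule has_derivative_eq_rhs[OF has_derivative_compose[OF bounded_linear_imp_has_derivative[OF lin] d[unfolded has_cgrad_def]]])
       (simp add: transpose_nth fun_eq_iff)
qed (simp_all add: det_transpose_hc transpose_nth)

lemma lap_transpose:
  assumes "p \<in> laurent_algebra"
  shows "lap (\<lambda>Z. p (transpose Z)) Z = lap p (transpose Z)"
  unfolding lap_def
  by (simp add: partial_transpose laurent_smooth laurent_partial assms)

text \<open>Transposition exchanges the mixed partial derivatives, which is also the difference between \<open>\<nabla>\<close>
  acting from the left and from the right; \<open>\<box>\<close> is symmetric.\<close>

lemma nabla_right_transposed:
  assumes f: "f \<in> laurent_spinors" and Z: "det Z \<noteq> 0"
  shows "nabla_right (laplacian (transposed f)) Z = nabla (laplacian f) (transpose Z)"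
proof -
  have Zt: "det (transpose Z) \<noteq> 0" using Z by (simp add: det_transpose_hc)
  have t: "(\<lambda>Z. transposed g Z $ i) = (\<lambda>Z. g (transpose Z) $ i)" for g i by (simp add: transposed_def)
  have sm: "smooth (\<lambda>Z. g Z $ i)" if "g \<in> laurent_spinors" for g i by (rule laurent_spinors_smooth[OF that])
  have "nabla_right (laplacian (transposed f)) Z = nabla_right (transposed (lapS f)) Z"
  proof (rule nabla_right_cong[OF Z])
    fix W :: hc assume W: "det W \<noteq> 0"
    have "lapS (transposed f) W = transposed (lapS f) W"
      using f lap_transpose[of "\<lambda>Z. f Z $ i" W for i] unfolding lapS_def transposed_def laurent_spinors_def vec_eq_iff by simp
    then show "laplacian (transposed f) W = transposed (lapS f) W"
      using laplacian_lapS[OF transposed_laurent[OF f] W] by simp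
  qed
  also have "\<dots> = nabla (lapS f) (transpose Z)"
  proof (rule spinor_eqI)
    note l = lapS_laurent[OF f] transposed_laurent[OF lapS_laurent[OF f]]
    show "nabla_right (transposed (lapS f)) Z $ 1 = nabla (lapS f) (transpose Z) $ 1"
      unfolding nabla_right_partial(1)[OF sm[OF l(2)] Z] nabla_partial(1)[OF sm[OF l(1)] Zt] t partial_transpose[OF sm[OF l(1)]] ..
    show "nabla_right (transposed (lapS f)) Z $ 2 = nabla (lapS f) (transpose Z) $ 2"
      unfolding nabla_right_partial(2)[OF sm[OF l(2)] Z] nabla_partial(2)[OF sm[OF l(1)] Zt] t partial_transpose[OF sm[OF l(1)]] ..
  qed
  also have "\<dots> = nabla (laplacian f) (transpose Z)"
    by (rule nabla_cong[OF Zt]) (simp add: laplacian_lapS[OF f])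
  finally show ?thesis .
qed

lemma transposed_quasi_antiregular: "f \<in> quasi_antiregular \<longleftrightarrow> transposed f \<in> quasi_antiregular_right"
proof -
  have l: "f \<in> laurent_spinors \<longleftrightarrow> transposed f \<in> laurent_spinors" using transposed_laurent transposed_transposed by metis
  have "(\<forall>Z. det Z \<noteq> 0 \<longrightarrow> nabla (laplacian f) Z = 0) \<longleftrightarrow> (\<forall>Z. det Z \<noteq> 0 \<longrightarrow> nabla_right (laplacian (transposed f)) Z = 0)"
    if "f \<in> laurent_spinors"
    using nabla_right_transposed[OF that] by (metis det_transpose_hc transpose_transpose)
  then show ?thesis using l unfolding quasi_antiregular_def quasi_antiregular_right_def laurent_spinors_def by blast
qed

lemma transposed_homogeneous: "homogeneous d (transposed f) \<longleftrightarrow> homogeneous d f"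
proof -
  have e: "transpose (cmul c Z) = cmul c (transpose Z)" for c and Z :: hc by (rule hc_eqI) (simp_all add: transpose_nth)
  show ?thesis unfolding homogeneous_def transposed_def e by (metis transpose_transpose)
qed

lemma subspace_U_minus: "fs.subspace U_minus"
  unfolding U_minus_span by (rule fs.subspace_span)

lemma transposed_U:
  shows "f \<in> U_plus \<Longrightarrow> transposed f \<in> U'_plus" "f \<in> U'_plus \<Longrightarrow> transposed f \<in> U_plus"
    and "f \<in> U_minus \<Longrightarrow> transposed f \<in> U'_minus" "f \<in> U'_minus \<Longrightarrow> transposed f \<in> U_minus"
proof -
  note m = span_map[OF transposed_add transposed_scale fs.subspace_span]
  have a: "transposed f \<in> quasi_antiregular" if "f \<in> quasi_antiregular_right" for f
    using that transposed_quasi_antiregular[of "transposed f"] by (simp add: transposed_transposed)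
  show "f \<in> U_plus \<Longrightarrow> transposed f \<in> U'_plus" unfolding U_plus_def U'_plus_def
    by (erule m[rotated], rule fs.span_base) (use transposed_quasi_antiregular in \<open>auto simp: transposed_homogeneous\<close>)
  show "f \<in> U'_plus \<Longrightarrow> transposed f \<in> U_plus" unfolding U_plus_def U'_plus_def
    by (erule m[rotated], rule fs.span_base) (use a in \<open>auto simp: transposed_homogeneous\<close>)
  show "f \<in> U_minus \<Longrightarrow> transposed f \<in> U'_minus" unfolding U_minus_def U'_minus_def
    by (erule m[rotated], rule fs.span_base) (use transposed_quasi_antiregular in \<open>auto simp: transposed_homogeneous\<close>)
  show "f \<in> U'_minus \<Longrightarrow> transposed f \<in> U_minus" unfolding U_minus_def U'_minus_def
    by (erule m[rotated], rule fs.span_base) (use a in \<open>auto simp: transposed_homogeneous\<close>)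
qed

lemma integral_transposed:
  assumes "f \<in> laurent_spinors" "g \<in> laurent_spinors"
  shows "integral_S3 (\<lambda>X. hdot (transposed f X) (transposed g X)) = integral_S3 (\<lambda>X. hdot (f X) (g X))"
  unfolding transposed_def
proof (rule integral_S3_invariant[where \<Psi> = transpose and F = "\<lambda>X. hdot (f X) (g X)"])
  show "transpose (A + B) = transpose A + transpose B" "transpose (r *\<^sub>R A) = r *\<^sub>R transpose A" for A B :: hc and r
    by (rule hc_eqI; simp add: transpose_nth)+
qed (use assms in \<open>auto simp: is_quat_def det_transpose_hc transpose_nth intro: hdot_sphere_bounded\<close>)

text \<open>This lemma and the three following ones say that the weights in the bases of row-valued functions
  compensate for the ratios of binomial coefficients in \<open>tcoef_transpose\<close> up to a common factor. They
  differ in which of the two sides carries the weights and in the range of the indices.\<close>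

lemma tcoef_transpose_weighted:
  assumes i: "0 \<le> i" "i \<le> k" and b: "0 \<le> b" "b \<le> k + 1"
  shows "\<exists>c. \<forall>Z. c * tcoef k b i (transpose Z) = of_int (k + 1 - b) * tcoef k i b Z
     \<and> c * tcoef k (b - 1) i (transpose Z) = of_int b * tcoef k i (b - 1) Z"
proof -
  let ?K = "of_int (k + 1) :: complex" and ?I = "of_nat (nat k choose nat i) :: complex" and ?B = "of_nat (nat (k + 1) choose nat b) :: complex"
  have B: "?B \<noteq> 0" by (rule choose_nonzero[OF b])
  show ?thesis
  proof (rule exI[of _ "?K * ?I / ?B"], intro allI conjI)
    fix Z
    have "?K * (?I * tcoef k b i (transpose Z)) = ?K * (of_nat (nat k choose nat b) * tcoef k i b Z)"
      unfolding tcoef_transpose[of k i b Z] ..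
    also have "\<dots> = of_int (k + 1 - b) * (?B * tcoef k i b Z)"
      by (rule choose_absorb(1)[OF b]) (simp add: tcoef_outside)
    finally show "?K * ?I / ?B * tcoef k b i (transpose Z) = of_int (k + 1 - b) * tcoef k i b Z"
      using B by (simp add: divide_simps mult_ac del: of_nat_eq_0_iff of_int_add of_int_diff)
    have "?K * (?I * tcoef k (b - 1) i (transpose Z)) = ?K * (of_nat (nat k choose nat (b - 1)) * tcoef k i (b - 1) Z)"
      unfolding tcoef_transpose[of k i "b - 1" Z] ..
    also have "\<dots> = of_int b * (?B * tcoef k i (b - 1) Z)"
      by (rule choose_absorb(2)[OF b]) (simp add: tcoef_outside)
    finally show "?K * ?I / ?B * tcoef k (b - 1) i (transpose Z) = of_int b * tcoef k i (b - 1) Z"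
      using B by (simp add: divide_simps mult_ac del: of_nat_eq_0_iff of_int_add of_int_diff)
  qed
qed

lemma tcoef_transpose_weighted':
  assumes i: "0 \<le> i" "i \<le> k" and b: "0 \<le> b" "b \<le> k + 1"
  shows "\<exists>c. \<forall>Z. c * (of_int (k + 1 - b) * tcoef k i b (transpose Z)) = tcoef k b i Z
     \<and> c * (of_int b * tcoef k i (b - 1) (transpose Z)) = tcoef k (b - 1) i Z"
proof -
  let ?K = "of_int (k + 1) :: complex" and ?I = "of_nat (nat k choose nat i) :: complex" and ?B = "of_nat (nat (k + 1) choose nat b) :: complex"
  have I: "?I \<noteq> 0" by (rule choose_nonzero[OF i])
  have "k + 1 \<noteq> 0" using i by linarith
  then have K: "?K \<noteq> 0" unfolding of_int_eq_0_iff .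
  show ?thesis
  proof (rule exI[of _ "?B / (?K * ?I)"], intro allI conjI)
    fix Z
    have "of_int (k + 1 - b) * (?B * tcoef k i b (transpose Z)) = ?K * (of_nat (nat k choose nat b) * tcoef k i b (transpose Z))"
      by (rule choose_absorb(1)[OF b, symmetric]) (simp add: tcoef_outside)
    also have "\<dots> = ?K * (?I * tcoef k b i Z)" unfolding tcoef_transpose ..
    finally show "?B / (?K * ?I) * (of_int (k + 1 - b) * tcoef k i b (transpose Z)) = tcoef k b i Z"
      using K I by (simp add: divide_simps mult_ac del: of_nat_eq_0_iff of_int_add of_int_diff)
    have "of_int b * (?B * tcoef k i (b - 1) (transpose Z)) = ?K * (of_nat (nat k choose nat (b - 1)) * tcoef k i (b - 1) (transpose Z))"
      by (rule choose_absorb(2)[OF b, symmetric]) (simp add: tcoef_outside)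
    also have "\<dots> = ?K * (?I * tcoef k (b - 1) i Z)" unfolding tcoef_transpose ..
    finally show "?B / (?K * ?I) * (of_int b * tcoef k i (b - 1) (transpose Z)) = tcoef k (b - 1) i Z"
      using K I by (simp add: divide_simps mult_ac del: of_nat_eq_0_iff of_int_add of_int_diff)
  qed
qed

lemma choose_step_complex:
  assumes "0 \<le> i" "i < k"
  shows "(of_int (i + 1) :: complex) * of_nat (nat k choose nat (i + 1)) = of_int (k - i) * of_nat (nat k choose nat i)"
proof -
  have "complex_of_real (real_of_int (i + 1) * real (nat k choose nat (i + 1))) = complex_of_real (real_of_int (k - i) * real (nat k choose nat i))"
    using choose_step[OF assms] by simp
  then show ?thesis unfolding of_real_mult of_real_of_int_eq of_real_of_nat_eq .
qed

lemma tcoef_transpose_step: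
  assumes b: "0 \<le> b" "b \<le> k" and i: "0 \<le> i" "i < k"
  shows "\<exists>c. \<forall>Z. c * tcoef k b i (transpose Z) = of_int (k - i) * tcoef k i b Z
     \<and> c * tcoef k b (i + 1) (transpose Z) = of_int (i + 1) * tcoef k (i + 1) b Z"
proof -
  let ?C = "\<lambda>i. of_nat (nat k choose nat i) :: complex"
  have B: "?C b \<noteq> 0" by (rule choose_nonzero[OF b])
  show ?thesis
  proof (rule exI[of _ "of_int (k - i) * ?C i / ?C b"], intro allI conjI)
    fix Z
    show "of_int (k - i) * ?C i / ?C b * tcoef k b i (transpose Z) = of_int (k - i) * tcoef k i b Z"
      using tcoef_transpose[of k i b Z] B by (simp add: divide_simps mult_ac del: of_nat_eq_0_iff of_int_add of_int_diff)
    show "of_int (k - i) * ?C i / ?C b * tcoef k b (i + 1) (transpose Z) = of_int (i + 1) * tcoef k (i + 1) b Z"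
      unfolding choose_step_complex[OF i, symmetric]
      using tcoef_transpose[of k "i + 1" b Z] B by (simp add: divide_simps mult_ac del: of_nat_eq_0_iff of_int_add of_int_diff)
  qed
qed

lemma tcoef_transpose_step':
  assumes b: "0 \<le> b" "b \<le> k" and i: "0 \<le> i" "i < k"
  shows "\<exists>c. \<forall>Z. c * (of_int (i + 1) * tcoef k (i + 1) b (transpose Z)) = tcoef k b (i + 1) Z
     \<and> c * (of_int (k - i) * tcoef k i b (transpose Z)) = tcoef k b i Z"
proof -
  let ?C = "\<lambda>i. of_nat (nat k choose nat i) :: complex"
  have B: "?C b \<noteq> 0" "?C (i + 1) \<noteq> 0" "?C i \<noteq> 0" by (rule choose_nonzero; use b i in linarith)+
  have "k - i \<noteq> 0" "i + 1 \<noteq> 0" using i by linarith+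
  then have ki: "(of_int (k - i) :: complex) \<noteq> 0" "(of_int (i + 1) :: complex) \<noteq> 0" unfolding of_int_eq_0_iff by blast+
  show ?thesis
  proof (rule exI[of _ "?C b / (of_int (k - i) * ?C i)"], intro allI conjI)
    fix Z
    have "?C b * tcoef k i b (transpose Z) = ?C i * tcoef k b i Z" by (rule tcoef_transpose)
    then show "?C b / (of_int (k - i) * ?C i) * (of_int (k - i) * tcoef k i b (transpose Z)) = tcoef k b i Z"
      using B ki by (simp add: divide_simps mult_ac del: of_nat_eq_0_iff of_int_add of_int_diff)
    have "?C b * tcoef k (i + 1) b (transpose Z) = ?C (i + 1) * tcoef k b (i + 1) Z" by (rule tcoef_transpose)
    then show "?C b / (of_int (k - i) * ?C i) * (of_int (i + 1) * tcoef k (i + 1) b (transpose Z)) = tcoef k b (i + 1) Z"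
      unfolding choose_step_complex[OF i, symmetric] using B ki by (simp add: divide_simps mult_ac del: of_nat_eq_0_iff of_int_add of_int_diff)
  qed
qed

lemma g_fam_transposed:
  assumes "(l, m, n) \<in> ind' \<alpha>"
  shows "\<exists>c. g_fam \<alpha> l m n = transposed (fscale c (f_fam \<alpha> l n m))"
  using assms[unfolded ind'_iff]
proof (cases rule: indE)
  case (First k i b)
  have t: "tf l n (m - 1/2) Z = tcoef k b i Z" "tf l n (m + 1/2) Z = tcoef k b (i - 1) Z" for Z
    by (rule tf_eq_tcoef; use First in simp)+
  have "l + m + 1/2 = of_int (k + 1 - i)" "l - m + 1/2 = of_int i" using First by simp_all
  then have co: "complex_of_real (l + m + 1/2) = of_int (k + 1 - i)" "complex_of_real (l - m + 1/2) = of_int i" by (simp_all only: of_real_of_int_eq)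
  obtain c where c: "\<And>Z. c * tcoef k i b (transpose Z) = of_int (k + 1 - i) * tcoef k b i Z"
    "\<And>Z. c * tcoef k (i - 1) b (transpose Z) = of_int i * tcoef k b (i - 1) Z" using tcoef_transpose_weighted[OF First(5-8)] by blast
  have f: "f_fam \<alpha> l n m = afun 0 k i b" using f_fam_First[OF First(2-4)] First(1) by simp
  have "g_fam \<alpha> l m n = transposed (fscale c (f_fam \<alpha> l n m))"
    unfolding f unfolding First(1) g_fam.simps t co
    by (rule ext, rule spinor_eqI)
       (simp_all add: on_invertible_def transposed_def afun_def lmono_def det_transpose_hc c del: of_int_diff of_int_add)
  then show ?thesis by blast
next
  case (Second k i b)
  have t: "tf l n (m - 1/2) Z = tcoef k b (i + 1) Z" "tf l n (m + 1/2) Z = tcoef k b i Z" for Z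
    by (rule tf_eq_tcoef; use Second in simp)+
  obtain c where c: "\<And>Z. c * (of_int (i + 1) * tcoef k (i + 1) b (transpose Z)) = tcoef k b (i + 1) Z"
    "\<And>Z. c * (of_int (k - i) * tcoef k i b (transpose Z)) = tcoef k b i Z" using tcoef_transpose_step'[OF Second(5-8)] by blast
  have f: "f_fam \<alpha> l n m = bfun 0 k i b" using f_fam_Second[OF Second(2-4)] Second(1) by simp
  have "g_fam \<alpha> l m n = transposed (fscale c (f_fam \<alpha> l n m))"
    unfolding f unfolding Second(1) g_fam.simps t
    by (rule ext, rule spinor_eqI)
       (simp_all add: on_invertible_def transposed_def bfun_def lmono_def det_transpose_hc c del: of_int_diff of_int_add)
  then show ?thesis by blast
next
  case (Third k i b)
  have t: "tf (l - 1) n (m - 1/2) Z = tcoef k b i Z" "tf (l - 1) n (m + 1/2) Z = tcoef k b (i - 1) Z" for Z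
    by (rule tf_eq_tcoef; use Third in simp)+
  have "l + m - 1/2 = of_int (k + 1 - i)" "l - m - 1/2 = of_int i" using Third by simp_all
  then have co: "complex_of_real (l + m - 1/2) = of_int (k + 1 - i)" "complex_of_real (l - m - 1/2) = of_int i" by (simp_all only: of_real_of_int_eq)
  obtain c where c: "\<And>Z. c * tcoef k i b (transpose Z) = of_int (k + 1 - i) * tcoef k b i Z"
    "\<And>Z. c * tcoef k (i - 1) b (transpose Z) = of_int i * tcoef k b (i - 1) Z" using tcoef_transpose_weighted[OF Third(5-8)] by blast
  have c': "c * (det Z * tcoef k i b (transpose Z)) = det Z * (of_int (k + 1 - i) * tcoef k b i Z)"
    "c * (det Z * tcoef k (i - 1) b (transpose Z)) = det Z * (of_int i * tcoef k b (i - 1) Z)" for Z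
    unfolding c[symmetric] by (simp_all only: mult.left_commute)
  have f: "f_fam \<alpha> l n m = afun 1 k i b" using f_fam_Third[OF Third(2-4)] Third(1) by simp
  have "g_fam \<alpha> l m n = transposed (fscale c (f_fam \<alpha> l n m))"
    unfolding f unfolding Third(1) g_fam.simps t co
    by (rule ext, rule spinor_eqI)
       (simp_all add: on_invertible_def transposed_def afun_def lmono_def det_transpose_hc c' del: of_int_diff of_int_add)
  then show ?thesis by blast
qed

lemma matrix_inv_transpose:
  assumes "det (Z :: hc) \<noteq> 0"
  shows "matrix_inv (transpose Z) = transpose (matrix_inv Z)"
  by (rule matrix_inv_eq) (simp add: matrix_transpose_mul[symmetric] matrix_inv_inverse[OF assms] transpose_mat)

lemma gt_fam_transposed:
  assumes "(l, m, n) \<in> ind \<alpha>"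
  shows "\<exists>c. gt_fam \<alpha> l m n = transposed (fscale c (ft_fam \<alpha> l n m))"
  using assms
proof (cases rule: indE)
  case (First k i b)
  have t: "tf (l + 1/2) (m + 1/2) n Z = tcoef (k + 1) b i Z" "tf (l + 1/2) (m - 1/2) n Z = tcoef (k + 1) (b + 1) i Z"
    "tf (l + 1/2) n (m + 1/2) Z = tcoef (k + 1) i b Z" "tf (l + 1/2) n (m - 1/2) Z = tcoef (k + 1) i (b + 1) Z" for Z
    by (rule tf_eq_tcoef; use First in simp)+
  have "l + m + 1 = of_int (k + 1 - b)" "l - m + 1 = of_int (b + 1)" using First by simp_all
  then have co: "complex_of_real (l + m + 1) = of_int (k + 1 - b)" "complex_of_real (l - m + 1) = of_int (b + 1)" by (simp_all only: of_real_of_int_eq)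
  obtain c where c: "\<And>Z. c * tcoef (k + 1) i b (transpose Z) = of_int (k + 1 - b) * tcoef (k + 1) b i Z"
    "\<And>Z. c * tcoef (k + 1) i (b + 1) (transpose Z) = of_int (b + 1) * tcoef (k + 1) (b + 1) i Z"
    using tcoef_transpose_step[of i "k + 1" b] First by auto
  have "gt_fam \<alpha> l m n = transposed (fscale c (ft_fam \<alpha> l n m))"
    unfolding First(1) gt_fam.simps ft_fam.simps t co
    by (rule ext, rule spinor_eqI)
       (simp_all add: on_invertible_def transposed_def det_transpose_hc matrix_inv_transpose c del: of_int_diff of_int_add)
  then show ?thesis by blast
next
  case (Second k i b)
  have t: "tf (l - 1/2) (m + 1/2) n Z = tcoef (k - 1) (b - 1) i Z" "tf (l - 1/2) (m - 1/2) n Z = tcoef (k - 1) b i Z"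
    "tf (l - 1/2) n (m + 1/2) Z = tcoef (k - 1) i (b - 1) Z" "tf (l - 1/2) n (m - 1/2) Z = tcoef (k - 1) i b Z" for Z
    by (rule tf_eq_tcoef; use Second in simp)+
  have "l + m = of_int (k - b)" "l - m = of_int b" using Second by simp_all
  then have co: "complex_of_real (l + m) = of_int (k - b)" "complex_of_real (l - m) = of_int b" by (simp_all only: of_real_of_int_eq)
  obtain c where c: "\<And>Z. c * (of_int (k - b) * tcoef (k - 1) i b (transpose Z)) = tcoef (k - 1) b i Z"
    "\<And>Z. c * (of_int b * tcoef (k - 1) i (b - 1) (transpose Z)) = tcoef (k - 1) (b - 1) i Z"
    using tcoef_transpose_weighted'[of i "k - 1" b, unfolded diff_add_cancel] Second by auto
  have c': "c * (inverse (det Z) * (of_int (k - b) * tcoef (k - 1) i b (transpose W))) = inverse (det Z) * tcoef (k - 1) b i W"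
    "c * (inverse (det Z) * (of_int b * tcoef (k - 1) i (b - 1) (transpose W))) = inverse (det Z) * tcoef (k - 1) (b - 1) i W" for Z W :: hc
    unfolding c[symmetric] by (simp_all only: mult.left_commute)
  have "gt_fam \<alpha> l m n = transposed (fscale c (ft_fam \<alpha> l n m))"
    unfolding Second(1) gt_fam.simps ft_fam.simps t co
    by (rule ext, rule spinor_eqI)
       (simp_all add: on_invertible_def transposed_def det_transpose_hc matrix_inv_transpose c' del: of_int_diff of_int_add)
  then show ?thesis by blast
next
  case (Third k i b)
  have t: "tf (l - 1/2) (m + 1/2) n Z = tcoef (k + 1) b i Z" "tf (l - 1/2) (m - 1/2) n Z = tcoef (k + 1) (b + 1) i Z"
    "tf (l - 1/2) n (m + 1/2) Z = tcoef (k + 1) i b Z" "tf (l - 1/2) n (m - 1/2) Z = tcoef (k + 1) i (b + 1) Z" for Z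
    by (rule tf_eq_tcoef; use Third in simp)+
  have "l + m = of_int (k + 1 - b)" "l - m = of_int (b + 1)" using Third by simp_all
  then have co: "complex_of_real (l + m) = of_int (k + 1 - b)" "complex_of_real (l - m) = of_int (b + 1)" by (simp_all only: of_real_of_int_eq)
  obtain c where c: "\<And>Z. c * tcoef (k + 1) i b (transpose Z) = of_int (k + 1 - b) * tcoef (k + 1) b i Z"
    "\<And>Z. c * tcoef (k + 1) i (b + 1) (transpose Z) = of_int (b + 1) * tcoef (k + 1) (b + 1) i Z"
    using tcoef_transpose_step[of i "k + 1" b] Third by auto
  have c': "c * (inverse (det Z) * tcoef (k + 1) i b (transpose W)) = inverse (det Z) * (of_int (k + 1 - b) * tcoef (k + 1) b i W)"
    "c * (inverse (det Z) * tcoef (k + 1) i (b + 1) (transpose W)) = inverse (det Z) * (of_int (b + 1) * tcoef (k + 1) (b + 1) i W)" for Z W :: hc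
    unfolding c[symmetric] by (simp_all only: mult.left_commute)
  have "gt_fam \<alpha> l m n = transposed (fscale c (ft_fam \<alpha> l n m))"
    unfolding Third(1) gt_fam.simps ft_fam.simps t co
    by (rule ext, rule spinor_eqI)
       (simp_all add: on_invertible_def transposed_def det_transpose_hc matrix_inv_transpose c' del: of_int_diff of_int_add)
  then show ?thesis by blast
qed

section \<open>The four invariant forms\<close>

lemma U_minus_form:
  "\<exists>B. pseudounitary U_minus B \<and> preserved_by_u22 pi_l U_minus B \<and> described_on_S3 ind' ft_fam B"
proof (rule transport_form[where \<Phi> = inversion and V = U_plus and act = pi_l and \<tau> = block_swap and ix = ind and b = f_fam])
  fix Y f assume f: "f \<in> U_minus"
  have "smooth (\<lambda>Z. inversion f Z $ i)" for i
    using inversion_U_minus[OF f] U_plus_laurent laurent_spinors_smooth by blast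
  from differentiated_inversion[OF this, of Y]
  show "differentiated pi_l Y f = inversion (differentiated pi_l (block_swap Y) (inversion f))"
    using f U_minus_laurent by (simp add: inversion_inversion subset_iff)
next
  fix \<alpha> l m n assume a: "(l, m, n) \<in> ind' \<alpha>"
  show "(l, n, m) \<in> ind \<alpha>" using a by (simp add: ind'_iff)
  show "\<exists>c. ft_fam \<alpha> l m n = inversion (fscale c (f_fam \<alpha> l n m))"
    by (rule exI[of _ 1]) (simp add: inversion_f_fam[OF a])
next
  fix f g assume "f \<in> U_plus" "g \<in> U_plus"
  then show "integral_S3 (\<lambda>X. hdot (inversion f X) (inversion g X)) = integral_S3 (\<lambda>X. hdot (f X) (g X))"
    using inversion_U_plus U_plus_laurent U_minus_laurent by (intro integral_inversion) blast+
next
  show "\<exists>B. pseudounitary U_plus B \<and> preserved_by_u22 pi_l U_plus B \<and> described_on_S3 ind f_fam B"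
    by (intro exI conjI) (rule plus_form_pseudounitary plus_form_preserved plus_form_described)+
qed (use U_plus_laurent U_minus_laurent in \<open>auto simp: inversion_add inversion_scale subspace_U_plus inversion_U_plus inversion_U_minus
    inversion_inversion subset_iff block_swap_u22 f_fam_U_plus\<close>)

text \<open>Transposition as an instance of the transport, for nonnegative and negative degrees alike.\<close>

lemma transposed_form:
  assumes V: "fs.subspace V" "V \<subseteq> laurent_spinors" and maps: "\<And>f. f \<in> V' \<Longrightarrow> transposed f \<in> V" "\<And>f. f \<in> V \<Longrightarrow> transposed f \<in> V'"
    and ix: "\<And>\<alpha> l m n. (l, m, n) \<in> ix' \<alpha> \<Longrightarrow> (l, n, m) \<in> ix \<alpha>"
    and fam: "\<And>\<alpha> l m n. (l, m, n) \<in> ix' \<alpha> \<Longrightarrow> \<exists>c. b' \<alpha> l m n = transposed (fscale c (b \<alpha> l n m))"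
    and bV: "\<And>\<alpha> l m n. (l, m, n) \<in> ix \<alpha> \<Longrightarrow> b \<alpha> l m n \<in> V"
    and ex: "\<exists>B. pseudounitary V B \<and> preserved_by_u22 pi_l V B \<and> described_on_S3 ix b B"
  shows "\<exists>B. pseudounitary V' B \<and> preserved_by_u22 pi_r V' B \<and> described_on_S3 ix' b' B"
proof (rule transport_form[where \<Phi> = transposed and V = V and act = pi_l and \<tau> = "\<lambda>Y. block_adjugate (- Y)" and ix = ix and b = b])
  fix Y f assume f: "f \<in> V'"
  have "smooth (\<lambda>Z. transposed f Z $ i)" for i
    using maps(1)[OF f] V(2) laurent_spinors_smooth by blast
  then show "differentiated pi_r Y f = transposed (differentiated pi_l (block_adjugate (- Y)) (transposed f))"
    by (rule differentiated_pi_r)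
next
  fix f g assume "f \<in> V" "g \<in> V"
  then show "integral_S3 (\<lambda>X. hdot (transposed f X) (transposed g X)) = integral_S3 (\<lambda>X. hdot (f X) (g X))"
    using V(2) by (intro integral_transposed) blast+
qed (fact | simp add: transposed_add transposed_scale transposed_transposed block_adjugate_u22 maps ix fam bV)+

theorem theorem49:
  shows
    "(\<exists>B. pseudounitary U_plus B \<and> preserved_by_u22 pi_l U_plus B \<and> described_on_S3 ind f_fam B) \<and>
     (\<exists>B. pseudounitary U_minus B \<and> preserved_by_u22 pi_l U_minus B \<and> described_on_S3 ind' ft_fam B) \<and>
     (\<exists>B. pseudounitary U'_plus B \<and> preserved_by_u22 pi_r U'_plus B \<and> described_on_S3 ind' g_fam B) \<and>
     (\<exists>B. pseudounitary U'_minus B \<and> preserved_by_u22 pi_r U'_minus B \<and> described_on_S3 ind gt_fam B)"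
proof -
  have plus: "\<exists>B. pseudounitary U_plus B \<and> preserved_by_u22 pi_l U_plus B \<and> described_on_S3 ind f_fam B"
    by (intro exI conjI) (rule plus_form_pseudounitary plus_form_preserved plus_form_described)+
  have "\<exists>B. pseudounitary U'_plus B \<and> preserved_by_u22 pi_r U'_plus B \<and> described_on_S3 ind' g_fam B"
    by (rule transposed_form[OF subspace_U_plus U_plus_laurent transposed_U(2,1) _ g_fam_transposed f_fam_U_plus plus])
       (simp_all add: ind'_iff)
  moreover have "\<exists>B. pseudounitary U'_minus B \<and> preserved_by_u22 pi_r U'_minus B \<and> described_on_S3 ind gt_fam B"
    by (rule transposed_form[OF subspace_U_minus U_minus_laurent transposed_U(4,3) _ gt_fam_transposed ft_fam_U_minus U_minus_form])
       (simp_all add: ind'_iff)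
  ultimately show ?thesis by (intro conjI plus U_minus_form)
qed

end
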